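(* Let $\Phi$ be a root system of type $A_r$ or $C_r$ and let $\lambda$ be a weight with $\langle\lambda,\alpha_i^\vee\rangle>0$ for all $i$. (1) The map $St_\lambda\to W$, $\mathrm{BZL}(v)\mapsto w_v$, is surjective. (2) Let $v\in\mathcal{B}_\lambda$ be such that $\mathrm{BZL}(v)$ is a stable pattern. Then $\mathrm{wt}(v)=w_v\lambda$.
   Context: **Root systems.** $\Phi$ is of type $A_r$ or $C_r$, with simple roots $\alpha_1,\dots,\alpha_r$ enumerated so that the Dynkin diagram is the chain $\alpha_1-\alpha_2-\cdots-\alpha_r$; in type $A$ all bonds are simple, and in type $C$ the bond between $\alpha_1$ and $\alpha_2$ is double, $\alpha_1$ is the long simple root, and the other bonds are simple. $W$ is the Weyl group, generated by the simple reflections $s_i$. **BZL patterns.** $\mathcal{B}_\lambda$ is the crystal graph of the irreducible highest weight module $V_\lambda$, with weight function $\mathrm{wt}$ and Kashiwara raising operators $e_i$ ($\mathrm{wt}(e_iv)=\mathrm{wt}(v)+\alpha_i$ if $e_iv\neq0$). Fix the reduced decomposition $w_0=s_{i_1}\cdots s_{i_N}$ of the longest element of $W$ given by - type $A$: $w_0=(s_1)(s_2s_1)\cdots(s_r\cdots s_1)$; - type $C$: $w_0=(s_1)(s_2s_1s_2)\cdots(s_rs_{r-1}\cdots s_1\cdots s_{r-1}s_r)$. For $v\in\mathcal{B}_\lambda$, $\mathrm{BZL}(v)=(b_1,\dots,b_N)$, where $b_1$ is the maximal integer with $v_1:=e_{i_1}^{b_1}(v)\ne0$, $b_2$ is the maximal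 integer with $v_2:=e_{i_2}^{b_2}(v_1)\neq0$, and so on. The pattern is divided into rows according to the parenthesized blocks of $w_0$ (the $m$-th row has $m$ entries in type $A$ and $2m-1$ entries in type $C$). The entries in each row are non-negative and weakly decreasing; $\phi_j$ denotes the inequality $b_j\ge b_{j+1}$ if $b_j,b_{j+1}$ lie in the same row, and $b_j\ge0$ if $b_j$ is the last entry of its row. The entries also satisfy $$\psi_j:\ b_j\le\Big\langle\lambda-\sum_{k=j+1}^Nb_k\alpha_{i_k},\alpha_{i_j}^\vee\Big\rangle,\qquad 1\le j\le N.$$ An entry $b_j$ is *circled* if $\phi_j$ is an equality and *boxed* if $\psi_j$ is an equality. A pattern is *stable* if every entry has one and only one of these two decorations. $St_\lambda$ is the set of stable patterns $\mathrm{BZL}(v)$, $v\in\mathcal{B}_\lambda$. **The element $w_v$.** If $\mathrm{BZL}(v)$ is stable, let $e_j=1$ if $b_j$ is boxed and $e_j=0$ otherwise, and set $w_v=s_{i_1}^{e_1}s_{i_2}^{e_2}\cdots s_{i_N}^{e_N}\in W$. *)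

theory Defs
  imports "HOL-Analysis.Analysis" "HOL-Computational_Algebra.Computational_Algebra"
begin

section \<open>Root systems of type A and C\<close>

text \<open>\<open>cpair x y\<close> is $\langle x, y^\vee\rangle$.\<close>

definition cpair :: "'a::euclidean_space \<Rightarrow> 'a \<Rightarrow> real" where
  "cpair x y = 2 * (x \<bullet> y) / (y \<bullet> y)"

definition reflection :: "'a::euclidean_space \<Rightarrow> 'a \<Rightarrow> 'a" where
  "reflection a x = x - cpair x a *\<^sub>R a"

definition root_system :: "'a::euclidean_space set \<Rightarrow> bool" where
  "root_system \<Phi> \<longleftrightarrow>
     finite \<Phi> \<and> 0 \<notin> \<Phi> \<and> span \<Phi> = UNIV \<and>
     (\<forall>a\<in>\<Phi>. \<forall>b\<in>\<Phi>. reflection a b \<in> \<Phi>) \<and>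
     (\<forall>a\<in>\<Phi>. \<forall>b\<in>\<Phi>. cpair b a \<in> \<int>) \<and>
     (\<forall>a\<in>\<Phi>. \<forall>c. c *\<^sub>R a \<in> \<Phi> \<longrightarrow> c = 1 \<or> c = -1)"

datatype cartan_type = Type_A | Type_C

text \<open>Nodes of the Dynkin diagram are numbered \<open>1, \<dots>, rk\<close>; values of \<open>sroot\<close> outside this
  range are never used.\<close>

record 'a root_datum =
  ctype :: cartan_type
  rk :: nat
  roots :: "'a set"
  sroot :: "nat \<Rightarrow> 'a"

definition idx :: "('a, 'm) root_datum_scheme \<Rightarrow> nat set" where
  "idx R = {1..rk R}"

definition simple_system :: "('a::euclidean_space, 'm) root_datum_scheme \<Rightarrow> bool" where
  "simple_system R \<longleftrightarrow>
     sroot R ` idx R \<subseteq> roots R \<and> inj_on (sroot R) (idx R) \<and> independent (sroot R ` idx R) \<and>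
     (\<forall>b\<in>roots R. \<exists>c::nat \<Rightarrow> nat.
        b = (\<Sum>i\<in>idx R. real (c i) *\<^sub>R sroot R i) \<or> b = - (\<Sum>i\<in>idx R. real (c i) *\<^sub>R sroot R i))"

text \<open>\<open>cartan_int X i j\<close> is $a_{ij} = \langle\alpha_j,\alpha_i^\vee\rangle$. In type C the root
  $\alpha_1$ is long, so $\langle\alpha_1,\alpha_2^\vee\rangle = -2$ and
  $\langle\alpha_2,\alpha_1^\vee\rangle = -1$.\<close>

definition cartan_int :: "cartan_type \<Rightarrow> nat \<Rightarrow> nat \<Rightarrow> int" where
  "cartan_int X i j =
     (if i = j then 2
      else if X = Type_C \<and> i = 2 \<and> j = 1 then -2
      else if i = Suc j \<or> j = Suc i then -1
      else 0)"

definition root_datum_AC :: "('a::euclidean_space, 'm) root_datum_scheme \<Rightarrow> bool" where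
  "root_datum_AC R \<longleftrightarrow>
     1 \<le> rk R \<and> root_system (roots R) \<and> simple_system R \<and>
     (\<forall>i\<in>idx R. \<forall>j\<in>idx R. cpair (sroot R j) (sroot R i) = of_int (cartan_int (ctype R) i j))"

definition sreflection :: "('a::euclidean_space, 'm) root_datum_scheme \<Rightarrow> nat \<Rightarrow> 'a \<Rightarrow> 'a" where
  "sreflection R i = reflection (sroot R i)"

text \<open>The simple reflections are involutions, so closure under inverses is automatic.\<close>

inductive_set weyl_group :: "('a::euclidean_space, 'm) root_datum_scheme \<Rightarrow> ('a \<Rightarrow> 'a) set"
  for R :: "('a, 'm) root_datum_scheme" where
  id: "id \<in> weyl_group R"
| refl: "w \<in> weyl_group R \<Longrightarrow> i \<in> idx R \<Longrightarrow> sreflection R i \<circ> w \<in> weyl_group R"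

definition weight_lattice :: "('a::euclidean_space, 'm) root_datum_scheme \<Rightarrow> 'a set" where
  "weight_lattice R = {\<mu>. \<forall>b\<in>roots R. cpair \<mu> b \<in> \<int>}"


section \<open>Modules over the quantized enveloping algebra\<close>

text \<open>The ground field is $\mathbb{Q}(q)$.\<close>

type_synonym ratq = "rat poly fract"

definition qq :: ratq where
  "qq = Fract [:0, 1:] 1"

text \<open>$q_i = q^{d_i}$, where the $d_i$ symmetrize the Cartan matrix: $d_i a_{ij} = d_j a_{ji}$.\<close>

definition qi :: "cartan_type \<Rightarrow> nat \<Rightarrow> ratq" where
  "qi X i = (if X = Type_C \<and> i = 1 then qq ^ 2 else qq)"

definition qint :: "cartan_type \<Rightarrow> nat \<Rightarrow> nat \<Rightarrow> ratq" where
  "qint X i n = (qi X i ^ n - inverse (qi X i) ^ n) / (qi X i - inverse (qi X i))"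

definition qfact :: "cartan_type \<Rightarrow> nat \<Rightarrow> nat \<Rightarrow> ratq" where
  "qfact X i n = (\<Prod>k=1..n. qint X i k)"

text \<open>A module is given by the action of the generators $E_i, F_i, K_i$ on the whole type
  \<open>'v\<close>; the action of $K_i^{-1}$ is the inverse map \<open>inv (Kop M i)\<close>.\<close>

record 'v qmodule =
  scl :: "ratq \<Rightarrow> 'v \<Rightarrow> 'v"
  Eop :: "nat \<Rightarrow> 'v \<Rightarrow> 'v"
  Fop :: "nat \<Rightarrow> 'v \<Rightarrow> 'v"
  Kop :: "nat \<Rightarrow> 'v \<Rightarrow> 'v"

definition divpow ::
    "('a, 'm) root_datum_scheme \<Rightarrow> ('v, 'n) qmodule_scheme \<Rightarrow> (nat \<Rightarrow> 'v \<Rightarrow> 'v) \<Rightarrow>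
     nat \<Rightarrow> nat \<Rightarrow> 'v \<Rightarrow> 'v" where
  "divpow R M T i n v = scl M (inverse (qfact (ctype R) i n)) ((T i ^^ n) v)"

definition serre_relation ::
    "('a, 'm) root_datum_scheme \<Rightarrow> ('v::ab_group_add, 'n) qmodule_scheme \<Rightarrow>
     (nat \<Rightarrow> 'v \<Rightarrow> 'v) \<Rightarrow> bool" where
  "serre_relation R M T \<longleftrightarrow>
     (\<forall>i\<in>idx R. \<forall>j\<in>idx R. i \<noteq> j \<longrightarrow>
       (let m = nat (1 - cartan_int (ctype R) i j) in
         \<forall>v. (\<Sum>n\<le>m. scl M ((-1) ^ n) (divpow R M T i n (T j (divpow R M T i (m - n) v)))) = 0))"

definition quantum_module ::
    "('a, 'm) root_datum_scheme \<Rightarrow> ('v::ab_group_add, 'n) qmodule_scheme \<Rightarrow> bool" where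
  "quantum_module R M \<longleftrightarrow>
     vector_space (scl M) \<and>
     (\<forall>i\<in>idx R. Vector_Spaces.linear (scl M) (scl M) (Eop M i) \<and>
                Vector_Spaces.linear (scl M) (scl M) (Fop M i) \<and>
                Vector_Spaces.linear (scl M) (scl M) (Kop M i) \<and> bij (Kop M i)) \<and>
     (\<forall>i\<in>idx R. \<forall>j\<in>idx R. \<forall>v.
        Kop M i (Kop M j v) = Kop M j (Kop M i v) \<and>
        Kop M i (Eop M j v) =
          scl M (qi (ctype R) i powi cartan_int (ctype R) i j) (Eop M j (Kop M i v)) \<and>
        Kop M i (Fop M j v) =
          scl M (qi (ctype R) i powi (- cartan_int (ctype R) i j)) (Fop M j (Kop M i v)) \<and>
        Eop M i (Fop M j v) - Fop M j (Eop M i v) =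
          (if i = j
           then scl M (inverse (qi (ctype R) i - inverse (qi (ctype R) i)))
                  (Kop M i v - inv (Kop M i) v)
           else 0)) \<and>
     serre_relation R M (Eop M) \<and> serre_relation R M (Fop M)"

text \<open>Used only for weights \<open>\<mu>\<close> in the weight lattice, where the floor is the exact value of
  the integer $\langle\mu,\alpha_i^\vee\rangle$.\<close>

definition weight_space ::
    "('a::euclidean_space, 'm) root_datum_scheme \<Rightarrow> ('v, 'n) qmodule_scheme \<Rightarrow> 'a \<Rightarrow> 'v set" where
  "weight_space R M \<mu> =
     {v. \<forall>i\<in>idx R. Kop M i v = scl M (qi (ctype R) i powi \<lfloor>cpair \<mu> (sroot R i)\<rfloor>) v}"

definition qsubmodule ::
    "('a, 'm) root_datum_scheme \<Rightarrow> ('v::ab_group_add, 'n) qmodule_scheme \<Rightarrow> 'v set \<Rightarrow> bool" where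
  "qsubmodule R M N \<longleftrightarrow>
     module.subspace (scl M) N \<and>
     (\<forall>i\<in>idx R. \<forall>v\<in>N. Eop M i v \<in> N \<and> Fop M i v \<in> N \<and> Kop M i v \<in> N \<and> inv (Kop M i) v \<in> N)"

definition irreducible_module ::
    "('a, 'm) root_datum_scheme \<Rightarrow> ('v::ab_group_add, 'n) qmodule_scheme \<Rightarrow> bool" where
  "irreducible_module R M \<longleftrightarrow>
     (UNIV :: 'v set) \<noteq> {0} \<and> (\<forall>N. qsubmodule R M N \<longrightarrow> N = {0} \<or> N = UNIV)"

definition highest_weight_module ::
    "('a::euclidean_space, 'm) root_datum_scheme \<Rightarrow> ('v::ab_group_add, 'n) qmodule_scheme \<Rightarrow>
     'a \<Rightarrow> bool" where
  "highest_weight_module R M lam \<longleftrightarrow>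
     (\<exists>u. u \<noteq> 0 \<and> u \<in> weight_space R M lam \<and> (\<forall>i\<in>idx R. Eop M i u = 0) \<and>
          (\<forall>N. qsubmodule R M N \<and> u \<in> N \<longrightarrow> N = UNIV))"

definition integrable_module ::
    "('a::euclidean_space, 'm) root_datum_scheme \<Rightarrow> ('v::ab_group_add, 'n) qmodule_scheme \<Rightarrow>
     bool" where
  "integrable_module R M \<longleftrightarrow>
     module.span (scl M) (\<Union>\<mu>\<in>weight_lattice R. weight_space R M \<mu>) = UNIV \<and>
     (\<forall>i\<in>idx R. \<forall>v. \<exists>n. (Eop M i ^^ n) v = 0 \<and> (Fop M i ^^ n) v = 0)"


section \<open>Crystal bases\<close>

text \<open>An integrable module is the direct sum of the subspaces $F_i^{(n)}(\ker E_i \cap V_\mu)$ with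
  $0 \le n \le \langle\mu,\alpha_i^\vee\rangle$. The Kashiwara operators are the linear operators
  sending $F_i^{(n)}u$ in such a summand to $F_i^{(n-1)}u$ (to \<open>0\<close> if \<open>n = 0\<close>) and
  to $F_i^{(n+1)}u$, respectively.\<close>

definition kashiwara_e ::
    "('a::euclidean_space, 'm) root_datum_scheme \<Rightarrow> ('v::ab_group_add, 'n) qmodule_scheme \<Rightarrow>
     nat \<Rightarrow> 'v \<Rightarrow> 'v" where
  "kashiwara_e R M i =
     (THE T. Vector_Spaces.linear (scl M) (scl M) T \<and>
        (\<forall>\<mu>\<in>weight_lattice R. \<forall>u\<in>weight_space R M \<mu>. \<forall>n.
           Eop M i u = 0 \<and> real n \<le> cpair \<mu> (sroot R i) \<longrightarrow>
           T (divpow R M (Fop M) i n u) =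
             (if n = 0 then 0 else divpow R M (Fop M) i (n - 1) u)))"

definition kashiwara_f ::
    "('a::euclidean_space, 'm) root_datum_scheme \<Rightarrow> ('v::ab_group_add, 'n) qmodule_scheme \<Rightarrow>
     nat \<Rightarrow> 'v \<Rightarrow> 'v" where
  "kashiwara_f R M i =
     (THE T. Vector_Spaces.linear (scl M) (scl M) T \<and>
        (\<forall>\<mu>\<in>weight_lattice R. \<forall>u\<in>weight_space R M \<mu>. \<forall>n.
           Eop M i u = 0 \<and> real n \<le> cpair \<mu> (sroot R i) \<longrightarrow>
           T (divpow R M (Fop M) i n u) = divpow R M (Fop M) i (Suc n) u))"

text \<open>The local ring of rational functions regular at \<open>q = 0\<close>.\<close>

definition regular_at_0 :: "ratq set" where
  "regular_at_0 = {Fract f g | f g. poly g 0 \<noteq> 0}"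

text \<open>The first condition says that \<open>L\<close> is the span, over the local ring, of a basis of the
  vector space, i.e. that \<open>L\<close> is free over that ring with $\mathbb{Q}(q) \otimes L = V$.
  The second one is $L = \bigoplus_\mu L \cap V_\mu$ (directness is automatic).\<close>

definition crystal_lattice ::
    "('a::euclidean_space, 'm) root_datum_scheme \<Rightarrow> ('v::ab_group_add, 'n) qmodule_scheme \<Rightarrow>
     'v set \<Rightarrow> bool" where
  "crystal_lattice R M L \<longleftrightarrow>
     (\<exists>S. \<not> module.dependent (scl M) S \<and> module.span (scl M) S = UNIV \<and>
          L = {(\<Sum>s\<in>T. scl M (a s) s) | T a. finite T \<and> T \<subseteq> S \<and> (\<forall>s\<in>T. a s \<in> regular_at_0)}) \<and>
     (\<forall>x\<in>L. \<exists>P y. finite P \<and> P \<subseteq> weight_lattice R \<and>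
          (\<forall>\<mu>\<in>P. y \<mu> \<in> L \<inter> weight_space R M \<mu>) \<and> x = (\<Sum>\<mu>\<in>P. y \<mu>)) \<and>
     (\<forall>i\<in>idx R. \<forall>x\<in>L. kashiwara_e R M i x \<in> L \<and> kashiwara_f R M i x \<in> L)"

text \<open>Elements of $L/qL$ are represented as cosets; \<open>qcoset M L 0\<close> is its zero element.\<close>

definition qcoset :: "('v::ab_group_add, 'n) qmodule_scheme \<Rightarrow> 'v set \<Rightarrow> 'v \<Rightarrow> 'v set" where
  "qcoset M L x = {x + scl M qq y | y. y \<in> L}"

definition induced_op ::
    "('v::ab_group_add, 'n) qmodule_scheme \<Rightarrow> 'v set \<Rightarrow> ('v \<Rightarrow> 'v) \<Rightarrow> 'v set \<Rightarrow> 'v set" where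
  "induced_op M L T b = (\<Union>x\<in>b. qcoset M L (T x))"

definition crystal_e ::
    "('a::euclidean_space, 'm) root_datum_scheme \<Rightarrow> ('v::ab_group_add, 'n) qmodule_scheme \<Rightarrow>
     'v set \<Rightarrow> nat \<Rightarrow> 'v set \<Rightarrow> 'v set" where
  "crystal_e R M L i = induced_op M L (kashiwara_e R M i)"

definition crystal_f ::
    "('a::euclidean_space, 'm) root_datum_scheme \<Rightarrow> ('v::ab_group_add, 'n) qmodule_scheme \<Rightarrow>
     'v set \<Rightarrow> nat \<Rightarrow> 'v set \<Rightarrow> 'v set" where
  "crystal_f R M L i = induced_op M L (kashiwara_f R M i)"

text \<open>\<open>B\<close> is a basis of the $\mathbb{Q}$-vector space $L/qL$, expressed through a system \<open>S\<close>
  of representatives in \<open>L\<close>. Uniqueness of \<open>c\<close> also forces distinct elements of \<open>S\<close>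
  to have distinct cosets.\<close>

definition quotient_basis ::
    "('v::ab_group_add, 'n) qmodule_scheme \<Rightarrow> 'v set \<Rightarrow> 'v set set \<Rightarrow> bool" where
  "quotient_basis M L B \<longleftrightarrow>
     (\<exists>S\<subseteq>L. B = qcoset M L ` S \<and>
        (\<forall>x\<in>L. \<exists>!c::'v \<Rightarrow> rat. finite {s. c s \<noteq> 0} \<and> {s. c s \<noteq> 0} \<subseteq> S \<and>
           x \<in> qcoset M L (\<Sum>s | c s \<noteq> 0. scl M (Fract [:c s:] 1) s)))"

definition crystal_basis ::
    "('a::euclidean_space, 'm) root_datum_scheme \<Rightarrow> ('v::ab_group_add, 'n) qmodule_scheme \<Rightarrow>
     'v set \<Rightarrow> 'v set set \<Rightarrow> bool" where
  "crystal_basis R M L B \<longleftrightarrow>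
     integrable_module R M \<and> crystal_lattice R M L \<and> quotient_basis M L B \<and>
     (\<forall>b\<in>B. \<exists>\<mu>\<in>weight_lattice R. \<exists>x\<in>L \<inter> weight_space R M \<mu>. b = qcoset M L x) \<and>
     (\<forall>i\<in>idx R. \<forall>b\<in>B. crystal_e R M L i b \<in> B \<union> {qcoset M L 0} \<and>
                       crystal_f R M L i b \<in> B \<union> {qcoset M L 0}) \<and>
     (\<forall>i\<in>idx R. \<forall>b\<in>B. \<forall>b'\<in>B. crystal_f R M L i b = b' \<longleftrightarrow> crystal_e R M L i b' = b)"

text \<open>Existence and uniqueness, up to isomorphism, of the crystal basis of the irreducible module
  $V_\lambda$ make \<open>B\<close>, with the operators \<open>crystal_e\<close> and the weight function
  \<open>crystal_wt\<close>, the crystal graph $\mathcal{B}_\lambda$.\<close>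

definition crystal_graph_of ::
    "('a::euclidean_space, 'm) root_datum_scheme \<Rightarrow> ('v::ab_group_add, 'n) qmodule_scheme \<Rightarrow>
     'a \<Rightarrow> 'v set \<Rightarrow> 'v set set \<Rightarrow> bool" where
  "crystal_graph_of R M lam L B \<longleftrightarrow>
     quantum_module R M \<and> irreducible_module R M \<and> highest_weight_module R M lam \<and>
     crystal_basis R M L B"

definition crystal_wt ::
    "('a::euclidean_space, 'm) root_datum_scheme \<Rightarrow> ('v::ab_group_add, 'n) qmodule_scheme \<Rightarrow>
     'v set \<Rightarrow> 'v set \<Rightarrow> 'a" where
  "crystal_wt R M L b =
     (THE \<mu>. \<mu> \<in> weight_lattice R \<and> (\<exists>x\<in>L \<inter> weight_space R M \<mu>. b = qcoset M L x))"


section \<open>BZL patterns\<close>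

fun word_row :: "cartan_type \<Rightarrow> nat \<Rightarrow> nat list" where
  "word_row Type_A m = rev [1..<Suc m]"
| "word_row Type_C m = rev [1..<Suc m] @ [2..<Suc m]"

definition word_rows :: "('a, 'm) root_datum_scheme \<Rightarrow> nat list list" where
  "word_rows R = map (word_row (ctype R)) [1..<Suc (rk R)]"

definition long_word :: "('a, 'm) root_datum_scheme \<Rightarrow> nat list" where
  "long_word R = concat (word_rows R)"

fun string_along :: "(nat \<Rightarrow> 'b \<Rightarrow> 'b) \<Rightarrow> 'b \<Rightarrow> nat list \<Rightarrow> 'b \<Rightarrow> nat list" where
  "string_along e z [] v = []"
| "string_along e z (i # is) v =
     (let b = (GREATEST k. (e i ^^ k) v \<noteq> z) in b # string_along e z is ((e i ^^ b) v))"

definition BZL ::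
    "('a::euclidean_space, 'm) root_datum_scheme \<Rightarrow> ('v::ab_group_add, 'n) qmodule_scheme \<Rightarrow>
     'v set \<Rightarrow> 'v set \<Rightarrow> nat list" where
  "BZL R M L v = string_along (crystal_e R M L) (qcoset M L 0) (long_word R) v"

text \<open>Positions in a pattern are counted from \<open>0\<close>: position \<open>j\<close> holds $b_{j+1}$.\<close>

definition last_in_row :: "('a, 'm) root_datum_scheme \<Rightarrow> nat \<Rightarrow> bool" where
  "last_in_row R j \<longleftrightarrow> (\<exists>m\<in>{1..rk R}. Suc j = length (concat (take m (word_rows R))))"

definition circled :: "('a, 'm) root_datum_scheme \<Rightarrow> nat list \<Rightarrow> nat \<Rightarrow> bool" where
  "circled R bs j \<longleftrightarrow> (if last_in_row R j then bs ! j = 0 else bs ! j = bs ! Suc j)"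

definition boxed ::
    "('a::euclidean_space, 'm) root_datum_scheme \<Rightarrow> 'a \<Rightarrow> nat list \<Rightarrow> nat \<Rightarrow> bool" where
  "boxed R lam bs j \<longleftrightarrow>
     real (bs ! j) =
       cpair (lam - (\<Sum>k\<in>{j<..<length (long_word R)}. real (bs ! k) *\<^sub>R sroot R (long_word R ! k)))
             (sroot R (long_word R ! j))"

definition stable ::
    "('a::euclidean_space, 'm) root_datum_scheme \<Rightarrow> 'a \<Rightarrow> nat list \<Rightarrow> bool" where
  "stable R lam bs \<longleftrightarrow> (\<forall>j<length (long_word R). circled R bs j \<noteq> boxed R lam bs j)"

definition stable_patterns ::
    "('a::euclidean_space, 'm) root_datum_scheme \<Rightarrow> ('v::ab_group_add, 'n) qmodule_scheme \<Rightarrow>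
     'a \<Rightarrow> 'v set \<Rightarrow> 'v set set \<Rightarrow> nat list set" where
  "stable_patterns R M lam L B = {BZL R M L v | v. v \<in> B \<and> stable R lam (BZL R M L v)}"

definition pattern_weyl ::
    "('a::euclidean_space, 'm) root_datum_scheme \<Rightarrow> 'a \<Rightarrow> nat list \<Rightarrow> 'a \<Rightarrow> 'a" where
  "pattern_weyl R lam bs =
     foldr (\<lambda>j w. (if boxed R lam bs j then sreflection R (long_word R ! j) else id) \<circ> w)
       [0..<length (long_word R)] id"

end

theory Submission
  imports Defs "HOL-Library.Function_Algebras"
begin

text \<open>The tensor powers of the vector representation carry a form for which words are orthonormal;
  it is anisotropic and $E_i$, $F_i$ are adjoint up to $K_i$, so each power is semisimple and has
  Kashiwara operators whose residues at $q = 0$ act on words by the signature rule. A highest weight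
  vector that is congruent to a dominant word embeds $V_\lambda$ into a tensor power, and every
  crystal basis of $V_\lambda$ becomes the set of words reachable from that word by lowering.

  On words the raising operators along the reduced word end at the dominant word, so the partial
  weights of a pattern are weights of crystal elements. In a stable pattern a nonzero circled entry
  would force an earlier entry to be both or neither of circled and boxed; hence circled entries
  vanish, boxed ones are reflections, and the weight is $w_v\lambda$. Conversely an element of
  extremal weight $w\lambda$ has a pattern that sorts $w\lambda$ by insertion, which is stable, and
  $w\lambda$ determines $w$ because $\lambda$ is regular.\<close>

text \<open>The obstacle is that \<open>L\<close> and \<open>B\<close> are known only through the
  axioms of a crystal basis, while strings have to be computed. The vector representation is
  explicit because in types A and C its weights form a single chain, along which each generator acts
  with coefficient 1. Anisotropy does the work of positivity: orthogonal projections exist, and a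
  vector of a cyclic submodule is determined by its pairings with the monomials in the F_i. For two
  highest weight vectors of equal weight these pairings agree up to the norms of the generators, so
  relations transfer from one module to the other. A crystal lattice is fixed only up to a scalar;
  hence the highest weight vector is first rescaled so that it lies in \<open>L\<close>, is
  primitive there and has its coset in \<open>B\<close>. After that \<open>L\<close> is exactly the
  set of vectors whose coordinates in the tensor power are regular at q = 0, and the elements of
  \<open>B\<close> are the classes of vectors congruent to a single word.\<close>

definition ev0 :: "ratq \<Rightarrow> rat" where
  "ev0 x = (THE c. \<exists>f g. x = Fract f g \<and> poly g 0 \<noteq> 0 \<and> c = poly f 0 / poly g 0)"

lemma regular_Fract: "poly g 0 \<noteq> 0 \<Longrightarrow> Fract f g \<in> regular_at_0"
  unfolding regular_at_0_def by blast

lemma regularE: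
  assumes "x \<in> regular_at_0"
  obtains f g where "x = Fract f g" "poly g 0 \<noteq> 0"
  using assms unfolding regular_at_0_def by blast

lemma ev0_Fract:
  assumes "poly g 0 \<noteq> 0"
  shows "ev0 (Fract f g) = poly f 0 / poly g 0"
  unfolding ev0_def
proof (rule the_equality)
  show "\<exists>f' g'. Fract f g = Fract f' g' \<and> poly g' 0 \<noteq> 0 \<and> poly f 0 / poly g 0 = poly f' 0 / poly g' 0"
    using assms by blast
next
  fix c assume "\<exists>f' g'. Fract f g = Fract f' g' \<and> poly g' 0 \<noteq> 0 \<and> c = poly f' 0 / poly g' 0"
  then obtain f' g' where h: "Fract f g = Fract f' g'" "poly g' 0 \<noteq> 0" "c = poly f' 0 / poly g' 0"
    by blast
  have "g \<noteq> 0" "g' \<noteq> 0" using assms h(2) by auto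
  with h(1) have "f * g' = f' * g" by (simp add: eq_fract)
  hence "poly (f * g') 0 = poly (f' * g) 0" by simp
  hence "poly f 0 * poly g' 0 = poly f' 0 * poly g 0" by simp
  thus "c = poly f 0 / poly g 0" unfolding h(3) using assms h(2) by (simp add: divide_eq_eq eq_divide_eq)
qed

lemma regular_mult:
  assumes "x \<in> regular_at_0" "y \<in> regular_at_0"
  shows "x * y \<in> regular_at_0 \<and> ev0 (x * y) = ev0 x * ev0 y"
proof -
  obtain f g f' g' where "x = Fract f g" "poly g 0 \<noteq> 0" "y = Fract f' g'" "poly g' 0 \<noteq> 0"
    using assms by (metis regularE)
  thus ?thesis by (simp add: regular_Fract ev0_Fract)
qed

lemma regular_add:
  assumes "x \<in> regular_at_0" "y \<in> regular_at_0"
  shows "x + y \<in> regular_at_0 \<and> ev0 (x + y) = ev0 x + ev0 y"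
proof -
  obtain f g f' g' where h: "x = Fract f g" "poly g 0 \<noteq> 0" "y = Fract f' g'" "poly g' 0 \<noteq> 0"
    using assms by (metis regularE)
  have ne: "g \<noteq> 0" "g' \<noteq> 0" using h by auto
  show ?thesis using h ne by (simp add: regular_Fract ev0_Fract add_frac_eq)
qed

lemma regular_const: "Fract [:c:] 1 \<in> regular_at_0" "ev0 (Fract [:c:] 1) = c"
  by (simp_all add: regular_Fract ev0_Fract)

lemma regular_0 [simp]: "0 \<in> regular_at_0" "ev0 0 = 0"
  using regular_const[of 0] by (simp_all add: Zero_fract_def)

lemma regular_1 [simp]: "1 \<in> regular_at_0" "ev0 1 = 1"
  using regular_const[of 1] by (simp_all add: One_fract_def one_pCons)

lemma regular_uminus:
  assumes "x \<in> regular_at_0"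
  shows "- x \<in> regular_at_0 \<and> ev0 (- x) = - ev0 x"
proof -
  have m: "(-1::ratq) = Fract [:-1:] 1" by (simp add: One_fract_def one_pCons)
  show ?thesis using regular_mult[OF regular_const(1)[of "-1"] assms] regular_const(2)[of "-1"]
    by (simp flip: m)
qed

lemma regular_diff:
  assumes "x \<in> regular_at_0" "y \<in> regular_at_0"
  shows "x - y \<in> regular_at_0 \<and> ev0 (x - y) = ev0 x - ev0 y"
  using regular_add[OF assms(1)] regular_uminus[OF assms(2)] by (simp only: diff_conv_add_uminus)

lemma regular_sum:
  assumes "\<And>i. i \<in> S \<Longrightarrow> f i \<in> regular_at_0"
  shows "sum f S \<in> regular_at_0 \<and> ev0 (sum f S) = (\<Sum>i\<in>S. ev0 (f i))"
  using assms by (induction S rule: infinite_finite_induct) (simp_all add: regular_add)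

lemma regular_power:
  assumes "x \<in> regular_at_0"
  shows "x ^ n \<in> regular_at_0 \<and> ev0 (x ^ n) = ev0 x ^ n"
  using assms by (induction n) (simp_all add: regular_mult)

lemma regular_inverse:
  assumes "x \<in> regular_at_0" "ev0 x \<noteq> 0"
  shows "inverse x \<in> regular_at_0 \<and> ev0 (inverse x) = inverse (ev0 x)"
proof -
  obtain f g where h: "x = Fract f g" "poly g 0 \<noteq> 0" using assms by (metis regularE)
  have "poly f 0 \<noteq> 0" using assms(2) h by (simp add: ev0_Fract)
  thus ?thesis using h by (simp add: regular_Fract ev0_Fract)
qed

lemma regular_divide:
  assumes "x \<in> regular_at_0" "y \<in> regular_at_0" "ev0 y \<noteq> 0"
  shows "x / y \<in> regular_at_0 \<and> ev0 (x / y) = ev0 x / ev0 y"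
  using regular_mult[OF assms(1), of "inverse y"] regular_inverse[OF assms(2,3)]
  by (simp add: divide_inverse)

lemma regular_qq [simp]: "qq \<in> regular_at_0" "ev0 qq = 0"
  unfolding qq_def by (simp_all add: regular_Fract ev0_Fract)

lemma qq_nonzero [simp]: "qq \<noteq> 0"
  unfolding qq_def by (simp add: Zero_fract_def eq_fract)

text \<open>A numerator with vanishing constant term is divisible by the indeterminate, so
  \<open>qq\<close> generates the maximal ideal of the local ring.\<close>

lemma ev0_eq_0D:
  assumes "x \<in> regular_at_0" "ev0 x = 0"
  shows "x / qq \<in> regular_at_0"
proof -
  obtain f g where h: "x = Fract f g" "poly g 0 \<noteq> 0" using assms by (metis regularE)
  have "poly f 0 = 0" using assms(2) h by (simp add: ev0_Fract)
  then obtain f' where f: "f = [:0,1:] * f'"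
    by (metis dvdE poly_eq_0_iff_dvd minus_zero)
  have "g \<noteq> 0" using h(2) by auto
  hence "x / qq = Fract f' g" unfolding h f qq_def
    by (simp add: eq_fract)
  thus ?thesis using h(2) by (simp add: regular_Fract)
qed

text \<open>Once all factors of the indeterminate are split off from numerator and denominator, the
  rest is a unit of the local ring; the surplus power decides which alternative holds.\<close>

lemma valuation_ring:
  assumes "(x::ratq) \<noteq> 0"
  shows "x \<in> regular_at_0 \<or> (inverse x \<in> regular_at_0 \<and> ev0 (inverse x) = 0)"
proof -
  obtain f g where h: "x = Fract f g" "g \<noteq> 0" by (cases x) auto
  have f0: "f \<noteq> 0" using assms h by (auto simp: Zero_fract_def eq_fract)
  obtain f' where f': "f = [:0,1:] ^ order 0 f * f'" "\<not> [:0,1:] dvd f'"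
    using order_decomp[OF f0, of 0] by auto
  obtain g' where g': "g = [:0,1:] ^ order 0 g * g'" "\<not> [:0,1:] dvd g'"
    using order_decomp[OF h(2), of 0] by auto
  have nz: "poly f' 0 \<noteq> 0" "poly g' 0 \<noteq> 0"
    using f'(2) g'(2) poly_eq_0_iff_dvd[of _ 0] by auto
  hence ne: "f' \<noteq> 0" "g' \<noteq> 0" by auto
  let ?X = "[:0,1::rat:]"
  show ?thesis
  proof (cases "order 0 f \<ge> order 0 g")
    case True
    then obtain k where "order 0 f = order 0 g + k" using le_Suc_ex by blast
    hence "x = Fract (?X ^ k * f') g'"
      unfolding h(1) using ne h(2) by (subst f'(1), subst g'(1)) (simp add: eq_fract power_add)
    thus ?thesis using nz by (simp add: regular_Fract)
  next
    case False
    then obtain k where k: "order 0 g = order 0 f + k" "k > 0" using less_imp_add_positive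
      by (metis not_le)
    hence "inverse x = Fract (?X ^ k * g') f'"
      unfolding h(1) inverse_fract using ne f0
      by (subst f'(1), subst g'(1)) (simp add: eq_fract power_add)
    thus ?thesis using nz k(2) by (simp add: regular_Fract ev0_Fract)
  qed
qed

text \<open>\<open>t\<close> is an entry of minimal valuation. Dividing by it makes the family
  regular with one entry equal to 1, so that passing to q = 0 does not lose everything.\<close>

lemma exists_dominating:
  fixes f :: "'i \<Rightarrow> ratq"
  assumes "finite S" "s \<in> S" "f s \<noteq> 0"
  shows "\<exists>t\<in>S. f t \<noteq> 0 \<and> (\<forall>s\<in>S. f s / f t \<in> regular_at_0)"
proof -
  have "s \<in> S \<Longrightarrow> f s \<noteq> 0 \<Longrightarrow> ?thesis" for s using assms(1)
  proof (induction S arbitrary: s rule: finite_induct)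
    case empty thus ?case by simp
  next
    case (insert x F)
    show ?case
    proof (cases "\<exists>s\<in>F. f s \<noteq> 0")
      case False
      hence "f x \<noteq> 0" using insert.prems by auto
      moreover have "f s / f x \<in> regular_at_0" if "s \<in> insert x F" for s
        using that False calculation by (cases "s = x") auto
      ultimately show ?thesis by blast
    next
      case True
      then obtain t where t: "t \<in> F" "f t \<noteq> 0" "\<forall>s\<in>F. f s / f t \<in> regular_at_0"
        using insert.IH by blast
      show ?thesis
      proof (cases "f x / f t \<in> regular_at_0")
        case True thus ?thesis using t by auto
      next
        case False
        hence nx: "f x \<noteq> 0" by auto
        hence "f t / f x \<in> regular_at_0" using valuation_ring[of "f x / f t"] False t(2) by auto
        hence "f s / f x \<in> regular_at_0" if "s \<in> F" for s
          using regular_mult[of "f s / f t" "f t / f x"] t that by simp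
        thus ?thesis using nx by (intro bexI[of _ x]) auto
      qed
    qed
  qed
  thus ?thesis using assms by blast
qed

text \<open>After division by a dominating entry, evaluation at q = 0 gives a vanishing sum of
  rational squares, one of which is 1.\<close>

lemma sum_squares_eq_0_ratq:
  fixes f :: "'i \<Rightarrow> ratq"
  assumes "finite S" "(\<Sum>s\<in>S. f s * f s) = 0" "s \<in> S"
  shows "f s = 0"
proof (rule ccontr)
  assume "f s \<noteq> 0"
  then obtain t where t: "t \<in> S" "f t \<noteq> 0" "\<forall>s\<in>S. f s / f t \<in> regular_at_0"
    using exists_dominating[OF assms(1,3), of f] by blast
  let ?g = "\<lambda>s. f s / f t"
  have "(\<Sum>s\<in>S. ?g s * ?g s) = (\<Sum>s\<in>S. f s * f s) / (f t * f t)"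
    by (simp add: sum_divide_distrib)
  hence "(\<Sum>s\<in>S. ?g s * ?g s) = 0" using assms by simp
  moreover have "ev0 (\<Sum>s\<in>S. ?g s * ?g s) = (\<Sum>s\<in>S. ev0 (?g s) * ev0 (?g s))"
  proof -
    have "ev0 (\<Sum>s\<in>S. ?g s * ?g s) = (\<Sum>s\<in>S. ev0 (?g s * ?g s))"
      using t(3) by (intro regular_sum[THEN conjunct2] regular_mult[THEN conjunct1]) blast+
    also have "\<dots> = (\<Sum>s\<in>S. ev0 (?g s) * ev0 (?g s))"
      using t(3) by (intro sum.cong refl regular_mult[THEN conjunct2]) blast+
    finally show ?thesis .
  qed
  ultimately have "(\<Sum>s\<in>S. ev0 (?g s) * ev0 (?g s)) = 0" by simp
  hence "ev0 (?g t) * ev0 (?g t) = 0"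
    using t(1) assms(1) by (subst (asm) sum_nonneg_eq_0_iff) (auto simp del: divide_self_if)
  moreover have "?g t = 1" using t(2) by simp
  ultimately show False by simp
qed

section \<open>Quantum integers\<close>

text \<open>Covers q and q^2 at once, so that quantum integers need no distinction between long and
  short roots.\<close>

definition qpar :: "ratq \<Rightarrow> bool" where
  "qpar v \<longleftrightarrow> (\<exists>d>0. v = qq ^ d)"

text \<open>The quantum integer [m]. Negative m must be allowed, because the commutator of E_i and
  F_i acts on a vector of i-weight m by [m].\<close>

definition qbr :: "ratq \<Rightarrow> int \<Rightarrow> ratq" where
  "qbr v m = (v powi m - v powi (- m)) / (v - inverse v)"

lemma qpar_qi: "qpar (qi X i)"
  unfolding qpar_def qi_def by (auto intro: exI[of _ 1] exI[of _ 2])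

lemma qint_qbr: "qint X i n = qbr (qi X i) (int n)"
  unfolding qint_def qbr_def by (simp add: power_int_minus power_inverse)

lemma qpar_nonzero: "qpar v \<Longrightarrow> v \<noteq> 0"
  unfolding qpar_def by auto

lemma qpar_regular: "qpar v \<Longrightarrow> v \<in> regular_at_0" "qpar v \<Longrightarrow> ev0 v = 0"
  unfolding qpar_def using regular_power[OF regular_qq(1)] by (auto simp: power_0_left)

lemma qpar_power_neq_1:
  assumes "qpar v" "n > 0"
  shows "v ^ n \<noteq> 1"
proof
  assume "v ^ n = 1"
  hence "ev0 (v ^ n) = 1" by simp
  thus False using regular_power[of v n] qpar_regular[OF assms(1)] assms(2) by (simp add: power_0_left)
qed

lemma qpar_powi_eq_1:
  assumes "qpar v"
  shows "v powi m = 1 \<longleftrightarrow> m = 0"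
proof
  assume h: "v powi m = 1"
  show "m = 0"
  proof (rule ccontr)
    assume "m \<noteq> 0"
    moreover have "v ^ nat \<bar>m\<bar> = 1"
      using h by (cases "m \<ge> 0") (auto simp: power_int_def power_inverse)
    ultimately show False using qpar_power_neq_1[OF assms, of "nat \<bar>m\<bar>"] by simp
  qed
qed simp

lemma qpar_powi_inj:
  assumes "qpar v"
  shows "v powi m = v powi n \<longleftrightarrow> m = n"
proof -
  have "v powi m = v powi n \<longleftrightarrow> v powi (m - n) = 1"
    using qpar_nonzero[OF assms] by (auto simp: power_int_diff)
  thus ?thesis using qpar_powi_eq_1[OF assms, of "m - n"] by simp
qed

lemma qpar_diff_nonzero: "qpar v \<Longrightarrow> v - inverse v \<noteq> 0"
  using qpar_powi_inj[of v 1 "-1"] by (simp add: power_int_minus)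

lemma qbr_0 [simp]: "qbr v 0 = 0"
  unfolding qbr_def by simp

lemma qbr_minus: "qbr v (- m) = - qbr v m"
  unfolding qbr_def by (simp add: minus_divide_left)

lemma qbr_1: "qpar v \<Longrightarrow> qbr v 1 = 1"
  unfolding qbr_def using qpar_diff_nonzero[of v] by (simp add: power_int_minus)

lemma qbr_eq_0_iff: "qpar v \<Longrightarrow> qbr v m = 0 \<longleftrightarrow> m = 0"
  unfolding qbr_def using qpar_diff_nonzero[of v] qpar_powi_inj[of v m "-m"] by auto

lemma qbr_step:
  assumes "qpar v"
  shows "qbr v (m + 1) = v * qbr v m + v powi (- m)"
proof -
  have v: "v \<noteq> 0" "v - inverse v \<noteq> 0" using assms qpar_nonzero qpar_diff_nonzero by auto
  have "v powi (m + 1) - v powi (- (m + 1)) =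
        v * (v powi m - v powi (- m)) + v powi (- m) * (v - inverse v)"
    using v(1) by (simp add: power_int_add power_int_diff power_int_minus field_simps)
  thus ?thesis unfolding qbr_def using v(2) by (simp add: field_simps)
qed

text \<open>By the recurrence \<open>qbr_step\<close>, each new term has a lower exponent and
  becomes the leading one at q = 0. Ratios of quantum integers therefore have an explicit order
  (\<open>qbr_ratio\<close>).\<close>

lemma qbr_leading:
  assumes "qpar v" "n > 0"
  shows "\<exists>u\<in>regular_at_0. ev0 u = 1 \<and> qbr v (int n) = v powi (1 - int n) * u"
  using assms(2)
proof (induction n rule: nat_induct_non_zero)
  case 1
  thus ?case using qbr_1[OF assms(1)] by (intro bexI[of _ 1]) auto
next
  case (Suc n)
  then obtain u where u: "u \<in> regular_at_0" "ev0 u = 1" "qbr v (int n) = v powi (1 - int n) * u"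
    by blast
  have v: "v \<noteq> 0" using assms qpar_nonzero by auto
  have "qbr v (int (Suc n)) = v * qbr v (int n) + v powi (- int n)"
    using qbr_step[OF assms(1), of "int n"] by (simp add: add.commute)
  also have "\<dots> = v powi (1 - int (Suc n)) * (1 + v * v * u)"
    unfolding u(3) using v by (simp add: power_int_diff power_int_minus field_simps)
  finally have e: "qbr v (int (Suc n)) = v powi (1 - int (Suc n)) * (1 + v * v * u)" .
  have "v * v * u \<in> regular_at_0 \<and> ev0 (v * v * u) = 0"
    using qpar_regular[OF assms(1)] u(1) by (simp add: regular_mult)
  thus ?case using e regular_add[of 1 "v * v * u"] by (intro bexI[of _ "1 + v * v * u"]) auto
qed

lemma qbr_ratio:
  assumes "qpar v" "m > 0" "n > 0"
  shows "\<exists>u\<in>regular_at_0. ev0 u = 1 \<and> qbr v (int m) / qbr v (int n) = v powi (int n - int m) * u"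
proof -
  obtain x y where h: "x \<in> regular_at_0" "ev0 x = 1" "qbr v (int m) = v powi (1 - int m) * x"
     "y \<in> regular_at_0" "ev0 y = 1" "qbr v (int n) = v powi (1 - int n) * y"
    using qbr_leading[OF assms(1)] assms(2,3) by metis
  have v: "v \<noteq> 0" using assms qpar_nonzero by auto
  have "y \<noteq> 0" using h by auto
  hence "qbr v (int m) / qbr v (int n) = v powi (int n - int m) * (x / y)"
    unfolding h using v by (simp add: power_int_diff field_simps)
  thus ?thesis using regular_divide[OF h(1,4)] h by (intro bexI[of _ "x / y"]) auto
qed

section \<open>The letters of the vector representation and their weights\<close>

locale letter_chain =
  fixes X :: cartan_type and r :: nat
  assumes rank_pos: "1 \<le> r"
begin

text \<open>The crystal of the vector representation is the chain $0 \to 1 \to \dots \to D$, in which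
  the arrow from \<open>t\<close> to \<open>t + 1\<close> is labelled \<open>lab t\<close>.\<close>

definition D :: nat where
  "D = (case X of Type_A \<Rightarrow> r | Type_C \<Rightarrow> 2 * r - 1)"

text \<open>Along the chain the labels read r, ..., 1 in type A and r, ..., 1, 2, ..., r in type C;
  the arrow at t = r - 1 carries the label 1.\<close>

definition lab :: "nat \<Rightarrow> nat" where
  "lab t = (if t < r then r - t else t - r + 2)"

definition up :: "nat \<Rightarrow> nat \<Rightarrow> bool" where
  "up i t \<longleftrightarrow> t < D \<and> lab t = i"

definition dn :: "nat \<Rightarrow> nat \<Rightarrow> bool" where
  "dn i t \<longleftrightarrow> 0 < t \<and> t \<le> D \<and> lab (t - 1) = i"

text \<open>The pairing of the weight of letter t with the i-th simple coroot. It lies in {-1, 0, 1}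
  because no two consecutive arrows have the same label. \<open>hp\<close> is its additive extension
  to words.\<close>

definition pr :: "nat \<Rightarrow> nat \<Rightarrow> int" where
  "pr i t = of_bool (up i t) - of_bool (dn i t)"

definition hp :: "nat \<Rightarrow> nat list \<Rightarrow> int" where
  "hp i w = (\<Sum>t\<leftarrow>w. pr i t)"

abbreviation ca :: "nat \<Rightarrow> nat \<Rightarrow> int" where "ca \<equiv> cartan_int X"
abbreviation idxs :: "nat set" where "idxs \<equiv> {1..r}"

lemma D_eq: "X = Type_A \<Longrightarrow> D = r" "X = Type_C \<Longrightarrow> D = 2 * r - 1"
  unfolding D_def by (simp_all split: cartan_type.split)

lemma D_if: "D = (if X = Type_A then r else 2 * r - 1)"
  unfolding D_def by (simp split: cartan_type.split)

lemma r_le_D: "r \<le> D"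
  using rank_pos unfolding D_if by auto

lemma lab_idxs: "t < D \<Longrightarrow> lab t \<in> idxs"
  using rank_pos unfolding D_if lab_def by (auto split: if_splits)

lemma lab_Suc_neq: "lab (Suc t) \<noteq> lab t"
  by (auto simp: lab_def)

lemma up_not_dn: "up i t \<Longrightarrow> \<not> dn i t"
  using lab_Suc_neq[of "t - 1"] by (auto simp: up_def dn_def)

lemma up_Suc: "up i t \<longleftrightarrow> dn i (Suc t)"
  by (auto simp: up_def dn_def)

lemma dn_pred: "dn i t \<Longrightarrow> up i (t - 1) \<and> t > 0"
  by (auto simp: up_def dn_def)

lemma up_lab: "t < D \<Longrightarrow> up (lab t) t"
  by (simp add: up_def)

lemma pr_up [simp]: "up i t \<Longrightarrow> pr i t = 1"
  using up_not_dn by (simp add: pr_def)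

lemma pr_dn [simp]: "dn i t \<Longrightarrow> pr i t = -1"
  using up_not_dn by (auto simp: pr_def)

lemma pr_neutral [simp]: "\<not> up i t \<Longrightarrow> \<not> dn i t \<Longrightarrow> pr i t = 0"
  by (simp add: pr_def)

text \<open>An arrow lowers the weight by the simple root of its label. By \<open>e\<close> this
  amounts to counting: the Cartan integer is 2 for the label itself and otherwise minus the number
  of neighbouring arrows labelled j. At the turning point of type C both neighbours, if present,
  carry the label 2, which yields the entry -2.\<close>

lemma pr_Suc:
  assumes "t < D" "j \<in> idxs"
  shows "pr j (Suc t) = pr j t - ca j (lab t)"
proof -
  have u: "up j (Suc t) \<longleftrightarrow> Suc t < D \<and> lab (Suc t) = j" and d: "dn j t \<longleftrightarrow> 0 < t \<and> lab (t - 1) = j"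
    using assms(1) by (auto simp: up_def dn_def)
  have e: "pr j (Suc t) - pr j t = of_bool (up j (Suc t)) + of_bool (dn j t) - 2 * of_bool (lab t = j)"
    using assms(1) by (simp add: pr_def up_def dn_def)
  have "of_bool (up j (Suc t)) + of_bool (dn j t) - 2 * of_bool (lab t = j) = - ca j (lab t)"
  proof (cases X)
    case Type_A
    have t: "t < r" using assms(1) D_eq Type_A by simp
    define l where "l = r - t"
    have tl: "t = r - l" "1 \<le> l" "l \<le> r" using t unfolding l_def by auto
    have "up j (Suc t) \<longleftrightarrow> Suc j = l" "dn j t \<longleftrightarrow> j = Suc l" "lab t = l"
      unfolding u d using tl assms(2) D_eq(1)[OF Type_A] by (auto simp: lab_def)
    thus ?thesis using Type_A by (auto simp: cartan_int_def)
  next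
    case Type_C
    have D: "D = 2 * r - 1" using D_eq(2) Type_C by simp
    show ?thesis
    proof (cases "Suc t < r")
      case True
      define l where "l = r - t"
      have tl: "t = r - l" "2 \<le> l" "l \<le> r" using True unfolding l_def by auto
      have "up j (Suc t) \<longleftrightarrow> Suc j = l" "dn j t \<longleftrightarrow> j = Suc l" "lab t = l"
        unfolding u d using tl assms(2) D by (auto simp: lab_def)
      thus ?thesis using Type_C tl assms(2) by (auto simp: cartan_int_def)
    next
      case False
      show ?thesis
      proof (cases "Suc t = r")
        case True
        have "up j (Suc t) \<longleftrightarrow> j = 2" "dn j t \<longleftrightarrow> j = 2" "lab t = 1"
          unfolding u d using True assms(2) D by (auto simp: lab_def)
        thus ?thesis using Type_C assms(2) by (auto simp: cartan_int_def)
      next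
        case False
        define l where "l = t - r + 2"
        have tl: "t = r + l - 2" "2 \<le> l" "l \<le> r"
          using False \<open>\<not> Suc t < r\<close> assms(1) D unfolding l_def by auto
        have "up j (Suc t) \<longleftrightarrow> j = Suc l" "lab t = l"
          unfolding u using tl assms(2) D by (auto simp: lab_def)
        moreover have "dn j t \<longleftrightarrow> Suc j = l"
        proof (cases "l = 2")
          case True thus ?thesis unfolding d using tl assms(2) by (auto simp: lab_def)
        next
          case False thus ?thesis unfolding d using tl assms(2) by (auto simp: lab_def)
        qed
        ultimately show ?thesis using Type_C tl assms(2) by (auto simp: cartan_int_def)
      qed
    qed
  qed
  thus ?thesis using e by simp
qed

lemma lab_eq:
  assumes "lab t = lab t'" "t < t'" "t' < D"
  shows "X = Type_C \<and> t < r \<and> r \<le> t' \<and> r + r = t + t' + 2"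
proof -
  have "r \<le> t'" using assms by (auto simp: lab_def split: if_splits)
  moreover from this have "X = Type_C" using assms(3) D_eq(1) by (cases X) auto
  moreover have "t < r" using assms(1,2) \<open>r \<le> t'\<close> by (auto simp: lab_def split: if_splits)
  ultimately show ?thesis using assms(1) by (auto simp: lab_def)
qed

text \<open>If t < t' had equal weights, the arrows leaving them would share a label, and so would
  the arrows entering them. By \<open>lab_eq\<close> equal labels sit at mirror positions, which
  would make t + t' and (t - 1) + (t' - 1) the same number.\<close>

lemma pr_inj:
  assumes "t \<le> D" "t' \<le> D" "\<And>i. i \<in> idxs \<Longrightarrow> pr i t = pr i t'"
  shows "t = t'"
proof -
  have up_iff: "up i t \<longleftrightarrow> pr i t = 1" and dn_iff: "dn i t \<longleftrightarrow> pr i t = -1" for i t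
    using up_not_dn[of i t] by (auto simp: pr_def of_bool_def)
  have w: False if h: "t < t'" "t' \<le> D" "\<And>i. i \<in> idxs \<Longrightarrow> pr i t = pr i t'" for t t'
  proof -
    have tD: "t < D" using h by simp
    hence "up (lab t) t'" using up_lab[OF tD] up_iff h(3) lab_idxs by metis
    hence *: "t' < D" "lab t = lab t'" by (auto simp: up_def)
    have d: "dn (lab (t' - 1)) t'" using h(1,2) by (auto simp: dn_def)
    have "lab (t' - 1) \<in> idxs" using lab_idxs[of "t' - 1"] *(1) by simp
    hence "dn (lab (t' - 1)) t" using d dn_iff h(3) by metis
    hence **: "t > 0" "lab (t - 1) = lab (t' - 1)" by (auto simp: dn_def)
    have a: "r + r = t + t' + 2" using lab_eq[OF *(2) h(1) *(1)] by simp
    have b: "r + r = (t - 1) + (t' - 1) + 2" using lab_eq[OF **(2)] ** h(1) *(1) by linarith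
    show False using a b **(1) h(1) by simp
  qed
  show ?thesis
    using w[of t t'] w[of t' t] assms by (metis linorder_cases)
qed

lemma hp_simps [simp]: "hp i [] = 0" "hp i (a # w) = pr i a + hp i w"
  by (simp_all add: hp_def)

lemma hp_append: "hp i (u @ w) = hp i u + hp i w"
  by (simp add: hp_def)

section \<open>The signature rule\<close>

text \<open>\<open>ep\<close> and \<open>ph\<close> are the string lengths $\varepsilon_i$, $\varphi_i$. The head of a list is the
  last tensor factor.\<close>

fun ep :: "nat \<Rightarrow> nat list \<Rightarrow> nat" and ph :: "nat \<Rightarrow> nat list \<Rightarrow> nat" where
  "ep i [] = 0"
| "ep i (a # w) = (if dn i a \<and> ph i w = 0 then Suc (ep i w) else ep i w)"
| "ph i [] = 0"
| "ph i (a # w) = (if up i a then Suc (ph i w) else if dn i a then ph i w - 1 else ph i w)"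

text \<open>A crystal operator only where \<open>ph i w > 0\<close>, just as \<open>ew\<close> is
  one only where \<open>ep i w > 0\<close>. The value zero of the crystal operators is expressed by
  these guards instead of an extra element.\<close>

fun fw :: "nat \<Rightarrow> nat list \<Rightarrow> nat list" where
  "fw i [] = []"
| "fw i (a # w) = (if up i a \<and> ph i w = 0 then Suc a # w else a # fw i w)"

fun ew :: "nat \<Rightarrow> nat list \<Rightarrow> nat list" where
  "ew i [] = []"
| "ew i (a # w) = (if dn i a \<and> ph i w = 0 then (a - 1) # w else a # ew i w)"

text \<open>All raisings by node i in a single pass: a letter is raised iff no letter of the tail
  cancels it. \<open>em_eq_funpow\<close> identifies this with the iteration of
  \<open>ew\<close>.\<close>

fun em :: "nat \<Rightarrow> nat list \<Rightarrow> nat list" where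
  "em i [] = []"
| "em i (a # w) = (if dn i a \<and> ph i w = 0 then a - 1 else a) # em i w"

lemma hp_eq: "hp i w = int (ph i w) - int (ep i w)"
  using up_not_dn by (induction w) (auto simp: of_nat_diff)

lemma fw_props:
  "ph i w > 0 \<Longrightarrow> ep i (fw i w) = Suc (ep i w) \<and> Suc (ph i (fw i w)) = ph i w \<and> ew i (fw i w) = w \<and>
     sum_list (fw i w) = Suc (sum_list w)"
proof (induction w)
  case Nil thus ?case by simp
next
  case (Cons a w)
  consider "up i a" "ph i w = 0" | "up i a" "ph i w > 0" | "dn i a" "ph i w > 1" |
     "\<not> up i a" "\<not> dn i a" "ph i w > 0"
    using Cons.prems by (auto split: if_splits)
  thus ?case
  proof cases
    case 1
    thus ?thesis using up_not_dn[of i a] up_Suc[of i a] up_not_dn[of i "Suc a"] by auto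
  next
    case 2 thus ?thesis using Cons.IH up_not_dn[of i a] by auto
  next
    case 3 thus ?thesis using Cons.IH up_not_dn[of i a] by auto
  next
    case 4 thus ?thesis using Cons.IH by auto
  qed
qed

lemma ew_props:
  "ep i w > 0 \<Longrightarrow> Suc (ep i (ew i w)) = ep i w \<and> ph i (ew i w) = Suc (ph i w) \<and> fw i (ew i w) = w \<and>
     Suc (sum_list (ew i w)) = sum_list w"
proof (induction w)
  case Nil thus ?case by simp
next
  case (Cons a w)
  consider "dn i a" "ph i w = 0" | "dn i a" "ph i w > 0" "ep i w > 0" | "\<not> dn i a" "ep i w > 0"
    using Cons.prems by (auto split: if_splits)
  thus ?case
  proof cases
    case 1
    thus ?thesis using dn_pred[of i a] up_not_dn[of i "a - 1"] up_not_dn[of i a] by auto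
  next
    case 2 thus ?thesis using Cons.IH up_not_dn[of i a] by auto
  next
    case 3 thus ?thesis using Cons.IH by auto
  qed
qed

lemma length_ops [simp]: "length (fw i w) = length w" "length (ew i w) = length w" "length (em i w) = length w"
  by (induction w) auto

lemma set_fw: "set w \<subseteq> {..D} \<Longrightarrow> set (fw i w) \<subseteq> {..D}"
  by (induction w) (auto simp: up_def)

lemma set_ew: "set w \<subseteq> {..D} \<Longrightarrow> set (ew i w) \<subseteq> {..D}"
  by (induction w) (auto simp: dn_def)

lemma pr_up_Suc: "up i a \<Longrightarrow> j \<in> idxs \<Longrightarrow> pr j (Suc a) = pr j a - ca j i"
  using pr_Suc[of a j] by (auto simp: up_def)

lemma hp_fw: "ph i w > 0 \<Longrightarrow> j \<in> idxs \<Longrightarrow> hp j (fw i w) = hp j w - ca j i"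
  by (induction w) (auto simp: pr_up_Suc split: if_splits)

lemma hp_ew: "ep i w > 0 \<Longrightarrow> j \<in> idxs \<Longrightarrow> hp j (ew i w) = hp j w + ca j i"
  using hp_fw[of i "ew i w" j] ew_props[of i w] by simp

lemma em_0: "ep i w = 0 \<Longrightarrow> em i w = w"
  by (induction w) (auto split: if_splits)

lemma em_ew: "ep i w > 0 \<Longrightarrow> em i (ew i w) = em i w"
proof (induction w)
  case (Cons a w)
  consider "dn i a" "ph i w = 0" | "dn i a" "ph i w > 0" "ep i w > 0" | "\<not> dn i a" "ep i w > 0"
    using Cons.prems by (auto split: if_splits)
  thus ?case
  proof cases
    case 1 thus ?thesis using dn_pred[of i a] up_not_dn[of i "a - 1"] by auto
  next
    case 2 thus ?thesis using Cons.IH ew_props[of i w] by auto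
  next
    case 3 thus ?thesis using Cons.IH by auto
  qed
qed simp

lemma em_eq_funpow: "em i w = (ew i ^^ ep i w) w"
proof (induction "ep i w" arbitrary: w)
  case 0 thus ?case by (simp add: em_0)
next
  case (Suc n)
  have "ep i (ew i w) = n" using ew_props[of i w] Suc.hyps(2) by simp
  hence "em i (ew i w) = (ew i ^^ n) (ew i w)" using Suc.hyps(1) by metis
  thus ?case using em_ew[of i w] Suc.hyps(2) by (metis funpow_swap1 funpow_simps_right(2) comp_apply zero_less_Suc)
qed

lemma ep_funpow_ew: "k \<le> ep i w \<Longrightarrow> ep i ((ew i ^^ k) w) = ep i w - k"
proof (induction k)
  case (Suc k)
  hence "ep i ((ew i ^^ k) w) = ep i w - k" by simp
  moreover have "Suc (ep i (ew i ((ew i ^^ k) w))) = ep i ((ew i ^^ k) w)"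
    using ew_props[of i "(ew i ^^ k) w"] Suc.prems calculation by simp
  ultimately show ?case by simp
qed simp

lemma hp_funpow_ew: "k \<le> ep i w \<Longrightarrow> j \<in> idxs \<Longrightarrow> hp j ((ew i ^^ k) w) = hp j w + int k * ca j i"
proof (induction k)
  case (Suc k)
  thus ?case using hp_ew[of i "(ew i ^^ k) w" j] ep_funpow_ew[of k i w] by (simp add: algebra_simps)
qed simp

lemma ep_em: "ep i (em i w) = 0"
  by (simp add: em_eq_funpow ep_funpow_ew)

lemma hp_em: "j \<in> idxs \<Longrightarrow> hp j (em i w) = hp j w + int (ep i w) * ca j i"
  by (simp add: em_eq_funpow hp_funpow_ew)

text \<open>$\varepsilon_i$ is minus the minimum of the pairing path: $e_i^{\max}$ is a Pitman transform.\<close>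

lemma ep_Cons: "int (ep i (a # w)) = max (int (ep i w)) (- hp i (a # w))"
proof -
  consider "up i a" | "dn i a" "ph i w = 0" | "dn i a" "ph i w > 0" | "\<not> up i a" "\<not> dn i a" by blast
  thus ?thesis using hp_eq[of i w] up_not_dn[of i a] by cases auto
qed

lemma ep_mono: "ep i w \<le> ep i (a # w)"
  by simp

lemma ep_ge: "int (ep i w) \<ge> - hp i w"
  using hp_eq[of i w] by simp

lemma em_Cons_ex: obtains b where "em i (a # w) = b # em i w"
  by simp

text \<open>On each suffix the i-height after \<open>em j\<close> is the old one, which is
  nonnegative, minus the j-exponent of that suffix. Since this exponent grows with the suffix, the
  minimum of the new path is bounded by the full exponent.\<close>

lemma em_simple_aux:
  assumes ij: "i \<in> idxs" "j \<in> idxs" "ca i j = -1"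
  shows "ep i w = 0 \<Longrightarrow> ep i (em j w) \<le> ep j w"
proof (induction w)
  case (Cons a w)
  obtain b where b: "em j (a # w) = b # em j w" by (rule em_Cons_ex)
  have "ep i w = 0" "hp i (a # w) \<ge> 0"
    using Cons.prems ep_Cons[of i a w] ep_mono[of i w a] by linarith+
  moreover have "hp i (b # em j w) = hp i (a # w) - int (ep j (a # w))"
    using hp_em[of i j "a # w"] ij b by simp
  moreover have "ep j w \<le> ep j (a # w)" by (rule ep_mono)
  moreover have "int (ep i (em j (a # w))) = max (int (ep i (em j w))) (- hp i (b # em j w))"
    unfolding b by (rule ep_Cons)
  ultimately show ?case using Cons.IH by linarith
qed simp

text \<open>Along suffixes the j-height becomes hp_j + 2 ep_j minus the middle exponent. The first
  two terms are at least ep_j, and \<open>em_simple_aux\<close> bounds the middle exponent by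
  ep_j.\<close>

lemma em_A2:
  assumes ij: "i \<in> idxs" "j \<in> idxs" "ca i j = -1" "ca j i = -1"
  shows "ep i w = 0 \<Longrightarrow> ep j (em i (em j w)) = 0"
proof (induction w)
  case (Cons a w)
  obtain b where b: "em j (a # w) = b # em j w" by (rule em_Cons_ex)
  obtain c where c: "em i (b # em j w) = c # em i (em j w)" by (rule em_Cons_ex)
  have "ep i w = 0" using Cons.prems ep_mono[of i w a] by linarith
  hence IH: "ep j (em i (em j w)) = 0" by (rule Cons.IH)
  have n: "ep i (em j (a # w)) \<le> ep j (a # w)" using em_simple_aux ij Cons.prems by blast
  have "hp j (em i (em j (a # w))) = hp j (a # w) + 2 * int (ep j (a # w)) - int (ep i (em j (a # w)))"
    using hp_em[of j i "em j (a # w)"] hp_em[of j j "a # w"] ij by (simp add: cartan_int_def)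
  moreover have "hp j (a # w) \<ge> - int (ep j (a # w))" using ep_ge[of j "a # w"] by linarith
  moreover have "int (ep j (em i (em j (a # w)))) =
      max (int (ep j (em i (em j w)))) (- hp j (em i (em j (a # w))))"
    unfolding b c by (rule ep_Cons)
  ultimately show ?case using IH n by linarith
qed simp

text \<open>The analogue of \<open>em_A2\<close> for a double bond, with i long. The inner claim
  \<open>p\<close> bounds the third exponent by the second; then the final i-height is at least - x
  + 2 x - x = 0, where x is the second exponent.\<close>

lemma em_C2:
  assumes ij: "i \<in> idxs" "j \<in> idxs" "ca i j = -1" "ca j i = -2"
  shows "ep i w = 0 \<Longrightarrow> ep i (em j (em i (em j w))) = 0"
proof -
  have p: "ep i w = 0 \<Longrightarrow> ep j (em i (em j w)) \<le> ep i (em j w)" for w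
  proof (induction w)
    case (Cons a w)
    obtain b where b: "em j (a # w) = b # em j w" by (rule em_Cons_ex)
    obtain c where c: "em i (b # em j w) = c # em i (em j w)" by (rule em_Cons_ex)
    have "ep i w = 0" using Cons.prems ep_mono[of i w a] by linarith
    hence IH: "ep j (em i (em j w)) \<le> ep i (em j w)" by (rule Cons.IH)
    have n: "ep i (em j (a # w)) \<le> ep j (a # w)" using em_simple_aux ij Cons.prems by blast
    have m: "ep i (em j w) \<le> ep i (em j (a # w))" unfolding b by (rule ep_mono)
    have "hp j (em i (em j (a # w))) = hp j (a # w) + 2 * int (ep j (a # w)) - 2 * int (ep i (em j (a # w)))"
      using hp_em[of j i "em j (a # w)"] hp_em[of j j "a # w"] ij by (simp add: cartan_int_def)
    moreover have "hp j (a # w) \<ge> - int (ep j (a # w))" using ep_ge[of j "a # w"] by linarith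
    ultimately have "- hp j (em i (em j (a # w))) \<le> ep i (em j (a # w))" using n by linarith
    moreover have "int (ep j (em i (em j (a # w)))) =
        max (int (ep j (em i (em j w)))) (- hp j (em i (em j (a # w))))"
      unfolding b c by (rule ep_Cons)
    ultimately show ?case using IH m by linarith
  qed simp
  show "ep i w = 0 \<Longrightarrow> ep i (em j (em i (em j w))) = 0"
  proof (induction w)
    case (Cons a w)
    obtain b where b: "em j (a # w) = b # em j w" by (rule em_Cons_ex)
    obtain c where c: "em i (b # em j w) = c # em i (em j w)" by (rule em_Cons_ex)
    obtain d where d: "em j (c # em i (em j w)) = d # em j (em i (em j w))" by (rule em_Cons_ex)
    have "ep i w = 0" using Cons.prems ep_mono[of i w a] by linarith
    hence IH: "ep i (em j (em i (em j w))) = 0" by (rule Cons.IH)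
    have "hp i (em j (em i (em j (a # w)))) = hp i (em j (a # w)) + 2 * int (ep i (em j (a # w)))
            - int (ep j (em i (em j (a # w))))"
      using hp_em[of i j "em i (em j (a # w))"] hp_em[of i i "em j (a # w)"] ij by (simp add: cartan_int_def)
    moreover have "hp i (em j (a # w)) \<ge> - int (ep i (em j (a # w)))"
      using ep_ge[of i "em j (a # w)"] by linarith
    moreover have "int (ep i (em j (em i (em j (a # w))))) =
        max (int (ep i (em j (em i (em j w))))) (- hp i (em j (em i (em j (a # w)))))"
      unfolding b c d by (rule ep_Cons)
    ultimately show ?case using IH p[OF Cons.prems] by linarith
  qed simp
qed

lemma em_commute:
  assumes ij: "i \<in> idxs" "j \<in> idxs" "ca i j = 0"
  shows "ep i w = 0 \<Longrightarrow> ep i (em j w) = 0"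
proof (induction w)
  case (Cons a w)
  obtain b where b: "em j (a # w) = b # em j w" by (rule em_Cons_ex)
  have "ep i w = 0" using Cons.prems ep_mono[of i w a] by linarith
  hence IH: "ep i (em j w) = 0" by (rule Cons.IH)
  have "hp i (em j (a # w)) = hp i (a # w)" using hp_em[of i j "a # w"] ij by simp
  moreover have "hp i (a # w) \<ge> 0" using ep_ge[of i "a # w"] Cons.prems by linarith
  moreover have "int (ep i (em j (a # w))) = max (int (ep i (em j w))) (- hp i (em j (a # w)))"
    unfolding b by (rule ep_Cons)
  ultimately show ?case using IH by linarith
qed simp

definition dominant :: "nat list \<Rightarrow> bool" where
  "dominant w \<longleftrightarrow> (\<forall>i\<in>idxs. ep i w = 0)"

lemma ep_Cons_eq_0: "ep i (a # w) = 0 \<longleftrightarrow> ep i w = 0 \<and> hp i w + pr i a \<ge> 0"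
proof -
  have max: "int x = max (int y) (- z) \<Longrightarrow> x = 0 \<longleftrightarrow> y = 0 \<and> z \<ge> 0" for x y :: nat and z
    by (cases "int y \<le> - z") (simp_all add: max_def, linarith+)
  show ?thesis using max[OF ep_Cons[of i a w]] unfolding hp_simps by (simp only: add.commute)
qed

lemma dominant_Cons: "dominant (a # w) \<longleftrightarrow> dominant w \<and> (\<forall>i\<in>idxs. hp i w + pr i a \<ge> 0)"
  unfolding dominant_def ep_Cons_eq_0 by auto

lemma dominant_hp: "dominant w \<Longrightarrow> i \<in> idxs \<Longrightarrow> hp i w = int (ph i w)"
  unfolding dominant_def using hp_eq[of i w] by simp

end

section \<open>Tensor powers of the vector representation\<close>

type_synonym tvec = "nat list \<Rightarrow> ratq"

definition tscale :: "ratq \<Rightarrow> tvec \<Rightarrow> tvec" where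
  "tscale c f = (\<lambda>w. c * f w)"

text \<open>Strips the last tensor factor. Since a \<open>tvec\<close> is a coordinate function, an
  operator sending the letter a + 1 to a reads, at a word with head a, the coordinate at the head a
  + 1.\<close>

definition sl :: "nat \<Rightarrow> tvec \<Rightarrow> tvec" where
  "sl a f = (\<lambda>u. f (a # u))"

lemma tscale_apply [simp]: "tscale c f w = c * f w"
  by (simp add: tscale_def)

lemma sl_apply [simp]: "sl a f u = f (a # u)"
  by (simp add: sl_def)

lemma sl_add: "sl a (f + g) = sl a f + sl a g" and sl_tscale: "sl a (tscale c f) = tscale c (sl a f)"
  and sl_zero: "sl a 0 = 0"
  by (auto simp: fun_eq_iff)

lemma tvec_eqI: "f [] = g [] \<Longrightarrow> (\<And>a. sl a f = sl a g) \<Longrightarrow> f = g"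
  by (rule ext, case_tac x) (auto simp: fun_eq_iff)

lemma tscale_simps [simp]: "tscale 0 f = 0" "tscale c 0 = 0" "tscale 1 f = f"
  "tscale c (tscale d f) = tscale (c * d) f"
  by (auto simp: fun_eq_iff)

lemma tscale_distribs: "tscale c (f + g) = tscale c f + tscale c g"
  "tscale (c + d) f = tscale c f + tscale d f"
  by (auto simp: fun_eq_iff algebra_simps)

lemma vector_space_tscale: "vector_space tscale"
  by unfold_locales (auto simp: fun_eq_iff algebra_simps)

lemma tvec_sum_apply: "(\<Sum>x\<in>S. f x :: tvec) w = (\<Sum>x\<in>S. f x w)"
  by (induction S rule: infinite_finite_induct) auto

context letter_chain
begin

abbreviation vi :: "nat \<Rightarrow> ratq" where "vi \<equiv> qi X"

lemma vi_nonzero [simp]: "vi i \<noteq> 0"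
  using qpar_nonzero[OF qpar_qi] .

lemma vi_symm:
  assumes "i \<in> idxs" "j \<in> idxs"
  shows "vi i powi ca i j = vi j powi ca j i"
  using assms by (cases X) (auto simp: qi_def cartan_int_def power2_eq_square power_int_minus power_int_numeral)

text \<open>The coproduct is $E_i \mapsto E_i \otimes K_i^{-1} + 1 \otimes E_i$,
  $F_i \mapsto F_i \otimes 1 + K_i \otimes F_i$.\<close>

fun TE :: "nat \<Rightarrow> tvec \<Rightarrow> tvec" where
  "TE i f [] = 0"
| "TE i f (a # u) = vi i powi (- pr i a) * TE i (sl a f) u + (if up i a then f (Suc a # u) else 0)"

fun TF :: "nat \<Rightarrow> tvec \<Rightarrow> tvec" where
  "TF i f [] = 0"
| "TF i f (a # u) = TF i (sl a f) u + (if dn i a then vi i powi hp i u * f ((a - 1) # u) else 0)"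

definition TK :: "nat \<Rightarrow> tvec \<Rightarrow> tvec" where
  "TK i f = (\<lambda>w. vi i powi hp i w * f w)"

definition TKi :: "nat \<Rightarrow> tvec \<Rightarrow> tvec" where
  "TKi i f = (\<lambda>w. vi i powi (- hp i w) * f w)"

lemma TK_apply [simp]: "TK i f w = vi i powi hp i w * f w"
  and TKi_apply [simp]: "TKi i f w = vi i powi (- hp i w) * f w"
  by (simp_all add: TK_def TKi_def)

lemma TK_inverse [simp]: "TK i (TKi i f) = f" "TKi i (TK i f) = f"
  by (auto simp: fun_eq_iff power_int_minus)

lemma TE_add: "TE i (f + g) = TE i f + TE i g"
proof
  show "TE i (f + g) w = (TE i f + TE i g) w" for w
    by (induction w arbitrary: f g) (auto simp: sl_add algebra_simps)
qed

lemma TE_tscale: "TE i (tscale c f) = tscale c (TE i f)"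
proof
  show "TE i (tscale c f) w = tscale c (TE i f) w" for w
    by (induction w arbitrary: f) (auto simp: sl_tscale algebra_simps)
qed

lemma TF_add: "TF i (f + g) = TF i f + TF i g"
proof
  show "TF i (f + g) w = (TF i f + TF i g) w" for w
    by (induction w arbitrary: f g) (auto simp: sl_add algebra_simps)
qed

lemma TF_tscale: "TF i (tscale c f) = tscale c (TF i f)"
proof
  show "TF i (tscale c f) w = tscale c (TF i f) w" for w
    by (induction w arbitrary: f) (auto simp: sl_tscale algebra_simps)
qed

lemma TK_add: "TK i (f + g) = TK i f + TK i g" and TK_tscale: "TK i (tscale c f) = tscale c (TK i f)"
  and TKi_add: "TKi i (f + g) = TKi i f + TKi i g" and TKi_tscale: "TKi i (tscale c f) = tscale c (TKi i f)"
  by (auto simp: fun_eq_iff algebra_simps)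

lemma T_zero [simp]: "TE i 0 = 0" "TF i 0 = 0" "TK i 0 = 0" "TKi i 0 = 0"
  using TE_tscale[of i 0 0] TF_tscale[of i 0 0] by (auto simp: fun_eq_iff)

lemmas T_linear = TE_add TE_tscale TF_add TF_tscale TK_add TK_tscale TKi_add TKi_tscale

lemma sl_TE: "sl a (TE i f) = tscale (vi i powi (- pr i a)) (TE i (sl a f)) +
     (if up i a then sl (Suc a) f else 0)"
  and sl_TF: "sl a (TF i f) = TF i (sl a f) + (if dn i a then TK i (sl (a - 1) f) else 0)"
  and sl_TK: "sl a (TK i f) = tscale (vi i powi pr i a) (TK i (sl a f))"
  and sl_TKi: "sl a (TKi i f) = tscale (vi i powi (- pr i a)) (TKi i (sl a f))"
  by (auto simp: fun_eq_iff power_int_add power_int_minus power_int_diff field_simps)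

text \<open>Identities between the operators are proved by induction on the length of a word; this
  rule reduces them to the slices.\<close>

lemma tvec_op_eqI:
  assumes "\<And>f. P f [] = Q f []"
    and "\<And>a u f. (\<And>f. P f u = Q f u) \<Longrightarrow> sl a (P f) u = sl a (Q f) u"
  shows "P f = Q (f :: tvec)"
proof
  show "P f w = Q f w" for w
  proof (induction w arbitrary: f)
    case Nil thus ?case by (rule assms(1))
  next
    case (Cons a u)
    have "sl a (P f) u = sl a (Q f) u" by (rule assms(2)) (rule Cons.IH)
    thus ?case by simp
  qed
qed

lemma TK_TF:
  assumes "i \<in> idxs" "j \<in> idxs"
  shows "TK i (TF j f) = tscale (vi i powi (- ca i j)) (TF j (TK i f))"
proof (rule tvec_op_eqI[where P = "\<lambda>f. TK i (TF j f)"])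
  fix a u f
  assume IH: "\<And>f. TK i (TF j f) u = tscale (vi i powi (- ca i j)) (TF j (TK i f)) u"
  have c: "dn j a \<Longrightarrow> pr i a = pr i (a - 1) - ca i j"
    using pr_up_Suc[of j "a - 1" i] dn_pred[of j a] assms by simp
  show "sl a (TK i (TF j f)) u = sl a (tscale (vi i powi (- ca i j)) (TF j (TK i f))) u"
  proof (cases "dn j a")
    case True
    have "sl a (TK i (TF j f)) u = vi i powi pr i a * TK i (TF j (sl a f)) u +
        vi i powi pr i a * (vi i powi hp i u * TK j (sl (a - 1) f) u)"
      using True unfolding sl_TK sl_TF by (simp add: algebra_simps del: TF.simps)
    also have "\<dots> = vi i powi (- ca i j) * (vi i powi pr i a * TF j (TK i (sl a f)) u +
        vi i powi pr i (a - 1) * (vi i powi hp i u * TK j (sl (a - 1) f) u))"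
    proof -
      have e: "vi i powi pr i a = vi i powi (- ca i j) * vi i powi pr i (a - 1)"
        unfolding c[OF True] by (simp add: power_int_diff power_int_minus divide_inverse)
      have "vi i powi pr i a * (vi i powi hp i u * TK j (sl (a - 1) f) u) =
          vi i powi (- ca i j) * (vi i powi pr i (a - 1) * (vi i powi hp i u * TK j (sl (a - 1) f) u))"
        unfolding e by (simp only: mult.assoc)
      thus ?thesis unfolding IH by (simp add: algebra_simps)
    qed
    also have "\<dots> = sl a (tscale (vi i powi (- ca i j)) (TF j (TK i f))) u"
      using True unfolding sl_tscale sl_TK sl_TF T_linear by (simp add: algebra_simps del: TF.simps)
    finally show ?thesis .
  next
    case False
    thus ?thesis unfolding sl_tscale sl_TK sl_TF T_linear
      using IH[of "sl a f"] by (simp add: algebra_simps)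
  qed
qed simp

lemma TK_TE:
  assumes "i \<in> idxs" "j \<in> idxs"
  shows "TK i (TE j f) = tscale (vi i powi ca i j) (TE j (TK i f))"
proof (rule tvec_op_eqI[where P = "\<lambda>f. TK i (TE j f)"])
  fix a u f
  assume IH: "\<And>f. TK i (TE j f) u = tscale (vi i powi ca i j) (TE j (TK i f)) u"
  have c: "up j a \<Longrightarrow> pr i (Suc a) = pr i a - ca i j"
    using pr_up_Suc[of j a i] assms by simp
  show "sl a (TK i (TE j f)) u = sl a (tscale (vi i powi ca i j) (TE j (TK i f))) u"
  proof (cases "up j a")
    case True
    have "sl a (TK i (TE j f)) u = vi i powi pr i a * (vi j powi (- pr j a) * TK i (TE j (sl a f)) u) +
        vi i powi pr i a * (vi i powi hp i u * sl (Suc a) f u)"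
      using True unfolding sl_TK sl_TE T_linear by (simp add: algebra_simps del: TE.simps)
    also have "\<dots> = vi i powi ca i j * (vi i powi pr i a * (vi j powi (- pr j a) * TE j (TK i (sl a f)) u) +
        vi i powi pr i (Suc a) * (vi i powi hp i u * sl (Suc a) f u))"
    proof -
      have e: "vi i powi pr i a = vi i powi ca i j * vi i powi pr i (Suc a)"
        unfolding c[OF True] by (simp add: power_int_diff)
      have "vi i powi pr i a * (vi i powi hp i u * sl (Suc a) f u) =
          vi i powi ca i j * (vi i powi pr i (Suc a) * (vi i powi hp i u * sl (Suc a) f u))"
        unfolding e by (simp only: mult.assoc)
      thus ?thesis unfolding IH by (simp add: algebra_simps)
    qed
    also have "\<dots> = sl a (tscale (vi i powi ca i j) (TE j (TK i f))) u"
      using True unfolding sl_tscale sl_TK sl_TE T_linear by (simp add: algebra_simps del: TE.simps)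
    finally show ?thesis .
  next
    case False
    thus ?thesis unfolding sl_tscale sl_TK sl_TE T_linear
      using IH[of "sl a f"] by (simp add: algebra_simps)
  qed
qed simp

text \<open>On a slice the cross terms cancel by \<open>vi_symm\<close> and \<open>TK_TE\<close>.
  There remain the commutator on the tail, scaled by the head, and the commutator on the head
  itself, which is the scalar \<open>pr i a\<close> because a letter lies on an i-string of length
  at most 1.\<close>

lemma TE_TF:
  assumes "i \<in> idxs" "j \<in> idxs"
  shows "TE i (TF j f) = TF j (TE i f) +
     (if i = j then tscale (inverse (vi i - inverse (vi i))) (TK i f + tscale (-1) (TKi i f)) else 0)"
proof (rule tvec_op_eqI[where P = "\<lambda>f. TE i (TF j f)"])
  fix a u f
  let ?h = "\<lambda>f. if i = j then tscale (inverse (vi i - inverse (vi i))) (TK i f + tscale (-1) (TKi i f)) else 0"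
  assume IH: "\<And>f. TE i (TF j f) u = (TF j (TE i f) + ?h f) u"
  have d0: "vi i - inverse (vi i) \<noteq> 0" by (rule qpar_diff_nonzero[OF qpar_qi])
  have L: "sl a (TE i (TF j f)) u = vi i powi (- pr i a) * (TE i (TF j (sl a f)) u +
        (if dn j a then TE i (TK j (sl (a - 1) f)) u else 0)) +
        (if up i a then TF j (sl (Suc a) f) u + (if dn j (Suc a) then TK j (sl a f) u else 0) else 0)"
    unfolding sl_TE sl_TF T_linear by (simp add: T_linear algebra_simps del: TE.simps TF.simps)
  have R: "sl a (TF j (TE i f)) u = vi i powi (- pr i a) * TF j (TE i (sl a f)) u +
       (if up i a then TF j (sl (Suc a) f) u else 0) +
       (if dn j a then vi i powi (- pr i (a - 1)) * TK j (TE i (sl (a - 1) f)) u +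
            (if up i (a - 1) then TK j (sl a f) u else 0) else 0)"
    using dn_pred[of j a]
    unfolding sl_TE sl_TF T_linear by (simp add: T_linear algebra_simps del: TE.simps TF.simps)
  have m: "vi i powi (- pr i a) * TE i (TK j (sl (a - 1) f)) u =
       vi i powi (- pr i (a - 1)) * TK j (TE i (sl (a - 1) f)) u" if "dn j a"
  proof -
    have *: "pr i a = pr i (a - 1) - ca i j"
      using that pr_up_Suc[of j "a - 1" i] dn_pred[of j a] assms by simp
    have "vi i powi (- pr i a) = vi i powi (- pr i (a - 1)) * vi j powi ca j i"
      unfolding vi_symm[OF assms, symmetric] * by (simp add: power_int_diff power_int_minus divide_inverse mult.commute)
    thus ?thesis unfolding TK_TE[OF assms(2,1)] by simp
  qed
  have du: "dn j (Suc a) \<longleftrightarrow> i = j" if "up i a"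
    using that up_Suc[of j a] by (auto simp: up_def)
  have ud: "up i (a - 1) \<longleftrightarrow> i = j" if "dn j a"
    using that dn_pred[of j a] by (auto simp: up_def)
  have "sl a (TE i (TF j f)) u - sl a (TF j (TE i f)) u =
     vi i powi (- pr i a) * ?h (sl a f) u + (if i = j then of_int (pr i a) * TK i (sl a f) u else 0)"
    unfolding L R IH using m du ud up_not_dn[of i a]
    by (cases "up i a"; cases "dn j a"; cases "dn i a"; cases "i = j") (auto simp: algebra_simps)
  also have "\<dots> = sl a (?h f) u"
  proof (cases "i = j")
    case True
    have "vi i powi (- pr i a) * (k - k') / (vi i - inverse (vi i)) + of_int (pr i a) * k =
       (vi i powi pr i a * k - vi i powi (- pr i a) * k') / (vi i - inverse (vi i))" for k k' :: ratq
      using d0 by (cases "up i a"; cases "dn i a") (auto simp: power_int_minus field_simps)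
    from this[of "TK i (sl a f) u" "TKi i (sl a f) u"] True show ?thesis
      unfolding if_P[OF True] sl_tscale sl_add sl_TK sl_TKi by (simp add: divide_inverse mult_ac)
  next
    case False thus ?thesis by (simp add: sl_zero)
  qed
  finally show "sl a (TE i (TF j f)) u = sl a (TF j (TE i f) + ?h f) u"
    unfolding sl_add by (simp add: algebra_simps)
qed simp

section \<open>The contravariant form\<close>

definition Wd :: "nat \<Rightarrow> nat list set" where
  "Wd n = {w. length w = n \<and> set w \<subseteq> {..D}}"

definition dot :: "nat \<Rightarrow> tvec \<Rightarrow> tvec \<Rightarrow> ratq" where
  "dot n f g = (\<Sum>w\<in>Wd n. f w * g w)"

lemma finite_Wd [simp]: "finite (Wd n)"
  using finite_lists_length_eq[of "{..D}" n] unfolding Wd_def by (simp add: conj_commute)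

lemma Wd_0: "Wd 0 = {[]}"
  unfolding Wd_def by auto

lemma Wd_Suc: "Wd (Suc n) = (\<lambda>(a, u). a # u) ` ({..D} \<times> Wd n)"
  unfolding Wd_def by (auto simp: length_Suc_conv image_iff)

lemma Cons_in_Wd: "a # u \<in> Wd (Suc n) \<longleftrightarrow> a \<le> D \<and> u \<in> Wd n"
  unfolding Wd_def by auto

lemma fw_Wd: "w \<in> Wd n \<Longrightarrow> fw i w \<in> Wd n" and ew_Wd: "w \<in> Wd n \<Longrightarrow> ew i w \<in> Wd n"
  unfolding Wd_def using set_fw set_ew by auto

lemma dot_Suc: "dot (Suc n) f g = (\<Sum>a\<le>D. dot n (sl a f) (sl a g))"
proof -
  have "inj_on (\<lambda>(a, u). a # u) ({..D} \<times> Wd n)" by (auto simp: inj_on_def)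
  hence "dot (Suc n) f g = (\<Sum>(a,u)\<in>{..D} \<times> Wd n. f (a # u) * g (a # u))"
    unfolding dot_def Wd_Suc by (subst sum.reindex) (auto simp: case_prod_unfold)
  also have "\<dots> = (\<Sum>a\<le>D. dot n (sl a f) (sl a g))"
    unfolding dot_def by (simp add: sum.cartesian_product)
  finally show ?thesis .
qed

lemma dot_commute: "dot n f g = dot n g f"
  unfolding dot_def by (simp add: mult.commute)

lemma dot_add: "dot n (f + g) h = dot n f h + dot n g h" "dot n h (f + g) = dot n h f + dot n h g"
  and dot_tscale: "dot n (tscale c f) h = c * dot n f h" "dot n h (tscale c f) = c * dot n h f"
  and dot_zero [simp]: "dot n 0 f = 0" "dot n f 0 = 0"
  unfolding dot_def by (auto simp: algebra_simps sum.distrib sum_distrib_left)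

lemma dot_sum: "dot n (\<Sum>x\<in>S. f x) h = (\<Sum>x\<in>S. dot n (f x) h)"
    "dot n h (\<Sum>x\<in>S. f x) = (\<Sum>x\<in>S. dot n h (f x))"
  by (induction S rule: infinite_finite_induct) (auto simp: dot_add)

lemma dot_TK: "dot n (TK i f) g = dot n f (TK i g)" and dot_TKi: "dot n (TKi i f) g = dot n f (TKi i g)"
  unfolding dot_def by (auto simp: mult_ac)

text \<open>The slice formula for F has an extra term for every arrow entering the head, the one for
  E for every arrow leaving it. Shifting the summation index by one matches the two
  (\<open>reindex\<close>).\<close>

lemma dot_TF: "dot n (TF i f) g = inverse (vi i) * dot n f (TK i (TE i g))"
proof (induction n arbitrary: f g)
  case 0 thus ?case by (simp add: dot_def Wd_0)
next
  case (Suc n)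
  have sa: "sl a (TK i (TE i g)) = TK i (TE i (sl a g)) + (if up i a then tscale (vi i) (TK i (sl (Suc a) g)) else 0)" for a
    unfolding sl_TK sl_TE by (auto simp: T_linear tscale_distribs power_int_minus)
  have reindex: "(\<Sum>a\<le>D. if dn i a then dot n (TK i (sl (a - 1) f)) (sl a g) else 0) =
      (\<Sum>a\<le>D. if up i a then dot n (sl a f) (TK i (sl (Suc a) g)) else 0)"
  proof -
    have s: "{a\<in>{..D}. dn i a} = Suc ` {a\<in>{..D}. up i a}"
    proof
      show "{a\<in>{..D}. dn i a} \<subseteq> Suc ` {a\<in>{..D}. up i a}"
      proof
        fix a assume a: "a \<in> {a\<in>{..D}. dn i a}"
        hence "up i (a - 1)" "a = Suc (a - 1)" using dn_pred[of i a] by auto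
        thus "a \<in> Suc ` {a\<in>{..D}. up i a}" by (intro image_eqI[of _ _ "a - 1"]) (auto simp: up_def)
      qed
    qed (auto simp: up_Suc dn_def)
    have "(\<Sum>a\<le>D. if dn i a then dot n (TK i (sl (a - 1) f)) (sl a g) else 0) =
        (\<Sum>a\<in>{a\<in>{..D}. dn i a}. dot n (TK i (sl (a - 1) f)) (sl a g))"
      by (rule sum.inter_filter[symmetric]) simp
    also have "\<dots> = (\<Sum>a\<in>{a\<in>{..D}. up i a}. dot n (TK i (sl a f)) (sl (Suc a) g))"
      unfolding s by (subst sum.reindex) auto
    also have "\<dots> = (\<Sum>a\<le>D. if up i a then dot n (sl a f) (TK i (sl (Suc a) g)) else 0)"
      unfolding dot_TK by (rule sum.inter_filter) simp
    finally show ?thesis .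
  qed
  have "dot (Suc n) (TF i f) g = (\<Sum>a\<le>D. dot n (TF i (sl a f)) (sl a g) +
      (if dn i a then dot n (TK i (sl (a - 1) f)) (sl a g) else 0))"
    unfolding dot_Suc sl_TF by (intro sum.cong) (auto simp: dot_add)
  also have "\<dots> = (\<Sum>a\<le>D. inverse (vi i) * dot n (sl a f) (TK i (TE i (sl a g))) +
      (if up i a then dot n (sl a f) (TK i (sl (Suc a) g)) else 0))"
    unfolding sum.distrib reindex Suc.IH ..
  also have "\<dots> = inverse (vi i) * dot (Suc n) f (TK i (TE i g))"
    unfolding dot_Suc sa sum_distrib_left by (intro sum.cong) (auto simp: dot_add dot_tscale algebra_simps)
  finally show ?case .
qed

lemma dot_TE: "dot n (TE i f) g = vi i * dot n f (TF i (TKi i g))"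
proof -
  have a: "dot n (TF i (TKi i g)) f = inverse (vi i) * dot n g (TE i f)"
    unfolding dot_TF dot_TKi TK_inverse ..
  have "vi i * dot n f (TF i (TKi i g)) = vi i * (inverse (vi i) * dot n g (TE i f))"
    unfolding dot_commute[of n f "TF i (TKi i g)"] a ..
  also have "\<dots> = dot n (TE i f) g"
    unfolding dot_commute[of n g] by (simp flip: mult.assoc)
  finally show ?thesis ..
qed

definition Tn :: "nat \<Rightarrow> tvec set" where
  "Tn n = {f. \<forall>w. w \<notin> Wd n \<longrightarrow> f w = 0}"

lemma Tn_closed:
  "0 \<in> Tn n" "f \<in> Tn n \<Longrightarrow> g \<in> Tn n \<Longrightarrow> f + g \<in> Tn n" "f \<in> Tn n \<Longrightarrow> tscale c f \<in> Tn n"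
  "f \<in> Tn n \<Longrightarrow> TK i f \<in> Tn n" "f \<in> Tn n \<Longrightarrow> TKi i f \<in> Tn n"
  by (auto simp: Tn_def)

lemma Tn_sum: "(\<And>x. x \<in> S \<Longrightarrow> f x \<in> Tn n) \<Longrightarrow> (\<Sum>x\<in>S. f x) \<in> Tn n"
  by (induction S rule: infinite_finite_induct) (auto simp: Tn_closed)

lemma Tn_Suc_iff: "f \<in> Tn (Suc n) \<longleftrightarrow> f [] = 0 \<and> (\<forall>a\<le>D. sl a f \<in> Tn n) \<and> (\<forall>a>D. sl a f = 0)"
proof
  assume f: "f \<in> Tn (Suc n)"
  have "f [] = 0" using f unfolding Tn_def Wd_def by simp
  moreover have "sl a f \<in> Tn n" if "a \<le> D" for a
    using f unfolding Tn_def by (simp add: Cons_in_Wd)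
  moreover have "sl a f = 0" if "a > D" for a
    using f that unfolding Tn_def by (auto simp: Cons_in_Wd fun_eq_iff)
  ultimately show "f [] = 0 \<and> (\<forall>a\<le>D. sl a f \<in> Tn n) \<and> (\<forall>a>D. sl a f = 0)" by blast
next
  assume h: "f [] = 0 \<and> (\<forall>a\<le>D. sl a f \<in> Tn n) \<and> (\<forall>a>D. sl a f = 0)"
  have "f w = 0" if "w \<notin> Wd (Suc n)" for w
  proof (cases w)
    case (Cons a u)
    have "sl a f u = 0"
      using h that unfolding Cons Cons_in_Wd Tn_def by (cases "a \<le> D") auto
    thus ?thesis unfolding Cons by simp
  qed (use h in simp)
  thus "f \<in> Tn (Suc n)" unfolding Tn_def by blast
qed

lemma Tn_0_iff: "f \<in> Tn 0 \<longleftrightarrow> (\<forall>a. sl a f = 0)"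
proof
  show "f \<in> Tn 0 \<Longrightarrow> \<forall>a. sl a f = 0" by (auto simp: Tn_def Wd_0 fun_eq_iff)
  assume h: "\<forall>a. sl a f = 0"
  have "f (a # u) = 0" for a u using h by (metis sl_apply zero_fun_apply)
  thus "f \<in> Tn 0" unfolding Tn_def Wd_0 by (auto simp: neq_Nil_conv)
qed

lemma TF_Tn: "f \<in> Tn n \<Longrightarrow> TF i f \<in> Tn n"
proof (induction n arbitrary: f)
  case 0
  thus ?case unfolding Tn_0_iff sl_TF by simp
next
  case (Suc n)
  have u: "dn i a \<Longrightarrow> a \<le> D \<and> a - 1 \<le> D" for a by (auto simp: dn_def)
  have f: "\<And>a. a \<le> D \<Longrightarrow> sl a f \<in> Tn n" "\<And>a. a > D \<Longrightarrow> sl a f = 0"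
    using Suc.prems by (auto simp: Tn_Suc_iff)
  have "sl a (TF i f) \<in> Tn n" if "a \<le> D" for a
    unfolding sl_TF by (intro Tn_closed Suc.IH f that) (use f u in \<open>auto intro!: Tn_closed\<close>)
  moreover have "sl a (TF i f) = 0" if "a > D" for a
    unfolding sl_TF using f that u[of a] by auto
  ultimately show ?case unfolding Tn_Suc_iff by simp
qed

lemma anisotropic: "f \<in> Tn n \<Longrightarrow> dot n f f = 0 \<Longrightarrow> f = 0"
proof
  assume f: "f \<in> Tn n" "dot n f f = 0"
  show "f w = 0 w" for w
    using sum_squares_eq_0_ratq[OF finite_Wd f(2)[unfolded dot_def], of w] f(1)
    by (cases "w \<in> Wd n") (simp_all add: Tn_def)
qed

definition reg :: "tvec \<Rightarrow> bool" where
  "reg f \<longleftrightarrow> (\<forall>w. f w \<in> regular_at_0)"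

lemma reg_closed:
  "reg 0" "reg f \<Longrightarrow> reg g \<Longrightarrow> reg (f + g)" "c \<in> regular_at_0 \<Longrightarrow> reg f \<Longrightarrow> reg (tscale c f)"
  unfolding reg_def by (auto simp: regular_add regular_mult)

lemma reg_dot:
  assumes "reg f" "reg g"
  shows "dot n f g \<in> regular_at_0 \<and> ev0 (dot n f g) = (\<Sum>w\<in>Wd n. ev0 (f w) * ev0 (g w))"
proof -
  have "f w * g w \<in> regular_at_0 \<and> ev0 (f w * g w) = ev0 (f w) * ev0 (g w)" for w
    using assms regular_mult unfolding reg_def by blast
  thus ?thesis unfolding dot_def using regular_sum[of "Wd n" "\<lambda>w. f w * g w"] by simp
qed

text \<open>Dividing by a coordinate of minimal valuation. The scaled vector has coordinate 1 at w,
  so its residue at q = 0 is nonzero; contradictions with vanishing residues start here.\<close>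

lemma reg_scaling:
  assumes "f \<in> Tn n" "f \<noteq> 0"
  obtains w where "w \<in> Wd n" "f w \<noteq> 0" "reg (tscale (inverse (f w)) f)"
proof -
  obtain s where s: "f s \<noteq> 0" using assms(2) by (auto simp: fun_eq_iff)
  hence "s \<in> Wd n" using assms(1) by (auto simp: Tn_def)
  then obtain t where t: "t \<in> Wd n" "f t \<noteq> 0" "\<forall>s\<in>Wd n. f s / f t \<in> regular_at_0"
    using exists_dominating[of "Wd n" s f] s by auto
  have "inverse (f t) * f w \<in> regular_at_0" for w
    using t(3) assms(1) by (cases "w \<in> Wd n") (auto simp: Tn_def divide_inverse mult.commute)
  thus ?thesis using t that unfolding reg_def by auto
qed

end

lemma qbr_step':
  assumes "qpar v"
  shows "qbr v (m + 1) = inverse v * qbr v m + v powi m"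
proof -
  have v: "v \<noteq> 0" using assms qpar_nonzero by auto
  have "qbr v (- m) = v * qbr v (- m - 1) + v powi (m + 1)"
    using qbr_step[OF assms, of "- m - 1"] by (simp add: add.commute)
  moreover have "qbr v (- m - 1) = - qbr v (m + 1)"
  proof -
    have "- m - 1 = - (m + 1)" by simp
    thus ?thesis by (simp only: qbr_minus)
  qed
  ultimately have "- qbr v m = - (v * qbr v (m + 1)) + v powi (m + 1)"
    by (simp add: qbr_minus)
  hence "v * qbr v (m + 1) = qbr v m + v powi (m + 1)" by algebra
  hence "qbr v (m + 1) = inverse v * (qbr v m + v powi (m + 1))"
    using v by (simp add: field_simps)
  thus ?thesis using v by (simp add: power_int_add algebra_simps)
qed

declare tscale_apply [simp del] plus_fun_apply [simp del] zero_fun_apply [simp del]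

lemmas tvec_apply = tscale_apply plus_fun_apply zero_fun_apply

definition tn :: "nat \<Rightarrow> tvec \<Rightarrow> tvec" where
  "tn a y = (\<lambda>w. case w of [] \<Rightarrow> 0 | b # u \<Rightarrow> if b = a then y u else 0)"

lemma tn_simps [simp]: "tn a y [] = 0" "tn a y (b # u) = (if b = a then y u else 0)"
  by (simp_all add: tn_def)

lemma sl_tn: "sl b (tn a y) = (if b = a then y else 0)"
  by (auto simp: fun_eq_iff tvec_apply)

lemma tn_linear: "tn a (x + y) = tn a x + tn a y" "tn a (tscale c x) = tscale c (tn a x)" "tn a 0 = 0"
  by (auto simp: tn_def fun_eq_iff tvec_apply split: list.split)


context letter_chain
begin

declare TK_apply [simp del] TKi_apply [simp del]

lemma TE_tn: "TE i (tn a y) = tscale (vi i powi (- pr i a)) (tn a (TE i y)) + (if dn i a then tn (a - 1) y else 0)"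
proof (rule tvec_eqI)
  fix b
  have "up i b \<and> Suc b = a \<longleftrightarrow> dn i a \<and> b = a - 1"
    using up_Suc[of i b] dn_pred[of i a] by auto
  thus "sl b (TE i (tn a y)) = sl b (tscale (vi i powi (- pr i a)) (tn a (TE i y)) + (if dn i a then tn (a - 1) y else 0))"
    unfolding sl_TE sl_add sl_tscale using up_not_dn[of i a] by (auto simp: sl_tn sl_zero)
qed (simp add: tvec_apply)

lemma TF_tn: "TF i (tn a y) = tn a (TF i y) + (if up i a then tn (Suc a) (TK i y) else 0)"
proof (rule tvec_eqI)
  fix b
  have "dn i b \<and> b - 1 = a \<longleftrightarrow> up i a \<and> b = Suc a"
    using up_Suc[of i a] dn_pred[of i b] dn_pred[of i a] by auto
  moreover have "\<not> dn i 0" by (simp add: dn_def)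
  ultimately show "sl b (TF i (tn a y)) = sl b (tn a (TF i y) + (if up i a then tn (Suc a) (TK i y) else 0))"
    unfolding sl_TF sl_add using dn_pred[of i b] by (auto simp: sl_tn sl_zero)
qed (simp add: tvec_apply)

lemma TK_tn: "TK i (tn a y) = tscale (vi i powi pr i a) (tn a (TK i y))"
  by (rule tvec_eqI) (auto simp: sl_TK sl_tscale sl_tn TK_apply tvec_apply)

lemma tn_Tn: "a \<le> D \<Longrightarrow> y \<in> Tn n \<Longrightarrow> tn a y \<in> Tn (Suc n)"
  unfolding Tn_Suc_iff sl_tn by (auto simp: Tn_closed)

lemma dot_tn: "a \<le> D \<Longrightarrow> dot (Suc n) (tn a x) (tn b y) = (if a = b then dot n x y else 0)"
proof -
  assume a: "a \<le> D"
  have "dot (Suc n) (tn a x) (tn b y) = (\<Sum>c\<le>D. if c = a then (if a = b then dot n x y else 0) else 0)"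
    unfolding dot_Suc sl_tn by (intro sum.cong) auto
  thus ?thesis using a by (simp add: sum.delta)
qed

section \<open>String bases of the tensor powers\<close>

text \<open>\<open>sv i d\<close> is $F_i^{(k)} z$, where $d = f_i^k c$ with $\varepsilon_i(c) = 0$ and $z$ is the
  $E_i$-highest vector congruent to the word $c$ modulo $q$. The coefficients come from decomposing
  the tensor product of a string of length $k + m$ with a two-dimensional module.\<close>

definition ca1 :: "nat \<Rightarrow> nat \<Rightarrow> nat \<Rightarrow> ratq" where
  "ca1 i k m = vi i powi (- int k) * qbr (vi i) (int m) / qbr (vi i) (int (k + m))"

definition cb1 :: "nat \<Rightarrow> nat \<Rightarrow> nat \<Rightarrow> ratq" where
  "cb1 i k m = - vi i * qbr (vi i) (int (Suc k)) / qbr (vi i) (int (k + m))"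

function sv :: "nat \<Rightarrow> nat list \<Rightarrow> tvec" where
  "sv i [] = (\<lambda>w. of_bool (w = []))"
| "sv i (a # w) =
    (if up i a then tn a (sv i w) +
        (if ep i w > 0 then tscale (vi i powi (int (ph i w) + 1)) (tn (Suc a) (sv i (ew i w))) else 0)
     else if dn i a \<and> ph i w > 0 then
        tscale (ca1 i (ep i w) (ph i w)) (tn a (sv i w)) +
        tscale (cb1 i (ep i w) (ph i w)) (tn (a - 1) (sv i (fw i w)))
     else tn a (sv i w))"
  by pat_completeness auto
termination by (relation "Wellfounded.measure (length \<circ> snd)") auto

lemma TK_sv: "i \<in> idxs \<Longrightarrow> j \<in> idxs \<Longrightarrow> TK j (sv i w) = tscale (vi j powi hp j w) (sv i w)"
proof (induction i w rule: sv.induct)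
  case (1 i)
  thus ?case by (auto simp: fun_eq_iff TK_apply tscale_apply)
next
  case (2 i a w)
  have u: "up i a \<Longrightarrow> pr j (Suc a) = pr j a - ca j i" using pr_up_Suc 2 by blast
  have d: "dn i a \<Longrightarrow> pr j (a - 1) = pr j a + ca j i" using pr_up_Suc[of i "a - 1" j] dn_pred[of i a] 2 by simp
  have n: "TK j (tn a (sv i w)) = tscale (vi j powi hp j (a # w)) (tn a (sv i w))"
  proof -
    have "TK j (sv i w) = tscale (vi j powi hp j w) (sv i w)"
      using "2.IH" "2.prems" by (cases "up i a"; cases "dn i a \<and> ph i w > 0") blast+
    thus ?thesis by (simp add: TK_tn tn_linear power_int_add)
  qed
  consider "up i a" | "dn i a" "ph i w > 0" "\<not> up i a" | "\<not> up i a" "\<not> (dn i a \<and> ph i w > 0)"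
    by argo
  thus ?case
  proof cases
    case 1
    show ?thesis
    proof (cases "ep i w > 0")
      case True
      hence "TK j (tn (Suc a) (sv i (ew i w))) = tscale (vi j powi hp j (a # w)) (tn (Suc a) (sv i (ew i w)))"
        using 2 1 u[OF 1] hp_ew[OF True, of j] by (auto simp: TK_tn tn_linear power_int_add[symmetric])
      thus ?thesis using n 1 True by (simp add: T_linear tscale_distribs mult.commute)
    next
      case False thus ?thesis using n 1 by simp
    qed
  next
    case 2
    hence "TK j (tn (a - 1) (sv i (fw i w))) = tscale (vi j powi hp j (a # w)) (tn (a - 1) (sv i (fw i w)))"
      using "2.IH" "2.prems" d[OF 2(1)] hp_fw[OF 2(2), of j] by (auto simp: TK_tn tn_linear power_int_add[symmetric])
    thus ?thesis using n 2 by (simp add: T_linear tscale_distribs mult.commute)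
  next
    case 3 thus ?thesis using n by auto
  qed
qed

text \<open>The Clebsch-Gordan rule for an i-string of length k + m times a two-dimensional module.
  A head with an outgoing arrow (\<open>U\<close>), or with an incoming one and m = 0
  (\<open>D0\<close>), belongs to the summand of length k + m + 1; \<open>D1\<close> belongs to the
  one of length k + m - 1; in case \<open>N\<close> the head is inert. The recurrences
  \<open>qbr_step\<close> and \<open>qbr_step'\<close> match the coefficients.\<close>

lemma sv_E_F:
  assumes i: "i \<in> idxs"
  shows "length w = n \<Longrightarrow>
     TE i (sv i w) = (if ep i w > 0 then tscale (qbr (vi i) (int (ph i w) + 1)) (sv i (ew i w)) else 0) \<and>
     TF i (sv i w) = (if ph i w > 0 then tscale (qbr (vi i) (int (ep i w) + 1)) (sv i (fw i w)) else 0)"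
proof (induction n arbitrary: w)
  case 0
  have z: "sl a (sv i []) = 0" for a by (auto simp: fun_eq_iff tvec_apply)
  have "TE i (sv i []) = 0" "TF i (sv i []) = 0"
    by (rule tvec_eqI; simp add: sl_TE sl_TF z sl_zero tvec_apply del: sv.simps)+
  thus ?case using 0 by simp
next
  case (Suc n)
  then obtain a u where w: "w = a # u" "length u = n" by (cases w) auto
  define k m where km: "k = ep i u" "m = ph i u"
  let ?v = "vi i"
  have q: "qpar ?v" by (rule qpar_qi)
  define S where "S = sv i u"
  define Se where "Se = sv i (ew i u)"
  define See where "See = sv i (ew i (ew i u))"
  define Sf where "Sf = sv i (fw i u)"
  define Sff where "Sff = sv i (fw i (fw i u))"
  have S: "TE i S = (if k > 0 then tscale (qbr ?v (int m + 1)) Se else 0)"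
     "TF i S = (if m > 0 then tscale (qbr ?v (int k + 1)) Sf else 0)"
    using Suc.IH[of u] w unfolding S_def Se_def Sf_def km by auto
  have Se: "TE i Se = (if k > 1 then tscale (qbr ?v (int m + 2)) See else 0)" "TF i Se = tscale (qbr ?v (int k)) S"
    if "k > 0"
  proof -
    have p: "Suc (ep i (ew i u)) = k" "ph i (ew i u) = Suc m" "fw i (ew i u) = u"
      using ew_props[of i u] that unfolding km by auto
    have p': "ep i (ew i u) = k - 1" using p by simp
    show "TE i Se = (if k > 1 then tscale (qbr ?v (int m + 2)) See else 0)" "TF i Se = tscale (qbr ?v (int k)) S"
      using Suc.IH[of "ew i u"] w that unfolding p p' Se_def See_def S_def by (auto simp: of_nat_diff add_ac)
  qed
  have Sf: "TF i Sf = (if m > 1 then tscale (qbr ?v (int k + 2)) Sff else 0)" "TE i Sf = tscale (qbr ?v (int m)) S"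
    if "m > 0"
  proof -
    have p: "ep i (fw i u) = Suc k" "Suc (ph i (fw i u)) = m" "ew i (fw i u) = u"
      using fw_props[of i u] that unfolding km by auto
    have p': "ph i (fw i u) = m - 1" using p by simp
    show "TF i Sf = (if m > 1 then tscale (qbr ?v (int k + 2)) Sff else 0)" "TE i Sf = tscale (qbr ?v (int m)) S"
      using Suc.IH[of "fw i u"] w that unfolding p p' Sf_def Sff_def S_def by (auto simp: of_nat_diff add_ac)
  qed
  have KS: "TK i S = tscale (?v powi (int m - int k)) S"
    unfolding S_def TK_sv[OF i i] hp_eq km ..
  have KSe: "TK i Se = tscale (?v powi (int m - int k + 2)) Se" if "k > 0"
    using that hp_ew[of i u i] i unfolding Se_def TK_sv[OF i i] by (simp add: hp_eq km cartan_int_def)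
  have KSf: "TK i Sf = tscale (?v powi (int m - int k - 2)) Sf" if "m > 0"
    using that hp_fw[of i u i] i unfolding Sf_def TK_sv[OF i i] by (simp add: hp_eq km cartan_int_def)
  have v0: "?v \<noteq> 0" by simp
  note lin = T_linear TE_tn TF_tn TK_tn tn_linear tscale_distribs
  consider (U) "up i a" | (D0) "dn i a" "m = 0" | (D1) "dn i a" "m > 0" | (N) "\<not> up i a" "\<not> dn i a" by blast
  thus ?case
  proof cases
    case N
    have sv: "sv i w = tn a S" "sv i (a # ew i u) = tn a Se" "sv i (a # fw i u) = tn a Sf"
      using N unfolding w S_def Se_def Sf_def by simp_all
    show ?thesis unfolding sv using N S unfolding w by (auto simp: lin sv simp flip: km Se_def Sf_def)
  next
    case U
    have nd: "\<not> dn i a" "dn i (Suc a)" "\<not> up i (Suc a)" using U up_not_dn up_Suc by blast+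
    have sv: "sv i w = tn a S + (if k > 0 then tscale (?v powi (int m + 1)) (tn (Suc a) Se) else 0)"
      using U unfolding w S_def Se_def km by simp
    have eps: "ep i w = k" "ph i w = Suc m" "ew i w = a # ew i u" "fw i w = (if m = 0 then Suc a # u else a # fw i u)"
      using U nd unfolding w km by auto
    have E: "TE i (sv i w) = (if k > 0 then tscale (qbr ?v (int (Suc m) + 1)) (sv i (a # ew i u)) else 0)"
    proof (cases "k > 0")
      case True
      have p: "Suc (ep i (ew i u)) = k" "ph i (ew i u) = Suc m"
        using ew_props[of i u] True unfolding km by auto
      have svE: "sv i (a # ew i u) = tn a Se + (if k > 1 then tscale (?v powi (int m + 2)) (tn (Suc a) See) else 0)"
        using U p(1) unfolding sv.simps p(2) Se_def See_def by (auto simp: add_ac)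
      have q1: "qbr ?v (int m + 2) = inverse ?v * qbr ?v (int m + 1) + ?v powi (int m + 1)"
        using qbr_step'[OF q, of "int m + 1"] by (simp add: add_ac)
      have q2: "?v powi (int m + 1) * ?v = ?v powi (int m + 2)"
        by (simp add: power_int_add power2_eq_square)
      have "TE i (sv i w) = tscale (inverse ?v * qbr ?v (int m + 1) + ?v powi (int m + 1)) (tn a Se) +
         (if k > 1 then tscale (?v powi (int m + 1) * ?v * qbr ?v (int m + 2)) (tn (Suc a) See) else 0)"
        unfolding sv using True U nd S Se[OF True] by (simp add: lin algebra_simps)
      thus ?thesis unfolding svE q2 q1[symmetric] using True by (simp add: tscale_distribs mult.commute add_ac)
    next
      case False
      thus ?thesis unfolding sv using U nd S by (simp add: lin)
    qed
    have F: "TF i (sv i w) = tscale (qbr ?v (int k + 1)) (sv i (fw i w))"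
    proof -
      have q1: "?v powi (int m - int k) + (if k > 0 then ?v powi (int m + 1) * qbr ?v (int k) else 0) = ?v powi int m * qbr ?v (int k + 1)"
        unfolding qbr_step[OF q, of "int k"]
        by (cases "k = 0") (simp_all add: power_int_add power_int_diff power_int_minus divide_inverse algebra_simps)
      have svF: "sv i (fw i w) = (if m > 0 then tn a Sf else 0) + tscale (?v powi int m) (tn (Suc a) S)"
      proof (cases "m = 0")
        case True
        thus ?thesis using nd unfolding eps S_def by (simp flip: km)
      next
        case False
        have "ew i (fw i u) = u" "ep i (fw i u) = Suc k" "Suc (ph i (fw i u)) = m"
          using fw_props[of i u] False unfolding km by auto
        hence "ew i (fw i u) = u" "ep i (fw i u) = Suc k" "int (ph i (fw i u)) + 1 = int m" by auto
        thus ?thesis using False U unfolding eps S_def Sf_def by simp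
      qed
      have "TF i (sv i w) = (if m > 0 then tscale (qbr ?v (int k + 1)) (tn a Sf) else 0) +
          tscale (?v powi (int m - int k) + (if k > 0 then ?v powi (int m + 1) * qbr ?v (int k) else 0)) (tn (Suc a) S)"
        unfolding sv using U nd S Se(2) KS by (simp add: lin add_ac)
      thus ?thesis unfolding q1 svF by (simp add: tscale_distribs mult.commute)
    qed
    show ?thesis using E F unfolding eps by simp
  next
    case D0
    have nd: "\<not> up i a" "up i (a - 1)" "Suc (a - 1) = a" using D0 up_not_dn dn_pred[of i a] by auto
    have sv: "sv i w = tn a S" using D0 nd unfolding w S_def km by simp
    have eps: "ep i w = Suc k" "ph i w = 0" "ew i w = (a - 1) # u" using D0 nd unfolding w km by auto
    have svE: "sv i ((a - 1) # u) = tn (a - 1) S + (if k > 0 then tscale ?v (tn a Se) else 0)"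
      using nd D0 unfolding S_def Se_def by (simp flip: km)
    show ?thesis unfolding eps svE unfolding sv using D0 nd S by (simp add: lin qbr_1[OF q] add_ac)
  next
    case D1
    have nd: "\<not> up i a" "up i (a - 1)" "Suc (a - 1) = a" "\<not> dn i (a - 1)"
      using D1 up_not_dn dn_pred[of i a] by auto
    have n0: "qbr ?v (int (k + m)) \<noteq> 0" using qbr_eq_0_iff[OF q] D1 by simp
    let ?N = "qbr ?v (int (k + m))"
    have sv: "sv i w = tscale (ca1 i k m) (tn a S) + tscale (cb1 i k m) (tn (a - 1) Sf)"
      using D1 nd unfolding w S_def Sf_def km by simp
    have eps: "ep i w = k" "ph i w = m - 1" "ew i w = a # ew i u" "fw i w = a # fw i u"
      using D1 nd unfolding w km by auto
    have E: "TE i (sv i w) = (if k > 0 then tscale (qbr ?v (int (m - 1) + 1)) (sv i (a # ew i u)) else 0)"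
    proof -
      have c: "TE i (sv i w) = (if k > 0 then tscale (ca1 i k m * ?v * qbr ?v (int m + 1)) (tn a Se) else 0) +
          tscale (ca1 i k m + cb1 i k m * inverse ?v * qbr ?v (int m)) (tn (a - 1) S)"
        unfolding sv using D1 nd S Sf by (simp add: lin algebra_simps)
      have qs: "qbr ?v (int k + 1) = ?v * qbr ?v (int k) + ?v powi (- int k)" by (rule qbr_step[OF q])
      have c2: "ca1 i k m + cb1 i k m * inverse ?v * qbr ?v (int m) = - (?v * qbr ?v (int k) / ?N) * qbr ?v (int m)"
        unfolding ca1_def cb1_def using n0 qs by (simp add: field_simps add_ac)
      show ?thesis
      proof (cases "k > 0")
        case True
        have p: "ep i (ew i u) = k - 1" "ph i (ew i u) = Suc m" "fw i (ew i u) = u"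
          using ew_props[of i u] True unfolding km by auto
        have svE: "sv i (a # ew i u) = tscale (ca1 i (k - 1) (Suc m)) (tn a Se) + tscale (cb1 i (k - 1) (Suc m)) (tn (a - 1) S)"
          using D1 nd unfolding sv.simps p S_def Se_def by simp
        have k1: "k - 1 + Suc m = k + m" "Suc (k - 1) = k" "int (k - 1) = int k - 1" "int (m - 1) + 1 = int m"
          using True D1 by auto
        have c1: "ca1 i k m * ?v * qbr ?v (int m + 1) = qbr ?v (int m) * ca1 i (k - 1) (Suc m)"
          unfolding ca1_def k1 using n0 by (simp add: power_int_diff power_int_minus field_simps add_ac)
        have c3: "- (?v * qbr ?v (int k) / ?N) * qbr ?v (int m) = qbr ?v (int m) * cb1 i (k - 1) (Suc m)"
          unfolding cb1_def k1 by simp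
        show ?thesis unfolding c c1 c2 c3 svE k1 using True by (simp add: tscale_distribs)
      next
        case False
        thus ?thesis unfolding c c2 by simp
      qed
    qed
    have F: "TF i (sv i w) = (if m > 1 then tscale (qbr ?v (int k + 1)) (sv i (a # fw i u)) else 0)"
    proof -
      have c: "TF i (sv i w) = tscale (ca1 i k m * qbr ?v (int k + 1) + cb1 i k m * ?v powi (int m - int k - 2)) (tn a Sf) +
          (if m > 1 then tscale (cb1 i k m * qbr ?v (int k + 2)) (tn (a - 1) Sff) else 0)"
        unfolding sv using D1 nd S Sf KSf by (simp add: lin algebra_simps)
      have qs: "qbr ?v (int m) = inverse ?v * qbr ?v (int m - 1) + ?v powi (int m - 1)"
        using qbr_step'[OF q, of "int m - 1"] by simp
      have pw: "?v * ?v powi (int m - int k - 2) = ?v powi (- int k) * ?v powi (int m - 1)"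
      proof -
        have "?v powi 1 * ?v powi (int m - int k - 2) = ?v powi (- int k) * ?v powi (int m - 1)"
          by (subst (1 2) power_int_add[symmetric]) (auto simp: algebra_simps)
        thus ?thesis by simp
      qed
      have "ca1 i k m * qbr ?v (int k + 1) + cb1 i k m * ?v powi (int m - int k - 2) =
         qbr ?v (int k + 1) * (?v powi (- int k) * qbr ?v (int m) - ?v * ?v powi (int m - int k - 2)) / ?N"
        unfolding ca1_def cb1_def by (simp add: diff_divide_distrib algebra_simps)
      also have "\<dots> = qbr ?v (int k + 1) * (?v powi (- int k) * inverse ?v * qbr ?v (int m - 1)) / ?N"
        unfolding pw qs by (simp add: algebra_simps)
      finally have c1: "ca1 i k m * qbr ?v (int k + 1) + cb1 i k m * ?v powi (int m - int k - 2) =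
         qbr ?v (int k + 1) * (?v powi (- int k) * inverse ?v * qbr ?v (int m - 1)) / ?N" .
      show ?thesis
      proof (cases "m > 1")
        case True
        have p: "ep i (fw i u) = Suc k" "ph i (fw i u) = m - 1"
          using fw_props[of i u] D1 unfolding km by auto
        have svF: "sv i (a # fw i u) = tscale (ca1 i (Suc k) (m - 1)) (tn a Sf) + tscale (cb1 i (Suc k) (m - 1)) (tn (a - 1) Sff)"
          using D1 nd True unfolding sv.simps p Sf_def Sff_def by simp
        have k1: "Suc k + (m - 1) = k + m" "int (m - 1) = int m - 1" using D1 by auto
        have c2: "qbr ?v (int k + 1) * (?v powi (- int k) * inverse ?v * qbr ?v (int m - 1)) / ?N = qbr ?v (int k + 1) * ca1 i (Suc k) (m - 1)"
          unfolding ca1_def k1 using n0 by (simp add: power_int_diff power_int_add power_int_minus field_simps)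
        have c3: "cb1 i k m * qbr ?v (int k + 2) = qbr ?v (int k + 1) * cb1 i (Suc k) (m - 1)"
          unfolding cb1_def k1 by (simp add: add_ac)
        show ?thesis unfolding c c1 c2 c3 svF using True by (simp add: tscale_distribs)
      next
        case False
        hence "m = 1" using D1 by simp
        thus ?thesis unfolding c c1 by simp
      qed
    qed
    show ?thesis unfolding eps using E F by simp
  qed
qed

end

context letter_chain
begin

lemma sv_Tn: "w \<in> Wd n \<Longrightarrow> sv i w \<in> Tn n"
proof (induction i w arbitrary: n rule: sv.induct)
  case (1 i)
  thus ?case by (auto simp: Tn_def Wd_def)
next
  case (2 i a w)
  then obtain n' where n: "n = Suc n'" "a \<le> D" "w \<in> Wd n'"
    by (cases n) (auto simp: Cons_in_Wd Wd_0)
  have u: "up i a \<Longrightarrow> Suc a \<le> D" by (simp add: up_def)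
  have e: "ew i w \<in> Wd n'" "fw i w \<in> Wd n'" using n(3) ew_Wd fw_Wd by auto
  have "sv i w \<in> Tn n'" using "2.IH" n(3) by (cases "up i a"; cases "dn i a \<and> ph i w > 0") blast+
  thus ?case unfolding n(1) sv.simps using "2.IH" n(2) e u by (auto intro!: Tn_closed tn_Tn)
qed

text \<open>The ratio [m] / [k + m] has leading term v^k, which the factor v^(-k) cancels. For
  \<open>cb1\<close> the leading term is v^m up to sign, which vanishes at q = 0.\<close>

lemma ca1_regular: "m > 0 \<Longrightarrow> ca1 i k m \<in> regular_at_0 \<and> ev0 (ca1 i k m) = 1"
proof -
  assume m: "m > 0"
  obtain u where u: "u \<in> regular_at_0" "ev0 u = 1"
    "qbr (vi i) (int m) / qbr (vi i) (int (k + m)) = vi i powi (int (k + m) - int m) * u"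
    using qbr_ratio[OF qpar_qi m, of "k + m"] m by auto
  have "ca1 i k m = vi i powi (- int k) * (vi i powi (int (k + m) - int m) * u)"
    unfolding ca1_def u(3)[symmetric] by simp
  also have "\<dots> = u" by (simp add: power_int_minus)
  finally show ?thesis using u by simp
qed

lemma cb1_regular: "m > 0 \<Longrightarrow> cb1 i k m \<in> regular_at_0 \<and> ev0 (cb1 i k m) = 0"
proof -
  assume m: "m > 0"
  obtain u where u: "u \<in> regular_at_0" "ev0 u = 1"
    "qbr (vi i) (int (Suc k)) / qbr (vi i) (int (k + m)) = vi i powi (int (k + m) - int (Suc k)) * u"
    using qbr_ratio[OF qpar_qi, of "Suc k" "k + m" X i] m by auto
  have "cb1 i k m = - (vi i * (vi i powi (int (k + m) - int (Suc k)) * u))"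
    unfolding cb1_def u(3)[symmetric] by simp
  also have "vi i * (vi i powi (int (k + m) - int (Suc k)) * u) = vi i ^ m * u"
    using m by (cases m) (simp_all add: power_int_add)
  finally have "cb1 i k m = - (vi i ^ m * u)" .
  moreover have "vi i ^ m \<in> regular_at_0 \<and> ev0 (vi i ^ m) = 0"
    using regular_power[OF qpar_regular(1)[OF qpar_qi]] qpar_regular(2)[OF qpar_qi] m by (simp add: power_0_left)
  ultimately show ?thesis using u regular_mult[of "vi i ^ m" u] regular_uminus[of "vi i ^ m * u"] by simp
qed

definition congr :: "tvec \<Rightarrow> nat list \<Rightarrow> bool" where
  "congr f w \<longleftrightarrow> reg f \<and> (\<forall>u. ev0 (f u) = of_bool (u = w))"

lemma congr_tn: "congr f w \<Longrightarrow> congr (tn a f) (a # w)"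
  unfolding congr_def reg_def by (auto simp: tn_def split: list.split)

lemma congr_add_small:
  assumes "congr f w" "reg g" "c \<in> regular_at_0" "ev0 c = 0"
  shows "congr (f + tscale c g) w"
proof -
  have "f u + c * g u \<in> regular_at_0 \<and> ev0 (f u + c * g u) = ev0 (f u)" for u
    using assms regular_mult[of c "g u"] regular_add[of "f u" "c * g u"] unfolding congr_def reg_def by simp
  thus ?thesis using assms(1) unfolding congr_def reg_def by (simp add: tvec_apply)
qed

lemma congr_tscale:
  assumes "congr f w" "c \<in> regular_at_0" "ev0 c = 1"
  shows "congr (tscale c f) w"
proof -
  have "c * f u \<in> regular_at_0 \<and> ev0 (c * f u) = ev0 (f u)" for u
    using assms regular_mult[of c "f u"] unfolding congr_def reg_def by simp
  thus ?thesis using assms(1) unfolding congr_def reg_def by (simp add: tvec_apply)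
qed

text \<open>In each branch of the recursion the summand with the unchanged head has a coefficient of
  residue 1, and the other one has a coefficient that vanishes at q = 0.\<close>

lemma congr_sv: "congr (sv i w) w"
proof (induction i w rule: sv.induct)
  case (1 i)
  show ?case unfolding congr_def reg_def by auto
next
  case (2 i a w)
  have v: "vi i powi (int (ph i w) + 1) \<in> regular_at_0 \<and> ev0 (vi i powi (int (ph i w) + 1)) = 0"
    using regular_power[OF qpar_regular(1)[OF qpar_qi], of X i "Suc (ph i w)"] qpar_regular(2)[OF qpar_qi, of X i]
    by (simp add: power_int_def nat_add_distrib)
  have reg: "\<And>f w. congr f w \<Longrightarrow> reg f" unfolding congr_def by simp
  consider "up i a" | "dn i a" "ph i w > 0" "\<not> up i a" | "\<not> up i a" "\<not> (dn i a \<and> ph i w > 0)" by argo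
  thus ?case
  proof cases
    case 1
    show ?thesis
    proof (cases "ep i w > 0")
      case True
      thus ?thesis unfolding sv.simps using 1 2
        by (simp only: if_True) (intro congr_add_small congr_tn reg[OF congr_tn]; (simp add: v)?)
    next
      case False thus ?thesis using 1 2 congr_tn by (simp add: )
    qed
  next
    case 2
    thus ?thesis unfolding sv.simps using "2.IH" ca1_regular[OF 2(2)] cb1_regular[OF 2(2)]
      by (simp only: if_True if_False simp_thms) (intro congr_add_small congr_tscale congr_tn reg[OF congr_tn]; simp)
  next
    case 3
    thus ?thesis unfolding sv.simps using "2.IH" congr_tn by auto
  qed
qed

text \<open>Words are orthonormal, so pairing with any lift of the word w reads off the residue at
  w. This turns orthogonality statements into statements on residues.\<close>

lemma ev0_dot_congr:
  assumes "reg f" "congr g w" "w \<in> Wd n"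
  shows "dot n f g \<in> regular_at_0 \<and> ev0 (dot n f g) = ev0 (f w)"
proof -
  have "(\<Sum>u\<in>Wd n. ev0 (f u) * ev0 (g u)) = (\<Sum>u\<in>Wd n. if u = w then ev0 (f w) else 0)"
    using assms(2) unfolding congr_def by (intro sum.cong) auto
  thus ?thesis using reg_dot[OF assms(1), of g n] assms unfolding congr_def by (simp add: sum.delta)
qed

definition nm :: "nat \<Rightarrow> nat \<Rightarrow> nat list \<Rightarrow> ratq" where
  "nm n i d = dot n (sv i d) (sv i d)"

lemma nm_regular: "d \<in> Wd n \<Longrightarrow> nm n i d \<in> regular_at_0 \<and> ev0 (nm n i d) = 1"
  unfolding nm_def using ev0_dot_congr[OF _ congr_sv, of "sv i d" d n i] congr_sv[of i d] unfolding congr_def by simp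

lemma nm_nonzero: "d \<in> Wd n \<Longrightarrow> nm n i d \<noteq> 0"
  using nm_regular[of d n i] by auto

lemma TE_sv: "i \<in> idxs \<Longrightarrow> TE i (sv i w) = (if ep i w > 0 then tscale (qbr (vi i) (int (ph i w) + 1)) (sv i (ew i w)) else 0)"
  and TF_sv: "i \<in> idxs \<Longrightarrow> TF i (sv i w) = (if ph i w > 0 then tscale (qbr (vi i) (int (ep i w) + 1)) (sv i (fw i w)) else 0)"
  using sv_E_F[of i w] by auto

lemma sv_as_TF: "i \<in> idxs \<Longrightarrow> ep i d > 0 \<Longrightarrow> TF i (sv i (ew i d)) = tscale (qbr (vi i) (int (ep i d))) (sv i d)"
proof -
  assume i: "i \<in> idxs" and e: "ep i d > 0"
  have p: "Suc (ep i (ew i d)) = ep i d" "ph i (ew i d) > 0" "fw i (ew i d) = d"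
    using ew_props[OF e] by auto
  have "int (ep i d) = int (ep i (ew i d)) + 1" using p(1) by linarith
  thus ?thesis unfolding TF_sv[OF i, of "ew i d"] using p(2,3) by simp
qed

lemma dot_F_sv:
  assumes "i \<in> idxs" "ep i d > 0"
  shows "dot n (sv i d) g = inverse (qbr (vi i) (int (ep i d))) * (inverse (vi i) * dot n (sv i (ew i d)) (TK i (TE i g)))"
proof -
  have q: "qbr (vi i) (int (ep i d)) \<noteq> 0" using qbr_eq_0_iff[OF qpar_qi] assms(2) by simp
  have "sv i d = tscale (inverse (qbr (vi i) (int (ep i d)))) (TF i (sv i (ew i d)))"
    unfolding sv_as_TF[OF assms] using q by simp
  thus ?thesis by (simp add: dot_tscale dot_TF)
qed

text \<open>Expanding both vectors by their heads leaves three kinds of pairings of tails: two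
  highest vectors (induction), a highest vector with a lowered one (zero, since F is adjoint to E up
  to K), and two lowered ones (\<open>FF\<close>, reduced to the first kind).\<close>

lemma sv_orth_hw:
  assumes i: "i \<in> idxs"
  shows "d \<in> Wd n \<Longrightarrow> d' \<in> Wd n \<Longrightarrow> ep i d = 0 \<Longrightarrow> ep i d' = 0 \<Longrightarrow> d \<noteq> d' \<Longrightarrow> dot n (sv i d) (sv i d') = 0"
proof (induction n arbitrary: d d')
  case 0 thus ?case by (simp add: Wd_0)
next
  case (Suc n)
  obtain a u b u' where d: "d = a # u" "a \<le> D" "u \<in> Wd n" "d' = b # u'" "b \<le> D" "u' \<in> Wd n"
    using Suc.prems(1,2) unfolding Wd_Suc by auto
  have e: "ep i u = 0" "ep i u' = 0" using Suc.prems d ep_mono[of i u a] ep_mono[of i u' b] by auto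
  have dm: "dn i a \<Longrightarrow> ph i u > 0" "dn i b \<Longrightarrow> ph i u' > 0" using Suc.prems d by (auto split: if_splits)
  have IH: "u \<noteq> u' \<Longrightarrow> dot n (sv i u) (sv i u') = 0" using Suc.IH d e by blast
  have E0: "TE i (sv i u) = 0" "TE i (sv i u') = 0" using TE_sv[OF i] e by auto
  have F: "dot n (sv i (fw i x)) g = 0" if "ph i x > 0" "TE i g = 0" for x g
  proof -
    have "ew i (fw i x) = x" "ep i (fw i x) > 0" using fw_props[OF that(1)] by auto
    thus ?thesis using dot_F_sv[OF i, of "fw i x" n g] that by simp
  qed
  have F': "dot n g (sv i (fw i x)) = 0" if "ph i x > 0" "TE i g = 0" for x g
    using F[OF that] by (simp add: dot_commute)
  have FF: "dot n (sv i (fw i u)) (sv i (fw i u')) = 0" if "ph i u > 0" "ph i u' > 0" "u \<noteq> u'"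
  proof -
    have "ew i (fw i u) = u" "ep i (fw i u) > 0" "ew i (fw i u') = u'" "ep i (fw i u') > 0"
      using fw_props[OF that(1)] fw_props[OF that(2)] by auto
    thus ?thesis using dot_F_sv[OF i, of "fw i u" n "sv i (fw i u')"] IH[OF that(3)] TE_sv[OF i, of "fw i u'"]
      by (simp add: T_linear TK_sv[OF i i] dot_tscale)
  qed
  have sva: "sv i (a # u) = (if dn i a then tscale (ca1 i 0 (ph i u)) (tn a (sv i u)) + tscale (cb1 i 0 (ph i u)) (tn (a - 1) (sv i (fw i u))) else tn a (sv i u))"
    using e dm up_not_dn[of i a] by auto
  have svb: "sv i (b # u') = (if dn i b then tscale (ca1 i 0 (ph i u')) (tn b (sv i u')) + tscale (cb1 i 0 (ph i u')) (tn (b - 1) (sv i (fw i u'))) else tn b (sv i u'))"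
    using e dm up_not_dn[of i b] by auto
  have pa: "dn i a \<Longrightarrow> a - 1 \<le> D \<and> \<not> dn i (a - 1) \<and> a > 0" "dn i b \<Longrightarrow> b - 1 \<le> D \<and> \<not> dn i (b - 1) \<and> b > 0"
    using dn_pred[of i a] dn_pred[of i b] up_not_dn[of i "a - 1"] up_not_dn[of i "b - 1"] by (auto simp: dn_def)
  have ne: "a = b \<Longrightarrow> u \<noteq> u'" using Suc.prems(5) d by auto
  show ?case unfolding d sva svb
    using d pa dm ne IH FF F[of u "sv i u'"] F'[of u' "sv i u"] E0
    by (cases "dn i a"; cases "dn i b"; cases "a = b")
       (auto simp: dot_add dot_tscale dot_tn)
qed

lemma sv_orth:
  assumes i: "i \<in> idxs"
  shows "d \<in> Wd n \<Longrightarrow> d' \<in> Wd n \<Longrightarrow> d \<noteq> d' \<Longrightarrow> dot n (sv i d) (sv i d') = 0"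
proof (induction "ep i d" arbitrary: d d')
  case 0
  show ?case
  proof (cases "ep i d' = 0")
    case True thus ?thesis using sv_orth_hw[OF i] 0 by metis
  next
    case False
    have "TE i (sv i d) = 0" using TE_sv[OF i] 0 by simp
    thus ?thesis using dot_F_sv[OF i, of d' n "sv i d"] False by (simp add: dot_commute)
  qed
next
  case (Suc k)
  have e: "ep i d > 0" using Suc by simp
  show ?case
  proof (cases "ep i d' = 0")
    case True
    thus ?thesis using dot_F_sv[OF i e] TE_sv[OF i] by simp
  next
    case False
    have "fw i (ew i d) = d" "fw i (ew i d') = d'" using ew_props[OF e] ew_props[of i d'] False by auto
    hence "ew i d \<noteq> ew i d'" using Suc.prems(3) by metis
    moreover have "k = ep i (ew i d)" using ew_props[OF e] Suc(2) by simp
    ultimately have "dot n (sv i (ew i d)) (sv i (ew i d')) = 0"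
      using Suc.hyps(1) Suc.prems ew_Wd by blast
    thus ?thesis using dot_F_sv[OF i e] TE_sv[OF i] False by (simp add: T_linear TK_sv[OF i i] dot_tscale)
  qed
qed

definition cf :: "nat \<Rightarrow> nat \<Rightarrow> tvec \<Rightarrow> nat list \<Rightarrow> ratq" where
  "cf n i f d = dot n f (sv i d) / nm n i d"

lemma cf_linear: "cf n i (f + g) d = cf n i f d + cf n i g d" "cf n i (tscale c f) d = c * cf n i f d"
  unfolding cf_def by (simp_all add: dot_add dot_tscale add_divide_distrib)

lemma cf_sv: "i \<in> idxs \<Longrightarrow> d \<in> Wd n \<Longrightarrow> d' \<in> Wd n \<Longrightarrow> cf n i (sv i d) d' = of_bool (d = d')"
  unfolding cf_def using sv_orth[of i d n d'] nm_nonzero[of d n i] by (auto simp: nm_def)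

text \<open>No dimension count is made: the remainder \<open>g\<close> is orthogonal to all string
  vectors, and if it were nonzero, scaling would give it residue 1 at some word w and hence a
  nonzero pairing with \<open>sv i w\<close>.\<close>

lemma sv_complete:
  assumes i: "i \<in> idxs" and f: "f \<in> Tn n"
  shows "f = (\<Sum>d\<in>Wd n. tscale (cf n i f d) (sv i d))"
proof -
  let ?s = "\<Sum>d\<in>Wd n. tscale (cf n i f d) (sv i d)"
  define g where "g = f + tscale (-1) ?s"
  have gT: "g \<in> Tn n" unfolding g_def using f by (intro Tn_closed Tn_sum sv_Tn)
  have "dot n ?s (sv i d) = dot n f (sv i d)" if d: "d \<in> Wd n" for d
  proof -
    have "dot n ?s (sv i d) = (\<Sum>d'\<in>Wd n. if d' = d then cf n i f d * nm n i d else 0)"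
      unfolding dot_sum dot_tscale nm_def using sv_orth[OF i _ d] by (intro sum.cong) auto
    thus ?thesis using d nm_nonzero[OF d] by (simp add: sum.delta cf_def)
  qed
  hence orth: "dot n g (sv i d) = 0" if "d \<in> Wd n" for d
    using that unfolding g_def dot_add dot_tscale by simp
  have "g = 0"
  proof (rule ccontr)
    assume "g \<noteq> 0"
    then obtain w where w: "w \<in> Wd n" "g w \<noteq> 0" "reg (tscale (inverse (g w)) g)"
      using reg_scaling[OF gT] by blast
    have "ev0 (dot n (tscale (inverse (g w)) g) (sv i w)) = ev0 (tscale (inverse (g w)) g w)"
      using ev0_dot_congr[OF w(3) congr_sv w(1)] by blast
    thus False using orth[OF w(1)] w(2) by (simp add: dot_tscale tvec_apply)
  qed
  have "f w = ?s w" for w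
  proof -
    have "g w = 0" using \<open>g = 0\<close> by (simp add: tvec_apply)
    thus ?thesis unfolding g_def by (simp add: tvec_apply)
  qed
  thus ?thesis by (rule ext)
qed

lemma tvec_sum_linear:
  assumes "\<And>f g. Q (f + g) = Q f + Q g" "Q 0 = (0 :: 'b :: comm_monoid_add)"
  shows "Q (\<Sum>x\<in>S. f x :: tvec) = (\<Sum>x\<in>S. Q (f x))"
  by (induction S rule: infinite_finite_induct) (auto simp: assms)

section \<open>Kashiwara operators on the tensor powers\<close>

text \<open>Each node has its own string basis; the operators shift it according to the signature
  rule, and \<open>cf\<close> extracts coordinates by orthogonality. \<open>kashiwara_Fd\<close>
  shows that these are the Kashiwara operators.\<close>

definition et :: "nat \<Rightarrow> nat \<Rightarrow> tvec \<Rightarrow> tvec" where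
  "et n i f = (\<Sum>d\<in>Wd n. if ep i d > 0 then tscale (cf n i f d) (sv i (ew i d)) else 0)"

definition ft :: "nat \<Rightarrow> nat \<Rightarrow> tvec \<Rightarrow> tvec" where
  "ft n i f = (\<Sum>d\<in>Wd n. if ph i d > 0 then tscale (cf n i f d) (sv i (fw i d)) else 0)"

lemma et_add: "et n i (f + g) = et n i f + et n i g" and ft_add: "ft n i (f + g) = ft n i f + ft n i g"
  unfolding et_def ft_def cf_linear sum.distrib[symmetric] by (auto intro!: sum.cong simp: tscale_distribs)

lemma tscale_sum: "tscale c (\<Sum>x\<in>S. f x) = (\<Sum>x\<in>S. tscale c (f x))"
  by (induction S rule: infinite_finite_induct) (auto simp: tscale_distribs)

lemma et_tscale: "et n i (tscale c f) = tscale c (et n i f)" and ft_tscale: "ft n i (tscale c f) = tscale c (ft n i f)"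
  unfolding et_def ft_def cf_linear tscale_sum by (auto intro!: sum.cong)

lemma et_0 [simp]: "et n i 0 = 0" and ft_0 [simp]: "ft n i 0 = 0"
  using et_tscale[of n i 0 0] ft_tscale[of n i 0 0] by auto

lemma et_Tn: "et n i f \<in> Tn n" and ft_Tn: "ft n i f \<in> Tn n"
  unfolding et_def ft_def by (auto intro!: Tn_sum Tn_closed sv_Tn ew_Wd fw_Wd)

lemma et_sv: "i \<in> idxs \<Longrightarrow> d \<in> Wd n \<Longrightarrow> et n i (sv i d) = (if ep i d > 0 then sv i (ew i d) else 0)"
proof -
  assume h: "i \<in> idxs" "d \<in> Wd n"
  have "et n i (sv i d) = (\<Sum>d'\<in>Wd n. if d' = d then (if ep i d > 0 then sv i (ew i d) else 0) else 0)"
    unfolding et_def using cf_sv h by (intro sum.cong) auto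
  thus ?thesis using h by (simp add: sum.delta)
qed

lemma ft_sv: "i \<in> idxs \<Longrightarrow> d \<in> Wd n \<Longrightarrow> ft n i (sv i d) = (if ph i d > 0 then sv i (fw i d) else 0)"
proof -
  assume h: "i \<in> idxs" "d \<in> Wd n"
  have "ft n i (sv i d) = (\<Sum>d'\<in>Wd n. if d' = d then (if ph i d > 0 then sv i (fw i d) else 0) else 0)"
    unfolding ft_def using cf_sv h by (intro sum.cong) auto
  thus ?thesis using h by (simp add: sum.delta)
qed

lemma cf_regular:
  assumes "reg f" "d \<in> Wd n"
  shows "cf n i f d \<in> regular_at_0 \<and> ev0 (cf n i f d) = ev0 (f d)"
  unfolding cf_def using ev0_dot_congr[OF assms(1) congr_sv assms(2), of i] nm_regular[OF assms(2), of i]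
    regular_divide[of "dot n f (sv i d)" "nm n i d"] by simp

text \<open>Coordinates in the string basis and in the word basis have equal residues
  (\<open>cf_regular\<close>), so a map of string vectors induces the same map of words at q =
  0.\<close>

lemma reg_comb:
  assumes "reg f" "\<And>d. d \<in> Wd n \<Longrightarrow> P d \<Longrightarrow> g d \<in> Wd n"
  shows "reg (\<Sum>d\<in>Wd n. if P d then tscale (cf n i f d) (sv i (g d)) else 0) \<and>
     ev0 ((\<Sum>d\<in>Wd n. if P d then tscale (cf n i f d) (sv i (g d)) else 0) w) =
       (\<Sum>d\<in>Wd n. if P d \<and> g d = w then ev0 (f d) else 0)"
proof -
  have r: "(if P d then tscale (cf n i f d) (sv i (g d)) else 0) w \<in> regular_at_0 \<and>
     ev0 ((if P d then tscale (cf n i f d) (sv i (g d)) else 0) w) = (if P d \<and> g d = w then ev0 (f d) else 0)"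
    if "d \<in> Wd n" for d w
    using cf_regular[OF assms(1) that, of i] congr_sv[of i "g d"] regular_mult[of "cf n i f d" "sv i (g d) w"]
    unfolding congr_def reg_def by (auto simp: tvec_apply)
  have "(\<Sum>d\<in>Wd n. if P d then tscale (cf n i f d) (sv i (g d)) else 0) w \<in> regular_at_0 \<and>
    ev0 ((\<Sum>d\<in>Wd n. if P d then tscale (cf n i f d) (sv i (g d)) else 0) w) =
       (\<Sum>d\<in>Wd n. if P d \<and> g d = w then ev0 (f d) else 0)" for w
    unfolding tvec_sum_apply
    using regular_sum[of "Wd n" "\<lambda>d. (if P d then tscale (cf n i f d) (sv i (g d)) else 0) w"] r by auto
  thus ?thesis unfolding reg_def by blast
qed

lemma et_regular:
  assumes "reg f"
  shows "reg (et n i f)" "w \<in> Wd n \<Longrightarrow> ev0 (et n i f w) = (if ph i w > 0 then ev0 (f (fw i w)) else 0)"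
proof -
  show "reg (et n i f)" unfolding et_def using reg_comb[OF assms, of n "\<lambda>d. ep i d > 0" "ew i"] ew_Wd by blast
  assume w: "w \<in> Wd n"
  have "ev0 (et n i f w) = (\<Sum>d\<in>Wd n. if ep i d > 0 \<and> ew i d = w then ev0 (f d) else 0)"
    unfolding et_def using reg_comb[OF assms, of n "\<lambda>d. ep i d > 0" "ew i"] ew_Wd by blast
  also have "\<dots> = (\<Sum>d\<in>Wd n. if d = fw i w then (if ph i w > 0 then ev0 (f (fw i w)) else 0) else 0)"
    using ew_props[of i] fw_props[of i w] by (intro sum.cong) (force)+
  finally show "ev0 (et n i f w) = (if ph i w > 0 then ev0 (f (fw i w)) else 0)"
    using fw_Wd[OF w] by (simp add: sum.delta)
qed

lemma ft_regular:
  assumes "reg f"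
  shows "reg (ft n i f)" "w \<in> Wd n \<Longrightarrow> ev0 (ft n i f w) = (if ep i w > 0 then ev0 (f (ew i w)) else 0)"
proof -
  show "reg (ft n i f)" unfolding ft_def using reg_comb[OF assms, of n "\<lambda>d. ph i d > 0" "fw i"] fw_Wd by blast
  assume w: "w \<in> Wd n"
  have "ev0 (ft n i f w) = (\<Sum>d\<in>Wd n. if ph i d > 0 \<and> fw i d = w then ev0 (f d) else 0)"
    unfolding ft_def using reg_comb[OF assms, of n "\<lambda>d. ph i d > 0" "fw i"] fw_Wd by blast
  also have "\<dots> = (\<Sum>d\<in>Wd n. if d = ew i w then (if ep i w > 0 then ev0 (f (ew i w)) else 0) else 0)"
    using fw_props[of i] ew_props[of i w] by (intro sum.cong) (force)+
  finally show "ev0 (ft n i f w) = (if ep i w > 0 then ev0 (f (ew i w)) else 0)"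
    using ew_Wd[OF w] by (simp add: sum.delta)
qed

end

section \<open>Divided powers, components of fixed depth and adjoints of the Kashiwara
  operators\<close>

context letter_chain
begin

definition Fd :: "nat \<Rightarrow> nat \<Rightarrow> tvec \<Rightarrow> tvec" where
  "Fd i k f = tscale (inverse (qfact X i k)) ((TF i ^^ k) f)"

lemma qfact_Suc: "qfact X i (Suc k) = qfact X i k * qbr (vi i) (int k + 1)"
  unfolding qfact_def qint_qbr by (simp add: add.commute)

lemma Fd_0 [simp]: "Fd i 0 f = f"
  by (simp add: Fd_def qfact_def)

lemma TF_pow_linear: "(TF i ^^ k) (f + g) = (TF i ^^ k) f + (TF i ^^ k) g"
    "(TF i ^^ k) (tscale c f) = tscale c ((TF i ^^ k) f)"
  by (induction k) (auto simp: T_linear)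

lemma Fd_linear: "Fd i k (f + g) = Fd i k f + Fd i k g" "Fd i k (tscale c f) = tscale c (Fd i k f)" "Fd i k 0 = 0"
proof -
  show "Fd i k (f + g) = Fd i k f + Fd i k g" "Fd i k (tscale c f) = tscale c (Fd i k f)" for f g c
    unfolding Fd_def TF_pow_linear by (simp_all add: tscale_distribs mult.commute)
  from this(2)[of 0 0] show "Fd i k 0 = 0" by simp
qed

lemma TF_Fd: "TF i (Fd i k f) = tscale (qbr (vi i) (int k + 1)) (Fd i (Suc k) f)"
proof -
  have "qbr (vi i) (int k + 1) * (inverse (qfact X i k) * inverse (qbr (vi i) (int k + 1))) = inverse (qfact X i k)"
    using qbr_eq_0_iff[OF qpar_qi, of X i "int k + 1"] by (simp add: field_simps)
  thus ?thesis unfolding Fd_def qfact_Suc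
    by (simp only: T_linear tscale_simps inverse_mult_distrib funpow.simps o_apply)
qed

lemma Fd_Suc: "Fd i (Suc k) f = tscale (inverse (qbr (vi i) (int k + 1))) (TF i (Fd i k f))"
  unfolding TF_Fd using qbr_eq_0_iff[OF qpar_qi, of X i "int k + 1"] by simp

lemma Fd_Tn: "f \<in> Tn n \<Longrightarrow> Fd i k f \<in> Tn n"
proof -
  assume "f \<in> Tn n"
  hence "(TF i ^^ k) f \<in> Tn n" by (induction k) (auto intro: TF_Tn)
  thus ?thesis unfolding Fd_def by (rule Tn_closed)
qed

lemma Fd_sv:
  assumes i: "i \<in> idxs" "ep i d = 0"
  shows "k \<le> ph i d \<Longrightarrow> Fd i k (sv i d) = sv i ((fw i ^^ k) d) \<and> ep i ((fw i ^^ k) d) = k \<and> ph i ((fw i ^^ k) d) = ph i d - k"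
proof (induction k)
  case 0 thus ?case using i by simp
next
  case (Suc k)
  hence IH: "Fd i k (sv i d) = sv i ((fw i ^^ k) d)" "ep i ((fw i ^^ k) d) = k" "ph i ((fw i ^^ k) d) = ph i d - k"
    by auto
  have p: "ph i ((fw i ^^ k) d) > 0" using IH(3) Suc.prems by simp
  have "Fd i (Suc k) (sv i d) = sv i ((fw i ^^ Suc k) d)"
    unfolding Fd_Suc IH(1) TF_sv[OF i(1)] using p IH(2) qbr_eq_0_iff[OF qpar_qi, of X i "int k + 1"] by simp
  thus ?case using fw_props[OF p] IH by (simp, arith)
qed

lemma Fd_sv_top:
  assumes i: "i \<in> idxs" "ep i d = 0"
  shows "Fd i (Suc (ph i d)) (sv i d) = 0"
  unfolding Fd_Suc using Fd_sv[OF i, of "ph i d"] TF_sv[OF i(1)] by simp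

lemma ew_pow_props: "k \<le> ep i d \<Longrightarrow> ep i ((ew i ^^ k) d) = ep i d - k \<and> ph i ((ew i ^^ k) d) = ph i d + k \<and> (fw i ^^ k) ((ew i ^^ k) d) = d"
proof (induction k)
  case (Suc k)
  hence p: "ep i ((ew i ^^ k) d) > 0" by simp
  have "(fw i ^^ Suc k) ((ew i ^^ Suc k) d) = (fw i ^^ k) (fw i (ew i ((ew i ^^ k) d)))"
    by (simp add: funpow_swap1)
  thus ?case using ew_props[OF p] Suc by (simp, arith)
qed simp

lemma ew_pow_Wd: "d \<in> Wd n \<Longrightarrow> (ew i ^^ k) d \<in> Wd n" and fw_pow_Wd: "d \<in> Wd n \<Longrightarrow> (fw i ^^ k) d \<in> Wd n"
  by (induction k) (auto intro: ew_Wd fw_Wd)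

lemma sv_eq_Fd:
  assumes "i \<in> idxs"
  shows "sv i d = Fd i (ep i d) (sv i ((ew i ^^ ep i d) d))"
  using ew_pow_props[of "ep i d" i d] Fd_sv[OF assms, of "(ew i ^^ ep i d) d" "ep i d"] by simp

definition ihw :: "nat \<Rightarrow> nat \<Rightarrow> int \<Rightarrow> tvec \<Rightarrow> bool" where
  "ihw n i m x \<longleftrightarrow> x \<in> Tn n \<and> TE i x = 0 \<and> TK i x = tscale (vi i powi m) x"

lemma dot_weight:
  assumes "TK i x = tscale (vi i powi a) x" "TK i y = tscale (vi i powi b) y" "a \<noteq> b"
  shows "dot n x y = 0"
proof -
  have "vi i powi a * dot n x y = vi i powi b * dot n x y"
    using dot_TK[of n i x y] unfolding assms(1,2) dot_tscale .
  thus ?thesis using qpar_powi_inj[OF qpar_qi, of X i a b] assms(3) by auto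
qed

lemma ihw_supp:
  assumes i: "i \<in> idxs" and x: "ihw n i m x" and d: "d \<in> Wd n" "cf n i x d \<noteq> 0"
  shows "ep i d = 0 \<and> hp i d = m"
proof
  have nz: "dot n x (sv i d) \<noteq> 0" using d unfolding cf_def by auto
  show "ep i d = 0"
  proof (rule ccontr)
    assume "ep i d \<noteq> 0"
    hence "dot n (sv i d) x = 0" using dot_F_sv[OF i, of d n x] x unfolding ihw_def by simp
    thus False using nz by (simp add: dot_commute)
  qed
  show "hp i d = m"
    using dot_weight[of i x m "sv i d" "hp i d" n] TK_sv[OF i i] x nz unfolding ihw_def by metis
qed

lemma ihw_expand:
  assumes i: "i \<in> idxs" and x: "ihw n i m x"
  shows "x = (\<Sum>d\<in>{d\<in>Wd n. ep i d = 0 \<and> hp i d = m}. tscale (cf n i x d) (sv i d))"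
proof -
  have "x = (\<Sum>d\<in>Wd n. tscale (cf n i x d) (sv i d))" using sv_complete[OF i] x unfolding ihw_def by blast
  also have "\<dots> = (\<Sum>d\<in>{d\<in>Wd n. ep i d = 0 \<and> hp i d = m}. tscale (cf n i x d) (sv i d))"
  proof (intro sum.mono_neutral_right ballI)
    fix d assume "d \<in> Wd n - {d\<in>Wd n. ep i d = 0 \<and> hp i d = m}"
    hence "cf n i x d = 0" using ihw_supp[OF i x, of d] by blast
    thus "tscale (cf n i x d) (sv i d) = 0" by simp
  qed auto
  finally show ?thesis .
qed

text \<open>All string vectors occurring in x are highest with the same \<open>ph\<close>, equal to
  m. The bound k <= m thus applies to each of them, and at k = m both sides of the lowering formula
  vanish.\<close>

lemma kashiwara_Fd:
  assumes i: "i \<in> idxs" and x: "ihw n i m x" and k: "int k \<le> m"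
  shows "ft n i (Fd i k x) = Fd i (Suc k) x"
    and "et n i (Fd i k x) = (if k = 0 then 0 else Fd i (k - 1) x)"
proof -
  let ?D = "{d\<in>Wd n. ep i d = 0 \<and> hp i d = m}"
  have ex: "x = (\<Sum>d\<in>?D. tscale (cf n i x d) (sv i d))" by (rule ihw_expand[OF i x])
  have F: "Fd i k x = (\<Sum>d\<in>?D. tscale (cf n i x d) (Fd i k (sv i d)))" for k
    by (subst ex, subst tvec_sum_linear[of "Fd i k"]) (simp_all add: Fd_linear)
  have d: "ph i d = nat m \<and> k \<le> ph i d" if "d \<in> ?D" for d
    using that hp_eq[of i d] k by auto
  have ftd: "ft n i (Fd i k (sv i d)) = Fd i (Suc k) (sv i d)" if "d \<in> ?D" for d
  proof (cases "k < ph i d")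
    case True
    thus ?thesis using that Fd_sv[OF i, of d k] Fd_sv[OF i, of d "Suc k"] ft_sv[OF i fw_pow_Wd] by auto
  next
    case False
    hence "k = ph i d" using d[OF that] by simp
    thus ?thesis using that Fd_sv[OF i, of d k] Fd_sv_top[OF i, of d] ft_sv[OF i fw_pow_Wd] by auto
  qed
  have etd: "et n i (Fd i k (sv i d)) = (if k = 0 then 0 else Fd i (k - 1) (sv i d))" if "d \<in> ?D" for d
  proof (cases k)
    case 0
    thus ?thesis using that et_sv[OF i, of d n] by simp
  next
    case (Suc j)
    have "Fd i k (sv i d) = sv i ((fw i ^^ k) d)" "ep i ((fw i ^^ k) d) = k"
       "Fd i j (sv i d) = sv i ((fw i ^^ j) d)" "ph i ((fw i ^^ j) d) = ph i d - j"
      using that d[OF that] Fd_sv[OF i, of d k] Fd_sv[OF i, of d j] Suc by auto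
    moreover have "ew i ((fw i ^^ k) d) = (fw i ^^ j) d"
      using fw_props[of i "(fw i ^^ j) d"] calculation(4) d[OF that] Suc by simp
    ultimately show ?thesis using et_sv[OF i fw_pow_Wd, of d n k] that Suc by auto
  qed
  have ftsum: "ft n i (\<Sum>d\<in>S. g d) = (\<Sum>d\<in>S. ft n i (g d))" and etsum: "et n i (\<Sum>d\<in>S. g d) = (\<Sum>d\<in>S. et n i (g d))"
     for S and g :: "nat list \<Rightarrow> tvec"
    by (rule tvec_sum_linear; simp add: ft_add et_add)+
  show "ft n i (Fd i k x) = Fd i (Suc k) x"
    unfolding F ftsum ft_tscale by (rule sum.cong[OF HOL.refl]) (subst ftd, assumption, rule HOL.refl)
  show "et n i (Fd i k x) = (if k = 0 then 0 else Fd i (k - 1) x)"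
  proof (cases "k = 0")
    case True
    show ?thesis unfolding F etsum et_tscale using True etd by (auto intro!: sum.neutral)
  next
    case False
    have "et n i (Fd i k x) = (\<Sum>d\<in>?D. tscale (cf n i x d) (Fd i (k - 1) (sv i d)))"
      unfolding F etsum et_tscale using False etd by (intro sum.cong HOL.refl) simp
    thus ?thesis unfolding F[of "k - 1"] using False by simp
  qed
qed


text \<open>Every string vector is a divided power of F_i on an i-highest vector, and an equivariant
  map takes i-highest vectors to i-highest vectors of the same weight. So the Kashiwara operators
  are functorial.\<close>

lemma kashiwara_equivariant:
  assumes i: "i \<in> idxs"
    and add: "\<And>f g. Q (f + g) = Q f + Q g" and scale: "\<And>c f. Q (tscale c f) = tscale c (Q f)"
    and Tn: "\<And>f. f \<in> Tn n \<Longrightarrow> Q f \<in> Tn n'"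
    and comm: "\<And>f. f \<in> Tn n \<Longrightarrow> Q (TE i f) = TE i (Q f)" "\<And>f. f \<in> Tn n \<Longrightarrow> Q (TF i f) = TF i (Q f)"
      "\<And>f. f \<in> Tn n \<Longrightarrow> Q (TK i f) = TK i (Q f)"
    and f: "f \<in> Tn n"
  shows "Q (ft n i f) = ft n' i (Q f)" "Q (et n i f) = et n' i (Q f)"
proof -
  have Q0: "Q 0 = 0" using scale[of 0 0] by simp
  have QFd: "Q (Fd i k f) = Fd i k (Q f)" if "f \<in> Tn n" for k f
  proof (induction k)
    case (Suc k)
    thus ?case unfolding Fd_Suc scale using comm(2)[OF Fd_Tn[OF that]] by simp
  qed simp
  have s: "Q (ft n i (sv i d)) = ft n' i (Q (sv i d)) \<and> Q (et n i (sv i d)) = et n' i (Q (sv i d))"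
    if d: "d \<in> Wd n" for d
  proof -
    let ?c = "(ew i ^^ ep i d) d" and ?k = "ep i d"
    have c: "?c \<in> Wd n" "ep i ?c = 0" "ph i ?c = ph i d + ?k"
      using ew_pow_Wd[OF d] ew_pow_props[of ?k i d] by auto
    have h: "ihw n i (hp i ?c) (sv i ?c)"
      unfolding ihw_def using c sv_Tn TE_sv[OF i] TK_sv[OF i i] by simp
    hence h': "ihw n' i (hp i ?c) (Q (sv i ?c))"
      unfolding ihw_def using comm[of "sv i ?c"] Tn by (metis Q0 scale)
    have k: "int ?k \<le> hp i ?c" using hp_eq[of i ?c] c by simp
    have e: "sv i d = Fd i ?k (sv i ?c)" by (rule sv_eq_Fd[OF i])
    show ?thesis
      unfolding e QFd[OF sv_Tn[OF c(1)]] kashiwara_Fd[OF i h k] kashiwara_Fd[OF i h' k]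
      by (simp add: QFd[OF sv_Tn[OF c(1)]] Q0)
  qed
  have lin: "\<And>S g. Q (\<Sum>d\<in>S. g d :: tvec) = (\<Sum>d\<in>S. Q (g d))"
    "\<And>S g n. ft n i (\<Sum>d\<in>S. g d :: tvec) = (\<Sum>d\<in>S. ft n i (g d))"
    "\<And>S g n. et n i (\<Sum>d\<in>S. g d :: tvec) = (\<Sum>d\<in>S. et n i (g d))"
    by (rule tvec_sum_linear; simp add: ft_add et_add add Q0)+
  have e: "f = (\<Sum>d\<in>Wd n. tscale (cf n i f d) (sv i d))" by (rule sv_complete[OF i f])
  show "Q (ft n i f) = ft n' i (Q f)"
    by (subst (1 2) e) (unfold lin ft_tscale scale, intro sum.cong HOL.refl, subst s, assumption, rule HOL.refl)
  show "Q (et n i f) = et n' i (Q f)"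
    by (subst (1 2) e) (unfold lin et_tscale scale, intro sum.cong HOL.refl, subst s, assumption, rule HOL.refl)
qed

definition pk :: "nat \<Rightarrow> nat \<Rightarrow> nat \<Rightarrow> tvec \<Rightarrow> tvec" where
  "pk n i K f = (\<Sum>d\<in>Wd n. if ep i d = K then tscale (cf n i f d) (sv i d) else 0)"

lemma pow_linear:
  assumes "\<And>f g. Q (f + g) = Q f + Q g" "\<And>c f. Q (tscale c f) = tscale c (Q f)"
  shows "(Q ^^ K) (f + g) = (Q ^^ K) f + (Q ^^ K) g" "(Q ^^ K) (tscale c f) = tscale c ((Q ^^ K) f)"
  by (induction K) (auto simp: assms)

text \<open>Raising K times and lowering K times projects onto the string vectors with
  \<open>ep\<close> at least K; consecutive differences isolate \<open>ep\<close> equal to K.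
  Written in this form, the component visibly preserves every crystal lattice.\<close>

lemma pk_eq:
  assumes i: "i \<in> idxs" and f: "f \<in> Tn n"
  shows "pk n i K f = (ft n i ^^ K) ((et n i ^^ K) f) + tscale (-1) ((ft n i ^^ Suc K) ((et n i ^^ Suc K) f))"
proof -
  have ew: "(et n i ^^ K) (sv i d) = (if K \<le> ep i d then sv i ((ew i ^^ K) d) else 0)" if "d \<in> Wd n" for d K
  proof (induction K)
    case (Suc K)
    show ?case
    proof (cases "Suc K \<le> ep i d")
      case True
      thus ?thesis using Suc et_sv[OF i ew_pow_Wd[OF that]] ew_pow_props[of K i d] by simp
    next
      case False
      show ?thesis
      proof (cases "K \<le> ep i d")
        case True
        thus ?thesis using Suc et_sv[OF i ew_pow_Wd[OF that]] ew_pow_props[of K i d] False by simp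
      next
        case f: False thus ?thesis using Suc False by simp
      qed
    qed
  qed simp
  have fw: "K \<le> ph i c \<Longrightarrow> (ft n i ^^ K) (sv i c) = sv i ((fw i ^^ K) c) \<and> ph i ((fw i ^^ K) c) = ph i c - K" if "c \<in> Wd n" for c K
  proof (induction K)
    case (Suc K)
    hence IH: "(ft n i ^^ K) (sv i c) = sv i ((fw i ^^ K) c)" "ph i ((fw i ^^ K) c) = ph i c - K" by auto
    moreover have "ph i ((fw i ^^ K) c) > 0" using IH Suc.prems by simp
    ultimately show ?case using ft_sv[OF i fw_pow_Wd[OF that], of K] fw_props[of i "(fw i ^^ K) c"] by (simp, arith)
  qed simp
  have lin: "\<And>f g. (ft n i ^^ K) ((et n i ^^ K) (f + g)) = (ft n i ^^ K) ((et n i ^^ K) f) + (ft n i ^^ K) ((et n i ^^ K) g)"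
     "\<And>c f. (ft n i ^^ K) ((et n i ^^ K) (tscale c f)) = tscale c ((ft n i ^^ K) ((et n i ^^ K) f))" for K
    using pow_linear[of "ft n i", OF ft_add ft_tscale] pow_linear[of "et n i", OF et_add et_tscale] by simp_all
  have z: "(ft n i ^^ K) 0 = 0" for K using lin(2)[of 0 0] by (induction K) auto
  have st: "(ft n i ^^ K) ((et n i ^^ K) (sv i d)) = (if K \<le> ep i d then sv i d else 0)" if "d \<in> Wd n" for d K
    using ew[OF that] fw[OF ew_pow_Wd[OF that, where i = i and k = K], of K] ew_pow_props[of K i d] z by auto
  have S: "(ft n i ^^ K) ((et n i ^^ K) f) = (\<Sum>d\<in>Wd n. if K \<le> ep i d then tscale (cf n i f d) (sv i d) else 0)" for K
  proof -
    have "(ft n i ^^ K) ((et n i ^^ K) f) = (\<Sum>d\<in>Wd n. (ft n i ^^ K) ((et n i ^^ K) (tscale (cf n i f d) (sv i d))))"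
      by (subst sv_complete[OF i f], rule tvec_sum_linear[of "\<lambda>f. (ft n i ^^ K) ((et n i ^^ K) f)"])
         (use lin(1) lin(2)[of K 0 0] in simp_all)
    thus ?thesis unfolding lin(2) using st by (auto intro!: sum.cong)
  qed
  show ?thesis unfolding S pk_def tscale_sum sum.distrib[symmetric]
    by (intro sum.cong HOL.refl) (auto simp: tvec_apply fun_eq_iff)
qed

text \<open>The ratio of the norms of \<open>sv i d\<close> and \<open>sv i (ew i d)\<close> when
  \<open>ep i d = K\<close> and \<open>hp i d = h\<close>, so that K + h is \<open>ph i d\<close>.
  The default 0 for negative K + h, where no word exists, makes \<open>rho_regular\<close> hold for
  every h.\<close>

definition rho :: "nat \<Rightarrow> nat \<Rightarrow> int \<Rightarrow> ratq" where
  "rho i K h = (if int K + h \<ge> 0 then vi i powi (h + 1) * qbr (vi i) (int K + h + 1) / qbr (vi i) (int K) else 0)"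

lemma rho_regular: "K > 0 \<Longrightarrow> rho i K h \<in> regular_at_0"
proof (cases "int K + h \<ge> 0")
  case True
  assume K: "K > 0"
  obtain m where m: "int K + h + 1 = int m" "m > 0" using True by (metis zero_less_imp_eq_int add_pos_nonneg add.commute zero_less_one of_nat_0_less_iff)
  obtain u where u: "u \<in> regular_at_0" "qbr (vi i) (int m) / qbr (vi i) (int K) = vi i powi (int K - int m) * u"
    using qbr_ratio[OF qpar_qi m(2) K] by blast
  have "rho i K h = vi i powi (h + 1) * (vi i powi (int K - int m) * u)"
    unfolding rho_def m(1) u(2)[symmetric] using True by simp
  also have "\<dots> = vi i powi (h + 1 + (int K - int m)) * u" by (simp only: mult.assoc power_int_add vi_nonzero simp_thms)
  also have "\<dots> = u" using m(1) by (simp add: algebra_simps)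
  finally show ?thesis using u by simp
qed (simp add: rho_def)

lemma nm_rho:
  assumes i: "i \<in> idxs" and e: "ep i d > 0"
  shows "nm n i d = rho i (ep i d) (hp i d) * nm n i (ew i d)"
proof -
  have q: "qbr (vi i) (int (ep i d)) \<noteq> 0" using qbr_eq_0_iff[OF qpar_qi] e by simp
  have h: "hp i (ew i d) = hp i d + 2" using hp_ew[OF e i] by (simp add: cartan_int_def)
  have p: "int (ph i d) = int (ep i d) + hp i d" using hp_eq[of i d] by simp
  have "nm n i d = inverse (qbr (vi i) (int (ep i d))) * (inverse (vi i) * (qbr (vi i) (int (ph i d) + 1) * (vi i powi hp i (ew i d) * nm n i (ew i d))))"
    unfolding nm_def dot_F_sv[OF i e] TE_sv[OF i] using e by (simp add: T_linear dot_tscale TK_sv[OF i i])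
  also have "\<dots> = (inverse (vi i) * vi i powi (hp i d + 2)) * qbr (vi i) (int (ep i d) + hp i d + 1) / qbr (vi i) (int (ep i d)) * nm n i (ew i d)"
    unfolding h p by (simp add: field_simps)
  also have "inverse (vi i) * vi i powi (hp i d + 2) = vi i powi (hp i d + 1)"
    by (simp add: power_int_add power2_eq_square)
  finally show ?thesis unfolding rho_def using p by simp
qed

lemma ep_le_length: "ep i d \<le> length d"
  by (induction d) auto

text \<open>Across the form f_i becomes e_i, up to a factor that depends on the depth and on the
  weight of a string vector. The weight is fixed by the eigenvector condition on z, the depth by
  splitting z with \<open>pk\<close>; it is at most the length n of a word.\<close>

lemma ft_adjoint:
  assumes i: "i \<in> idxs" and z: "z \<in> Tn n" "TK i z = tscale (vi i powi h) z"
  shows "dot n z (ft n i y) = (\<Sum>K=1..n. rho i K h * dot n (et n i (pk n i K z)) y)"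
proof -
  have cf0: "cf n i z d = 0" if "hp i d \<noteq> h" for d
    using dot_weight[OF z(2) TK_sv[OF i i]] that unfolding cf_def by simp
  have sd: "dot n (sv i d) (ft n i y) = (if ep i d > 0 then rho i (ep i d) (hp i d) * dot n (sv i (ew i d)) y else 0)"
    if d: "d \<in> Wd n" for d
  proof -
    have "dot n (sv i d) (ft n i y) = (\<Sum>e\<in>Wd n. if ph i e > 0 then cf n i y e * dot n (sv i d) (sv i (fw i e)) else 0)"
      unfolding ft_def dot_sum by (intro sum.cong) (auto simp: dot_tscale)
    also have "\<dots> = (\<Sum>e\<in>Wd n. if e = ew i d then (if ep i d > 0 then cf n i y (ew i d) * nm n i d else 0) else 0)"
    proof (intro sum.cong HOL.refl)
      fix e assume e: "e \<in> Wd n"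
      show "(if ph i e > 0 then cf n i y e * dot n (sv i d) (sv i (fw i e)) else 0) =
        (if e = ew i d then (if ep i d > 0 then cf n i y (ew i d) * nm n i d else 0) else 0)"
      proof (cases "ph i e > 0 \<and> fw i e = d")
        case True
        hence "ew i d = e" "ep i d > 0" using fw_props[of i e] by auto
        thus ?thesis using True by (simp add: nm_def)
      next
        case False
        hence "ph i e > 0 \<Longrightarrow> dot n (sv i d) (sv i (fw i e)) = 0" using sv_orth[OF i d fw_Wd[OF e]] by metis
        moreover have "\<not> (e = ew i d \<and> ep i d > 0)"
        proof
          assume "e = ew i d \<and> ep i d > 0"
          hence "ph i e > 0 \<and> fw i e = d" using ew_props[of i d] by auto
          thus False using False by blast
        qed
        hence "(if e = ew i d then (if ep i d > 0 then cf n i y (ew i d) * nm n i d else 0) else 0) = 0"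
          by (cases "ep i d > 0") auto
        ultimately show ?thesis by (cases "ph i e > 0") auto
      qed
    qed
    also have "\<dots> = (if ep i d > 0 then cf n i y (ew i d) * nm n i d else 0)"
      using ew_Wd[OF d] by (simp add: sum.delta)
    also have "\<dots> = (if ep i d > 0 then rho i (ep i d) (hp i d) * dot n (sv i (ew i d)) y else 0)"
      using nm_rho[OF i, of d n] nm_nonzero[OF ew_Wd[OF d]] by (auto simp: cf_def dot_commute)
    finally show ?thesis .
  qed
  have ept: "et n i (pk n i K z) = (\<Sum>d\<in>Wd n. if ep i d = K \<and> ep i d > 0 then tscale (cf n i z d) (sv i (ew i d)) else 0)" for K
  proof -
    have "et n i (pk n i K z) = (\<Sum>d\<in>Wd n. et n i (if ep i d = K then tscale (cf n i z d) (sv i d) else 0))"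
      unfolding pk_def by (rule tvec_sum_linear) (simp_all add: et_add)
    thus ?thesis using et_sv[OF i] by (auto intro!: sum.cong simp: et_tscale)
  qed
  have "dot n z (ft n i y) = (\<Sum>d\<in>Wd n. cf n i z d * dot n (sv i d) (ft n i y))"
    by (subst sv_complete[OF i z(1)]) (simp add: dot_sum dot_tscale)
  also have "\<dots> = (\<Sum>d\<in>Wd n. if ep i d > 0 then rho i (ep i d) h * (cf n i z d * dot n (sv i (ew i d)) y) else 0)"
  proof (intro sum.cong HOL.refl)
    fix d assume "d \<in> Wd n"
    thus "cf n i z d * dot n (sv i d) (ft n i y) =
        (if ep i d > 0 then rho i (ep i d) h * (cf n i z d * dot n (sv i (ew i d)) y) else 0)"
      using sd[of d] cf0[of d] by (cases "hp i d = h") simp_all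
  qed
  also have "\<dots> = (\<Sum>d\<in>Wd n. \<Sum>K=1..n. if ep i d = K then rho i K h * (cf n i z d * dot n (sv i (ew i d)) y) else 0)"
  proof (intro sum.cong HOL.refl)
    fix d assume d: "d \<in> Wd n"
    hence l: "ep i d \<le> n" using ep_le_length[of i d] by (simp add: Wd_def)
    show "(if ep i d > 0 then rho i (ep i d) h * (cf n i z d * dot n (sv i (ew i d)) y) else 0) =
       (\<Sum>K=1..n. if ep i d = K then rho i K h * (cf n i z d * dot n (sv i (ew i d)) y) else 0)"
      using l by (subst sum.delta') auto
  qed
  also have "\<dots> = (\<Sum>K=1..n. \<Sum>d\<in>Wd n. if ep i d = K then rho i K h * (cf n i z d * dot n (sv i (ew i d)) y) else 0)"
    by (rule sum.swap)
  also have "\<dots> = (\<Sum>K=1..n. rho i K h * dot n (et n i (pk n i K z)) y)"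
    unfolding ept dot_sum sum_distrib_left
    by (intro sum.cong HOL.refl) (auto simp: dot_tscale)
  finally show ?thesis .
qed

end

section \<open>Abstract highest weight modules and formal lowering monomials\<close>

locale nondeg_chain = letter_chain +
  assumes nondeg: "J \<noteq> [] \<Longrightarrow> set J \<subseteq> idxs \<Longrightarrow> \<exists>i\<in>idxs. (\<Sum>j\<leftarrow>J. ca i j) \<noteq> 0"
begin

text \<open>A formal combination of monomials in the F_i applied to a highest weight vector.
  Computing with lists shows that the coefficients depend on the highest weight only, and so are
  common to all modules with that weight.\<close>

type_synonym comb = "(ratq \<times> nat list) list"

definition okc :: "comb \<Rightarrow> bool" where
  "okc cs \<longleftrightarrow> (\<forall>(c, J) \<in> set cs. set J \<subseteq> idxs)"

definition fcomb :: "nat \<Rightarrow> comb \<Rightarrow> comb" where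
  "fcomb i cs = map (\<lambda>(c, J). (c, i # J)) cs"

definition scomb :: "ratq \<Rightarrow> comb \<Rightarrow> comb" where
  "scomb d cs = map (\<lambda>(c, J). (d * c, J)) cs"

text \<open>E_j is commuted to the right through the monomial until it kills the highest weight
  vector; each F_j passed leaves the quantum integer of the weight of the remaining
  monomial.\<close>

fun ecomb1 :: "(nat \<Rightarrow> int) \<Rightarrow> nat \<Rightarrow> nat list \<Rightarrow> comb" where
  "ecomb1 h j [] = []"
| "ecomb1 h j (i # J) = fcomb i (ecomb1 h j J) @
     (if i = j then [(qbr (vi j) (h j - (\<Sum>l\<leftarrow>J. ca j l)), J)] else [])"

definition ecomb :: "(nat \<Rightarrow> int) \<Rightarrow> nat \<Rightarrow> comb \<Rightarrow> comb" where
  "ecomb h j cs = concat (map (\<lambda>(c, J). scomb c (ecomb1 h j J)) cs)"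

definition topc :: "comb \<Rightarrow> ratq" where
  "topc cs = (\<Sum>(c, J)\<leftarrow>cs. if J = [] then c else 0)"

lemma okc_simps [simp]: "okc []" "okc ((c, J) # cs) \<longleftrightarrow> set J \<subseteq> idxs \<and> okc cs" "okc (cs @ ds) \<longleftrightarrow> okc cs \<and> okc ds"
  by (auto simp: okc_def)

lemma okc_fcomb [simp]: "i \<in> idxs \<Longrightarrow> okc cs \<Longrightarrow> okc (fcomb i cs)"
  and okc_scomb [simp]: "okc (scomb d cs) \<longleftrightarrow> okc cs"
  by (induction cs) (auto simp: fcomb_def scomb_def)

lemma okc_ecomb1: "set J \<subseteq> idxs \<Longrightarrow> okc (ecomb1 h j J)"
  by (induction J) auto

lemma okc_ecomb: "okc cs \<Longrightarrow> okc (ecomb h j cs)"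
  by (induction cs) (auto simp: ecomb_def okc_ecomb1)

lemma okc_ecombs: "okc cs \<Longrightarrow> okc (foldr (ecomb h) js cs)"
  by (induction js) (auto intro: okc_ecomb)

end

locale hw_module = nondeg_chain X r + vs: vector_space scl
  for X r and scl :: "ratq \<Rightarrow> 'v::ab_group_add \<Rightarrow> 'v" +
  fixes E F K Ki :: "nat \<Rightarrow> 'v \<Rightarrow> 'v" and h :: "nat \<Rightarrow> int" and u :: 'v
  assumes E_lin: "i \<in> {1..r} \<Longrightarrow> E i (x + y) = E i x + E i y" "i \<in> {1..r} \<Longrightarrow> E i (scl c x) = scl c (E i x)"
    and F_lin: "i \<in> {1..r} \<Longrightarrow> F i (x + y) = F i x + F i y" "i \<in> {1..r} \<Longrightarrow> F i (scl c x) = scl c (F i x)"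
    and K_lin: "i \<in> {1..r} \<Longrightarrow> K i (x + y) = K i x + K i y" "i \<in> {1..r} \<Longrightarrow> K i (scl c x) = scl c (K i x)"
    and KKi: "i \<in> {1..r} \<Longrightarrow> Ki i (K i x) = x"
    and KF: "i \<in> {1..r} \<Longrightarrow> j \<in> {1..r} \<Longrightarrow>
        K i (F j x) = scl (qi X i powi (- cartan_int X i j)) (F j (K i x))"
    and EF: "i \<in> {1..r} \<Longrightarrow> j \<in> {1..r} \<Longrightarrow> E i (F j x) = F j (E i x) +
        (if i = j then scl (inverse (qi X i - inverse (qi X i))) (K i x - Ki i x) else 0)"
    and u_nz: "u \<noteq> 0"
    and u_E: "i \<in> {1..r} \<Longrightarrow> E i u = 0"
    and u_K: "i \<in> {1..r} \<Longrightarrow> K i u = scl (qi X i powi h i) u"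
begin

fun FI :: "nat list \<Rightarrow> 'v" where
  "FI [] = u"
| "FI (i # J) = F i (FI J)"

definition ev :: "comb \<Rightarrow> 'v" where
  "ev cs = (\<Sum>(c, J)\<leftarrow>cs. scl c (FI J))"

lemma ev_simps [simp]: "ev [] = 0" "ev ((c, J) # cs) = scl c (FI J) + ev cs" "ev (cs @ ds) = ev cs + ev ds"
  by (simp_all add: ev_def)

lemma ev_scomb: "ev (scomb d cs) = scl d (ev cs)"
  by (induction cs) (auto simp: scomb_def vs.scale_right_distrib)

lemma ev_fcomb: "i \<in> idxs \<Longrightarrow> ev (fcomb i cs) = F i (ev cs)"
proof (induction cs)
  case Nil
  have "F i 0 = 0" using F_lin(2)[OF Nil, of 0 0] by simp
  thus ?case by (simp add: fcomb_def)
next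
  case (Cons a cs)
  thus ?case by (cases a) (auto simp: fcomb_def F_lin)
qed

lemma K_FI: "i \<in> idxs \<Longrightarrow> set J \<subseteq> idxs \<Longrightarrow> K i (FI J) = scl (vi i powi (h i - (\<Sum>j\<leftarrow>J. ca i j))) (FI J)"
proof (induction J)
  case Nil thus ?case by (simp add: u_K)
next
  case (Cons j J)
  hence "K i (FI (j # J)) = scl (vi i powi (- ca i j) * vi i powi (h i - (\<Sum>j\<leftarrow>J. ca i j))) (FI (j # J))"
    by (simp add: KF F_lin)
  also have "vi i powi (- ca i j) * vi i powi (h i - (\<Sum>j\<leftarrow>J. ca i j)) = vi i powi (h i - (\<Sum>j\<leftarrow>j # J. ca i j))"
    by (subst power_int_add[symmetric]) (auto simp: algebra_simps)
  finally show ?case .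
qed

lemma Ki_weight:
  assumes "i \<in> idxs" "K i x = scl (vi i powi m) x"
  shows "Ki i x = scl (vi i powi (- m)) x"
proof -
  have "x = K i (scl (vi i powi (- m)) x)" using assms K_lin(2)[OF assms(1)] by (simp add: power_int_minus)
  hence "Ki i x = Ki i (K i (scl (vi i powi (- m)) x))" by simp
  thus ?thesis using KKi[OF assms(1)] by simp
qed

lemma E_FI: "j \<in> idxs \<Longrightarrow> set J \<subseteq> idxs \<Longrightarrow> E j (FI J) = ev (ecomb1 h j J)"
proof (induction J)
  case Nil thus ?case by (simp add: u_E)
next
  case (Cons i J)
  hence i: "i \<in> idxs" "set J \<subseteq> idxs" by auto
  let ?m = "h j - (\<Sum>l\<leftarrow>J. ca j l)"
  have "scl (inverse (vi j - inverse (vi j))) (K j (FI J) - Ki j (FI J)) = scl (qbr (vi j) ?m) (FI J)"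
    using K_FI[OF Cons.prems(1) i(2)] Ki_weight[OF Cons.prems(1) K_FI[OF Cons.prems(1) i(2)]]
    by (simp add: qbr_def divide_inverse mult.commute flip: vs.scale_left_diff_distrib)
  thus ?case using EF[OF Cons.prems(1) i(1), of "FI J"] Cons.IH[OF Cons.prems(1) i(2)] ev_fcomb[OF i(1)] by auto
qed

lemma E_zero: "i \<in> idxs \<Longrightarrow> E i 0 = 0" and F_zero: "i \<in> idxs \<Longrightarrow> F i 0 = 0" and K_zero: "i \<in> idxs \<Longrightarrow> K i 0 = 0"
  using E_lin(2)[of i 0 0] F_lin(2)[of i 0 0] K_lin(2)[of i 0 0] by auto

lemma E_ev: "j \<in> idxs \<Longrightarrow> okc cs \<Longrightarrow> E j (ev cs) = ev (ecomb h j cs)"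
proof (induction cs)
  case Nil thus ?case by (simp add: E_zero ecomb_def)
next
  case (Cons a cs)
  obtain c J where a: "a = (c, J)" by (cases a)
  show ?case using Cons unfolding a by (simp add: E_lin E_FI ev_scomb ecomb_def)
qed

text \<open>The operators $K_i - v_i^{m_i}$ kill one summand at a time.\<close>

lemma weight_indep:
  assumes "\<forall>i\<in>idxs. K i y0 = scl (vi i powi m0 i) y0"
    and "\<forall>(y, m)\<in>set ys. (\<forall>i\<in>idxs. K i y = scl (vi i powi m i) y) \<and> (\<exists>i\<in>idxs. m i \<noteq> m0 i)"
    and "y0 + (\<Sum>(y, m)\<leftarrow>ys. y) = 0"
  shows "y0 = 0"
  using assms
proof (induction "length ys" arbitrary: y0 ys)
  case 0 thus ?case by simp
next
  case (Suc n)
  then obtain y m ys' where ys: "ys = (y, m) # ys'" "length ys' = n" by (cases ys) auto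
  obtain i where i: "i \<in> idxs" "m i \<noteq> m0 i" using Suc.prems(2) ys by auto
  define T where "T x = K i x - scl (vi i powi m i) x" for x
  have Tadd: "T (a + b) = T a + T b" for a b unfolding T_def by (simp add: K_lin[OF i(1)] vs.scale_right_distrib)
  have Tsum: "T (\<Sum>(y, m)\<leftarrow>zs. y) = (\<Sum>(y, m)\<leftarrow>map (\<lambda>(y, m). (T y, m)) zs. y)" for zs :: "('v \<times> (nat \<Rightarrow> int)) list"
  proof (induction zs)
    case Nil show ?case unfolding T_def by (simp add: K_zero[OF i(1)])
  next
    case (Cons a zs) thus ?case by (cases a) (simp add: Tadd)
  qed
  have Tw: "T z = scl (vi i powi m' i - vi i powi m i) z" if "\<forall>i\<in>idxs. K i z = scl (vi i powi m' i) z" for z m'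
    unfolding T_def using that i by (simp add: vs.scale_left_diff_distrib)
  have Ty: "T y = 0" using Tw[of y m] Suc.prems(2) ys by simp
  have wK: "\<forall>j\<in>idxs. K j (T z) = scl (vi j powi m' j) (T z)" if "\<forall>i\<in>idxs. K i z = scl (vi i powi m' i) z" for z m'
    unfolding Tw[OF that] using that by (simp add: K_lin mult.commute)
  have "T y0 + (\<Sum>(y, m)\<leftarrow>map (\<lambda>(y, m). (T y, m)) ys'. y) = T (y0 + (\<Sum>(y, m)\<leftarrow>ys. y))"
    unfolding Tadd Tsum ys by (simp add: Ty)
  also have "\<dots> = 0" unfolding Suc.prems(3) T_def by (simp add: K_zero[OF i(1)])
  finally have s: "T y0 + (\<Sum>(y, m)\<leftarrow>map (\<lambda>(y, m). (T y, m)) ys'. y) = 0" .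
  have "T y0 = 0"
  proof (rule Suc.hyps(1)[OF _ _ _ s])
    show "n = length (map (\<lambda>(y, m). (T y, m)) ys')" using ys by simp
    show "\<forall>i\<in>idxs. K i (T y0) = scl (vi i powi m0 i) (T y0)" by (rule wK[OF Suc.prems(1)])
    have "(\<forall>j\<in>idxs. K j (T z) = scl (vi j powi m' j) (T z)) \<and> (\<exists>i\<in>idxs. m' i \<noteq> m0 i)" if "(z, m') \<in> set ys'" for z m'
      using Suc.prems(2) that wK[of z m'] unfolding ys by auto
    thus "\<forall>(y, m)\<in>set (map (\<lambda>(y, m). (T y, m)) ys').
        (\<forall>i\<in>idxs. K i y = scl (vi i powi m i) y) \<and> (\<exists>i\<in>idxs. m i \<noteq> m0 i)"
      unfolding set_map by (intro ballI) (elim imageE, clarsimp)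
  qed
  moreover have "vi i powi m0 i - vi i powi m i \<noteq> 0" using qpar_powi_inj[OF qpar_qi, of X i "m0 i" "m i"] i by auto
  ultimately show ?case unfolding Tw[OF Suc.prems(1)] by simp
qed

lemma ev_split: "ev cs = scl (topc cs) u + (\<Sum>(y, m)\<leftarrow>map (\<lambda>(c, J). (scl c (FI J), \<lambda>i. h i - (\<Sum>j\<leftarrow>J. ca i j)))
    (filter (\<lambda>(c, J). J \<noteq> []) cs). y)"
proof (induction cs)
  case Nil thus ?case by (simp add: topc_def)
next
  case (Cons a cs)
  obtain c J where a: "a = (c, J)" by (cases a)
  show ?case using Cons unfolding a by (cases J) (auto simp: topc_def vs.scale_left_distrib algebra_simps)
qed

text \<open>By \<open>nondeg\<close> a nonempty monomial never has the weight of u. The difference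
  of the two sides has the weight of u and cancels against terms of other weights, so
  \<open>weight_indep\<close> makes it zero.\<close>

lemma weight_part:
  assumes ok: "okc cs" and w: "\<forall>i\<in>idxs. K i (ev cs) = scl (vi i powi h i) (ev cs)"
  shows "ev cs = scl (topc cs) u"
proof -
  let ?ys = "map (\<lambda>(c, J). (scl c (FI J), \<lambda>i. h i - (\<Sum>j\<leftarrow>J. ca i j))) (filter (\<lambda>(c, J). J \<noteq> []) cs)"
  let ?y0 = "scl (topc cs) u - ev cs"
  have "?y0 = 0"
  proof (rule weight_indep)
    show "\<forall>i\<in>idxs. K i ?y0 = scl (vi i powi h i) ?y0"
    proof
      fix i assume i: "i \<in> idxs"
      have e: "?y0 = scl (topc cs) u + scl (-1) (ev cs)" by simp
      show "K i ?y0 = scl (vi i powi h i) ?y0"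
        unfolding e K_lin[OF i] u_K[OF i] using w i by (simp add: vs.scale_right_distrib vs.scale_right_diff_distrib mult.commute)
    qed
    show "?y0 + (\<Sum>(y, m)\<leftarrow>?ys. y) = 0" by (subst ev_split) simp
    show "\<forall>(y, m)\<in>set ?ys. (\<forall>i\<in>idxs. K i y = scl (vi i powi m i) y) \<and> (\<exists>i\<in>idxs. m i \<noteq> h i)"
    proof -
      have "(\<forall>i\<in>idxs. K i (scl c (FI J)) = scl (vi i powi (h i - (\<Sum>j\<leftarrow>J. ca i j))) (scl c (FI J))) \<and>
         (\<exists>i\<in>idxs. h i - (\<Sum>j\<leftarrow>J. ca i j) \<noteq> h i)" if "(c, J) \<in> set cs" "J \<noteq> []" for c J
      proof -
        have J: "set J \<subseteq> idxs" using ok that unfolding okc_def by auto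
        show ?thesis using nondeg[OF that(2) J] K_FI[OF _ J] by (auto simp: K_lin mult.commute)
      qed
      thus ?thesis by auto
    qed
  qed
  thus ?thesis by simp
qed

lemma zero_top: "okc cs \<Longrightarrow> ev cs = 0 \<Longrightarrow> topc cs = 0"
  using weight_part[of cs] K_zero u_nz by auto

lemma ev_ecombs: "set js \<subseteq> idxs \<Longrightarrow> okc cs \<Longrightarrow> ev (foldr (ecomb h) js cs) = foldr E js (ev cs)"
proof (induction js)
  case (Cons j js)
  thus ?case using E_ev[of j "foldr (ecomb h) js cs"] okc_ecombs by simp
qed simp

text \<open>A relation remains a relation after any sequence of raisings, and u is nonzero. The
  numbers found to vanish involve only h and the formal combination, which is what
  \<open>transfer\<close> exploits.\<close>

lemma zero_tops:
  assumes "okc cs" "ev cs = 0" "set js \<subseteq> idxs"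
  shows "topc (foldr (ecomb h) js cs) = 0"
proof -
  have "foldr E js 0 = 0" using assms(3) by (induction js) (auto simp: E_zero)
  thus ?thesis using zero_top[OF okc_ecombs[OF assms(1)]] ev_ecombs[OF assms(3,1)] assms(2) by simp
qed

definition U :: "'v set" where
  "U = {ev cs | cs. okc cs}"

lemma U_closed: "0 \<in> U" "u \<in> U" "x \<in> U \<Longrightarrow> y \<in> U \<Longrightarrow> x + y \<in> U" "x \<in> U \<Longrightarrow> scl c x \<in> U"
  "i \<in> idxs \<Longrightarrow> x \<in> U \<Longrightarrow> E i x \<in> U" "i \<in> idxs \<Longrightarrow> x \<in> U \<Longrightarrow> F i x \<in> U"
proof -
  have "ev [] = 0" "okc []" by simp_all
  thus "0 \<in> U" unfolding U_def by (metis (mono_tags, lifting) mem_Collect_eq)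
  have "ev [(1, [])] = u" "okc [(1, [])]" by simp_all
  thus "u \<in> U" unfolding U_def by (metis (mono_tags, lifting) mem_Collect_eq)
  show "x \<in> U \<Longrightarrow> y \<in> U \<Longrightarrow> x + y \<in> U"
  proof -
    assume "x \<in> U" "y \<in> U"
    then obtain cs ds where "okc cs" "x = ev cs" "okc ds" "y = ev ds" unfolding U_def by auto
    hence "okc (cs @ ds)" "x + y = ev (cs @ ds)" by auto
    thus ?thesis unfolding U_def by blast
  qed
  show "x \<in> U \<Longrightarrow> scl c x \<in> U"
  proof -
    assume "x \<in> U"
    then obtain cs where "okc cs" "x = ev cs" unfolding U_def by auto
    hence "okc (scomb c cs)" "scl c x = ev (scomb c cs)" by (auto simp: ev_scomb)
    thus ?thesis unfolding U_def by blast
  qed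
  show "i \<in> idxs \<Longrightarrow> x \<in> U \<Longrightarrow> E i x \<in> U"
  proof -
    assume i: "i \<in> idxs" and "x \<in> U"
    then obtain cs where "okc cs" "x = ev cs" unfolding U_def by auto
    hence "okc (ecomb h i cs)" "E i x = ev (ecomb h i cs)" using E_ev[OF i] okc_ecomb by auto
    thus ?thesis unfolding U_def by blast
  qed
  show "i \<in> idxs \<Longrightarrow> x \<in> U \<Longrightarrow> F i x \<in> U"
  proof -
    assume i: "i \<in> idxs" and "x \<in> U"
    then obtain cs where "okc cs" "x = ev cs" unfolding U_def by auto
    hence "okc (fcomb i cs)" "F i x = ev (fcomb i cs)" using ev_fcomb[OF i] okc_fcomb[OF i] by auto
    thus ?thesis unfolding U_def by blast
  qed
qed

lemma U_K: "i \<in> idxs \<Longrightarrow> x \<in> U \<Longrightarrow> K i x \<in> U \<and> Ki i x \<in> U"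
proof -
  assume i: "i \<in> idxs" and "x \<in> U"
  then obtain cs where cs: "okc cs" "x = ev cs" unfolding U_def by auto
  define kc where "kc s = map (\<lambda>(c, J). (c * vi i powi (s * (h i - (\<Sum>j\<leftarrow>J. ca i j))), J)) cs" for s :: int
  have ok: "okc (kc s)" for s using cs(1) unfolding kc_def okc_def by auto
  have 1: "K i (ev cs) = ev (kc 1)" unfolding kc_def using cs(1)
    by (induction cs) (auto simp: K_zero[OF i] K_lin[OF i] K_FI[OF i])
  have "K i (ev (kc (-1))) = ev cs" unfolding kc_def using cs(1)
    by (induction cs) (auto simp: K_zero[OF i] K_lin[OF i] K_FI[OF i] power_int_minus power_int_diff)
  hence "Ki i (ev cs) = ev (kc (-1))" using KKi[OF i] by metis
  thus ?thesis using 1 ok cs unfolding U_def by blast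
qed

end

interpretation tv: vector_space tscale
  by (rule vector_space_tscale)

lemma tvec_diff: "f - g = f + tscale (-1) g" for f g :: tvec
  by (simp add: fun_eq_iff tvec_apply)

declare uminus_apply [simp del] minus_apply [simp del]

context letter_chain
begin

lemma dot_minus: "dot n (- f) g = - dot n f g" "dot n g (- f) = - dot n g f"
  and dot_diff: "dot n (f - f') g = dot n f g - dot n f' g" "dot n g (f - f') = dot n g f - dot n g f'"
  unfolding dot_def by (simp_all add: sum_negf sum_subtractf uminus_apply minus_apply algebra_simps)

end

section \<open>Cyclic submodules of tensor powers and transfer of relations\<close>

context nondeg_chain
begin

definition Thw :: "nat \<Rightarrow> (nat \<Rightarrow> int) \<Rightarrow> tvec \<Rightarrow> bool" where
  "Thw n h x \<longleftrightarrow> x \<in> Tn n \<and> x \<noteq> 0 \<and> (\<forall>i\<in>idxs. TE i x = 0 \<and> TK i x = tscale (vi i powi h i) x)"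

abbreviation tFI :: "tvec \<Rightarrow> nat list \<Rightarrow> tvec" where "tFI \<equiv> hw_module.FI TF"
abbreviation tev :: "tvec \<Rightarrow> comb \<Rightarrow> tvec" where "tev \<equiv> hw_module.ev tscale TF"
abbreviation tU :: "tvec \<Rightarrow> tvec set" where "tU \<equiv> hw_module.U r tscale TF"

lemma Thw_module: "Thw n h x \<Longrightarrow> hw_module X r tscale TE TF TK TKi h x"
proof -
  assume x: "Thw n h x"
  show ?thesis
  proof (intro hw_module.intro hw_module_axioms.intro vector_space_tscale)
    show "nondeg_chain X r" by unfold_locales
    fix i j y assume ij: "i \<in> {1..r}" "j \<in> {1..r}"
    show "TE i (TF j y) = TF j (TE i y) +
        (if i = j then tscale (inverse (vi i - inverse (vi i))) (TK i y - TKi i y) else 0)"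
      unfolding tvec_diff by (rule TE_TF[OF ij])
    show "TK i (TF j y) = tscale (vi i powi (- ca i j)) (TF j (TK i y))" by (rule TK_TF[OF ij])
  next
    show "x \<noteq> 0" using x unfolding Thw_def by blast
  next
    fix i assume "i \<in> {1..r}"
    thus "TE i x = 0" "TK i x = tscale (vi i powi h i) x" using x unfolding Thw_def by blast+
  qed (simp_all only: T_linear TK_inverse)
qed

context
  fixes n h x assumes x: "Thw n h x"
begin

interpretation M: hw_module X r tscale TE TF TK TKi h x by (rule Thw_module[OF x])

lemma tFI_Tn: "set J \<subseteq> idxs \<Longrightarrow> tFI x J \<in> Tn n"
  using x by (induction J) (auto simp: Thw_def TF_Tn)

lemma tev_Tn: "okc cs \<Longrightarrow> tev x cs \<in> Tn n"
proof (induction cs)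
  case (Cons a cs) thus ?case by (cases a) (auto simp: tFI_Tn intro!: Tn_closed)
qed (simp add: Tn_closed)

lemma tU_Tn: "y \<in> tU x \<Longrightarrow> y \<in> Tn n"
  unfolding M.U_def by (auto simp: tev_Tn)

lemma tU_x: "x \<in> tU x"
  by (rule M.U_closed)

lemma tU_closed: "0 \<in> tU x" "y \<in> tU x \<Longrightarrow> z \<in> tU x \<Longrightarrow> y + z \<in> tU x" "y \<in> tU x \<Longrightarrow> tscale c y \<in> tU x"
  "i \<in> idxs \<Longrightarrow> y \<in> tU x \<Longrightarrow> TE i y \<in> tU x" "i \<in> idxs \<Longrightarrow> y \<in> tU x \<Longrightarrow> TF i y \<in> tU x"
  "i \<in> idxs \<Longrightarrow> y \<in> tU x \<Longrightarrow> TK i y \<in> tU x"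
  using M.U_closed M.U_K by auto

lemma tFI_in_tU: "set J \<subseteq> idxs \<Longrightarrow> tFI x J \<in> tU x"
  by (induction J) (auto simp: tU_x tU_closed)

lemma TK_tFI: "i \<in> idxs \<Longrightarrow> set J \<subseteq> idxs \<Longrightarrow> TK i (tFI x J) = tscale (vi i powi (h i - (\<Sum>j\<leftarrow>J. ca i j))) (tFI x J)"
  by (rule M.K_FI)

lemma TKi_tFI: "i \<in> idxs \<Longrightarrow> set J \<subseteq> idxs \<Longrightarrow> TKi i (tFI x J) = tscale (vi i powi - (h i - (\<Sum>j\<leftarrow>J. ca i j))) (tFI x J)"
  using M.Ki_weight TK_tFI by blast

lemma dot_tFI_hw: "J \<noteq> [] \<Longrightarrow> set J \<subseteq> idxs \<Longrightarrow> \<forall>i\<in>idxs. TE i y = 0 \<Longrightarrow> dot n (tFI x J) y = 0"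
  by (cases J) (auto simp: dot_TF)

lemma dot_tev_x: "okc cs \<Longrightarrow> dot n (tev x cs) x = topc cs * dot n x x"
proof (induction cs)
  case Nil thus ?case by (simp add: topc_def)
next
  case (Cons a cs)
  obtain c J where a: "a = (c, J)" by (cases a)
  have "\<forall>i\<in>idxs. TE i x = 0" using x by (simp add: Thw_def)
  thus ?case using Cons dot_tFI_hw[of J x] unfolding a
    by (cases "J = []") (auto simp: topc_def dot_add dot_tscale dot_minus dot_diff algebra_simps)
qed

end

text \<open>The scalar collected when the lowering operators of a monomial are moved across the form
  one by one, each as v_j^(-1) K_j E_j with K_j evaluated on the remaining monomial.\<close>

fun cJ :: "(nat \<Rightarrow> int) \<Rightarrow> nat list \<Rightarrow> ratq" where
  "cJ h [] = 1"
| "cJ h (j # J) = inverse (vi j) * vi j powi (h j - (\<Sum>l\<leftarrow>J. ca j l)) * cJ h J"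

lemma dot_FI:
  assumes x: "Thw n h x"
  shows "set J \<subseteq> idxs \<Longrightarrow> dot n y (tFI x J) = cJ h J * dot n (foldr TE (rev J) y) x"
proof (induction J arbitrary: y)
  case Nil
  interpret M: hw_module X r tscale TE TF TK TKi h x by (rule Thw_module[OF x])
  show ?case by simp
next
  case (Cons j J)
  interpret M: hw_module X r tscale TE TF TK TKi h x by (rule Thw_module[OF x])
  have j: "j \<in> idxs" "set J \<subseteq> idxs" using Cons.prems by auto
  have "dot n y (tFI x (j # J)) = dot n (TF j (tFI x J)) y" by (simp add: dot_commute)
  also have "\<dots> = inverse (vi j) * dot n (TK j (tFI x J)) (TE j y)" unfolding dot_TF dot_TK ..
  also have "\<dots> = inverse (vi j) * vi j powi (h j - (\<Sum>l\<leftarrow>J. ca j l)) * dot n (TE j y) (tFI x J)"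
    unfolding TK_tFI[OF x j] dot_tscale by (simp add: dot_commute)
  also have "\<dots> = cJ h (j # J) * dot n (foldr TE (rev (j # J)) y) x"
    unfolding Cons.IH[OF j(2)] by simp
  finally show ?case .
qed

lemma dot_tev_FI:
  assumes x: "Thw n h x" and ok: "okc cs" "set J \<subseteq> idxs"
  shows "dot n (tev x cs) (tFI x J) = cJ h J * topc (foldr (ecomb h) (rev J) cs) * dot n x x"
proof -
  interpret M: hw_module X r tscale TE TF TK TKi h x by (rule Thw_module[OF x])
  have "foldr TE (rev J) (tev x cs) = tev x (foldr (ecomb h) (rev J) cs)"
    using M.ev_ecombs[of "rev J" cs] ok by simp
  thus ?thesis unfolding dot_FI[OF x ok(2)] using dot_tev_x[OF x okc_ecombs[OF ok(1)]] by simp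
qed

text \<open>The difference lies in \<open>tU x\<close> and is orthogonal to all monomials, hence to
  itself; anisotropy finishes.\<close>

lemma tU_eqI:
  assumes x: "Thw n h x" and y: "y \<in> tU x" "z \<in> tU x" "\<And>J. set J \<subseteq> idxs \<Longrightarrow> dot n y (tFI x J) = dot n z (tFI x J)"
  shows "y = z"
proof -
  interpret M: hw_module X r tscale TE TF TK TKi h x by (rule Thw_module[OF x])
  have d: "y + tscale (-1) z \<in> tU x" using y by (intro tU_closed[OF x])
  then obtain cs where cs: "okc cs" "y + tscale (-1) z = tev x cs" unfolding M.U_def by auto
  have "dot n (y + tscale (-1) z) (tev x ds) = 0" if "okc ds" for ds
    using that
  proof (induction ds)
    case (Cons a ds) thus ?case using y(3) by (cases a) (auto simp: dot_add dot_tscale dot_minus dot_diff)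
  qed simp
  hence "dot n (y + tscale (-1) z) (y + tscale (-1) z) = 0" using cs by metis
  hence "y + tscale (-1) z = 0" using anisotropic tU_Tn[OF x d] by blast
  thus ?thesis by (simp flip: tvec_diff)
qed

lemma tev_zeroI:
  assumes x: "Thw n h x" and ok: "okc cs" "\<And>js. set js \<subseteq> idxs \<Longrightarrow> topc (foldr (ecomb h) js cs) = 0"
  shows "tev x cs = 0"
proof -
  interpret M: hw_module X r tscale TE TF TK TKi h x by (rule Thw_module[OF x])
  show ?thesis
  proof (rule tU_eqI[OF x])
    show "tev x cs \<in> tU x" unfolding M.U_def using ok(1) by blast
    fix J assume J: "set J \<subseteq> idxs"
    thus "dot n (tev x cs) (tFI x J) = dot n 0 (tFI x J)"
      unfolding dot_tev_FI[OF x ok(1) J] using ok(2)[of "rev J"] by simp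
  qed (rule tU_closed[OF x])
qed

text \<open>A relation in any highest weight module has vanishing contravariant pairings with all monomials;
  these depend only on the weight, and in a tensor power the form is anisotropic.\<close>

lemma transfer:
  assumes "hw_module X r sc E F K Ki h u" and x: "Thw n h x" and ok: "okc cs"
    and z: "hw_module.ev sc F u cs = 0"
  shows "tev x cs = 0"
proof -
  interpret M: hw_module X r sc E F K Ki h u by fact
  show ?thesis by (rule tev_zeroI[OF x ok]) (rule M.zero_tops[OF ok z])
qed

section \<open>Orthogonal projections\<close>

text \<open>Gram-Schmidt. Division by the norm of the new residual \<open>?y\<close> is legitimate
  by anisotropy; if \<open>?y\<close> is zero, the previous projection already works.\<close>

lemma proj_exists:
  assumes "finite S" "S \<subseteq> Tn n"
  shows "\<exists>p\<in>tv.span S. \<forall>s\<in>S. dot n (z + tscale (-1) p) s = 0"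
  using assms
proof (induction S arbitrary: z rule: finite_induct)
  case empty thus ?case by (auto intro: tv.span_zero)
next
  case (insert y S)
  have span: "dot n z' p = 0" if "\<forall>s\<in>S. dot n z' s = 0" "p \<in> tv.span S" for z' p
    using that(2) by (induction rule: tv.span_induct_alt) (use that(1) in \<open>auto simp: dot_add dot_tscale dot_minus dot_diff\<close>)
  obtain py where py: "py \<in> tv.span S" "\<forall>s\<in>S. dot n (y + tscale (-1) py) s = 0"
    using insert by blast
  obtain pz where pz: "pz \<in> tv.span S" "\<forall>s\<in>S. dot n (z + tscale (-1) pz) s = 0"
    using insert by blast
  have spanT: "p \<in> Tn n" if "p \<in> tv.span S" for p
    using that by (induction rule: tv.span_induct_alt) (use insert.prems in \<open>auto intro!: Tn_closed\<close>)
  let ?y = "y + tscale (-1) py" and ?z = "z + tscale (-1) pz"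
  have mono: "p \<in> tv.span S \<Longrightarrow> p \<in> tv.span (insert y S)" for p
    using tv.span_mono[of S "insert y S"] by blast
  show ?case
  proof (cases "?y = 0")
    case True
    hence "y = py" by (simp flip: tvec_diff)
    hence "dot n ?z y = 0" using span[OF pz(2)] py(1) by blast
    thus ?thesis using pz mono by (intro bexI[of _ pz]) auto
  next
    case False
    have yT: "?y \<in> Tn n" by (intro Tn_closed spanT[OF py(1)]) (use insert.prems in auto)
    have nz: "dot n ?y ?y \<noteq> 0" using anisotropic[OF yT] False by blast
    have yy: "dot n ?y y = dot n ?y ?y"
      using span[OF py(2) py(1)] by (simp add: dot_add dot_tscale dot_minus dot_diff)
    define c where "c = dot n ?z y / dot n ?y y"
    let ?p = "pz + tscale c ?y"
    have "?p \<in> tv.span (insert y S)"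
      by (intro tv.span_add tv.span_scale mono[OF pz(1)] mono[OF py(1)] tv.span_base[of y]) simp
    moreover have e: "z + tscale (-1) ?p = ?z + tscale (- c) ?y"
      by (simp add: fun_eq_iff tvec_apply algebra_simps)
    have "dot n (?z + tscale (- c) ?y) s = 0" if "s \<in> insert y S" for s
    proof (cases "s = y")
      case True
      have "dot n (?z + tscale (- c) ?y) y = dot n ?z y + - c * dot n ?y y"
        by (simp only: dot_add dot_tscale dot_minus dot_diff)
      thus ?thesis using True nz yy by (simp add: c_def)
    next
      case False
      hence "dot n ?z s = 0" "dot n ?y s = 0" using that pz(2) py(2) by auto
      hence "dot n ?z s + - c * dot n ?y s = 0" by simp
      thus ?thesis by (simp only: dot_add dot_tscale dot_minus dot_diff)
    qed
    ultimately show ?thesis unfolding e[symmetric] by blast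
  qed
qed

definition lowdeg :: "nat \<Rightarrow> tvec \<Rightarrow> bool" where
  "lowdeg k f \<longleftrightarrow> (\<forall>w. sum_list w < k \<longrightarrow> f w = 0)"

lemma lowdeg_TF: "lowdeg k f \<Longrightarrow> lowdeg (Suc k) (TF i f)"
proof -
  have "(\<forall>w. sum_list w < k \<longrightarrow> f w = 0) \<Longrightarrow> sum_list w < Suc k \<Longrightarrow> TF i f w = 0" for w
  proof (induction w arbitrary: f k)
    case (Cons a u)
    have "TF i (sl a f) u = 0"
    proof (cases "a \<le> k")
      case True
      show ?thesis by (rule Cons.IH[of "k - a"]) (use Cons.prems True in auto)
    next
      case False thus ?thesis using Cons.prems by simp
    qed
    moreover have "dn i a \<Longrightarrow> f ((a - 1) # u) = 0" using Cons.prems by (auto simp: dn_def)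
    ultimately show ?case by simp
  qed simp
  thus "lowdeg k f \<Longrightarrow> lowdeg (Suc k) (TF i f)" unfolding lowdeg_def by blast
qed

lemma sum_list_Wd: "w \<in> Wd n \<Longrightarrow> sum_list w \<le> n * D"
proof (induction n arbitrary: w)
  case (Suc n) thus ?case unfolding Wd_Suc by (auto simp: add_mono)
qed (simp add: Wd_0)

text \<open>Each lowering step raises the lower bound on the letter sums in the support by one,
  while a word of length n has letter sum at most n * D. So finitely many monomials span
  \<open>tU x\<close>, and orthogonal projection onto it is available.\<close>

lemma tFI_vanish:
  assumes x: "Thw n h x" and J: "set J \<subseteq> idxs" "length J > n * D"
  shows "tFI x J = 0"
proof -
  interpret M: hw_module X r tscale TE TF TK TKi h x by (rule Thw_module[OF x])
  have "lowdeg (length J) (tFI x J)" for J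
    by (induction J) (auto simp: lowdeg_TF, simp add: lowdeg_def)
  hence "tFI x J w = 0" if "w \<in> Wd n" for w
    using sum_list_Wd[OF that] J(2) unfolding lowdeg_def by (meson le_less_trans)
  thus ?thesis using tFI_Tn[OF x J(1)] unfolding Tn_def by (auto simp: fun_eq_iff tvec_apply)
qed

lemma proj_tU:
  assumes x: "Thw n h x"
  shows "\<exists>cs. okc cs \<and> (\<forall>J. set J \<subseteq> idxs \<longrightarrow> dot n z (tFI x J) = dot n (tev x cs) (tFI x J))"
proof -
  interpret M: hw_module X r tscale TE TF TK TKi h x by (rule Thw_module[OF x])
  let ?S = "tFI x ` {J. set J \<subseteq> idxs \<and> length J \<le> n * D}"
  have fin: "finite ?S" using finite_lists_length_le[of idxs "n * D"] by simp
  have T: "?S \<subseteq> Tn n" using tFI_Tn[OF x] by auto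
  obtain p where p: "p \<in> tv.span ?S" "\<forall>s\<in>?S. dot n (z + tscale (-1) p) s = 0"
    using proj_exists[OF fin T] by blast
  have "p \<in> tU x" using p(1)
    by (induction rule: tv.span_induct_alt) (auto intro!: tU_closed[OF x] tFI_in_tU[OF x])
  then obtain cs where cs: "okc cs" "p = tev x cs" unfolding M.U_def by auto
  have "dot n z (tFI x J) = dot n (tev x cs) (tFI x J)" if J: "set J \<subseteq> idxs" for J
  proof (cases "length J \<le> n * D")
    case True
    hence "dot n (z + tscale (-1) p) (tFI x J) = 0" using p(2) J by auto
    thus ?thesis unfolding cs(2)[symmetric] by (simp add: dot_add dot_tscale dot_minus dot_diff)
  next
    case False thus ?thesis using tFI_vanish[OF x J] by simp
  qed
  thus ?thesis using cs(1) by blast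
qed

text \<open>The adjoint of the isomorphism between the submodules generated by two highest weight
  vectors of the same weight.\<close>

lemma intertwiner_exists:
  assumes u: "Thw m h u" and x: "Thw n h x"
  obtains Q where "\<And>f g. Q (f + g) = Q f + Q g" "\<And>c f. Q (tscale c f) = tscale c (Q f)"
    "\<And>z. Q z \<in> tU x" "\<And>z J. set J \<subseteq> idxs \<Longrightarrow> dot n (Q z) (tFI x J) = dot m z (tFI u J)"
    "\<And>z i. i \<in> idxs \<Longrightarrow> Q (TE i z) = TE i (Q z)" "\<And>z i. i \<in> idxs \<Longrightarrow> Q (TF i z) = TF i (Q z)"
    "\<And>z i. i \<in> idxs \<Longrightarrow> Q (TK i z) = TK i (Q z)"
proof -
  interpret M: hw_module X r tscale TE TF TK TKi h x by (rule Thw_module[OF x])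
  interpret N: hw_module X r tscale TE TF TK TKi h u by (rule Thw_module[OF u])
  have xx: "dot n x x \<noteq> 0" using anisotropic[of x n] x unfolding Thw_def by blast
  have uu: "dot m u u \<noteq> 0" using anisotropic[of u m] u unfolding Thw_def by blast
  have ex: "\<exists>y. y \<in> tU x \<and> (\<forall>J. set J \<subseteq> idxs \<longrightarrow> dot n y (tFI x J) = dot m z (tFI u J))" for z
  proof -
    obtain cs where cs: "okc cs" "\<forall>J. set J \<subseteq> idxs \<longrightarrow> dot m z (tFI u J) = dot m (tev u cs) (tFI u J)"
      using proj_tU[OF u] by blast
    \<comment> \<open>By \<open>dot_tev_FI\<close> both pairings are the same formal number times
      the norm of the respective generator; the factor exchanges the norms.\<close>
    let ?y = "tscale (dot m u u / dot n x x) (tev x cs)"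
    have "tev x cs \<in> tU x" unfolding M.U_def using cs(1) by blast
    hence "?y \<in> tU x" by (intro tU_closed[OF x])
    moreover have "dot n ?y (tFI x J) = dot m z (tFI u J)" if J: "set J \<subseteq> idxs" for J
      using cs J xx by (simp add: dot_tscale dot_tev_FI[OF x cs(1) J] dot_tev_FI[OF u cs(1) J])
    ultimately show ?thesis by blast
  qed
  define Q where "Q z = (SOME y. y \<in> tU x \<and> (\<forall>J. set J \<subseteq> idxs \<longrightarrow> dot n y (tFI x J) = dot m z (tFI u J)))" for z
  have Q: "Q z \<in> tU x" "\<And>J. set J \<subseteq> idxs \<Longrightarrow> dot n (Q z) (tFI x J) = dot m z (tFI u J)" for z
    using someI_ex[OF ex[of z]] unfolding Q_def by auto
  have Qev: "dot n (Q z) (tev x cs) = dot m z (tev u cs)" if "okc cs" for z cs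
    using that
  proof (induction cs)
    case (Cons a cs) thus ?case using Q(2) by (cases a) (auto simp: dot_add dot_tscale dot_minus dot_diff)
  qed simp
  have add: "Q (f + g) = Q f + Q g" for f g
    by (rule tU_eqI[OF x]) (auto simp: Q dot_add intro!: tU_closed[OF x])
  have sc: "Q (tscale c f) = tscale c (Q f)" for c f
    by (rule tU_eqI[OF x]) (auto simp: Q dot_tscale intro!: tU_closed[OF x])
  have K: "Q (TK i z) = TK i (Q z)" if i: "i \<in> idxs" for i z
  proof (rule tU_eqI[OF x Q(1) tU_closed(6)[OF x i Q(1)]])
    fix J assume J: "set J \<subseteq> idxs"
    show "dot n (Q (TK i z)) (tFI x J) = dot n (TK i (Q z)) (tFI x J)"
      unfolding Q(2)[OF J] dot_TK TK_tFI[OF x i J] TK_tFI[OF u i J] dot_tscale ..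
  qed
  have E: "Q (TE i z) = TE i (Q z)" if i: "i \<in> idxs" for i z
  proof (rule tU_eqI[OF x Q(1) tU_closed(4)[OF x i Q(1)]])
    fix J assume J: "set J \<subseteq> idxs"
    have iJ: "set (i # J) \<subseteq> idxs" using i J by simp
    have "dot n (Q z) (TF i (tFI x J)) = dot m z (TF i (tFI u J))" using Q(2)[OF iJ] by simp
    thus "dot n (Q (TE i z)) (tFI x J) = dot n (TE i (Q z)) (tFI x J)"
      unfolding Q(2)[OF J] dot_TE TKi_tFI[OF x i J] TKi_tFI[OF u i J] T_linear dot_tscale by simp
  qed
  \<comment> \<open>The adjoint of F_i involves E_i, and E_i of a monomial is the same formal
    combination in both submodules, so \<open>Qev\<close> applies.\<close>
  have F: "Q (TF i z) = TF i (Q z)" if i: "i \<in> idxs" for i z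
  proof (rule tU_eqI[OF x Q(1) tU_closed(5)[OF x i Q(1)]])
    fix J assume J: "set J \<subseteq> idxs"
    have "dot n (Q (TK i z)) (TE i (tFI x J)) = dot m (TK i z) (TE i (tFI u J))"
      unfolding M.E_FI[OF i J] N.E_FI[OF i J] by (rule Qev[OF okc_ecomb1[OF J]])
    thus "dot n (Q (TF i z)) (tFI x J) = dot n (TF i (Q z)) (tFI x J)"
      unfolding Q(2)[OF J] dot_TF dot_TK[symmetric] K[OF i] by simp
  qed
  show ?thesis by (rule that[OF add sc Q E F K])
qed

text \<open>The intertwiner from x to itself has the same pairings with the monomials as the
  identity, so it fixes \<open>tU x\<close>: it is the orthogonal projection.\<close>

lemma projection_exists:
  assumes x: "Thw n h x"
  obtains Q where "\<And>f g. Q (f + g) = Q f + Q g" "\<And>c f. Q (tscale c f) = tscale c (Q f)"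
    "\<And>z. Q z \<in> tU x" "\<And>z. z \<in> tU x \<Longrightarrow> Q z = z"
    "\<And>z i. i \<in> idxs \<Longrightarrow> Q (TE i z) = TE i (Q z)" "\<And>z i. i \<in> idxs \<Longrightarrow> Q (TF i z) = TF i (Q z)"
    "\<And>z i. i \<in> idxs \<Longrightarrow> Q (TK i z) = TK i (Q z)"
proof -
  obtain Q where Q: "\<And>f g. Q (f + g) = Q f + Q g" "\<And>c f. Q (tscale c f) = tscale c (Q f)"
    "\<And>z. Q z \<in> tU x" "\<And>z J. set J \<subseteq> idxs \<Longrightarrow> dot n (Q z) (tFI x J) = dot n z (tFI x J)"
    "\<And>z i. i \<in> idxs \<Longrightarrow> Q (TE i z) = TE i (Q z)" "\<And>z i. i \<in> idxs \<Longrightarrow> Q (TF i z) = TF i (Q z)"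
    "\<And>z i. i \<in> idxs \<Longrightarrow> Q (TK i z) = TK i (Q z)"
    by (rule intertwiner_exists[OF x x], rule that; assumption)
  have "Q z = z" if "z \<in> tU x" for z
    by (rule tU_eqI[OF x Q(3) that Q(4)])
  thus ?thesis using that Q by blast
qed

lemma tU_kashiwara:
  assumes x: "Thw n h x" and y: "y \<in> tU x" and i: "i \<in> idxs"
  shows "ft n i y \<in> tU x" "et n i y \<in> tU x"
proof -
  obtain Q where Q: "\<And>f g. Q (f + g) = Q f + Q g" "\<And>c f. Q (tscale c f) = tscale c (Q f)"
    "\<And>z. Q z \<in> tU x" "\<And>z. z \<in> tU x \<Longrightarrow> Q z = z"
    "\<And>z i. i \<in> idxs \<Longrightarrow> Q (TE i z) = TE i (Q z)" "\<And>z i. i \<in> idxs \<Longrightarrow> Q (TF i z) = TF i (Q z)"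
    "\<And>z i. i \<in> idxs \<Longrightarrow> Q (TK i z) = TK i (Q z)"
    by (rule projection_exists[OF x], rule that; assumption)
  have "Q (ft n i y) = ft n i (Q y)" "Q (et n i y) = et n i (Q y)"
    by (rule kashiwara_equivariant[OF i, of Q n n]; use Q i tU_Tn[OF x] y in blast)+
  thus "ft n i y \<in> tU x" "et n i y \<in> tU x" using Q(3,4) y by metis+
qed

end

text \<open>The head of a word is its last tensor factor, so the first m entries belong to the
  second argument y.\<close>

definition tens :: "nat \<Rightarrow> tvec \<Rightarrow> tvec \<Rightarrow> tvec" where
  "tens m x y = (\<lambda>w. y (take m w) * x (drop m w))"

lemma tens_0: "tens 0 x y = tscale (y []) x"
  by (simp add: tens_def fun_eq_iff tvec_apply)

lemma sl_tens: "sl a (tens (Suc m) x y) = tens m x (sl a y)"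
  by (simp add: tens_def fun_eq_iff)

lemma tens_linear: "tens m x (y + z) = tens m x y + tens m x z" "tens m (x + z) y = tens m x y + tens m z y"
  "tens m x (tscale c y) = tscale c (tens m x y)" "tens m (tscale c x) y = tscale c (tens m x y)"
  "tens m x 0 = 0" "tens m 0 y = 0"
  by (simp_all add: tens_def fun_eq_iff tvec_apply algebra_simps)

section \<open>Tensor products of highest weight vectors\<close>

context letter_chain
begin

lemma TK_tens: "TK i (tens m x y) = tens m (TK i x) (TK i y)"
proof
  fix w
  have "hp i w = hp i (take m w) + hp i (drop m w)" using hp_append[of i "take m w" "drop m w"] by simp
  thus "TK i (tens m x y) w = tens m (TK i x) (TK i y) w"
    by (simp add: TK_apply tens_def power_int_add)
qed

lemma TE_tens: "y \<in> Tn m \<Longrightarrow> TE i (tens m x y) = tens m (TE i x) (TKi i y) + tens m x (TE i y)"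
proof (induction m arbitrary: y)
  case 0
  have "TKi i y [] = y []" by (simp add: TKi_apply)
  thus ?case unfolding tens_0 by (simp add: T_linear)
next
  case (Suc m)
  have T: "sl a y \<in> Tn m" for a
    using Suc.prems unfolding Tn_Suc_iff by (cases "a \<le> D") (auto simp: Tn_closed)
  show ?case
  proof (rule tvec_eqI)
    have "y [] = 0" using Suc.prems unfolding Tn_Suc_iff by simp
    thus "TE i (tens (Suc m) x y) [] = (tens (Suc m) (TE i x) (TKi i y) + tens (Suc m) x (TE i y)) []"
      by (simp add: tvec_apply tens_def TKi_apply)
    fix a
    show "sl a (TE i (tens (Suc m) x y)) = sl a (tens (Suc m) (TE i x) (TKi i y) + tens (Suc m) x (TE i y))"
      unfolding sl_TE sl_add sl_tens Suc.IH[OF T] sl_TKi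
      by (simp add: tens_linear tscale_distribs sl_TE add_ac)
  qed
qed

lemma tens_Tn: "x \<in> Tn n \<Longrightarrow> y \<in> Tn m \<Longrightarrow> tens m x y \<in> Tn (n + m)"
proof (induction m arbitrary: y)
  case 0 thus ?case by (simp add: tens_0 Tn_closed)
next
  case (Suc m)
  have "y [] = 0" using Suc.prems unfolding Tn_Suc_iff by simp
  hence "tens (Suc m) x y [] = 0" by (simp add: tens_def)
  thus ?case using Suc unfolding add_Suc_right Tn_Suc_iff sl_tens by (auto simp: tens_linear)
qed

lemma tens_nonzero:
  assumes "x \<noteq> 0" "y \<in> Tn m" "y \<noteq> 0"
  shows "tens m x y \<noteq> 0"
proof -
  obtain u w where uw: "x u \<noteq> 0" "y w \<noteq> 0" using assms by (auto simp: fun_eq_iff tvec_apply)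
  hence "length w = m" using assms(2) unfolding Tn_def Wd_def by auto
  hence "tens m x y (w @ u) \<noteq> 0" using uw by (simp add: tens_def)
  thus ?thesis by (metis zero_fun_apply)
qed

section \<open>Quantum exterior powers\<close>

text \<open>\<open>col S\<close> is the q-antisymmetrization of the letters in \<open>S\<close>: the coefficient of an ordering
  of \<open>S\<close> is $-q$ to the number of inversions.\<close>

fun colw :: "nat list \<Rightarrow> nat set \<Rightarrow> ratq" where
  "colw [] S = of_bool (S = {})"
| "colw (a # u) S = (if a \<in> S then (- qq) ^ card {s\<in>S. s > a} * colw u (S - {a}) else 0)"

definition col :: "nat set \<Rightarrow> tvec" where
  "col S = (\<lambda>w. colw w S)"

text \<open>The number of letters allowed in a column. In type C only the letters before the long
  arrow are used; between them all arrows have parameter q, which the antisymmetrization with powers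
  of -q requires.\<close>

definition kmax :: nat where
  "kmax = (if X = Type_A then Suc r else r)"

lemma col_Nil: "col S [] = of_bool (S = {})"
  by (simp add: col_def)

lemma sl_col: "sl a (col S) = (if a \<in> S then tscale ((- qq) ^ card {s\<in>S. s > a}) (col (S - {a})) else 0)"
  by (simp add: col_def fun_eq_iff tvec_apply)

lemma kmax_le: "kmax \<le> Suc D"
  using rank_pos unfolding kmax_def D_if by auto

lemma col_Tn: "finite S \<Longrightarrow> S \<subseteq> {..D} \<Longrightarrow> col S \<in> Tn (card S)"
proof (induction "card S" arbitrary: S)
  case 0
  hence "S = {}" by simp
  thus ?case by (simp add: Tn_0_iff sl_col)
next
  case (Suc n)
  have "sl a (col S) \<in> Tn n" for a
  proof (cases "a \<in> S")
    case True
    hence "card (S - {a}) = n" using Suc by simp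
    hence "col (S - {a}) \<in> Tn n" using Suc.hyps(1)[of "S - {a}"] Suc.prems by auto
    thus ?thesis unfolding sl_col using True by (simp add: Tn_closed)
  qed (simp add: sl_col Tn_closed)
  moreover have "S \<noteq> {}" using Suc by auto
  ultimately show ?case unfolding Suc(2)[symmetric] Tn_Suc_iff
    using Suc.prems by (auto simp: col_Nil sl_col)
qed

lemma col_nonzero: "finite S \<Longrightarrow> col S \<noteq> 0"
proof (induction S rule: finite_induct)
  case empty
  have "col {} [] \<noteq> 0" by (simp add: col_Nil)
  thus ?case by (metis zero_fun_apply)
next
  case (insert a S)
  have "sl a (col (insert a S)) = tscale ((- qq) ^ card {s\<in>insert a S. s > a}) (col S)"
    unfolding sl_col using insert by simp
  moreover have "tscale ((- qq) ^ card {s\<in>insert a S. s > a}) (col S) \<noteq> 0" using insert by simp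
  ultimately show ?case by (metis sl_zero)
qed

lemma TK_col: "finite S \<Longrightarrow> TK i (col S) = tscale (vi i powi (\<Sum>s\<in>S. pr i s)) (col S)"
proof (induction "card S" arbitrary: S)
  case 0
  hence "S = {}" by simp
  show ?case unfolding \<open>S = {}\<close> by (rule tvec_eqI, simp add: TK_apply tvec_apply, simp add: sl_TK sl_tscale sl_col)
next
  case (Suc n)
  show ?case
  proof (rule tvec_eqI)
    show "TK i (col S) [] = tscale (vi i powi (\<Sum>s\<in>S. pr i s)) (col S) []"
      using Suc by (auto simp: TK_apply tvec_apply col_Nil)
    fix a
    show "sl a (TK i (col S)) = sl a (tscale (vi i powi (\<Sum>s\<in>S. pr i s)) (col S))"
    proof (cases "a \<in> S")
      case True
      have "TK i (col (S - {a})) = tscale (vi i powi (\<Sum>s\<in>S - {a}. pr i s)) (col (S - {a}))"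
        using Suc True by (intro Suc.hyps(1)) auto
      moreover have "(\<Sum>s\<in>S. pr i s) = pr i a + (\<Sum>s\<in>S - {a}. pr i s)"
        by (rule sum.remove) (use Suc True in auto)
      hence "vi i powi (\<Sum>s\<in>S. pr i s) = vi i powi pr i a * vi i powi (\<Sum>s\<in>S - {a}. pr i s)"
        by (simp add: power_int_add)
      ultimately show ?thesis
        unfolding sl_TK sl_tscale sl_col using True by (simp only: if_True T_linear tscale_simps mult_ac)
    next
      case False thus ?thesis unfolding sl_TK sl_tscale sl_col by simp
    qed
  qed
qed

lemma up_small: "i \<in> idxs \<Longrightarrow> Suc a < kmax \<Longrightarrow> up i a \<longleftrightarrow> a = r - i"
proof -
  assume i: "i \<in> idxs" and a: "Suc a < kmax"
  have "a < r" using a unfolding kmax_def by (auto split: if_splits)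
  moreover have "a < D" using calculation r_le_D by simp
  ultimately show "up i a \<longleftrightarrow> a = r - i" using i unfolding up_def lab_def by auto
qed

text \<open>If both ends t and t + 1 of the i-arrow lie in S, the two contributions to the slice at
  t cancel: exchanging them changes the inversion number by one, so they are q^(-1) (-q)^(c+1) and
  (-q)^c.\<close>

lemma TE_col:
  assumes i: "i \<in> idxs" and t: "t = r - i"
  shows "S \<subseteq> {..<kmax} \<Longrightarrow> TE i (col S) = (if Suc t \<in> S \<and> t \<notin> S then col (insert t (S - {Suc t})) else 0)"
proof (induction "card S" arbitrary: S)
  case 0
  hence "S = {}" using finite_subset[OF 0(2)] by simp
  show ?case unfolding \<open>S = {}\<close> by (rule tvec_eqI) (auto simp: sl_TE sl_col sl_zero tvec_apply)
next
  case (Suc n)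
  have fin: "finite S" using finite_subset[OF Suc.prems] by simp
  have IH: "TE i (col (S - {a})) = (if Suc t \<in> S - {a} \<and> t \<notin> S - {a} then col (insert t (S - {a} - {Suc t})) else 0)"
    if "a \<in> S" for a
    using Suc that fin by (intro Suc.hyps(1)) auto
  have up: "up i a \<longleftrightarrow> a = t" if "Suc a \<in> S" for a
    using up_small[OF i] Suc.prems that t by auto
  have dn_t: "dn i (Suc t)" if "Suc t \<in> S" using up[OF that] up_Suc by blast
  show ?case
  proof (rule tvec_eqI)
    show "TE i (col S) [] = (if Suc t \<in> S \<and> t \<notin> S then col (insert t (S - {Suc t})) else 0) []"
      by (simp add: col_Nil tvec_apply)
    fix a
    have L: "sl a (TE i (col S)) = tscale (vi i powi (- pr i a)) (TE i (sl a (col S))) +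
        (if Suc a \<in> S \<and> a = t then tscale ((- qq) ^ card {s\<in>S. s > Suc t}) (col (S - {Suc t})) else 0)"
      unfolding sl_TE using up[of a] by (auto simp: sl_col)
    consider (both) "Suc t \<in> S" "t \<in> S" | (one) "Suc t \<in> S" "t \<notin> S" | (none) "Suc t \<notin> S" by blast
    thus "sl a (TE i (col S)) = sl a (if Suc t \<in> S \<and> t \<notin> S then col (insert t (S - {Suc t})) else 0)"
    proof cases
      case none
      thus ?thesis unfolding L using IH[of a] by (auto simp: sl_col T_linear sl_zero)
    next
      case both
      show ?thesis
      proof (cases "a = t")
        case True
        have "Suc t < kmax" using both Suc.prems by auto
        hence v: "vi i = qq" using t i unfolding qi_def kmax_def by auto
        have p: "pr i t = 1" using up[OF both(1)] by simp
        have c: "card {s\<in>S. s > t} = Suc (card {s\<in>S. s > Suc t})"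
        proof -
          have "{s\<in>S. s > t} = insert (Suc t) {s\<in>S. s > Suc t}" using both by auto
          thus ?thesis using fin by simp
        qed
        have "insert t (S - {t} - {Suc t}) = S - {Suc t}" using both by auto
        hence "TE i (col (S - {t})) = col (S - {Suc t})"
          using IH[OF both(2)] both by simp
        hence "sl a (TE i (col S)) = tscale (inverse qq * (- qq) ^ card {s\<in>S. s > t} + (- qq) ^ card {s\<in>S. s > Suc t}) (col (S - {Suc t}))"
          unfolding L using True both p v by (simp add: sl_col T_linear tscale_distribs)
        also have "inverse qq * (- qq) ^ card {s\<in>S. s > t} + (- qq) ^ card {s\<in>S. s > Suc t} = 0"
          unfolding c by (simp add: field_simps)
        finally have "sl a (TE i (col S)) = 0" by (simp only: tscale_simps)
        thus ?thesis using both by (simp add: sl_zero del: sl_apply TE.simps)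
      next
        case False
        thus ?thesis unfolding L using IH[of a] both by (auto simp: sl_col T_linear sl_zero)
      qed
    next
      case one
      let ?S' = "insert t (S - {Suc t})"
      consider "a = t" | "a = Suc t" | "a \<noteq> t" "a \<noteq> Suc t" by blast
      thus ?thesis
      proof cases
        case 1
        have "card {s\<in>?S'. s > t} = card {s\<in>S. s > Suc t}"
        proof -
          have "{s\<in>?S'. s > t} = {s\<in>S. s > Suc t}" using one by auto
          thus ?thesis by simp
        qed
        moreover have "?S' - {t} = S - {Suc t}" using one by auto
        ultimately show ?thesis unfolding L using 1 one by (simp add: sl_col)
      next
        case 2
        thus ?thesis unfolding L using IH[of a] one by (simp add: sl_col T_linear)
      next
        case 3
        have nd: "a \<in> S \<Longrightarrow> pr i a = 0"
        proof -
          assume aS: "a \<in> S"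
          have "\<not> dn i a"
          proof
            assume "dn i a"
            hence "up i (a - 1)" "Suc (a - 1) = a" using dn_pred by auto
            hence "a - 1 = t" using up[of "a - 1"] aS by simp
            thus False using 3 \<open>Suc (a - 1) = a\<close> by simp
          qed
          moreover have "\<not> up i a"
          proof
            assume u: "up i a"
            show False
            proof (cases "Suc a < kmax")
              case True thus False using up_small[OF i True] u 3 t by simp
            next
              case False
              hence "Suc a = kmax" using aS Suc.prems by auto
              hence "a < r \<Longrightarrow> lab a = r - a" "X = Type_A \<Longrightarrow> a = D" unfolding kmax_def lab_def D_if by auto
              hence "a = r - i" using u \<open>Suc a = kmax\<close> unfolding up_def kmax_def
                by (auto split: if_splits)
              thus False using 3 t by simp
            qed
          qed
          ultimately show ?thesis by simp
        qed
        have c: "a \<in> S \<Longrightarrow> card {s\<in>?S'. s > a} = card {s\<in>S. s > a}"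
        proof -
          assume aS: "a \<in> S"
          show ?thesis
          proof (cases "a < t")
            case True
            have "{s\<in>?S'. s > a} = insert t ({s\<in>S. s > a} - {Suc t})" using True by auto
            moreover have "card (insert t (Y - {Suc t})) = card Y" if "Suc t \<in> Y" "t \<notin> Y" "finite Y" for Y
              using that card.remove[of Y "Suc t"] by simp
            moreover have "Suc t \<in> {s\<in>S. s > a}" "t \<notin> {s\<in>S. s > a}" "finite {s\<in>S. s > a}" using one True fin by auto
            ultimately show ?thesis by metis
          next
            case False
            hence "{s\<in>?S'. s > a} = {s\<in>S. s > a}" using 3 by auto
            thus ?thesis by simp
          qed
        qed
        have s: "insert t (S - {a} - {Suc t}) = ?S' - {a}" using 3 by auto
        show ?thesis unfolding L using IH[of a] one 3 nd c s by (auto simp: sl_col T_linear)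
      qed
    qed
  qed
qed

lemma sum_pr: "k \<le> Suc D \<Longrightarrow> (\<Sum>s<k. pr i s) = of_bool (k > 0 \<and> up i (k - 1))"
proof (induction k)
  case (Suc k)
  have "dn i k \<longleftrightarrow> k > 0 \<and> up i (k - 1)"
  proof (cases k)
    case 0 thus ?thesis by (simp add: dn_def)
  next
    case (Suc j) thus ?thesis using up_Suc[of i j] by simp
  qed
  thus ?case using Suc by (simp add: pr_def)
qed simp

end

declare sl_apply [simp del]

definition nuc :: "(nat \<Rightarrow> tvec) \<Rightarrow> tvec" where
  "nuc G = (\<lambda>w. case w of [] \<Rightarrow> 0 | a # u \<Rightarrow> G a u)"

lemma nuc_simps [simp]: "nuc G [] = 0" "sl a (nuc G) = G a"
  by (simp_all add: nuc_def sl_def)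

context nondeg_chain
begin

declare TE.simps [simp del] TF.simps [simp del]

lemma T_Nil_eq [simp]: "TE i f [] = 0" "TF i f [] = 0" "TK i f [] = f []"
  by (simp_all add: TE.simps TF.simps TK_apply)

lemma Thw_cong: "(\<And>i. i \<in> idxs \<Longrightarrow> h i = h' i) \<Longrightarrow> Thw n h x \<longleftrightarrow> Thw n h' x"
  unfolding Thw_def by auto

lemma Thw_tens:
  assumes x: "Thw n h x" and y: "Thw m h' y"
  shows "Thw (n + m) (\<lambda>i. h i + h' i) (tens m x y)"
proof -
  have "TE i (tens m x y) = 0" "TK i (tens m x y) = tscale (vi i powi (h i + h' i)) (tens m x y)" if "i \<in> idxs" for i
  proof -
    have e: "TE i x = 0" "TK i x = tscale (vi i powi h i) x" "TE i y = 0" "TK i y = tscale (vi i powi h' i) y" "y \<in> Tn m"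
      using x y that unfolding Thw_def by blast+
    show "TE i (tens m x y) = 0" unfolding TE_tens[OF e(5)] e by (simp add: tens_linear)
    show "TK i (tens m x y) = tscale (vi i powi (h i + h' i)) (tens m x y)"
      unfolding TK_tens e by (simp add: tens_linear power_int_add mult.commute)
  qed
  thus ?thesis using x y tens_Tn[of x n y m] tens_nonzero[of x y m] unfolding Thw_def by blast
qed

lemma Thw_col: "k \<le> kmax \<Longrightarrow> Thw k (\<lambda>i. of_bool (k > 0 \<and> up i (k - 1))) (col {..<k})"
proof -
  assume k: "k \<le> kmax"
  have "k \<le> Suc D" using k kmax_le by (rule le_trans)
  hence "{..<k} \<subseteq> {..D}" by auto
  hence "col {..<k} \<in> Tn k" using col_Tn[of "{..<k}"] by simp
  moreover have "TE i (col {..<k}) = 0" if "i \<in> idxs" for i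
    using TE_col[OF that HOL.refl, of "{..<k}"] k by auto
  moreover have "TK i (col {..<k}) = tscale (vi i powi of_bool (k > 0 \<and> up i (k - 1))) (col {..<k})" for i
    using TK_col[of "{..<k}" i] sum_pr[of k i] k kmax_le by simp
  ultimately show ?thesis using col_nonzero[of "{..<k}"] unfolding Thw_def by blast
qed

text \<open>The column with letters 0, ..., r - i has the i-th fundamental weight: inner arrows
  cancel, and the arrow leaving its last letter has label i. Products of columns give every dominant
  weight.\<close>

lemma dominant_weight_exists:
  "(\<And>i. i \<in> idxs \<Longrightarrow> h i \<ge> 0) \<Longrightarrow> \<exists>n x. Thw n h x"
proof (induction "\<Sum>i\<in>idxs. nat (h i)" arbitrary: h)
  case 0
  hence "\<forall>i\<in>idxs. nat (h i) = 0" using sum_eq_0_iff[of idxs "\<lambda>i. nat (h i)"] by auto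
  hence "\<forall>i\<in>idxs. h i = 0" using 0(2) by force
  hence "Thw 0 h (col {..<0})" using Thw_col[of 0] Thw_cong[of "\<lambda>i. of_bool (0 > (0::nat) \<and> up i (0 - 1))" h] by auto
  thus ?case by blast
next
  case (Suc k)
  have "\<exists>i\<in>idxs. h i > 0"
  proof (rule ccontr)
    assume "\<not> ?thesis"
    hence "(\<Sum>i\<in>idxs. nat (h i)) = 0" by (intro sum.neutral) auto
    thus False using Suc.hyps(2) by simp
  qed
  then obtain i0 where i0: "i0 \<in> idxs" "h i0 > 0" by blast
  define h0 where "h0 = h(i0 := h i0 - 1)"
  have "(\<Sum>i\<in>idxs. nat (h i)) = nat (h i0) + (\<Sum>i\<in>idxs - {i0}. nat (h i))"
    using i0 by (intro sum.remove) auto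
  moreover have "(\<Sum>i\<in>idxs. nat (h0 i)) = nat (h0 i0) + (\<Sum>i\<in>idxs - {i0}. nat (h0 i))"
    using i0 by (intro sum.remove) auto
  moreover have "(\<Sum>i\<in>idxs - {i0}. nat (h0 i)) = (\<Sum>i\<in>idxs - {i0}. nat (h i))"
    unfolding h0_def by (intro sum.cong) auto
  ultimately have "k = (\<Sum>i\<in>idxs. nat (h0 i))" using Suc.hyps(2) i0 unfolding h0_def by simp
  then obtain n x where x: "Thw n h0 x"
    using Suc.hyps(1)[of h0] Suc.prems i0 unfolding h0_def by fastforce
  let ?k = "Suc (r - i0)"
  have "?k \<le> kmax" using i0 unfolding kmax_def by auto
  from Thw_tens[OF x Thw_col[OF this]]
  have T: "Thw (n + ?k) (\<lambda>i. h0 i + of_bool (?k > 0 \<and> up i (?k - 1))) (tens ?k x (col {..<?k}))" .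
  have e: "h0 i + of_bool (?k > 0 \<and> up i (?k - 1)) = h i" if "i \<in> idxs" for i
  proof -
    have "r - i0 < D" using i0 r_le_D by auto
    hence "up i (r - i0) \<longleftrightarrow> i = i0" using i0 unfolding up_def lab_def by auto
    thus ?thesis unfolding h0_def by auto
  qed
  have "Thw (n + ?k) h (tens ?k x (col {..<?k}))" using T by (subst (asm) Thw_cong[OF e])
  thus ?case by blast
qed

section \<open>The invariant of the symplectic vector module\<close>

text \<open>Coefficients of the invariant \<open>winv\<close>, which pairs the letter a with its
  dual letter D - a. The recursion makes the two contributions to \<open>TE i winv\<close> on a
  slice cancel, one from raising the dual letter and one from the head a + 1.\<close>

primrec om :: "nat \<Rightarrow> ratq" where
  "om 0 = 1"
| "om (Suc a) = - om a / vi (lab a)"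

lemma om_nonzero: "om a \<noteq> 0"
  by (induction a) auto

definition winv :: tvec where
  "winv = nuc (\<lambda>a. if a \<le> D then tscale (om a) (tn (D - a) (col {})) else 0)"

lemma col_empty: "TE i (col {}) = 0" "TK i (col {}) = col {}" "col {} \<in> Tn 0" "col {} \<noteq> 0"
proof -
  show "TE i (col {}) = 0" by (rule tvec_eqI) (simp_all add: sl_TE sl_col sl_zero tvec_apply)
  show "TK i (col {}) = col {}" using TK_col[of "{}" i] by simp
  show "col {} \<in> Tn 0" using col_Tn[of "{}"] by simp
  show "col {} \<noteq> 0" by (rule col_nonzero) simp
qed

lemma winv_hw:
  assumes C: "X = Type_C"
  shows "Thw 2 (\<lambda>i. 0) winv"
proof -
  have D: "D = 2 * r - 1" using D_eq C by simp
  have labs: "lab (D - 1 - a) = lab a" if "a < D" for a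
    using that D rank_pos unfolding lab_def by auto
  have dn: "dn i (D - a) \<longleftrightarrow> up i a" if "a \<le> D" for i a
    using that labs[of a] unfolding dn_def up_def by auto
  have up: "up i (D - a) \<longleftrightarrow> dn i a" if "a \<le> D" for i a
    using dn[of "D - a" i] that by simp
  have pr: "pr i (D - a) = - pr i a" if "a \<le> D" for i a
    unfolding pr_def using dn[OF that] up[OF that] by simp
  have "winv \<in> Tn (Suc (Suc 0))" unfolding winv_def Tn_Suc_iff[of _ "Suc 0"]
    by (auto intro!: Tn_closed tn_Tn[of _ _ 0] col_empty)
  moreover have "winv \<noteq> 0"
  proof
    assume "winv = 0"
    hence "sl 0 winv = 0" by (simp add: sl_zero)
    hence "tn D (col {}) = 0" unfolding winv_def by simp
    hence "sl D (tn D (col {})) = 0" by (simp add: sl_zero)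
    thus False using col_empty(4) by (simp add: sl_tn)
  qed
  moreover have "TE i winv = 0" for i
  proof (rule tvec_eqI)
    fix a
    have "sl a (TE i winv) = 0"
    proof (cases "a \<le> D")
      case True
      show ?thesis
      proof (cases "up i a")
        case u: True
        hence a: "a < D" "lab a = i" "dn i (D - a)" using dn[OF True] by (auto simp: up_def)
        have "sl a (TE i winv) = tscale (inverse (vi i) * om a) (tn (D - a - 1) (col {})) + tscale (om (Suc a)) (tn (D - Suc a) (col {}))"
          unfolding sl_TE winv_def nuc_simps using True u a
          by (simp add: T_linear TE_tn col_empty tn_linear)
        also have "D - Suc a = D - a - 1" by simp
        also have "tscale (inverse (vi i) * om a) (tn (D - a - 1) (col {})) + tscale (om (Suc a)) (tn (D - a - 1) (col {})) =
           tscale (inverse (vi i) * om a + om (Suc a)) (tn (D - a - 1) (col {}))" by (simp only: tscale_distribs)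
        also have "inverse (vi i) * om a + om (Suc a) = 0" using a(2) by (simp add: divide_inverse)
        finally show ?thesis by simp
      next
        case False
        thus ?thesis unfolding sl_TE winv_def nuc_simps using True dn[OF True, of i]
          by (simp add: T_linear TE_tn col_empty tn_linear)
      qed
    next
      case False
      hence "\<not> up i a" by (simp add: up_def)
      thus ?thesis unfolding sl_TE winv_def nuc_simps using False by simp
    qed
    thus "sl a (TE i winv) = sl a 0" by (simp add: sl_zero)
  qed (simp add: tvec_apply)
  moreover have "TK i winv = winv" for i
  proof (rule tvec_eqI)
    fix a
    show "sl a (TK i winv) = sl a winv"
      unfolding sl_TK winv_def nuc_simps using pr[of a i]
      by (simp add: T_linear TK_tn col_empty power_int_minus)
  qed (simp add: winv_def)
  ultimately show ?thesis unfolding Thw_def by (simp add: numeral_2_eq_2)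
qed

section \<open>Highest weight vectors in the product with the vector module\<close>

text \<open>The intertwiner is applied to every slice of Z. As it commutes with E_i and K_i, the
  result is again highest of the same weight, now with all slices in \<open>tU x\<close>; the
  condition \<open>nz\<close> says that slice j is not killed.\<close>

lemma map_hw:
  assumes u: "Thw m h u" and x: "Thw n h x"
    and Z: "Thw (Suc m) (\<lambda>i. h i + pr i j) Z" and j: "j \<le> D" and nz: "dot m (sl j Z) u \<noteq> 0"
  shows "\<exists>Y. Thw (Suc n) (\<lambda>i. h i + pr i j) Y \<and> (\<forall>a. sl a Y \<in> tU x)"
proof -
  interpret M: hw_module X r tscale TE TF TK TKi h x by (rule Thw_module[OF x])
  interpret N: hw_module X r tscale TE TF TK TKi h u by (rule Thw_module[OF u])
  obtain Q where Q: "\<And>f g. Q (f + g) = Q f + Q g" "\<And>c f. Q (tscale c f) = tscale c (Q f)"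
    "\<And>z. Q z \<in> tU x" "\<And>z J. set J \<subseteq> idxs \<Longrightarrow> dot n (Q z) (tFI x J) = dot m z (tFI u J)"
    "\<And>z i. i \<in> idxs \<Longrightarrow> Q (TE i z) = TE i (Q z)" "\<And>z i. i \<in> idxs \<Longrightarrow> Q (TF i z) = TF i (Q z)"
    "\<And>z i. i \<in> idxs \<Longrightarrow> Q (TK i z) = TK i (Q z)"
    by (rule intertwiner_exists[OF u x], rule that; assumption)
  have Q0: "Q 0 = 0" using Q(2)[of 0 0] by simp
  define Y where "Y = nuc (\<lambda>a. Q (sl a Z))"
  have Z': "Z \<in> Tn (Suc m)" "\<And>i. i \<in> idxs \<Longrightarrow> TE i Z = 0"
    "\<And>i. i \<in> idxs \<Longrightarrow> TK i Z = tscale (vi i powi (h i + pr i j)) Z" using Z unfolding Thw_def by auto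
  have "Y \<in> Tn (Suc n)"
    unfolding Tn_Suc_iff Y_def using tU_Tn[OF x Q(3)] Z'(1) Q0 unfolding Tn_Suc_iff by auto
  moreover have "Y \<noteq> 0"
  proof
    assume "Y = 0"
    hence "Q (sl j Z) = 0" using nuc_simps(2)[of j "\<lambda>a. Q (sl a Z)"] unfolding Y_def by (metis sl_zero)
    hence "dot n 0 (tFI x []) = dot m (sl j Z) (tFI u [])" using Q(4)[of "[]" "sl j Z"] by simp
    thus False using nz by simp
  qed
  moreover have "TE i Y = 0" if i: "i \<in> idxs" for i
  proof (rule tvec_eqI)
    fix a
    have "sl a (TE i Y) = Q (sl a (TE i Z))"
      unfolding sl_TE Y_def nuc_simps Q Q(5)[OF i, symmetric] by (simp add: Q0)
    thus "sl a (TE i Y) = sl a 0" using Z'(2)[OF i] Q0 by (simp add: sl_zero)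
  qed (simp add: tvec_apply)
  moreover have "TK i Y = tscale (vi i powi (h i + pr i j)) Y" if i: "i \<in> idxs" for i
  proof (rule tvec_eqI)
    fix a
    have "sl a (TK i Y) = Q (sl a (TK i Z))"
      unfolding sl_TK Y_def nuc_simps Q Q(7)[OF i, symmetric] ..
    thus "sl a (TK i Y) = sl a (tscale (vi i powi (h i + pr i j)) Y)"
      using Z'(3)[OF i] by (simp add: sl_tscale Y_def Q)
  qed (simp add: Y_def tvec_apply)
  ultimately have "Thw (Suc n) (\<lambda>i. h i + pr i j) Y" unfolding Thw_def by blast
  moreover have "sl a Y \<in> tU x" for a unfolding Y_def by (simp add: Q(3))
  ultimately show ?thesis by blast
qed

lemma Thw_self_dot: "Thw n h x \<Longrightarrow> dot n x x \<noteq> 0"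
  using anisotropic[of x n] unfolding Thw_def by blast

lemma sl_col_top: "sl k (col {..<Suc k}) = col {..<k}"
proof -
  have "card {s\<in>{..<Suc k}. s > k} = 0" by (subst card_0_eq) auto
  moreover have "{..<Suc k} - {k} = {..<k}" by auto
  ultimately show ?thesis unfolding sl_col by (simp only: lessThan_iff lessI if_True power_0 tscale_simps)
qed

text \<open>For a letter adding a box, the vector comes from the product of a highest weight vector with
  \<open>col\<close>; the remaining letters (type C) are reached by contracting with \<open>winv\<close>.\<close>

lemma step_exists:
  assumes x: "Thw n h x" and j: "j \<le> D" and h: "\<And>i. i \<in> idxs \<Longrightarrow> h i \<ge> 0" "\<And>i. i \<in> idxs \<Longrightarrow> h i + pr i j \<ge> 0"
  shows "\<exists>Y. Thw (Suc n) (\<lambda>i. h i + pr i j) Y \<and> (\<forall>a. sl a Y \<in> tU x)"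
proof (cases "j < kmax")
  case True
  \<comment> \<open>A column of size j is taken out of h; putting one of size j + 1 in its place
    adds exactly the letter j.\<close>
  define h' where "h' i = h i - of_bool (j > 0 \<and> up i (j - 1))" for i
  have du: "j > 0 \<and> up i (j - 1) \<longleftrightarrow> dn i j" for i
    using dn_pred[of i j] up_Suc[of i "j - 1"] by auto
  have "h' i \<ge> 0" if "i \<in> idxs" for i
    using h(2)[OF that] h(1)[OF that] unfolding h'_def du by (cases "dn i j") auto
  then obtain n' x' where x': "Thw n' h' x'" using dominant_weight_exists by blast
  have u: "Thw (n' + j) h (tens j x' (col {..<j}))"
    using Thw_tens[OF x' Thw_col[of j]] True by (simp add: h'_def)
  have "Thw (n' + Suc j) (\<lambda>i. h' i + of_bool (Suc j > 0 \<and> up i (Suc j - 1))) (tens (Suc j) x' (col {..<Suc j}))"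
    by (rule Thw_tens[OF x' Thw_col]) (use True in simp)
  moreover have "h' i + of_bool (Suc j > 0 \<and> up i (Suc j - 1)) = h i + pr i j" for i
    unfolding h'_def du pr_def by simp
  ultimately have Z: "Thw (Suc (n' + j)) (\<lambda>i. h i + pr i j) (tens (Suc j) x' (col {..<Suc j}))" by simp
  show ?thesis
    by (rule map_hw[OF u x Z j]) (simp add: sl_tens sl_col_top Thw_self_dot[OF u])
next
  case False
  have "j \<le> r \<Longrightarrow> X = Type_A \<Longrightarrow> False" using False unfolding kmax_def by auto
  hence C: "X = Type_C" using j D_eq by (cases X) auto
  have D: "D = 2 * r - 1" using D_eq C by simp
  define b where "b = D - j"
  have "r \<le> j" using False C unfolding kmax_def by simp
  hence b: "j = D - b" "b < r" "b \<le> D" using j D rank_pos unfolding b_def by arith+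
  have b4: "Suc b \<le> kmax" using b(2) C unfolding kmax_def by simp
  have labs: "lab (D - 1 - a) = lab a" if "a < D" for a
    using that D rank_pos unfolding lab_def by auto
  have dn: "dn i j \<longleftrightarrow> up i b" for i
    using b labs[of b] unfolding dn_def up_def by auto
  have up: "up i j \<longleftrightarrow> dn i b" for i
    using b(1,3) labs[of j] unfolding dn_def up_def by auto
  \<comment> \<open>The letter j = D - b has the weight opposite to that of b. Hence a column of
    size b + 1 is taken out of h and replaced by one of size b, and the invariant supplies the two
    missing tensor factors.\<close>
  define h' where "h' i = h i - of_bool (up i b)" for i
  have "h' i \<ge> 0" if "i \<in> idxs" for i
    using h(2)[OF that] h(1)[OF that] unfolding h'_def dn[symmetric] by (cases "dn i j") auto
  then obtain n' x' where x': "Thw n' h' x'" using dominant_weight_exists by blast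
  have u: "Thw (n' + Suc b) h (tens (Suc b) x' (col {..<Suc b}))"
    using Thw_tens[OF x' Thw_col[OF b4]] by (simp add: h'_def)
  let ?y = "tens b x' (col {..<b})"
  have y: "Thw (n' + b) (\<lambda>i. h' i + of_bool (b > 0 \<and> up i (b - 1))) ?y"
    by (rule Thw_tens[OF x' Thw_col]) (use b4 in simp)
  have du: "b > 0 \<and> up i (b - 1) \<longleftrightarrow> dn i b" for i
    using dn_pred[of i b] up_Suc[of i "b - 1"] by auto
  have "Thw (n' + b + 2) (\<lambda>i. h' i + of_bool (b > 0 \<and> up i (b - 1)) + 0) (tens 2 ?y winv)"
    by (rule Thw_tens[OF y winv_hw[OF C]])
  moreover have "h' i + of_bool (b > 0 \<and> up i (b - 1)) + 0 = h i + pr i j" for i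
    unfolding h'_def du pr_def dn up by simp
  ultimately have Z: "Thw (Suc (n' + Suc b)) (\<lambda>i. h i + pr i j) (tens 2 ?y winv)" by simp
  have t1: "tens (Suc 0) ?y (tn b (col {})) = tn b ?y"
    by (rule tvec_eqI) (simp add: tens_def, simp add: sl_tens sl_tn tens_0 col_Nil tens_linear tvec_apply)
  have "sl j (tens 2 ?y winv) = tscale (om j) (tn b ?y)"
    unfolding numeral_2_eq_2 sl_tens winv_def nuc_simps using j b by (simp add: tens_linear t1)
  hence "dot (n' + Suc b) (sl j (tens 2 ?y winv)) (tens (Suc b) x' (col {..<Suc b})) = om j * dot (Suc (n' + b)) (tn b ?y) (tens (Suc b) x' (col {..<Suc b}))"
    by (simp add: dot_tscale)
  also have "dot (Suc (n' + b)) (tn b ?y) (tens (Suc b) x' (col {..<Suc b})) = dot (n' + b) ?y ?y"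
  proof -
    have "dot (Suc (n' + b)) (tn b ?y) (tens (Suc b) x' (col {..<Suc b})) = (\<Sum>a\<le>D. if a = b then dot (n' + b) ?y ?y else 0)"
      unfolding dot_Suc sl_tn sl_tens by (intro sum.cong) (auto simp: sl_col_top)
    thus ?thesis using b by (simp add: sum.delta)
  qed
  finally have "dot (n' + Suc b) (sl j (tens 2 ?y winv)) (tens (Suc b) x' (col {..<Suc b})) \<noteq> 0"
    using om_nonzero Thw_self_dot[OF y] by simp
  thus ?thesis by (rule map_hw[OF u x Z j])
qed

end

section \<open>Lifting dominant words to highest weight vectors\<close>

context nondeg_chain
begin

abbreviation hpf :: "nat list \<Rightarrow> nat \<Rightarrow> int" where "hpf d \<equiv> (\<lambda>i. hp i d)"

definition lifts :: "nat \<Rightarrow> bool" where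
  "lifts n \<longleftrightarrow> (\<forall>d\<in>Wd n. dominant d \<longrightarrow> (\<exists>x. Thw n (hpf d) x \<and> congr x d))"

lemma eigen_supp: "TK i f = tscale (vi i powi a) f \<Longrightarrow> f w \<noteq> 0 \<Longrightarrow> hp i w = a"
proof -
  assume h: "TK i f = tscale (vi i powi a) f" "f w \<noteq> 0"
  have "TK i f w = tscale (vi i powi a) f w" using h by simp
  hence "vi i powi hp i w = vi i powi a" using h(2) by (simp add: TK_apply tscale_apply)
  thus ?thesis using qpar_powi_inj[OF qpar_qi] by blast
qed

lemma tU_weight_part:
  assumes x: "Thw n h x" and z: "z \<in> tU x"
  shows "\<exists>c. \<forall>w. (\<forall>i\<in>idxs. hp i w = h i) \<longrightarrow> z w = c * x w"
proof -
  interpret M: hw_module X r tscale TE TF TK TKi h x by (rule Thw_module[OF x])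
  obtain cs where cs: "okc cs" "z = tev x cs" using z unfolding M.U_def by auto
  have "tev x cs w = topc cs * x w" if w: "\<forall>i\<in>idxs. hp i w = h i" for w
    using cs(1)
  proof (induction cs)
    case Nil show ?case unfolding M.ev_simps by (simp add: topc_def zero_fun_apply)
  next
    case (Cons a cs)
    obtain c J where a: "a = (c, J)" by (cases a)
    have "tFI x J w = 0" if J: "J \<noteq> []" "set J \<subseteq> idxs"
    proof (rule ccontr)
      assume nz: "tFI x J w \<noteq> 0"
      obtain i where i: "i \<in> idxs" "(\<Sum>j\<leftarrow>J. ca i j) \<noteq> 0" using nondeg[OF J] by blast
      have "hp i w = h i - (\<Sum>j\<leftarrow>J. ca i j)" by (rule eigen_supp[OF TK_tFI[OF x i(1) that(2)] nz])
      thus False using w i by simp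
    qed
    moreover have "tev x ((c, J) # cs) w = c * tFI x J w + tev x cs w"
      unfolding M.ev_simps plus_fun_apply tscale_apply ..
    ultimately show ?case using Cons unfolding a by (cases "J = []") (auto simp: topc_def algebra_simps)
  qed
  thus ?thesis using cs by blast
qed

lemma tU_orth_hw:
  assumes x: "Thw n h x" and y: "Thw n h' y" and ne: "\<exists>i\<in>idxs. h i \<noteq> h' i" and z: "z \<in> tU x"
  shows "dot n z y = 0"
proof -
  interpret M: hw_module X r tscale TE TF TK TKi h x by (rule Thw_module[OF x])
  obtain cs where cs: "okc cs" "z = tev x cs" using z unfolding M.U_def by auto
  have Ey: "\<forall>i\<in>idxs. TE i y = 0" using y by (simp add: Thw_def)
  obtain i where i: "i \<in> idxs" "h i \<noteq> h' i" using ne by blast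
  have xy: "dot n x y = 0" using dot_weight[of i x "h i" y "h' i" n] x y i unfolding Thw_def by blast
  have "dot n (tev x cs) y = 0" using cs(1)
  proof (induction cs)
    case (Cons a cs)
    obtain c J where a: "a = (c, J)" by (cases a)
    show ?case using Cons dot_tFI_hw[OF x, of J y] Ey xy unfolding a
      by (cases "J = []") (auto simp: dot_add dot_tscale)
  qed simp
  thus ?thesis using cs by simp
qed

text \<open>A dominant word in the reduction of a vector of the submodule generated by \<open>x\<close> lifts to a
  highest weight vector, which is orthogonal to the submodule unless the weights agree.\<close>

lemma dominant_residue:
  assumes L: "lifts n" and x: "Thw n (hpf b) x" "congr x b" "b \<in> Wd n"
    and z: "z \<in> tU x" "reg z" and d: "d \<in> Wd n" "dominant d" "ev0 (z d) \<noteq> 0"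
  shows "d = b"
proof (cases "\<exists>i\<in>idxs. hp i b \<noteq> hp i d")
  case True
  obtain y where y: "Thw n (hpf d) y" "congr y d" using L d unfolding lifts_def by blast
  have "dot n z y = 0" by (rule tU_orth_hw[OF x(1) y(1) True z(1)])
  moreover have "ev0 (dot n z y) = ev0 (z d)" using ev0_dot_congr[OF z(2) y(2) d(1)] by blast
  ultimately show ?thesis using d(3) by simp
next
  case False
  obtain c where c: "\<forall>w. (\<forall>i\<in>idxs. hp i w = hp i b) \<longrightarrow> z w = c * x w"
    using tU_weight_part[OF x(1) z(1)] by blast
  have zb: "z b = c * x b" and zd: "z d = c * x d" using c False by auto
  have xb: "x b \<in> regular_at_0" "ev0 (x b) = 1" "\<And>w. x w \<in> regular_at_0 \<and> ev0 (x w) = of_bool (w = b)"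
    using x(2) unfolding congr_def reg_def by auto
  have "x b \<noteq> 0" using xb(2) by auto
  hence "c = z b / x b" using zb by simp
  hence "c \<in> regular_at_0" using regular_divide[of "z b" "x b"] z(2) xb unfolding reg_def by simp
  hence "ev0 (z d) = ev0 c * of_bool (d = b)" unfolding zd using regular_mult[of c "x d"] xb(3) by simp
  thus ?thesis using d(3) by (auto split: if_splits)
qed

lemma ihw_residue:
  assumes i: "i \<in> idxs" and y: "ihw n i m y" "reg y" and e: "e \<in> Wd n" "ev0 (y e) \<noteq> 0"
  shows "ep i e = 0 \<and> hp i e = m"
proof -
  have "cf n i y e \<noteq> 0" using cf_regular[OF y(2) e(1), of i] e(2) by auto
  thus ?thesis using ihw_supp[OF i y(1) e(1)] by blast
qed

text \<open>The vector from \<open>step_exists\<close>, once scaled, has nonzero residue. A word in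
  the residue is dominant of the given weight; its tail is dominant and occurs in the residue of a
  vector of \<open>tU x\<close>, so it is d' by \<open>dominant_residue\<close>, and then the weight
  determines the head by \<open>pr_inj\<close>. The residue is therefore the single word d.\<close>

lemma lifts_all: "lifts n"
proof (induction n)
  case 0
  have "congr (col {}) []" unfolding congr_def reg_def
  proof (intro conjI allI)
    fix u show "col {} u \<in> regular_at_0" "ev0 (col {} u) = of_bool (u = [])"
      by (cases u; simp add: col_def)+
  qed
  moreover have "Thw 0 (hpf []) (col {})" using col_empty unfolding Thw_def by simp
  ultimately show ?case unfolding lifts_def Wd_0 by blast
next
  case (Suc n)
  show ?case unfolding lifts_def
  proof (intro ballI impI)
    fix d assume d: "d \<in> Wd (Suc n)" "dominant d"
    then obtain a d' where da: "d = a # d'" "a \<le> D" "d' \<in> Wd n" unfolding Wd_Suc by auto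
    have dom: "dominant d'" "\<And>i. i \<in> idxs \<Longrightarrow> hp i d' + pr i a \<ge> 0" using d(2) unfolding da dominant_Cons by auto
    obtain x where x: "Thw n (hpf d') x" "congr x d'" using Suc.IH dom(1) da(3) unfolding lifts_def by blast
    have "hp i d' \<ge> 0" if "i \<in> idxs" for i using dominant_hp[OF dom(1) that] by simp
    then obtain Y where Y: "Thw (Suc n) (\<lambda>i. hp i d' + pr i a) Y" "\<And>a. sl a Y \<in> tU x"
      using step_exists[OF x(1) da(2)] dom(2) by blast
    have YT: "Y \<in> Tn (Suc n)" "Y \<noteq> 0" using Y(1) unfolding Thw_def by auto
    obtain w where w: "w \<in> Wd (Suc n)" "Y w \<noteq> 0" "reg (tscale (inverse (Y w)) Y)"
      using reg_scaling[OF YT] by blast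
    let ?Y = "tscale (inverse (Y w)) Y"
    have Y': "Thw (Suc n) (hpf d) ?Y"
      using Y(1) w(2) unfolding Thw_def da by (auto simp: T_linear Tn_closed mult.commute add.commute)
    have res: "e = d" if e: "e \<in> Wd (Suc n)" "ev0 (?Y e) \<noteq> 0" for e
    proof -
      have E: "ep i e = 0 \<and> hp i e = hp i d" if i: "i \<in> idxs" for i
        by (rule ihw_residue[OF i _ w(3) e]) (use Y' i in \<open>auto simp: ihw_def Thw_def\<close>)
      hence de: "dominant e" unfolding dominant_def by blast
      obtain k e' where k: "e = k # e'" "k \<le> D" "e' \<in> Wd n" using e(1) unfolding Wd_Suc by auto
      have "sl k ?Y \<in> tU x" unfolding sl_tscale by (intro tU_closed[OF x(1)] Y(2))
      moreover have "reg (sl k ?Y)" using w(3) unfolding reg_def by (simp add: sl_apply)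
      moreover have "ev0 (sl k ?Y e') \<noteq> 0" using e(2) k(1) by (simp add: sl_apply)
      moreover have "dominant e'" using de unfolding k dominant_Cons by blast
      ultimately have e': "e' = d'" using dominant_residue[OF Suc.IH x(1,2) da(3)] k(3) by blast
      have "pr i k = pr i a" if "i \<in> idxs" for i using E[OF that] unfolding k da e' by simp
      hence "k = a" using pr_inj[OF k(2) da(2)] by blast
      thus ?thesis using k da e' by simp
    qed
    have one: "?Y w = 1" using w(2) by (simp add: tvec_apply)
    hence "w = d" using res[OF w(1)] by simp
    have "congr ?Y d" unfolding congr_def
    proof (intro conjI allI w(3))
      fix u
      show "ev0 (?Y u) = of_bool (u = d)"
      proof (cases "u = d")
        case True thus ?thesis using one \<open>w = d\<close> by simp
      next
        case False
        have "?Y \<in> Tn (Suc n)" using Y' unfolding Thw_def by blast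
        hence "ev0 (?Y u) = 0" using res[of u] False by (cases "u \<in> Wd (Suc n)") (auto simp: Tn_def)
        thus ?thesis using False by simp
      qed
    qed
    thus "\<exists>x. Thw (Suc n) (hpf d) x \<and> congr x d" using Y' by blast
  qed
qed

inductive_set reach :: "nat list \<Rightarrow> nat list set" for b where
  reach_base: "b \<in> reach b"
| reach_step: "d \<in> reach b \<Longrightarrow> i \<in> idxs \<Longrightarrow> ph i d > 0 \<Longrightarrow> fw i d \<in> reach b"

lemma reach_Wd: "d \<in> reach b \<Longrightarrow> b \<in> Wd n \<Longrightarrow> d \<in> Wd n"
  by (induction rule: reach.induct) (auto intro: fw_Wd)

text \<open>Induction on the letter sum. A residue at a word that is not dominant moves to a smaller
  word under a Kashiwara operator, which preserves the hypotheses because \<open>reach b\<close> is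
  closed under lowering. Among dominant words only b can occur, and b is reachable.\<close>

lemma residue_vanishes:
  assumes x: "Thw n (hpf b) x" "congr x b" "b \<in> Wd n"
  shows "z \<in> tU x \<Longrightarrow> reg z \<Longrightarrow> (\<And>d. d \<in> reach b \<Longrightarrow> ev0 (z d) = 0) \<Longrightarrow> ev0 (z w) = 0"
proof (induction "sum_list w" arbitrary: z w rule: less_induct)
  case less
  show ?case
  proof (cases "w \<in> Wd n")
    case False
    thus ?thesis using tU_Tn[OF x(1) less.prems(1)] unfolding Tn_def by simp
  next
    case w: True
    show ?thesis
    proof (cases "dominant w")
      case True
      thus ?thesis using dominant_residue[OF lifts_all x less.prems(1,2) w True] less.prems(3) reach_base by blast
    next
      case False
      then obtain i where i: "i \<in> idxs" "ep i w > 0" unfolding dominant_def by auto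
      have p: "fw i (ew i w) = w" "ph i (ew i w) > 0" "sum_list (ew i w) < sum_list w"
        using ew_props[OF i(2)] by auto
      have "ev0 (et n i z (ew i w)) = 0"
      proof (rule less.hyps[OF p(3)])
        show "et n i z \<in> tU x" by (rule tU_kashiwara[OF x(1) less.prems(1) i(1)])
        show "reg (et n i z)" by (rule et_regular[OF less.prems(2)])
        fix d assume d: "d \<in> reach b"
        show "ev0 (et n i z d) = 0"
          using et_regular(2)[OF less.prems(2) reach_Wd[OF d x(3)], of i] less.prems(3)[of "fw i d"] reach_step[OF d i(1)] by auto
      qed
      thus ?thesis using et_regular(2)[OF less.prems(2) ew_Wd[OF w], of i i] p by simp
    qed
  qed
qed

end

section \<open>Root data\<close>

lemma cpair_linear: "cpair (x + y) a = cpair x a + cpair y a" "cpair (x - y) a = cpair x a - cpair y a"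
  "cpair (c *\<^sub>R x) a = c * cpair x a" "cpair 0 a = 0"
  by (simp_all add: cpair_def inner_add_left inner_diff_left algebra_simps add_divide_distrib diff_divide_distrib)

lemma cpair_sum: "cpair (\<Sum>x\<in>S. f x) a = (\<Sum>x\<in>S. cpair (f x) a)"
  by (induction S rule: infinite_finite_induct) (auto simp: cpair_linear)

lemma cpair_sum_list: "cpair (\<Sum>x\<leftarrow>xs. f x) a = (\<Sum>x\<leftarrow>xs. cpair (f x) a)"
  by (induction xs) (auto simp: cpair_linear)

locale root_datum_loc =
  fixes R :: "'a::euclidean_space root_datum"
  assumes rd: "root_datum_AC R"
begin

abbreviation "al \<equiv> sroot R"

lemma idx_eq: "idx R = {1..rk R}"
  by (simp add: idx_def)

lemma rk_pos: "1 \<le> rk R" and rs: "root_system (roots R)" and ss: "simple_system R"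
  and cart: "i \<in> idx R \<Longrightarrow> j \<in> idx R \<Longrightarrow> cpair (al j) (al i) = of_int (cartan_int (ctype R) i j)"
  using rd unfolding root_datum_AC_def by auto

lemma al_root: "i \<in> idx R \<Longrightarrow> al i \<in> roots R"
  using ss unfolding simple_system_def by auto

lemma al_nz: "i \<in> idx R \<Longrightarrow> al i \<noteq> 0"
  using al_root[of i] rs unfolding root_system_def by auto

lemma span_simple: "span (al ` idx R) = UNIV"
proof -
  have "b \<in> span (al ` idx R)" if b: "b \<in> roots R" for b
  proof -
    obtain c :: "nat \<Rightarrow> nat" where "b = (\<Sum>i\<in>idx R. real (c i) *\<^sub>R al i) \<or> b = - (\<Sum>i\<in>idx R. real (c i) *\<^sub>R al i)"
      using ss b unfolding simple_system_def by blast
    moreover have "(\<Sum>i\<in>idx R. real (c i) *\<^sub>R al i) \<in> span (al ` idx R)"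
      by (intro span_sum span_scale span_base) auto
    ultimately show ?thesis using span_neg by auto
  qed
  hence "roots R \<subseteq> span (al ` idx R)" by blast
  hence "span (roots R) \<subseteq> span (al ` idx R)" by (metis span_mono span_span)
  thus ?thesis using rs unfolding root_system_def by auto
qed

lemma cpair_eq_0: "i \<in> idx R \<Longrightarrow> cpair x (al i) = 0 \<longleftrightarrow> x \<bullet> al i = 0"
  using al_nz[of i] by (simp add: cpair_def)

lemma weight_eqI:
  assumes "\<And>i. i \<in> idx R \<Longrightarrow> cpair x (al i) = cpair y (al i)"
  shows "x = y"
proof -
  have "(x - y) \<bullet> z = 0" if "z \<in> span (al ` idx R)" for z
    using that
  proof (induction rule: span_induct_alt)
    case (step c a z)
    then obtain i where "i \<in> idx R" "a = al i" by auto
    hence "(x - y) \<bullet> a = 0" using assms[of i] cpair_eq_0[of i "x - y"] by (simp add: cpair_linear)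
    thus ?case using step by (simp add: inner_add_right)
  qed simp
  hence "(x - y) \<bullet> (x - y) = 0" using span_simple by blast
  thus ?thesis by simp
qed

lemma sum_list_count:
  "set J \<subseteq> A \<Longrightarrow> finite A \<Longrightarrow> (\<Sum>j\<leftarrow>J. f j :: 'a) = (\<Sum>j\<in>A. real (count_list J j) *\<^sub>R f j)"
proof (induction J)
  case (Cons a J)
  have "(\<Sum>j\<in>A. real (count_list (a # J) j) *\<^sub>R f j) = (\<Sum>j\<in>A. (if j = a then f a else 0) + real (count_list J j) *\<^sub>R f j)"
    by (intro sum.cong HOL.refl) (auto simp: algebra_simps)
  also have "\<dots> = f a + (\<Sum>j\<in>A. real (count_list J j) *\<^sub>R f j)"
    using Cons.prems by (simp add: sum.distrib sum.delta)
  finally show ?case using Cons by simp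
qed simp

lemma nondeg_al:
  assumes "J \<noteq> []" "set J \<subseteq> idx R"
  shows "\<exists>i\<in>idx R. (\<Sum>j\<leftarrow>J. cartan_int (ctype R) i j) \<noteq> 0"
proof (rule ccontr)
  assume h: "\<not> ?thesis"
  let ?b = "\<Sum>j\<leftarrow>J. al j"
  have "cpair ?b (al i) = of_int (\<Sum>j\<leftarrow>J. cartan_int (ctype R) i j)" if "i \<in> idx R" for i
    using assms(2) by (induction J) (auto simp: cpair_linear cart[OF that])
  hence "?b = 0" using weight_eqI[of ?b 0] h by (simp add: cpair_linear)
  hence z: "(\<Sum>j\<in>idx R. real (count_list J j) *\<^sub>R al j) = 0"
    using sum_list_count[OF assms(2), of al] by (simp add: idx_eq)
  obtain j0 where j0: "j0 \<in> set J" using assms(1) by (cases J) auto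
  have ind: "independent (al ` idx R)" and inj: "inj_on al (idx R)" using ss unfolding simple_system_def by auto
  have "(\<Sum>v\<in>al ` idx R. real (count_list J (the_inv_into (idx R) al v)) *\<^sub>R v) = 0"
    using z by (subst sum.reindex[OF inj]) (simp add: the_inv_into_f_f[OF inj])
  hence "real (count_list J (the_inv_into (idx R) al (al j0))) = 0"
    using ind j0 assms(2) by (intro independentD[OF ind, of "al ` idx R"]) (auto simp: idx_eq)
  hence "count_list J j0 = 0" using the_inv_into_f_f[OF inj, of j0] j0 assms(2) by auto
  thus False using j0 by (simp add: count_list_0_iff)
qed

sublocale nondeg_chain "ctype R" "rk R"
  by unfold_locales (use rk_pos nondeg_al idx_eq in auto)

lemma weight_lattice_diff: "x \<in> weight_lattice R \<Longrightarrow> i \<in> idx R \<Longrightarrow> x - al i \<in> weight_lattice R"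
  using rs al_root unfolding weight_lattice_def root_system_def by (auto simp: cpair_linear)

end

context letter_chain
begin

lemma dominant_column: "dominant w \<Longrightarrow> k \<le> Suc D \<Longrightarrow> dominant (rev [0..<k] @ w) \<and>
   (\<forall>i. hp i (rev [0..<k] @ w) = hp i w + of_bool (k > 0 \<and> up i (k - 1)))"
proof (induction k)
  case (Suc k)
  have e: "hp i (rev [0..<k] @ w) = hp i w + (\<Sum>s<k. pr i s)" for i
    using Suc sum_pr[of k i] by simp
  have h: "hp i (rev [0..<Suc k] @ w) = hp i w + of_bool (Suc k > 0 \<and> up i (Suc k - 1))" for i
    using e[of i] sum_pr[OF Suc.prems(2), of i] by simp
  have "hp i (rev [0..<k] @ w) + pr i k \<ge> 0" if "i \<in> idxs" for i
    using h[of i] dominant_hp[OF Suc.prems(1) that] by (cases "up i k") auto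
  thus ?case using Suc h by (simp add: dominant_Cons)
qed simp

text \<open>The combinatorial counterpart of \<open>dominant_weight_exists\<close>: the column of a
  fundamental weight becomes the word with letters 0, ..., r - i, reversed because the head of a
  list is the last factor.\<close>

lemma dominant_word_exists:
  "(\<And>i. i \<in> idxs \<Longrightarrow> h i \<ge> 0) \<Longrightarrow> \<exists>n. \<exists>w\<in>Wd n. dominant w \<and> (\<forall>i\<in>idxs. hp i w = h i)"
proof (induction "\<Sum>i\<in>idxs. nat (h i)" arbitrary: h)
  case 0
  hence "\<forall>i\<in>idxs. nat (h i) = 0" using sum_eq_0_iff[of idxs "\<lambda>i. nat (h i)"] by auto
  hence "\<forall>i\<in>idxs. h i = 0" using 0(2) by force
  thus ?case by (intro exI[of _ 0] bexI[of _ "[]"]) (auto simp: Wd_0 dominant_def)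
next
  case (Suc k)
  have "\<exists>i\<in>idxs. h i > 0"
  proof (rule ccontr)
    assume "\<not> ?thesis"
    hence "(\<Sum>i\<in>idxs. nat (h i)) = 0" by (intro sum.neutral) auto
    thus False using Suc.hyps(2) by simp
  qed
  then obtain i0 where i0: "i0 \<in> idxs" "h i0 > 0" by blast
  define h0 where "h0 = h(i0 := h i0 - 1)"
  have "(\<Sum>i\<in>idxs. nat (h i)) = nat (h i0) + (\<Sum>i\<in>idxs - {i0}. nat (h i))"
    using i0 by (intro sum.remove) auto
  moreover have "(\<Sum>i\<in>idxs. nat (h0 i)) = nat (h0 i0) + (\<Sum>i\<in>idxs - {i0}. nat (h0 i))"
    using i0 by (intro sum.remove) auto
  moreover have "(\<Sum>i\<in>idxs - {i0}. nat (h0 i)) = (\<Sum>i\<in>idxs - {i0}. nat (h i))"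
    unfolding h0_def by (intro sum.cong) auto
  ultimately have "k = (\<Sum>i\<in>idxs. nat (h0 i))" using Suc.hyps(2) i0 unfolding h0_def by simp
  moreover have "\<And>i. i \<in> idxs \<Longrightarrow> h0 i \<ge> 0" using Suc.prems i0 unfolding h0_def by auto
  ultimately obtain n w where w: "w \<in> Wd n" "dominant w" "\<forall>i\<in>idxs. hp i w = h0 i"
    using Suc.hyps(1)[of h0] by blast
  let ?k = "Suc (r - i0)" and ?w = "rev [0..<Suc (r - i0)] @ w"
  have k: "?k \<le> Suc D" using r_le_D by simp
  have "?w \<in> Wd (?k + n)" using w(1) r_le_D unfolding Wd_def by auto
  moreover have "hp i ?w = h i" if "i \<in> idxs" for i
  proof -
    have "r - i0 < D" using i0 r_le_D by auto
    hence "up i (r - i0) \<longleftrightarrow> i = i0" using i0 unfolding up_def lab_def by auto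
    thus ?thesis using dominant_column[OF w(2) k] w(3) that unfolding h0_def by auto
  qed
  ultimately show ?case using dominant_column[OF w(2) k] by blast
qed

end

section \<open>The given module and its embedding into a tensor power\<close>

locale crystal_setup = root_datum_loc R
  for R :: "'a::euclidean_space root_datum" +
  fixes lam :: 'a and M :: "'v::ab_group_add qmodule" and L :: "'v set" and B :: "'v set set"
  assumes lamw: "lam \<in> weight_lattice R"
    and pos: "i \<in> idx R \<Longrightarrow> cpair lam (sroot R i) > 0"
    and cg: "crystal_graph_of R M lam L B"
begin

abbreviation "sc \<equiv> scl M"

lemma qm: "quantum_module R M" and irr: "irreducible_module R M" and hwm: "highest_weight_module R M lam"
  and cb: "crystal_basis R M L B"
  using cg unfolding crystal_graph_of_def by auto

sublocale vm: vector_space sc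
  using qm unfolding quantum_module_def by blast

lemma op_linear:
  assumes "i \<in> idxs"
  shows "Eop M i (x + y) = Eop M i x + Eop M i y" "Eop M i (sc c x) = sc c (Eop M i x)"
    "Fop M i (x + y) = Fop M i x + Fop M i y" "Fop M i (sc c x) = sc c (Fop M i x)"
    "Kop M i (x + y) = Kop M i x + Kop M i y" "Kop M i (sc c x) = sc c (Kop M i x)"
proof -
  have "Vector_Spaces.linear sc sc (Eop M i)" "Vector_Spaces.linear sc sc (Fop M i)" "Vector_Spaces.linear sc sc (Kop M i)"
    using qm assms unfolding quantum_module_def idx_eq by auto
  thus "Eop M i (x + y) = Eop M i x + Eop M i y" "Eop M i (sc c x) = sc c (Eop M i x)"
    "Fop M i (x + y) = Fop M i x + Fop M i y" "Fop M i (sc c x) = sc c (Fop M i x)"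
    "Kop M i (x + y) = Kop M i x + Kop M i y" "Kop M i (sc c x) = sc c (Kop M i x)"
    unfolding Vector_Spaces.linear_iff by blast+
qed

lemma bij_K: "i \<in> idxs \<Longrightarrow> bij (Kop M i)"
  using qm unfolding quantum_module_def idx_eq by auto

lemma invK: "i \<in> idxs \<Longrightarrow> inv (Kop M i) (Kop M i x) = x" "i \<in> idxs \<Longrightarrow> Kop M i (inv (Kop M i) x) = x"
  using bij_K[of i] by (simp_all add: bij_is_inj bij_is_surj surj_f_inv_f)

definition hl :: "nat \<Rightarrow> int" where
  "hl i = \<lfloor>cpair lam (al i)\<rfloor>"

lemma cpair_floor: "\<mu> \<in> weight_lattice R \<Longrightarrow> i \<in> idxs \<Longrightarrow> cpair \<mu> (al i) = of_int \<lfloor>cpair \<mu> (al i)\<rfloor>"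
  using al_root[of i] unfolding weight_lattice_def idx_eq by (auto simp: floor_of_int elim!: Ints_cases)

lemma cpair_lam: "i \<in> idxs \<Longrightarrow> cpair lam (al i) = of_int (hl i)"
  unfolding hl_def by (rule cpair_floor[OF lamw])

lemma hl_pos: "i \<in> idxs \<Longrightarrow> hl i > 0"
  using pos[of i] cpair_lam[of i] idx_eq by simp

lemma weight_space_iff: "v \<in> weight_space R M \<mu> \<longleftrightarrow> (\<forall>i\<in>idxs. Kop M i v = sc (vi i powi \<lfloor>cpair \<mu> (al i)\<rfloor>) v)"
  unfolding weight_space_def idx_eq by auto

lemma hw_moduleI:
  assumes "u \<noteq> 0" "u \<in> weight_space R M lam" "\<And>i. i \<in> idxs \<Longrightarrow> Eop M i u = 0"
  shows "hw_module (ctype R) (rk R) sc (Eop M) (Fop M) (Kop M) (\<lambda>i. inv (Kop M i)) hl u"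
proof (intro hw_module.intro hw_module_axioms.intro vm.vector_space_axioms)
  show "nondeg_chain (ctype R) (rk R)" by unfold_locales
  fix i j x assume ij: "i \<in> idxs" "j \<in> idxs"
  show "Kop M i (Fop M j x) = sc (vi i powi (- ca i j)) (Fop M j (Kop M i x))"
    using qm ij unfolding quantum_module_def idx_eq by blast
  have "Eop M i (Fop M j x) - Fop M j (Eop M i x) =
     (if i = j then sc (inverse (vi i - inverse (vi i))) (Kop M i x - inv (Kop M i) x) else 0)"
    using qm ij unfolding quantum_module_def idx_eq by blast
  thus "Eop M i (Fop M j x) = Fop M j (Eop M i x) +
     (if i = j then sc (inverse (vi i - inverse (vi i))) (Kop M i x - inv (Kop M i) x) else 0)"
    by (simp add: algebra_simps)
next
  fix i assume i: "i \<in> idxs"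
  show "Kop M i u = sc (vi i powi hl i) u" using assms(2) i unfolding weight_space_iff hl_def by blast
  show "Eop M i u = 0" by (rule assms(3)[OF i])
  show "inv (Kop M i) (Kop M i y) = y" for y by (rule invK(1)[OF i])
qed (rule op_linear assms(1); assumption)+

text \<open>By irreducibility every vector is a combination of monomials on u. Evaluating the same
  combination on x is independent of the chosen expression by \<open>transfer\<close>, and the
  kernel is a submodule without u, hence zero.\<close>

lemma phi_exists:
  assumes u: "u \<noteq> 0" "u \<in> weight_space R M lam" "\<And>i. i \<in> idxs \<Longrightarrow> Eop M i u = 0"
    and x: "Thw n hl x"
  obtains \<phi> where "\<And>v w. \<phi> (v + w) = \<phi> v + \<phi> w" "\<And>c v. \<phi> (sc c v) = tscale c (\<phi> v)"
    "\<And>v. \<phi> v = 0 \<Longrightarrow> v = 0" "\<And>v. \<phi> v \<in> tU x" "\<And>y. y \<in> tU x \<Longrightarrow> \<exists>v. \<phi> v = y"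
    "\<And>i v. i \<in> idxs \<Longrightarrow> \<phi> (Eop M i v) = TE i (\<phi> v)" "\<And>i v. i \<in> idxs \<Longrightarrow> \<phi> (Fop M i v) = TF i (\<phi> v)"
    "\<And>i v. i \<in> idxs \<Longrightarrow> \<phi> (Kop M i v) = TK i (\<phi> v)" "\<phi> u = x"
proof -
  interpret V: hw_module "ctype R" "rk R" sc "Eop M" "Fop M" "Kop M" "\<lambda>i. inv (Kop M i)" hl u
    by (rule hw_moduleI[OF u])
  interpret T: hw_module "ctype R" "rk R" tscale TE TF TK TKi hl x by (rule Thw_module[OF x])
  have "qsubmodule R M V.U"
    unfolding qsubmodule_def vm.subspace_def idx_eq using V.U_closed V.U_K by auto
  hence UU: "V.U = UNIV"
    using irr V.U_closed(2) u(1) unfolding irreducible_module_def by blast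
  have all: "\<exists>cs. okc cs \<and> V.ev cs = v" for v
  proof -
    have "v \<in> V.U" unfolding UU by simp
    thus ?thesis unfolding V.U_def by auto
  qed
  define rep where "rep v = (SOME cs. okc cs \<and> V.ev cs = v)" for v
  have rep: "okc (rep v)" "V.ev (rep v) = v" for v
    using someI_ex[OF all[of v]] unfolding rep_def by auto
  define \<phi> where "\<phi> v = T.ev (rep v)" for v
  have ev: "\<phi> (V.ev cs) = T.ev cs" if "okc cs" for cs
  proof -
    let ?ds = "cs @ scomb (-1) (rep (V.ev cs))"
    have "V.ev ?ds = 0" using rep(2) by (simp add: V.ev_scomb)
    hence "T.ev ?ds = 0"
      using transfer[OF V.hw_module_axioms x, of ?ds] that rep(1) by simp
    hence "T.ev cs - T.ev (rep (V.ev cs)) = 0" by (simp add: T.ev_scomb)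
    thus ?thesis unfolding \<phi>_def by simp
  qed
  have add: "\<phi> (v + w) = \<phi> v + \<phi> w" for v w
    using ev[of "rep v @ rep w"] rep unfolding \<phi>_def by simp
  have scale: "\<phi> (sc c v) = tscale c (\<phi> v)" for c v
    using ev[of "scomb c (rep v)"] rep by (simp add: V.ev_scomb T.ev_scomb \<phi>_def)
  have E: "\<phi> (Eop M i v) = TE i (\<phi> v)" if i: "i \<in> idxs" for i v
    using ev[OF okc_ecomb[OF rep(1)], of hl i v] V.E_ev[OF i rep(1)] T.E_ev[OF i rep(1)] rep(2) by (simp add: \<phi>_def)
  have F: "\<phi> (Fop M i v) = TF i (\<phi> v)" if i: "i \<in> idxs" for i v
    using ev[OF okc_fcomb[OF i rep(1)], of v] V.ev_fcomb[OF i] T.ev_fcomb[OF i] rep(2) by (simp add: \<phi>_def)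
  have K: "\<phi> (Kop M i v) = TK i (\<phi> v)" if i: "i \<in> idxs" for i v
  proof -
    have "\<phi> (Kop M i (V.ev cs)) = TK i (T.ev cs)" if "okc cs" for cs using that
    proof (induction cs)
      case Nil thus ?case using V.K_zero[OF i] T.K_zero[OF i] ev[of "[]"] by simp
    next
      case (Cons a cs)
      obtain c J where a: "a = (c, J)" by (cases a)
      have "\<phi> (V.FI J) = T.FI J" using ev[of "[(1, J)]"] Cons.prems a by simp
      thus ?case using Cons V.K_FI[OF i, of J] T.K_FI[OF i, of J] unfolding a
        by (simp add: V.K_lin[OF i] T.K_lin[OF i] add scale)
    qed
    from this[OF rep(1)[of v]] show ?thesis using rep(2) by (simp add: \<phi>_def)
  qed
  have pu: "\<phi> u = x" using ev[of "[(1, [])]"] by simp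
  have zero: "\<phi> 0 = 0" using scale[of 0 0] by simp
  have "qsubmodule R M {v. \<phi> v = 0}"
    unfolding qsubmodule_def vm.subspace_def idx_eq
  proof (intro conjI ballI)
    fix i v assume i: "i \<in> idxs" and v: "v \<in> {v. \<phi> v = 0}"
    have "TK i (\<phi> (inv (Kop M i) v)) = 0" using K[OF i, of "inv (Kop M i) v"] v invK(2)[OF i] by simp
    hence "\<phi> (inv (Kop M i) v) = 0" using T.KKi[OF i] by (metis T_zero(4))
    thus "Eop M i v \<in> {v. \<phi> v = 0}" "Fop M i v \<in> {v. \<phi> v = 0}" "Kop M i v \<in> {v. \<phi> v = 0}" "inv (Kop M i) v \<in> {v. \<phi> v = 0}"
      using E[OF i] F[OF i] K[OF i] v by simp_all
  qed (simp_all add: add scale zero)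
  moreover have "{v. \<phi> v = 0} \<noteq> UNIV" using pu T.u_nz by auto
  ultimately have ker: "{v. \<phi> v = 0} = {0}" using irr unfolding irreducible_module_def by blast
  have inj: "\<phi> v = 0 \<Longrightarrow> v = 0" for v using ker by blast
  have surj: "y \<in> T.U \<Longrightarrow> \<exists>v. \<phi> v = y" for y unfolding T.U_def using ev by blast
  have ran: "\<phi> v \<in> T.U" for v unfolding T.U_def \<phi>_def using rep(1) by blast
  show ?thesis by (rule that[OF add scale inj ran surj E F K pu])
qed

end

text \<open>The irreducible module is realized inside a tensor power by an embedding \<open>\<phi>\<close> that sends
  \<open>u\<close> to the highest weight vector \<open>x\<close>, the lift of the dominant word \<open>b\<close>.\<close>

locale crystal_embedding = crystal_setup R lam M L B
  for R :: "'a::euclidean_space root_datum" and lam :: 'a and M :: "'v::ab_group_add qmodule"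
    and L :: "'v set" and B :: "'v set set" +
  fixes n :: nat and b :: "nat list" and x :: tvec and \<phi> :: "'v \<Rightarrow> tvec" and u :: 'v
  assumes b: "b \<in> Wd n" "dominant b" "i \<in> idxs \<Longrightarrow> hp i b = hl i"
    and x: "Thw n hl x" "congr x b"
    and phi_add: "\<phi> (v + w) = \<phi> v + \<phi> w" and phi_sc: "\<phi> (sc c v) = tscale c (\<phi> v)"
    and phi_inj: "\<phi> v = 0 \<Longrightarrow> v = 0" and phi_ran: "\<phi> v \<in> tU x" and phi_surj: "y \<in> tU x \<Longrightarrow> \<exists>v. \<phi> v = y"
    and phi_E: "i \<in> idxs \<Longrightarrow> \<phi> (Eop M i v) = TE i (\<phi> v)" and phi_F: "i \<in> idxs \<Longrightarrow> \<phi> (Fop M i v) = TF i (\<phi> v)"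
    and phi_K: "i \<in> idxs \<Longrightarrow> \<phi> (Kop M i v) = TK i (\<phi> v)"
    and phi_u: "\<phi> u = x"
begin

lemma x': "Thw n (hpf b) x"
  using x(1) Thw_cong[of hl "hpf b" n x] b(3) by simp

lemma phi_zero [simp]: "\<phi> 0 = 0"
  using phi_sc[of 0 0] by simp

lemma phi_diff: "\<phi> (v - w) = \<phi> v - \<phi> w"
  using phi_add[of v "sc (-1) w"] phi_sc[of "-1" w] by simp

lemma phi_eq: "\<phi> v = \<phi> w \<Longrightarrow> v = w"
  using phi_inj[of "v - w"] phi_diff[of v w] by simp

lemma phi_sum: "\<phi> (\<Sum>s\<in>S. f s) = (\<Sum>s\<in>S. \<phi> (f s))"
  by (induction S rule: infinite_finite_induct) (auto simp: phi_add)

lemma phi_Tn: "\<phi> v \<in> Tn n"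
  by (rule tU_Tn[OF x(1) phi_ran])

lemma phi_divpow: "i \<in> idxs \<Longrightarrow> \<phi> (divpow R M (Fop M) i k v) = Fd i k (\<phi> v)"
proof -
  assume i: "i \<in> idxs"
  have "\<phi> ((Fop M i ^^ k) v) = (TF i ^^ k) (\<phi> v)" by (induction k) (auto simp: phi_F[OF i])
  thus ?thesis unfolding divpow_def Fd_def phi_sc by simp
qed

lemma weight_space_phi: "v \<in> weight_space R M \<mu> \<longleftrightarrow> (\<forall>i\<in>idxs. TK i (\<phi> v) = tscale (vi i powi \<lfloor>cpair \<mu> (al i)\<rfloor>) (\<phi> v))"
proof -
  have "Kop M i v = sc (vi i powi \<lfloor>cpair \<mu> (al i)\<rfloor>) v \<longleftrightarrow>
      TK i (\<phi> v) = tscale (vi i powi \<lfloor>cpair \<mu> (al i)\<rfloor>) (\<phi> v)" if "i \<in> idxs" for i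
    unfolding phi_K[OF that, symmetric] phi_sc[symmetric] using phi_eq by auto
  thus ?thesis unfolding weight_space_iff by blast
qed

text \<open>A word in the support of y occurs in some monomial, whose weight is \<open>lam\<close>
  minus simple roots. The Kashiwara operators are characterized on genuine lattice weights, so
  eigenvalues of the K_i alone would not suffice.\<close>

lemma weight_of:
  assumes y: "y \<in> tU x" and w: "y w \<noteq> 0"
  shows "\<exists>\<mu>\<in>weight_lattice R. \<forall>i\<in>idxs. cpair \<mu> (al i) = of_int (hp i w)"
proof -
  interpret T: hw_module "ctype R" "rk R" tscale TE TF TK TKi hl x by (rule Thw_module[OF x(1)])
  obtain cs where cs: "okc cs" "y = T.ev cs" using y unfolding T.U_def by blast
  have "\<exists>J. set J \<subseteq> idxs \<and> T.FI J w \<noteq> 0"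
  proof (rule ccontr)
    assume z: "\<not> ?thesis"
    have "T.ev cs w = 0" using cs(1)
    proof (induction cs)
      case Nil show ?case unfolding T.ev_simps by (simp add: zero_fun_apply)
    next
      case (Cons a cs)
      obtain c J where a: "a = (c, J)" by (cases a)
      have "T.ev ((c, J) # cs) w = c * T.FI J w + T.ev cs w"
        unfolding T.ev_simps plus_fun_apply tscale_apply ..
      thus ?case using Cons z unfolding a by simp
    qed
    thus False using w cs by simp
  qed
  then obtain J where J: "set J \<subseteq> idxs" "T.FI J w \<noteq> 0" by blast
  have hw: "hp i w = hl i - (\<Sum>j\<leftarrow>J. ca i j)" if "i \<in> idxs" for i
    by (rule eigen_supp[OF TK_tFI[OF x(1) that J(1)] J(2)])
  have "lam - (\<Sum>j\<leftarrow>J. al j) \<in> weight_lattice R" using J(1)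
  proof (induction J)
    case Nil thus ?case using lamw by simp
  next
    case (Cons j J)
    have "lam - (\<Sum>j\<leftarrow>j # J. al j) = (lam - (\<Sum>j\<leftarrow>J. al j)) - al j" by simp
    moreover have "(lam - (\<Sum>j\<leftarrow>J. al j)) - al j \<in> weight_lattice R"
      using Cons idx_eq by (intro weight_lattice_diff) auto
    ultimately show ?case by (simp only:)
  qed
  moreover have "cpair (lam - (\<Sum>j\<leftarrow>J. al j)) (al i) = of_int (hp i w)" if i: "i \<in> idxs" for i
  proof -
    have "(\<Sum>j\<leftarrow>J. cpair (al j) (al i)) = (\<Sum>j\<leftarrow>J. of_int (ca i j))"
      using J(1) cart[of i] i idx_eq by (intro arg_cong[of _ _ sum_list] map_cong) auto
    also have "\<dots> = of_int (\<Sum>j\<leftarrow>J. ca i j)" by (induction J) auto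
    finally show ?thesis using hw[OF i] by (simp add: cpair_linear cpair_sum_list cpair_lam[OF i])
  qed
  ultimately show ?thesis by blast
qed

section \<open>Kashiwara operators\<close>

definition psi :: "tvec \<Rightarrow> 'v" where
  "psi y = (SOME v. \<phi> v = y)"

lemma phi_psi: "y \<in> tU x \<Longrightarrow> \<phi> (psi y) = y"
  unfolding psi_def using someI_ex[OF phi_surj] by blast

lemma ihw_phi:
  assumes i: "i \<in> idxs" and mu: "\<mu> \<in> weight_lattice R" and v: "v \<in> weight_space R M \<mu>" "Eop M i v = 0"
    and k: "real k \<le> cpair \<mu> (al i)"
  shows "ihw n i \<lfloor>cpair \<mu> (al i)\<rfloor> (\<phi> v)" "int k \<le> \<lfloor>cpair \<mu> (al i)\<rfloor>"
proof -
  show "ihw n i \<lfloor>cpair \<mu> (al i)\<rfloor> (\<phi> v)"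
    unfolding ihw_def using phi_Tn phi_E[OF i, of v] v i unfolding weight_space_phi by simp
  show "int k \<le> \<lfloor>cpair \<mu> (al i)\<rfloor>" using k by (simp add: le_floor_iff)
qed

text \<open>Strings exist in the tensor power, and the orthogonal projection to the submodule commutes with
  $E_i$, $F_i$, $K_i$.\<close>

lemma string_decomposition:
  assumes i: "i \<in> idxs"
  shows "\<exists>c k w. v = (\<Sum>d\<in>Wd n. sc (c d) (divpow R M (Fop M) i (k d) (w d))) \<and>
    (\<forall>d\<in>Wd n. w d = 0 \<or> (\<exists>\<mu>\<in>weight_lattice R. w d \<in> weight_space R M \<mu> \<and> Eop M i (w d) = 0 \<and> real (k d) \<le> cpair \<mu> (al i)))"
proof -
  obtain Q where Q: "\<And>f g. Q (f + g) = Q f + Q g" "\<And>c f. Q (tscale c f) = tscale c (Q f)"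
    "\<And>z. Q z \<in> tU x" "\<And>z. z \<in> tU x \<Longrightarrow> Q z = z"
    "\<And>z i. i \<in> idxs \<Longrightarrow> Q (TE i z) = TE i (Q z)" "\<And>z i. i \<in> idxs \<Longrightarrow> Q (TF i z) = TF i (Q z)"
    "\<And>z i. i \<in> idxs \<Longrightarrow> Q (TK i z) = TK i (Q z)"
    by (rule projection_exists[OF x(1)], rule that; assumption)
  have Q0: "Q 0 = 0" using Q(2)[of 0 0] by simp
  have QFd: "Q (Fd i k f) = Fd i k (Q f)" for k f
  proof (induction k)
    case (Suc k) thus ?case unfolding Fd_Suc Q(2) using Q(6)[OF i] by simp
  qed simp
  define cd where "cd d = (ew i ^^ ep i d) d" for d
  define w where "w d = psi (Q (sv i (cd d)))" for d
  have pw: "\<phi> (w d) = Q (sv i (cd d))" for d unfolding w_def by (rule phi_psi[OF Q(3)])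
  have "\<phi> v = Q (\<phi> v)" using Q(4)[OF phi_ran] by simp
  also have "\<dots> = (\<Sum>d\<in>Wd n. Q (tscale (cf n i (\<phi> v) d) (sv i d)))"
    by (subst sv_complete[OF i phi_Tn]) (rule tvec_sum_linear; simp add: Q Q0)
  also have "\<dots> = (\<Sum>d\<in>Wd n. tscale (cf n i (\<phi> v) d) (Fd i (ep i d) (\<phi> (w d))))"
    unfolding Q(2) pw QFd[symmetric] cd_def sv_eq_Fd[OF i, symmetric] ..
  also have "\<dots> = \<phi> (\<Sum>d\<in>Wd n. sc (cf n i (\<phi> v) d) (divpow R M (Fop M) i (ep i d) (w d)))"
    unfolding phi_sum phi_sc phi_divpow[OF i] ..
  finally have 1: "v = (\<Sum>d\<in>Wd n. sc (cf n i (\<phi> v) d) (divpow R M (Fop M) i (ep i d) (w d)))" by (rule phi_eq)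
  have 2: "w d = 0 \<or> (\<exists>\<mu>\<in>weight_lattice R. w d \<in> weight_space R M \<mu> \<and> Eop M i (w d) = 0 \<and> real (ep i d) \<le> cpair \<mu> (al i))"
    if d: "d \<in> Wd n" for d
  proof (cases "w d = 0")
    case False
    hence "\<phi> (w d) \<noteq> 0" using phi_inj by blast
    then obtain t where t: "\<phi> (w d) t \<noteq> 0" by (auto simp: fun_eq_iff zero_fun_apply)
    have K: "TK j (\<phi> (w d)) = tscale (vi j powi hp j (cd d)) (\<phi> (w d))" if "j \<in> idxs" for j
      unfolding pw using Q(7)[OF that, of "sv i (cd d)"] TK_sv[OF i that] Q(2) by simp
    obtain \<mu> where mu: "\<mu> \<in> weight_lattice R" "\<forall>j\<in>idxs. cpair \<mu> (al j) = of_int (hp j t)"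
      using weight_of[OF phi_ran t] by blast
    have ht: "hp j t = hp j (cd d)" if "j \<in> idxs" for j by (rule eigen_supp[OF K[OF that] t])
    have e: "ep i (cd d) = 0" "ph i (cd d) = ph i d + ep i d" using ew_pow_props[of "ep i d" i d] unfolding cd_def by auto
    have "w d \<in> weight_space R M \<mu>" unfolding weight_space_phi using K mu(2) ht by simp
    moreover have "\<phi> (Eop M i (w d)) = 0" unfolding phi_E[OF i] pw using Q(5)[OF i, of "sv i (cd d)"] TE_sv[OF i, of "cd d"] e Q0 by simp
    hence "Eop M i (w d) = 0" by (rule phi_inj)
    moreover have "real (ep i d) \<le> cpair \<mu> (al i)" using mu(2) ht[OF i] hp_eq[of i "cd d"] e i by simp
    ultimately show ?thesis using mu(1) by blast
  qed simp
  show ?thesis using 1 2 by blast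
qed

lemma kashiwara_unique:
  assumes i: "i \<in> idxs"
    and S: "\<And>v w. S (v + w) = S v + S w" "\<And>c v. S (sc c v) = sc c (S v)"
    and T: "\<And>v w. T (v + w) = T v + T w" "\<And>c v. T (sc c v) = sc c (T v)"
    and eq: "\<And>\<mu> w k. \<mu> \<in> weight_lattice R \<Longrightarrow> w \<in> weight_space R M \<mu> \<Longrightarrow> Eop M i w = 0 \<Longrightarrow> real k \<le> cpair \<mu> (al i) \<Longrightarrow>
       S (divpow R M (Fop M) i k w) = T (divpow R M (Fop M) i k w)"
  shows "S v = (T v :: 'v)"
proof -
  have sum: "S (\<Sum>d\<in>A. f d) = (\<Sum>d\<in>A. S (f d))" "T (\<Sum>d\<in>A. f d) = (\<Sum>d\<in>A. T (f d))" for A and f :: "nat list \<Rightarrow> 'v"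
    using S(2)[of 0 0] T(2)[of 0 0] by (induction A rule: infinite_finite_induct) (auto simp: S T)
  obtain c k w where e: "v = (\<Sum>d\<in>Wd n. sc (c d) (divpow R M (Fop M) i (k d) (w d)))"
    "\<forall>d\<in>Wd n. w d = 0 \<or> (\<exists>\<mu>\<in>weight_lattice R. w d \<in> weight_space R M \<mu> \<and> Eop M i (w d) = 0 \<and> real (k d) \<le> cpair \<mu> (al i))"
    using string_decomposition[OF i, of v] by blast
  have "S (divpow R M (Fop M) i (k d) (w d)) = T (divpow R M (Fop M) i (k d) (w d))" if d: "d \<in> Wd n" for d
  proof (cases "w d = 0")
    case True
    have "\<phi> (divpow R M (Fop M) i (k d) 0) = 0" unfolding phi_divpow[OF i] by (simp add: Fd_linear)
    hence "divpow R M (Fop M) i (k d) 0 = 0" by (rule phi_inj)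
    thus ?thesis using True S(2)[of 0 0] T(2)[of 0 0] by simp
  next
    case False thus ?thesis using e(2) d eq by blast
  qed
  thus ?thesis unfolding e(1) sum S(2) T(2) by simp
qed

text \<open>The operator of the tensor power, pulled back along \<open>\<phi>\<close>, has the
  defining property by \<open>kashiwara_Fd\<close>; \<open>kashiwara_unique\<close> then identifies
  it with the definite description.\<close>

lemma kashiwara_f_phi: "i \<in> idxs \<Longrightarrow> \<phi> (kashiwara_f R M i v) = ft n i (\<phi> v)"
  and kashiwara_e_phi: "i \<in> idxs \<Longrightarrow> \<phi> (kashiwara_e R M i v) = et n i (\<phi> v)"
proof -
  have lin: "Vector_Spaces.linear sc sc T \<longleftrightarrow> (\<forall>v w. T (v + w) = T v + T w) \<and> (\<forall>c v. T (sc c v) = sc c (T v))" for T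
    unfolding Vector_Spaces.linear_iff using vm.vector_space_axioms by blast
  assume i: "i \<in> idxs"
  have tU: "ft n i (\<phi> v) \<in> tU x" "et n i (\<phi> v) \<in> tU x" for v using tU_kashiwara[OF x(1) phi_ran i] by auto
  let ?f = "\<lambda>v. psi (ft n i (\<phi> v))" and ?e = "\<lambda>v. psi (et n i (\<phi> v))"
  have pf: "\<phi> (?f v) = ft n i (\<phi> v)" and pe: "\<phi> (?e v) = et n i (\<phi> v)" for v
    using phi_psi tU by auto
  have linf: "?f (v + w) = ?f v + ?f w" "?f (sc c v) = sc c (?f v)"
    and line: "?e (v + w) = ?e v + ?e w" "?e (sc c v) = sc c (?e v)" for v w c
  proof -
    show "?f (v + w) = ?f v + ?f w" by (rule phi_eq) (metis pf phi_add ft_add)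
    show "?f (sc c v) = sc c (?f v)" by (rule phi_eq) (metis pf phi_sc ft_tscale)
    show "?e (v + w) = ?e v + ?e w" by (rule phi_eq) (metis pe phi_add et_add)
    show "?e (sc c v) = sc c (?e v)" by (rule phi_eq) (metis pe phi_sc et_tscale)
  qed
  have propf: "?f (divpow R M (Fop M) i k w) = divpow R M (Fop M) i (Suc k) w"
   and prope: "?e (divpow R M (Fop M) i k w) = (if k = 0 then 0 else divpow R M (Fop M) i (k - 1) w)"
    if h: "\<mu> \<in> weight_lattice R" "w \<in> weight_space R M \<mu>" "Eop M i w = 0" "real k \<le> cpair \<mu> (al i)" for \<mu> w k
  proof -
    note k = kashiwara_Fd[OF i ihw_phi[OF i h]]
    show "?f (divpow R M (Fop M) i k w) = divpow R M (Fop M) i (Suc k) w"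
      by (rule phi_eq, subst pf) (simp only: phi_divpow[OF i] k(1))
    show "?e (divpow R M (Fop M) i k w) = (if k = 0 then 0 else divpow R M (Fop M) i (k - 1) w)"
      by (rule phi_eq, subst pe) (auto simp: phi_divpow[OF i] k(2))
  qed
  have "kashiwara_f R M i = ?f"
    unfolding kashiwara_f_def lin
  proof (rule the_equality)
    fix T assume T: "((\<forall>v w. T (v + w) = T v + T w) \<and> (\<forall>c v. T (sc c v) = sc c (T v))) \<and>
      (\<forall>\<mu>\<in>weight_lattice R. \<forall>u\<in>weight_space R M \<mu>. \<forall>n. Eop M i u = 0 \<and> real n \<le> cpair \<mu> (al i) \<longrightarrow>
           T (divpow R M (Fop M) i n u) = divpow R M (Fop M) i (Suc n) u)"
    show "T = ?f"
      by (rule ext, rule kashiwara_unique[OF i]) (use T linf propf in auto)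
  qed (use linf propf in blast)
  thus "\<phi> (kashiwara_f R M i v) = ft n i (\<phi> v)" using pf by simp
  have "kashiwara_e R M i = ?e"
    unfolding kashiwara_e_def lin
  proof (rule the_equality)
    fix T assume T: "((\<forall>v w. T (v + w) = T v + T w) \<and> (\<forall>c v. T (sc c v) = sc c (T v))) \<and>
      (\<forall>\<mu>\<in>weight_lattice R. \<forall>u\<in>weight_space R M \<mu>. \<forall>n. Eop M i u = 0 \<and> real n \<le> cpair \<mu> (al i) \<longrightarrow>
           T (divpow R M (Fop M) i n u) = (if n = 0 then 0 else divpow R M (Fop M) i (n - 1) u))"
    show "T = ?e"
      by (rule ext, rule kashiwara_unique[OF i]) (use T line prope in auto)
  qed (use line prope in blast)
  thus "\<phi> (kashiwara_e R M i v) = et n i (\<phi> v)" using pe by simp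
qed

end

section \<open>The lattice and the cosets modulo q\<close>

context crystal_setup
begin

lemma cl: "crystal_lattice R M L" and qb: "quotient_basis M L B"
  and B_weight: "\<And>c. c \<in> B \<Longrightarrow> \<exists>\<mu>\<in>weight_lattice R. \<exists>x\<in>L \<inter> weight_space R M \<mu>. c = qcoset M L x"
  and B_e: "\<And>i c. i \<in> idxs \<Longrightarrow> c \<in> B \<Longrightarrow> crystal_e R M L i c \<in> B \<union> {qcoset M L 0}"
  and B_f: "\<And>i c. i \<in> idxs \<Longrightarrow> c \<in> B \<Longrightarrow> crystal_f R M L i c \<in> B \<union> {qcoset M L 0}"
  using cb unfolding crystal_basis_def idx_eq by auto

text \<open>Coefficient functions are extended by zero so as to be regular everywhere; expansions
  with different supports can then be added.\<close>

lemma lattice_basis: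
  obtains S0 where "vm.independent S0" "vm.span S0 = UNIV"
    "\<And>v. v \<in> L \<longleftrightarrow> (\<exists>T a. finite T \<and> T \<subseteq> S0 \<and> (\<forall>s. a s \<in> regular_at_0) \<and> v = (\<Sum>s\<in>T. sc (a s) s))"
proof -
  obtain S0 where S0: "vm.independent S0" "vm.span S0 = UNIV"
    "L = {(\<Sum>s\<in>T. sc (a s) s) | T a. finite T \<and> T \<subseteq> S0 \<and> (\<forall>s\<in>T. a s \<in> regular_at_0)}"
    using cl unfolding crystal_lattice_def by blast
  have "v \<in> L \<longleftrightarrow> (\<exists>T a. finite T \<and> T \<subseteq> S0 \<and> (\<forall>s. a s \<in> regular_at_0) \<and> v = (\<Sum>s\<in>T. sc (a s) s))" for v
  proof
    assume "v \<in> L"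
    then obtain T a where T: "finite T" "T \<subseteq> S0" "\<forall>s\<in>T. a s \<in> regular_at_0" "v = (\<Sum>s\<in>T. sc (a s) s)"
      unfolding S0(3) by blast
    have "v = (\<Sum>s\<in>T. sc (if s \<in> T then a s else 0) s)" unfolding T(4) by (intro sum.cong) auto
    moreover have "\<forall>s. (if s \<in> T then a s else 0) \<in> regular_at_0" using T(3) by simp
    ultimately show "\<exists>T a. finite T \<and> T \<subseteq> S0 \<and> (\<forall>s. a s \<in> regular_at_0) \<and> v = (\<Sum>s\<in>T. sc (a s) s)"
      using T(1,2) by (intro exI[of _ T] exI[of _ "\<lambda>s. if s \<in> T then a s else 0"] conjI)
  qed (unfold S0(3), blast)
  thus ?thesis using that S0(1,2) by blast
qed

lemma L_add: "v \<in> L \<Longrightarrow> w \<in> L \<Longrightarrow> v + w \<in> L" and L_scale: "c \<in> regular_at_0 \<Longrightarrow> v \<in> L \<Longrightarrow> sc c v \<in> L"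
  and L_0: "0 \<in> L"
proof -
  obtain S0 where S0: "vm.independent S0" "vm.span S0 = UNIV"
    "\<And>v. v \<in> L \<longleftrightarrow> (\<exists>T a. finite T \<and> T \<subseteq> S0 \<and> (\<forall>s. a s \<in> regular_at_0) \<and> v = (\<Sum>s\<in>T. sc (a s) s))"
    by (rule lattice_basis, rule that; assumption)
  show "0 \<in> L" unfolding S0(3) by (intro exI[of _ "{}"] exI[of _ "\<lambda>_. 0"]) auto
  {
    assume "c \<in> regular_at_0" "v \<in> L"
    then obtain T a where T: "finite T" "T \<subseteq> S0" "\<forall>s. a s \<in> regular_at_0" "v = (\<Sum>s\<in>T. sc (a s) s)"
      unfolding S0(3) by blast
    have "sc c v = (\<Sum>s\<in>T. sc (c * a s) s)" unfolding T(4) by (simp add: vm.scale_sum_right)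
    moreover have "\<forall>s. c * a s \<in> regular_at_0" using T(3) \<open>c \<in> regular_at_0\<close> regular_mult by blast
    ultimately show "sc c v \<in> L" unfolding S0(3) using T(1,2)
      by (intro exI[of _ T] exI[of _ "\<lambda>s. c * a s"]) auto
  }
  {
    assume "v \<in> L" "w \<in> L"
    then obtain T a T' a' where T: "finite T" "T \<subseteq> S0" "\<forall>s. a s \<in> regular_at_0" "v = (\<Sum>s\<in>T. sc (a s) s)"
      and T': "finite T'" "T' \<subseteq> S0" "\<forall>s. a' s \<in> regular_at_0" "w = (\<Sum>s\<in>T'. sc (a' s) s)"
      unfolding S0(3) by blast
    let ?c = "\<lambda>s. (if s \<in> T then a s else 0) + (if s \<in> T' then a' s else 0)"
    have "v = (\<Sum>s\<in>T \<union> T'. sc (if s \<in> T then a s else 0) s)"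
      unfolding T(4) using T(1) T'(1) by (intro sum.mono_neutral_cong_left) auto
    moreover have "w = (\<Sum>s\<in>T \<union> T'. sc (if s \<in> T' then a' s else 0) s)"
      unfolding T'(4) using T(1) T'(1) by (intro sum.mono_neutral_cong_left) auto
    ultimately have "v + w = (\<Sum>s\<in>T \<union> T'. sc (?c s) s)"
      by (simp add: sum.distrib[symmetric] vm.scale_left_distrib)
    moreover have "\<forall>s. ?c s \<in> regular_at_0" using T(3) T'(3) by (auto simp: regular_add)
    ultimately show "v + w \<in> L" unfolding S0(3) using T T' by (intro exI[of _ "T \<union> T'"] exI[of _ ?c]) auto
  }
qed

lemma L_minus: "v \<in> L \<Longrightarrow> - v \<in> L"
  using L_scale[of "-1" v] regular_uminus[of 1] by simp

lemma L_diff: "v \<in> L \<Longrightarrow> w \<in> L \<Longrightarrow> v - w \<in> L"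
  using L_add[of v "- w"] L_minus by simp

lemma L_sum: "(\<And>s. s \<in> S \<Longrightarrow> f s \<in> L) \<Longrightarrow> (\<Sum>s\<in>S. f s) \<in> L"
  by (induction S rule: infinite_finite_induct) (auto simp: L_0 L_add)

lemma L_grading: "v \<in> L \<Longrightarrow> \<exists>P y. finite P \<and> P \<subseteq> weight_lattice R \<and>
          (\<forall>\<mu>\<in>P. y \<mu> \<in> L \<inter> weight_space R M \<mu>) \<and> v = (\<Sum>\<mu>\<in>P. y \<mu>)"
  using cl unfolding crystal_lattice_def by blast

lemma L_kash: "i \<in> idxs \<Longrightarrow> v \<in> L \<Longrightarrow> kashiwara_e R M i v \<in> L" "i \<in> idxs \<Longrightarrow> v \<in> L \<Longrightarrow> kashiwara_f R M i v \<in> L"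
  using cl unfolding crystal_lattice_def idx_eq by blast+

lemma qcoset_iff: "v \<in> qcoset M L w \<longleftrightarrow> (\<exists>y\<in>L. v = w + sc qq y)"
  unfolding qcoset_def by blast

lemma qcoset_self: "v \<in> qcoset M L v"
  unfolding qcoset_iff using L_0 by (intro bexI[of _ 0]) auto

lemma qcoset_sym: "v \<in> qcoset M L w \<Longrightarrow> w \<in> qcoset M L v"
proof -
  assume "v \<in> qcoset M L w"
  then obtain y where "y \<in> L" "v = w + sc qq y" unfolding qcoset_iff by blast
  thus ?thesis unfolding qcoset_iff using L_minus by (intro bexI[of _ "- y"]) auto
qed

lemma qcoset_trans: "v \<in> qcoset M L w \<Longrightarrow> w \<in> qcoset M L z \<Longrightarrow> v \<in> qcoset M L z"
proof -
  assume "v \<in> qcoset M L w" "w \<in> qcoset M L z"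
  then obtain y y' where "y \<in> L" "v = w + sc qq y" "y' \<in> L" "w = z + sc qq y'" unfolding qcoset_iff by blast
  thus ?thesis unfolding qcoset_iff using L_add by (intro bexI[of _ "y + y'"]) (auto simp: vm.scale_right_distrib)
qed

lemma qcoset_eq_iff: "qcoset M L v = qcoset M L w \<longleftrightarrow> v \<in> qcoset M L w"
  using qcoset_self qcoset_sym qcoset_trans by blast

abbreviation rc :: "rat \<Rightarrow> ratq" where "rc c \<equiv> Fract [:c:] 1"

lemma B_reps:
  obtains S where "S \<subseteq> L" "B = qcoset M L ` S"
    "\<And>x. x \<in> L \<Longrightarrow> \<exists>c. finite {s. c s \<noteq> 0} \<and> {s. c s \<noteq> 0} \<subseteq> S \<and> x \<in> qcoset M L (\<Sum>s | c s \<noteq> 0. sc (rc (c s)) s)"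
    "\<And>x c c'. x \<in> L \<Longrightarrow> finite {s. c s \<noteq> 0} \<Longrightarrow> {s. c s \<noteq> 0} \<subseteq> S \<Longrightarrow> x \<in> qcoset M L (\<Sum>s | c s \<noteq> 0. sc (rc (c s)) s) \<Longrightarrow>
       finite {s. c' s \<noteq> 0} \<Longrightarrow> {s. c' s \<noteq> 0} \<subseteq> S \<Longrightarrow> x \<in> qcoset M L (\<Sum>s | c' s \<noteq> 0. sc (rc (c' s)) s) \<Longrightarrow> c = c'"
proof -
  obtain S where S: "S \<subseteq> L" "B = qcoset M L ` S"
    "\<forall>x\<in>L. \<exists>!c::'v \<Rightarrow> rat. finite {s. c s \<noteq> 0} \<and> {s. c s \<noteq> 0} \<subseteq> S \<and>
           x \<in> qcoset M L (\<Sum>s | c s \<noteq> 0. sc (rc (c s)) s)"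
    using qb unfolding quotient_basis_def by blast
  show ?thesis
    by (rule that[OF S(1,2)]) (use S(3) in blast)+
qed

text \<open>Otherwise zero would have two expansions, the empty one and one with coefficient 1 at
  the representative of that coset.\<close>

lemma B_nonzero: "qcoset M L 0 \<notin> B"
proof
  assume z: "qcoset M L 0 \<in> B"
  obtain S where S: "S \<subseteq> L" "B = qcoset M L ` S" and
   uq: "\<And>x c c'. x \<in> L \<Longrightarrow> finite {s. c s \<noteq> 0} \<Longrightarrow> {s. c s \<noteq> 0} \<subseteq> S \<Longrightarrow> x \<in> qcoset M L (\<Sum>s | c s \<noteq> 0. sc (rc (c s)) s) \<Longrightarrow>
       finite {s. c' s \<noteq> 0} \<Longrightarrow> {s. c' s \<noteq> 0} \<subseteq> S \<Longrightarrow> x \<in> qcoset M L (\<Sum>s | c' s \<noteq> 0. sc (rc (c' s)) s) \<Longrightarrow> c = c'"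
    by (rule B_reps, rule that; assumption)
  obtain s where s: "s \<in> S" "qcoset M L 0 = qcoset M L s" using z S(2) by blast
  let ?c = "\<lambda>t. if t = s then (1::rat) else 0"
  have set: "{t. ?c t \<noteq> 0} = {s}" by auto
  have one: "rc 1 = 1" by (simp add: One_fract_def one_pCons)
  have "(\<lambda>_. 0) = ?c"
    by (rule uq[of 0]) (use s L_0 qcoset_self one in \<open>auto simp: set\<close>)
  thus False by (metis zero_neq_one)
qed

end

section \<open>Normalization of the highest weight vector\<close>

context crystal_embedding
begin

lemma weight_line:
  assumes y: "y \<in> tU x" and K: "\<forall>i\<in>idxs. TK i y = tscale (vi i powi hl i) y"
  shows "\<exists>c. y = tscale c x"
proof -
  obtain c where c: "\<forall>w. (\<forall>i\<in>idxs. hp i w = hl i) \<longrightarrow> y w = c * x w" using tU_weight_part[OF x(1) y] by blast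
  have "y w = c * x w" for w
  proof (cases "\<forall>i\<in>idxs. hp i w = hl i")
    case True thus ?thesis using c by blast
  next
    case False
    have "y w = 0" using False K eigen_supp by blast
    moreover have "x w = 0" using False x(1) eigen_supp unfolding Thw_def by blast
    ultimately show ?thesis by simp
  qed
  hence "y = tscale c x" by (simp add: fun_eq_iff tscale_apply)
  thus ?thesis by blast
qed

lemma weight_lam: "v \<in> weight_space R M lam \<Longrightarrow> \<exists>c. v = sc c u"
proof -
  assume "v \<in> weight_space R M lam"
  then obtain c where "\<phi> v = tscale c x" using weight_line[OF phi_ran] unfolding weight_space_phi hl_def by blast
  hence "\<phi> v = \<phi> (sc c u)" by (simp add: phi_sc phi_u)
  thus ?thesis using phi_eq by blast
qed

definition wpart :: "tvec \<Rightarrow> tvec" where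
  "wpart f = (\<lambda>w. if \<forall>i\<in>idxs. hp i w = hl i then f w else 0)"

lemma wpart_linear: "wpart (f + g) = wpart f + wpart g" "wpart (tscale c f) = tscale c (wpart f)" "wpart 0 = 0"
  by (auto simp: wpart_def fun_eq_iff tvec_apply)

lemma wpart_sum: "wpart (\<Sum>s\<in>S. f s) = (\<Sum>s\<in>S. wpart (f s))"
  by (rule tvec_sum_linear) (simp_all add: wpart_linear)

lemma wpart_weight:
  assumes mu: "\<mu> \<in> weight_lattice R" and v: "v \<in> weight_space R M \<mu>"
  shows "wpart (\<phi> v) = (if \<mu> = lam then \<phi> v else 0)"
proof -
  have K: "hp i w = \<lfloor>cpair \<mu> (al i)\<rfloor>" if "\<phi> v w \<noteq> 0" "i \<in> idxs" for i w
    using v eigen_supp that unfolding weight_space_phi by blast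
  show ?thesis
  proof (cases "\<mu> = lam")
    case True
    have "wpart (\<phi> v) w = \<phi> v w" for w
      using K[of w] True unfolding wpart_def hl_def by (cases "\<phi> v w = 0") auto
    thus ?thesis using True by (auto simp: fun_eq_iff)
  next
    case False
    then obtain i where i: "i \<in> idxs" "cpair \<mu> (al i) \<noteq> cpair lam (al i)"
      using weight_eqI[of \<mu> lam] unfolding idx_eq by blast
    hence "\<lfloor>cpair \<mu> (al i)\<rfloor> \<noteq> hl i" using cpair_floor[OF mu i(1)] cpair_lam[OF i(1)] by auto
    hence "\<phi> v w = 0 \<or> \<not> (\<forall>i\<in>idxs. hp i w = hl i)" for w
      using K[OF _ i(1), of w] i(1) by metis
    hence "wpart (\<phi> v) w = 0" for w unfolding wpart_def by auto
    thus ?thesis using False by (auto simp: fun_eq_iff zero_fun_apply)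
  qed
qed

text \<open>Scaling u by a dominating coefficient gives a primitive vector \<open>u0\<close> of L.
  Its expansion modulo q must use a basis coset of weight \<open>lam\<close>; the weight vector
  \<open>xs s\<close> in that coset is a multiple of \<open>u0\<close>, and the factor is a unit
  because a basis coset is not zero. So \<open>xs s\<close> inherits primitivity.\<close>

lemma adapted_generator:
  assumes u0: "u \<in> weight_space R M lam"
  shows "\<exists>w. w \<noteq> 0 \<and> w \<in> weight_space R M lam \<and> (\<forall>i\<in>idxs. Eop M i w = 0) \<and> w \<in> L \<and>
    (\<forall>a. sc a w \<in> L \<longrightarrow> a \<in> regular_at_0) \<and> qcoset M L w \<in> B"
proof -
  have unz: "u \<noteq> 0" using phi_u x(1) unfolding Thw_def by auto
  obtain S0 where S0: "vm.independent S0" "vm.span S0 = UNIV"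
    "\<And>v. v \<in> L \<longleftrightarrow> (\<exists>T a. finite T \<and> T \<subseteq> S0 \<and> (\<forall>s. a s \<in> regular_at_0) \<and> v = (\<Sum>s\<in>T. sc (a s) s))"
    by (rule lattice_basis, rule that; assumption)
  have "u \<in> vm.span S0" using S0(2) by simp
  then obtain T r where T: "finite T" "T \<subseteq> S0" "u = (\<Sum>s\<in>T. sc (r s) s)"
    unfolding vm.span_explicit by blast
  have "\<exists>s\<in>T. r s \<noteq> 0"
  proof (rule ccontr)
    assume "\<not> ?thesis"
    hence "u = 0" unfolding T(3) by (intro sum.neutral) auto
    thus False using unz by simp
  qed
  then obtain t0 where t0: "t0 \<in> T" "r t0 \<noteq> 0" "\<forall>s\<in>T. r s / r t0 \<in> regular_at_0"
    using exists_dominating[OF T(1), of _ r] by blast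
  define u0 where "u0 = sc (inverse (r t0)) u"
  have u0e: "u0 = (\<Sum>s\<in>T. sc (r s / r t0) s)"
    unfolding u0_def T(3) by (simp add: vm.scale_sum_right divide_inverse mult.commute)
  have u0L: "u0 \<in> L"
  proof -
    have "u0 = (\<Sum>s\<in>T. sc (if s \<in> T then r s / r t0 else 0) s)" unfolding u0e by (intro sum.cong) auto
    moreover have "\<forall>s. (if s \<in> T then r s / r t0 else 0) \<in> regular_at_0" using t0(3) by simp
    ultimately show ?thesis unfolding S0(3) using T(1,2)
      by (intro exI[of _ T] exI[of _ "\<lambda>s. if s \<in> T then r s / r t0 else 0"]) auto
  qed
  \<comment> \<open>The coordinate of \<open>u0\<close> at \<open>t0\<close> is 1, so a itself is a
    coordinate of a lattice element.\<close>
  have u0a: "a \<in> regular_at_0" if aL: "sc a u0 \<in> L" for a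
  proof -
    obtain T' a' where T': "finite T'" "T' \<subseteq> S0" "\<forall>s. a' s \<in> regular_at_0" "sc a u0 = (\<Sum>s\<in>T'. sc (a' s) s)"
      using aL unfolding S0(3) by blast
    let ?d = "\<lambda>s. (if s \<in> T then a * (r s / r t0) else 0) - (if s \<in> T' then a' s else 0)"
    have "sc a u0 = (\<Sum>s\<in>T \<union> T'. sc (if s \<in> T then a * (r s / r t0) else 0) s)"
      unfolding u0e vm.scale_sum_right using T(1) T'(1) by (intro sum.mono_neutral_cong_left) auto
    moreover have "sc a u0 = (\<Sum>s\<in>T \<union> T'. sc (if s \<in> T' then a' s else 0) s)"
      unfolding T'(4) using T(1) T'(1) by (intro sum.mono_neutral_cong_left) auto
    ultimately have "(\<Sum>s\<in>T \<union> T'. sc (?d s) s) = 0"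
      by (simp add: vm.scale_left_diff_distrib sum_subtractf)
    hence "?d t0 = 0" using T T' t0(1) by (intro vm.independentD[OF S0(1), of "T \<union> T'" ?d]) auto
    thus ?thesis using t0 T'(3) by (auto split: if_splits)
  qed
  have u0w: "u0 \<in> weight_space R M lam"
    using u0 unfolding u0_def weight_space_phi phi_sc by (auto simp: T_linear mult.commute)
  obtain S where S: "S \<subseteq> L" "B = qcoset M L ` S" and
   ex: "\<And>x. x \<in> L \<Longrightarrow> \<exists>c. finite {s. c s \<noteq> 0} \<and> {s. c s \<noteq> 0} \<subseteq> S \<and> x \<in> qcoset M L (\<Sum>s | c s \<noteq> 0. sc (rc (c s)) s)"
    by (rule B_reps, rule that; assumption)
  obtain c where c: "finite {s. c s \<noteq> 0}" "{s. c s \<noteq> 0} \<subseteq> S" "u0 \<in> qcoset M L (\<Sum>s | c s \<noteq> 0. sc (rc (c s)) s)"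
    using ex[OF u0L] by blast
  then obtain y where y: "y \<in> L" "u0 = (\<Sum>s | c s \<noteq> 0. sc (rc (c s)) s) + sc qq y" unfolding qcoset_iff by blast
  have "\<exists>\<mu> x y. \<mu> \<in> weight_lattice R \<and> x \<in> L \<and> x \<in> weight_space R M \<mu> \<and> qcoset M L s = qcoset M L x \<and> y \<in> L \<and> s = x + sc qq y"
    if "s \<in> S" for s
  proof -
    have "qcoset M L s \<in> B" using S(2) that by blast
    then obtain \<mu> x where "\<mu> \<in> weight_lattice R" "x \<in> L \<inter> weight_space R M \<mu>" "qcoset M L s = qcoset M L x"
      using B_weight by blast
    moreover have "s \<in> qcoset M L x" using calculation(3) qcoset_self by blast
    ultimately show ?thesis unfolding qcoset_iff by blast
  qed
  then obtain \<mu> xs ys where rep: "\<And>s. s \<in> S \<Longrightarrow> \<mu> s \<in> weight_lattice R \<and> xs s \<in> L \<and> xs s \<in> weight_space R M (\<mu> s) \<and>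
      qcoset M L s = qcoset M L (xs s) \<and> ys s \<in> L \<and> s = xs s + sc qq (ys s)" by metis
  let ?C = "{s. c s \<noteq> 0}"
  define y' where "y' = (\<Sum>s\<in>?C. sc (rc (c s)) (ys s)) + y"
  have y'L: "y' \<in> L" unfolding y'_def using rep c(2) y(1) regular_const(1) by (intro L_add L_sum L_scale) auto
  have "sc (rc (c s)) s = sc (rc (c s)) (xs s) + sc qq (sc (rc (c s)) (ys s))" if "s \<in> ?C" for s
  proof -
    have "s = xs s + sc qq (ys s)" using rep[of s] c(2) that by blast
    hence "sc (rc (c s)) s = sc (rc (c s)) (xs s + sc qq (ys s))" by metis
    thus ?thesis by (simp add: vm.scale_right_distrib mult.commute)
  qed
  hence "(\<Sum>s\<in>?C. sc (rc (c s)) s) = (\<Sum>s\<in>?C. sc (rc (c s)) (xs s)) + sc qq (\<Sum>s\<in>?C. sc (rc (c s)) (ys s))"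
    unfolding vm.scale_sum_right sum.distrib[symmetric] by (intro sum.cong) auto
  hence e: "u0 = (\<Sum>s\<in>?C. sc (rc (c s)) (xs s)) + sc qq y'"
    using y(2) unfolding y'_def by (simp add: vm.scale_right_distrib)
  obtain P yy where P: "finite P" "P \<subseteq> weight_lattice R" "\<forall>\<mu>\<in>P. yy \<mu> \<in> L \<inter> weight_space R M \<mu>" "y' = (\<Sum>\<mu>\<in>P. yy \<mu>)"
    using L_grading[OF y'L] by blast
  \<comment> \<open>Otherwise the part of weight \<open>lam\<close> comes from the term divisible by
    q alone, and \<open>u0\<close> would be q times a lattice element.\<close>
  have "\<exists>s\<in>?C. \<mu> s = lam"
  proof (rule ccontr)
    assume no: "\<not> ?thesis"
    define yl where "yl = (if lam \<in> P then yy lam else 0)"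
    have ylL: "yl \<in> L" unfolding yl_def using P(3) L_0 by auto
    have "wpart (\<phi> (\<Sum>s\<in>?C. sc (rc (c s)) (xs s))) = (\<Sum>s\<in>?C. tscale (rc (c s)) (wpart (\<phi> (xs s))))"
      unfolding phi_sum wpart_sum phi_sc wpart_linear ..
    also have "\<dots> = 0"
    proof (intro sum.neutral ballI)
      fix s assume s: "s \<in> ?C"
      have "s \<in> S" "\<mu> s \<noteq> lam" using s c(2) no by auto
      hence "wpart (\<phi> (xs s)) = 0" using rep[of s] wpart_weight[of "\<mu> s" "xs s"] by simp
      thus "tscale (rc (c s)) (wpart (\<phi> (xs s))) = 0" by simp
    qed
    finally have 1: "wpart (\<phi> (\<Sum>s\<in>?C. sc (rc (c s)) (xs s))) = 0" .
    have "wpart (\<phi> y') = (\<Sum>\<mu>\<in>P. wpart (\<phi> (yy \<mu>)))" unfolding P(4) phi_sum wpart_sum ..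
    also have "\<dots> = (\<Sum>\<mu>\<in>P. if \<mu> = lam then \<phi> yl else 0)"
    proof (intro sum.cong HOL.refl)
      fix \<mu> assume "\<mu> \<in> P"
      thus "wpart (\<phi> (yy \<mu>)) = (if \<mu> = lam then \<phi> yl else 0)"
        using wpart_weight[of \<mu> "yy \<mu>"] P(2,3) unfolding yl_def by auto
    qed
    also have "\<dots> = \<phi> yl" using P(1) unfolding yl_def by (simp add: sum.delta)
    finally have 2: "wpart (\<phi> y') = \<phi> yl" .
    have "\<phi> u0 = wpart (\<phi> u0)" using wpart_weight[OF lamw u0w] by simp
    also have "\<dots> = tscale qq (\<phi> yl)"
      by (subst e) (simp only: phi_add wpart_linear 1 phi_sc 2 add_0)
    finally have "u0 = sc qq yl" by (intro phi_eq) (simp add: phi_sc)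
    hence "sc (inverse qq) u0 \<in> L" using ylL by simp
    hence "inverse qq \<in> regular_at_0" by (rule u0a)
    hence "ev0 (qq * inverse qq) = 0" using regular_mult[of qq "inverse qq"] by simp
    thus False by simp
  qed
  then obtain s where s: "s \<in> ?C" "\<mu> s = lam" by blast
  have sS: "s \<in> S" using s c(2) by blast
  note rs = rep[OF sS, unfolded s(2)]
  obtain k where "xs s = sc k u" using weight_lam rs by blast
  hence xe: "xs s = sc (k * r t0) u0" unfolding u0_def using t0(2) by simp
  let ?e = "k * r t0"
  have eA: "?e \<in> regular_at_0" using u0a rs xe by metis
  have e0: "ev0 ?e \<noteq> 0"
  proof
    assume "ev0 ?e = 0"
    hence "?e / qq \<in> regular_at_0" by (rule ev0_eq_0D[OF eA])
    hence "sc (?e / qq) u0 \<in> L" using L_scale u0L by blast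
    moreover have "xs s = 0 + sc qq (sc (?e / qq) u0)" unfolding xe by simp
    ultimately have "xs s \<in> qcoset M L 0" unfolding qcoset_iff by blast
    hence "qcoset M L (xs s) = qcoset M L 0" unfolding qcoset_eq_iff .
    moreover have "qcoset M L (xs s) \<in> B" using rs S(2) sS by auto
    ultimately show False using B_nonzero by simp
  qed
  hence enz: "?e \<noteq> 0" by auto
  have px: "\<phi> (xs s) = tscale k x" using \<open>xs s = sc k u\<close> by (simp add: phi_sc phi_u)
  have "xs s \<noteq> 0"
    using enz \<open>xs s = sc k u\<close> unz by auto
  moreover have "Eop M i (xs s) = 0" if i: "i \<in> idxs" for i
  proof -
    have "\<phi> (Eop M i (xs s)) = 0" unfolding phi_E[OF i] px using x(1) i unfolding Thw_def by (simp add: T_linear)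
    thus ?thesis by (rule phi_inj)
  qed
  moreover have "a \<in> regular_at_0" if "sc a (xs s) \<in> L" for a
  proof -
    have "a * ?e \<in> regular_at_0" using u0a[of "a * ?e"] that xe by simp
    hence "a * ?e / ?e \<in> regular_at_0" using regular_divide[OF _ eA e0] by blast
    moreover have "a * ?e / ?e = a" using enz by simp
    ultimately show ?thesis by simp
  qed
  moreover have "qcoset M L (xs s) \<in> B" using rs S(2) sS by auto
  ultimately show ?thesis using rs by (intro exI[of _ "xs s"]) blast
qed

end

section \<open>Identification of the lattice and of the crystal with words\<close>

locale crystal_adapted = crystal_embedding +
  assumes uL: "u \<in> L" and uA: "sc a u \<in> L \<Longrightarrow> a \<in> regular_at_0" and uB: "qcoset M L u \<in> B"
begin

text \<open>Concrete lattice elements: by \<open>reach_lift\<close> they contain a lift of every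
  reachable word.\<close>

inductive_set fset :: "'b set" where
  fset_base: "u \<in> fset"
| fset_step: "v \<in> fset \<Longrightarrow> i \<in> idxs \<Longrightarrow> kashiwara_f R M i v \<in> fset"

lemma fset_L: "v \<in> fset \<Longrightarrow> v \<in> L"
  by (induction rule: fset.induct) (auto intro: uL L_kash)

lemma congr_ft:
  assumes "congr f d" "d \<in> Wd n" "ph i d > 0"
  shows "congr (ft n i f) (fw i d)"
  unfolding congr_def
proof (intro conjI allI)
  have f: "reg f" using assms(1) unfolding congr_def by simp
  show "reg (ft n i f)" by (rule ft_regular[OF f])
  fix w
  show "ev0 (ft n i f w) = of_bool (w = fw i d)"
  proof (cases "w \<in> Wd n")
    case True
    have "ep i w > 0 \<and> ew i w = d \<longleftrightarrow> w = fw i d" using fw_props[OF assms(3)] ew_props[of i w] by auto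
    thus ?thesis using ft_regular(2)[OF f True, of i] assms(1) unfolding congr_def by auto
  next
    case False
    hence "ft n i f w = 0" using ft_Tn[of n i f] unfolding Tn_def by blast
    moreover have "w \<noteq> fw i d" using False fw_Wd[OF assms(2)] by blast
    ultimately show ?thesis by simp
  qed
qed

lemma finite_reach: "finite (reach b)"
proof (rule finite_subset[OF _ finite_Wd])
  show "reach b \<subseteq> Wd n" using reach_Wd b(1) by blast
qed

lemma reach_lift: "d \<in> reach b \<Longrightarrow> \<exists>v\<in>fset. congr (\<phi> v) d"
proof (induction rule: reach.induct)
  case reach_base
  show ?case using fset_base phi_u x(2) by (intro bexI[of _ u]) auto
next
  case (reach_step d i)
  then obtain v where v: "v \<in> fset" "congr (\<phi> v) d" by blast
  have "congr (\<phi> (kashiwara_f R M i v)) (fw i d)"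
    unfolding kashiwara_f_phi[OF reach_step(2)] by (rule congr_ft[OF v(2) reach_Wd[OF reach_step(1) b(1)] reach_step(3)])
  thus ?case using fset_step[OF v(1) reach_step(2)] by blast
qed

lemma weight_lam_u:
  assumes v: "v \<in> L" "v \<in> weight_space R M lam"
  shows "\<exists>c\<in>regular_at_0. \<phi> v = tscale c x"
proof -
  obtain c where c: "v = sc c u" using weight_lam[OF v(2)] by blast
  thus ?thesis using uA[of c] v(1) by (intro bexI[of _ c]) (auto simp: phi_sc phi_u)
qed

lemma weight_dot_x:
  assumes mu: "\<mu> \<in> weight_lattice R" and v: "v \<in> weight_space R M \<mu>" and ne: "\<mu> \<noteq> lam"
  shows "dot n (\<phi> v) x = 0"
proof -
  obtain i where i: "i \<in> idxs" "cpair \<mu> (al i) \<noteq> cpair lam (al i)"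
    using weight_eqI[of \<mu> lam] ne unfolding idx_eq by blast
  hence h: "\<lfloor>cpair \<mu> (al i)\<rfloor> \<noteq> hl i" using cpair_floor[OF mu i(1)] cpair_lam[OF i(1)] by auto
  have "TK i x = tscale (vi i powi hl i) x" using x(1) i(1) unfolding Thw_def by blast
  moreover have "TK i (\<phi> v) = tscale (vi i powi \<lfloor>cpair \<mu> (al i)\<rfloor>) (\<phi> v)" using v i(1) unfolding weight_space_phi by blast
  ultimately show ?thesis using dot_weight h by blast
qed

lemma kash_pow_phi:
  "i \<in> idxs \<Longrightarrow> \<phi> ((kashiwara_f R M i ^^ k) v) = (ft n i ^^ k) (\<phi> v)"
  "i \<in> idxs \<Longrightarrow> \<phi> ((kashiwara_e R M i ^^ k) v) = (et n i ^^ k) (\<phi> v)"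
  by (induction k) (auto simp: kashiwara_f_phi kashiwara_e_phi)

lemma kash_pow_L: "i \<in> idxs \<Longrightarrow> v \<in> L \<Longrightarrow> (kashiwara_f R M i ^^ k) v \<in> L" "i \<in> idxs \<Longrightarrow> v \<in> L \<Longrightarrow> (kashiwara_e R M i ^^ k) v \<in> L"
  by (induction k) (auto intro: L_kash)

lemma string_part_L:
  assumes i: "i \<in> idxs" and v: "v \<in> L"
  shows "\<exists>w\<in>L. \<phi> w = et n i (pk n i K (\<phi> v))"
proof -
  let ?s = "(kashiwara_f R M i ^^ K) ((kashiwara_e R M i ^^ K) v) - (kashiwara_f R M i ^^ Suc K) ((kashiwara_e R M i ^^ Suc K) v)"
  have "?s \<in> L" by (intro L_diff kash_pow_L i v)
  moreover have "\<phi> ?s = pk n i K (\<phi> v)"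
    unfolding phi_diff kash_pow_phi[OF i] pk_eq[OF i phi_Tn] tvec_diff ..
  ultimately show ?thesis using L_kash(1)[OF i, of ?s] kashiwara_e_phi[OF i, of ?s] by (intro bexI[of _ "kashiwara_e R M i ?s"]) auto
qed

text \<open>Up to units congruent to 1, the Kashiwara operators $e_i$ and $f_i$ are adjoint.\<close>

lemma dot_fset: "y \<in> fset \<Longrightarrow> v \<in> L \<Longrightarrow> dot n (\<phi> v) (\<phi> y) \<in> regular_at_0"
proof (induction arbitrary: v rule: fset.induct)
  case fset_base
  obtain P y where P: "finite P" "P \<subseteq> weight_lattice R" "\<forall>\<mu>\<in>P. y \<mu> \<in> L \<inter> weight_space R M \<mu>" "v = (\<Sum>\<mu>\<in>P. y \<mu>)"
    using L_grading[OF fset_base] by blast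
  have rx: "reg x" using x(2) unfolding congr_def by simp
  have "dot n (\<phi> (y \<mu>)) x \<in> regular_at_0" if mu: "\<mu> \<in> P" for \<mu>
  proof (cases "\<mu> = lam")
    case True
    then obtain c where c: "c \<in> regular_at_0" "\<phi> (y \<mu>) = tscale c x" using weight_lam_u P(3) mu by blast
    have "dot n x x \<in> regular_at_0" using reg_dot[OF rx rx] by simp
    thus ?thesis unfolding c(2) dot_tscale using c(1) regular_mult by blast
  next
    case False
    have "dot n (\<phi> (y \<mu>)) x = 0" by (rule weight_dot_x[of \<mu>]) (use P mu False in auto)
    thus ?thesis by simp
  qed
  thus ?case unfolding P(4) phi_sum phi_u dot_sum by (intro regular_sum[THEN conjunct1])
next
  case (fset_step y' i)
  obtain P y where P: "finite P" "P \<subseteq> weight_lattice R" "\<forall>\<mu>\<in>P. y \<mu> \<in> L \<inter> weight_space R M \<mu>" "v = (\<Sum>\<mu>\<in>P. y \<mu>)"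
    using L_grading[OF fset_step.prems] by blast
  have i: "i \<in> idxs" by (rule fset_step.hyps)
  have "dot n (\<phi> (y \<mu>)) (ft n i (\<phi> y')) \<in> regular_at_0" if mu: "\<mu> \<in> P" for \<mu>
  proof -
    have yL: "y \<mu> \<in> L" and ys: "y \<mu> \<in> weight_space R M \<mu>" using P(3) mu by auto
    have K: "TK i (\<phi> (y \<mu>)) = tscale (vi i powi \<lfloor>cpair \<mu> (al i)\<rfloor>) (\<phi> (y \<mu>))"
      using ys i unfolding weight_space_phi by blast
    have "rho i k \<lfloor>cpair \<mu> (al i)\<rfloor> * dot n (et n i (pk n i k (\<phi> (y \<mu>)))) (\<phi> y') \<in> regular_at_0" if "k \<in> {1..n}" for k
    proof -
      obtain w where w: "w \<in> L" "\<phi> w = et n i (pk n i k (\<phi> (y \<mu>)))" using string_part_L[OF i yL] by blast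
      have "dot n (\<phi> w) (\<phi> y') \<in> regular_at_0" by (rule fset_step.IH[OF w(1)])
      thus ?thesis using rho_regular[of k i] that regular_mult unfolding w(2) by auto
    qed
    thus ?thesis unfolding ft_adjoint[OF i phi_Tn K] by (intro regular_sum[THEN conjunct1])
  qed
  thus ?case unfolding P(4) phi_sum kashiwara_f_phi[OF i] dot_sum by (intro regular_sum[THEN conjunct1])
qed

lemma ev0_zero_of_reach:
  assumes "z \<in> tU x" "reg z" "\<And>d. d \<in> reach b \<Longrightarrow> ev0 (z d) = 0"
  shows "ev0 (z w) = 0"
  by (rule residue_vanishes[OF x' x(2) b(1) assms])

text \<open>If a coordinate had a pole, multiplication by a scalar vanishing at q = 0 would yield a
  regular vector with nonzero residue, hence with nonzero residue at a reachable word d. Its pairing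
  with a lift of d from \<open>fset\<close> would have that residue, but by \<open>dot_fset\<close>
  it is the scalar times a regular number.\<close>

lemma L_reg: "v \<in> L \<Longrightarrow> reg (\<phi> v)"
proof (rule ccontr)
  assume v: "v \<in> L" and nr: "\<not> reg (\<phi> v)"
  let ?z = "\<phi> v"
  have "?z \<noteq> 0" using nr reg_closed(1) by metis
  then obtain w0 where w0: "w0 \<in> Wd n" "?z w0 \<noteq> 0" "reg (tscale (inverse (?z w0)) ?z)"
    using reg_scaling[OF phi_Tn] by blast
  let ?c = "inverse (?z w0)"
  have "?z w0 \<notin> regular_at_0"
  proof
    assume a: "?z w0 \<in> regular_at_0"
    have "?z w \<in> regular_at_0" for w
    proof -
      have "?z w0 * (?c * ?z w) \<in> regular_at_0"
        using regular_mult[OF a] w0(3) unfolding reg_def tscale_apply by blast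
      moreover have "?z w0 * (?c * ?z w) = ?z w" using w0(2) by simp
      ultimately show ?thesis by (simp only:)
    qed
    thus False using nr unfolding reg_def by blast
  qed
  hence c: "?c \<in> regular_at_0" "ev0 ?c = 0" using valuation_ring[OF w0(2)] by auto
  have cU: "tscale ?c ?z \<in> tU x" using tU_closed(3)[OF x(1) phi_ran] .
  have one: "ev0 (tscale ?c ?z w0) = 1" using w0(2) by (simp add: tscale_apply)
  have "\<exists>d\<in>reach b. ev0 (tscale ?c ?z d) \<noteq> 0"
    using ev0_zero_of_reach[OF cU w0(3), of w0] one by fastforce
  then obtain d where d: "d \<in> reach b" "ev0 (tscale ?c ?z d) \<noteq> 0" by blast
  obtain y where y: "y \<in> fset" "congr (\<phi> y) d" using reach_lift[OF d(1)] by blast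
  have "ev0 (dot n (tscale ?c ?z) (\<phi> y)) = ev0 (tscale ?c ?z d)"
    using ev0_dot_congr[OF w0(3) y(2) reach_Wd[OF d(1) b(1)]] by blast
  moreover have "ev0 (dot n (tscale ?c ?z) (\<phi> y)) = 0"
    unfolding dot_tscale using regular_mult[OF c(1) dot_fset[OF y(1) v]] c(2) by simp
  ultimately show False using d(2) by simp
qed

text \<open>The lifts \<open>Y d\<close> of the reachable words span: a remainder orthogonal to them
  has no residue at reachable words, even after scaling, and so is zero. The coefficients of v are
  regular, since dividing by a dominating nonregular one would make the residue at that word both 1
  and 0.\<close>

lemma reg_L:
  assumes "reg (\<phi> v)"
  shows "v \<in> L"
proof -
  obtain Y where Y: "\<And>d. d \<in> reach b \<Longrightarrow> Y d \<in> fset \<and> congr (\<phi> (Y d)) d" using reach_lift by metis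
  have fin: "finite (reach b)" by (rule finite_reach)
  let ?S = "(\<lambda>d. \<phi> (Y d)) ` reach b"
  obtain p where p: "p \<in> tv.span ?S" "\<forall>s\<in>?S. dot n (\<phi> v + tscale (-1) p) s = 0"
    using proj_exists[of ?S n "\<phi> v"] fin phi_Tn by blast
  have pU: "p \<in> tU x" using p(1)
    by (induction rule: tv.span_induct_alt) (auto intro!: tU_closed[OF x(1)] phi_ran)
  let ?z = "\<phi> v + tscale (-1) p"
  have zU: "?z \<in> tU x" by (intro tU_closed[OF x(1)] phi_ran pU)
  have "?z = 0"
  proof (rule ccontr)
    assume "?z \<noteq> 0"
    then obtain w0 where w0: "w0 \<in> Wd n" "?z w0 \<noteq> 0" "reg (tscale (inverse (?z w0)) ?z)"
      using reg_scaling[OF tU_Tn[OF x(1) zU]] by blast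
    have cU: "tscale (inverse (?z w0)) ?z \<in> tU x" by (rule tU_closed(3)[OF x(1) zU])
    have "ev0 (tscale (inverse (?z w0)) ?z d) = 0" if d: "d \<in> reach b" for d
    proof -
      have "ev0 (tscale (inverse (?z w0)) ?z d) = ev0 (dot n (tscale (inverse (?z w0)) ?z) (\<phi> (Y d)))"
        using ev0_dot_congr[OF w0(3) _ reach_Wd[OF d b(1)]] Y[OF d] by metis
      also have "dot n (tscale (inverse (?z w0)) ?z) (\<phi> (Y d)) = inverse (?z w0) * dot n ?z (\<phi> (Y d))"
        by (rule dot_tscale)
      also have "dot n ?z (\<phi> (Y d)) = 0" using p(2) d by blast
      finally show ?thesis by simp
    qed
    hence "ev0 (tscale (inverse (?z w0)) ?z w0) = 0" by (rule ev0_zero_of_reach[OF cU w0(3)])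
    thus False using w0(2) by (simp add: tscale_apply)
  qed
  hence "\<phi> v - p = 0" unfolding tvec_diff .
  hence "\<phi> v \<in> tv.span ?S" using p(1) by simp
  moreover have "finite ?S" using fin by simp
  moreover have inj: "inj_on (\<lambda>d. \<phi> (Y d)) (reach b)"
  proof (rule inj_onI)
    fix d d' assume h: "d \<in> reach b" "d' \<in> reach b" "\<phi> (Y d) = \<phi> (Y d')"
    have "ev0 (\<phi> (Y d) d) = 1" "ev0 (\<phi> (Y d') d) = of_bool (d = d')"
      using Y[OF h(1)] Y[OF h(2)] unfolding congr_def by auto
    thus "d = d'" unfolding h(3) by (cases "d = d'") simp_all
  qed
  ultimately obtain a where "\<phi> v = (\<Sum>s\<in>?S. tscale (a s) s)" unfolding tv.span_finite[OF \<open>finite ?S\<close>] by blast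
  hence av: "\<phi> v = (\<Sum>d\<in>reach b. tscale (a (\<phi> (Y d))) (\<phi> (Y d)))"
    by (subst (asm) sum.reindex[OF inj]) simp
  define c where "c d = a (\<phi> (Y d))" for d
  have cv: "\<phi> v = (\<Sum>d\<in>reach b. tscale (c d) (\<phi> (Y d)))" using av unfolding c_def .
  have res: "ev0 ((\<Sum>d\<in>reach b. tscale (e d) (\<phi> (Y d))) d0) = ev0 (e d0)"
    if "d0 \<in> reach b" "\<And>d. d \<in> reach b \<Longrightarrow> e d \<in> regular_at_0" for d0 e
  proof -
    have t: "tscale (e d) (\<phi> (Y d)) d0 \<in> regular_at_0 \<and> ev0 (tscale (e d) (\<phi> (Y d)) d0) = (if d = d0 then ev0 (e d0) else 0)"
      if "d \<in> reach b" for d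
      using regular_mult[of "e d" "\<phi> (Y d) d0"] that Y[OF that] \<open>\<And>d. d \<in> reach b \<Longrightarrow> e d \<in> regular_at_0\<close>
      unfolding congr_def reg_def by (auto simp: tscale_apply)
    have "ev0 (\<Sum>d\<in>reach b. tscale (e d) (\<phi> (Y d)) d0) = (\<Sum>d\<in>reach b. if d = d0 then ev0 (e d0) else 0)"
      using regular_sum[of "reach b" "\<lambda>d. tscale (e d) (\<phi> (Y d)) d0"] t by simp
    thus ?thesis unfolding tvec_sum_apply using fin that(1) by (simp add: sum.delta)
  qed
  have cA: "c d \<in> regular_at_0" if dr: "d \<in> reach b" for d
  proof (rule ccontr)
    assume nA: "c d \<notin> regular_at_0"
    hence "c d \<noteq> 0" by auto
    then obtain t where t: "t \<in> reach b" "c t \<noteq> 0" "\<forall>s\<in>reach b. c s / c t \<in> regular_at_0"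
      using exists_dominating[OF fin dr, of c] by blast
    have "c t \<notin> regular_at_0"
    proof
      assume "c t \<in> regular_at_0"
      hence "c d / c t * c t \<in> regular_at_0" using regular_mult[of "c d / c t" "c t"] t(3) dr by blast
      thus False using nA t(2) by simp
    qed
    hence k: "inverse (c t) \<in> regular_at_0" "ev0 (inverse (c t)) = 0" using valuation_ring[OF t(2)] by auto
    have "tscale (inverse (c t)) (\<phi> v) = (\<Sum>d\<in>reach b. tscale (c d / c t) (\<phi> (Y d)))"
      unfolding cv tscale_sum by (simp add: divide_inverse mult.commute)
    hence "ev0 (tscale (inverse (c t)) (\<phi> v) t) = ev0 (c t / c t)"
      using res[OF t(1), of "\<lambda>d. c d / c t"] t(3) by simp
    moreover have "ev0 (tscale (inverse (c t)) (\<phi> v) t) = 0"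
      using regular_mult[OF k(1), of "\<phi> v t"] k(2) assms unfolding reg_def by (simp add: tscale_apply)
    ultimately show False using t(2) by simp
  qed
  have "\<phi> v = \<phi> (\<Sum>d\<in>reach b. sc (c d) (Y d))" unfolding cv phi_sum phi_sc ..
  hence "v = (\<Sum>d\<in>reach b. sc (c d) (Y d))" by (rule phi_eq)
  moreover have "(\<Sum>d\<in>reach b. sc (c d) (Y d)) \<in> L" using cA Y fset_L by (intro L_sum L_scale) blast+
  ultimately show ?thesis by simp
qed

lemma qcoset_phi: "w \<in> L \<Longrightarrow> v \<in> qcoset M L w \<longleftrightarrow> reg (\<phi> v) \<and> (\<forall>t. ev0 (\<phi> v t) = ev0 (\<phi> w t))"
proof -
  assume w: "w \<in> L"
  have rw: "reg (\<phi> w)" by (rule L_reg[OF w])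
  show ?thesis
  proof
    assume "v \<in> qcoset M L w"
    then obtain y where y: "y \<in> L" "v = w + sc qq y" unfolding qcoset_iff by blast
    have "\<phi> v t \<in> regular_at_0 \<and> ev0 (\<phi> v t) = ev0 (\<phi> w t)" for t
    proof -
      have "\<phi> v t = \<phi> w t + qq * \<phi> y t" unfolding y(2) phi_add phi_sc by (simp add: tvec_apply)
      thus ?thesis using rw L_reg[OF y(1)] regular_mult[OF regular_qq(1), of "\<phi> y t"] regular_add[of "\<phi> w t" "qq * \<phi> y t"]
        unfolding reg_def by simp
    qed
    thus "reg (\<phi> v) \<and> (\<forall>t. ev0 (\<phi> v t) = ev0 (\<phi> w t))" unfolding reg_def by blast
  next
    assume h: "reg (\<phi> v) \<and> (\<forall>t. ev0 (\<phi> v t) = ev0 (\<phi> w t))"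
    let ?y = "sc (inverse qq) (v - w)"
    have "\<phi> ?y t \<in> regular_at_0" for t
    proof -
      have "\<phi> v t - \<phi> w t \<in> regular_at_0 \<and> ev0 (\<phi> v t - \<phi> w t) = 0"
        using h rw regular_diff[of "\<phi> v t" "\<phi> w t"] unfolding reg_def by simp
      hence "(\<phi> v t - \<phi> w t) / qq \<in> regular_at_0" using ev0_eq_0D by blast
      thus ?thesis unfolding phi_sc phi_diff by (simp add: tscale_apply minus_apply divide_inverse mult.commute)
    qed
    hence "?y \<in> L" using reg_L unfolding reg_def by blast
    moreover have "v = w + sc qq ?y" by simp
    ultimately show "v \<in> qcoset M L w" unfolding qcoset_iff by blast
  qed
qed

definition bc :: "nat list \<Rightarrow> 'b set" where
  "bc d = {v. congr (\<phi> v) d}"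

lemma qcoset_bc: "congr (\<phi> v) d \<Longrightarrow> qcoset M L v = bc d"
proof -
  assume v: "congr (\<phi> v) d"
  hence "v \<in> L" using reg_L unfolding congr_def by blast
  hence "w \<in> qcoset M L v \<longleftrightarrow> w \<in> bc d" for w
    unfolding bc_def using qcoset_phi[of v w] v unfolding congr_def by simp
  thus ?thesis by blast
qed

lemma bc_obtain: "d \<in> reach b \<Longrightarrow> \<exists>v\<in>L. congr (\<phi> v) d \<and> qcoset M L v = bc d"
  using reach_lift fset_L qcoset_bc by blast

lemma bc_inj: "congr (\<phi> v) d \<Longrightarrow> congr (\<phi> v) d' \<Longrightarrow> d = d'"
  unfolding congr_def by (metis of_bool_eq_iff)

lemma zero_coset: "qcoset M L 0 = {v. reg (\<phi> v) \<and> (\<forall>t. ev0 (\<phi> v t) = 0)}"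
  using qcoset_phi[OF L_0] by (auto simp: zero_fun_apply)

lemma bc_neq_zero: "d \<in> reach b \<Longrightarrow> bc d \<noteq> qcoset M L 0"
proof
  assume d: "d \<in> reach b" and e: "bc d = qcoset M L 0"
  obtain v where "congr (\<phi> v) d" "v \<in> bc d" using bc_obtain[OF d] unfolding bc_def by blast
  thus False using e unfolding zero_coset congr_def by auto
qed

lemma induced_op_coset:
  assumes T: "\<And>v w. T (v - w) = T v - T w" "\<And>c v. T (sc c v) = sc c (T v)" "\<And>v. v \<in> L \<Longrightarrow> T v \<in> L" and w: "w \<in> L"
  shows "induced_op M L T (qcoset M L w) = qcoset M L (T w)"
proof -
  have "qcoset M L (T v) = qcoset M L (T w)" if v: "v \<in> qcoset M L w" for v
  proof -
    obtain y where y: "y \<in> L" "v = w + sc qq y" using v unfolding qcoset_iff by blast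
    have "T v - T w = sc qq (T y)" using T(1)[of v w] T(2)[of qq y] y(2) by simp
    hence "T v = T w + sc qq (T y)" by (simp add: algebra_simps)
    hence "T v \<in> qcoset M L (T w)" unfolding qcoset_iff using T(3)[OF y(1)] by blast
    thus ?thesis using qcoset_eq_iff by blast
  qed
  thus ?thesis unfolding induced_op_def using qcoset_self by blast
qed

lemma kash_linear:
  assumes "i \<in> idxs"
  shows "kashiwara_e R M i (v - w) = kashiwara_e R M i v - kashiwara_e R M i w"
    "kashiwara_e R M i (sc c v) = sc c (kashiwara_e R M i v)"
    "kashiwara_f R M i (v - w) = kashiwara_f R M i v - kashiwara_f R M i w"
    "kashiwara_f R M i (sc c v) = sc c (kashiwara_f R M i v)"
proof -
  note k = kashiwara_e_phi[OF assms] kashiwara_f_phi[OF assms] phi_diff phi_sc tvec_diff et_add ft_add et_tscale ft_tscale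
  show "kashiwara_e R M i (v - w) = kashiwara_e R M i v - kashiwara_e R M i w"
    "kashiwara_e R M i (sc c v) = sc c (kashiwara_e R M i v)"
    "kashiwara_f R M i (v - w) = kashiwara_f R M i v - kashiwara_f R M i w"
    "kashiwara_f R M i (sc c v) = sc c (kashiwara_f R M i v)"
    by (rule phi_eq, simp only: k)+
qed

lemma crystal_e_coset: "i \<in> idxs \<Longrightarrow> v \<in> L \<Longrightarrow> crystal_e R M L i (qcoset M L v) = qcoset M L (kashiwara_e R M i v)"
  and crystal_f_coset: "i \<in> idxs \<Longrightarrow> v \<in> L \<Longrightarrow> crystal_f R M L i (qcoset M L v) = qcoset M L (kashiwara_f R M i v)"
  unfolding crystal_e_def crystal_f_def by (rule induced_op_coset; simp add: kash_linear L_kash)+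

lemma bc_B: "d \<in> reach b \<Longrightarrow> bc d \<in> B"
proof (induction rule: reach.induct)
  case reach_base
  thus ?case using uB qcoset_bc[of u b] phi_u x(2) by simp
next
  case (reach_step d i)
  obtain v where v: "v \<in> L" "congr (\<phi> v) d" "qcoset M L v = bc d" using bc_obtain[OF reach_step(1)] by blast
  have c: "congr (\<phi> (kashiwara_f R M i v)) (fw i d)"
    unfolding kashiwara_f_phi[OF reach_step(2)] by (rule congr_ft[OF v(2) reach_Wd[OF reach_step(1) b(1)] reach_step(3)])
  have "crystal_f R M L i (bc d) = bc (fw i d)"
    unfolding v(3)[symmetric] crystal_f_coset[OF reach_step(2) v(1)] by (rule qcoset_bc[OF c])
  moreover have "bc (fw i d) \<noteq> qcoset M L 0"
    by (rule bc_neq_zero[OF reach.reach_step[OF reach_step(1-3)]])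
  ultimately show ?case using B_f[OF reach_step(2,4)] by auto
qed

text \<open>The reachable words already give elements of B, and by \<open>ev0_zero_of_reach\<close>
  a representative s is congruent to a rational combination of their representatives. Uniqueness
  compares this with the expansion of s by itself, so s is one of them.\<close>

lemma B_bc: "c \<in> B \<Longrightarrow> \<exists>d\<in>reach b. c = bc d"
proof -
  assume cB: "c \<in> B"
  obtain S where S: "S \<subseteq> L" "B = qcoset M L ` S" and
   uq: "\<And>x c c'. x \<in> L \<Longrightarrow> finite {s. c s \<noteq> 0} \<Longrightarrow> {s. c s \<noteq> 0} \<subseteq> S \<Longrightarrow> x \<in> qcoset M L (\<Sum>s | c s \<noteq> 0. sc (rc (c s)) s) \<Longrightarrow>
       finite {s. c' s \<noteq> 0} \<Longrightarrow> {s. c' s \<noteq> 0} \<subseteq> S \<Longrightarrow> x \<in> qcoset M L (\<Sum>s | c' s \<noteq> 0. sc (rc (c' s)) s) \<Longrightarrow> c = c'"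
    by (rule B_reps, rule that; assumption)
  obtain s where s: "s \<in> S" "c = qcoset M L s" using cB S(2) by blast
  have "\<exists>t\<in>S. bc d = qcoset M L t" if "d \<in> reach b" for d using bc_B[OF that] S(2) by blast
  then obtain t where t: "\<And>d. d \<in> reach b \<Longrightarrow> t d \<in> S \<and> bc d = qcoset M L (t d)" by metis
  have tc: "congr (\<phi> (t d)) d" if "d \<in> reach b" for d
    using t[OF that] qcoset_self[of "t d"] unfolding bc_def by blast
  have tinj: "inj_on t (reach b)"
  proof (rule inj_onI)
    fix d d' assume h: "d \<in> reach b" "d' \<in> reach b" "t d = t d'"
    show "d = d'" by (rule bc_inj[OF tc[OF h(1)]]) (simp add: h(3) tc[OF h(2)])
  qed
  have fin: "finite (reach b)" by (rule finite_reach)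
  have sL: "s \<in> L" using s S by blast
  have rs: "reg (\<phi> s)" by (rule L_reg[OF sL])
  define e where "e d = ev0 (\<phi> s d)" for d
  define c' where "c' v = (if v \<in> t ` reach b then e (the_inv_into (reach b) t v) else 0)" for v
  have c't: "c' (t d) = e d" if "d \<in> reach b" for d
    unfolding c'_def using that the_inv_into_f_f[OF tinj that] by simp
  have supp: "{v. c' v \<noteq> 0} \<subseteq> t ` reach b" unfolding c'_def by auto
  let ?y = "\<Sum>d\<in>reach b. sc (rc (e d)) (t d)"
  have rc0: "rc 0 = 0" by (simp add: Zero_fract_def)
  have "(\<Sum>v | c' v \<noteq> 0. sc (rc (c' v)) v) = (\<Sum>v\<in>t ` reach b. sc (rc (c' v)) v)"
    using supp fin rc0 by (intro sum.mono_neutral_left) auto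
  also have "\<dots> = ?y" by (subst sum.reindex[OF tinj]) (auto simp: c't intro!: sum.cong)
  finally have y: "(\<Sum>v | c' v \<noteq> 0. sc (rc (c' v)) v) = ?y" .
  have yL: "?y \<in> L" using t S(1) regular_const(1) by (intro L_sum L_scale) auto
  have py: "ev0 (\<phi> ?y w) = (if w \<in> reach b then e w else 0)" for w
  proof -
    have q: "rc (e d) * \<phi> (t d) w \<in> regular_at_0 \<and> ev0 (rc (e d) * \<phi> (t d) w) = (if d = w then e w else 0)" if "d \<in> reach b" for d
      using tc[OF that] regular_mult[OF regular_const(1), of "\<phi> (t d) w" "e d"] regular_const(2) unfolding congr_def reg_def by auto
    have "\<phi> ?y w = (\<Sum>d\<in>reach b. rc (e d) * \<phi> (t d) w)" unfolding phi_sum phi_sc tvec_sum_apply tscale_apply ..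
    hence "ev0 (\<phi> ?y w) = (\<Sum>d\<in>reach b. if d = w then e w else 0)"
      using regular_sum[of "reach b" "\<lambda>d. rc (e d) * \<phi> (t d) w"] q by simp
    thus ?thesis using fin by (simp add: sum.delta)
  qed
  have "ev0 (\<phi> s w) = ev0 (\<phi> ?y w)" for w
  proof -
    let ?z = "\<phi> (s - ?y)"
    have dz: "?z w \<in> regular_at_0 \<and> ev0 (?z w) = ev0 (\<phi> s w) - ev0 (\<phi> ?y w)" for w
      unfolding phi_diff minus_apply using rs L_reg[OF yL] regular_diff unfolding reg_def by blast
    have "ev0 (?z w) = 0"
    proof (rule ev0_zero_of_reach[OF phi_ran])
      show "reg ?z" using dz unfolding reg_def by blast
      show "\<And>d. d \<in> reach b \<Longrightarrow> ev0 (?z d) = 0" using dz py unfolding e_def by simp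
    qed
    thus ?thesis using dz[of w] by simp
  qed
  hence sy: "s \<in> qcoset M L ?y" using qcoset_phi[OF yL] rs by blast
  let ?d = "\<lambda>v. if v = s then (1::rat) else 0"
  have ds: "{v. ?d v \<noteq> 0} = {s}" by auto
  have one: "rc 1 = 1" by (simp add: One_fract_def one_pCons)
  have "?d = c'"
  proof (rule uq[OF sL])
    show "s \<in> qcoset M L (\<Sum>v | ?d v \<noteq> 0. sc (rc (?d v)) v)" unfolding ds using one qcoset_self by simp
    show "s \<in> qcoset M L (\<Sum>v | c' v \<noteq> 0. sc (rc (c' v)) v)" unfolding y by (rule sy)
    show "finite {v. c' v \<noteq> 0}" using finite_subset[OF supp] fin by simp
    show "{v. c' v \<noteq> 0} \<subseteq> S" using supp t by auto
  qed (use s in auto)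
  from fun_cong[OF this, of s] have "c' s = 1" by simp
  hence "s \<in> t ` reach b" using supp by auto
  then obtain d where "d \<in> reach b" "s = t d" by blast
  thus ?thesis using t s(2) by metis
qed

lemma crystal_e_zero: "i \<in> idxs \<Longrightarrow> crystal_e R M L i (qcoset M L 0) = qcoset M L 0"
  using crystal_e_coset[OF _ L_0] kash_linear(2)[of i 0 0] by simp

lemma crystal_e_bc:
  assumes i: "i \<in> idxs" and d: "d \<in> reach b"
  shows "crystal_e R M L i (bc d) = (if ep i d > 0 then bc (ew i d) else qcoset M L 0)"
    and "ep i d > 0 \<Longrightarrow> ew i d \<in> reach b"
proof -
  obtain v where v: "v \<in> L" "congr (\<phi> v) d" "qcoset M L v = bc d" using bc_obtain[OF d] by blast
  have rv: "reg (\<phi> v)" by (rule L_reg[OF v(1)])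
  have dW: "d \<in> Wd n" by (rule reach_Wd[OF d b(1)])
  let ?w = "kashiwara_e R M i v"
  have wL: "?w \<in> L" by (rule L_kash(1)[OF i v(1)])
  have c: "crystal_e R M L i (bc d) = qcoset M L ?w" unfolding v(3)[symmetric] by (rule crystal_e_coset[OF i v(1)])
  have ev: "ev0 (\<phi> ?w t) = of_bool (ph i t > 0 \<and> fw i t = d)" for t
  proof (cases "t \<in> Wd n")
    case True
    thus ?thesis unfolding kashiwara_e_phi[OF i] using et_regular(2)[OF rv True, of i] v(2) unfolding congr_def by simp
  next
    case False
    hence "et n i (\<phi> v) t = 0" using et_Tn[of n i "\<phi> v"] unfolding Tn_def by blast
    moreover have "\<not> (ph i t > 0 \<and> fw i t = d)"
    proof
      assume "ph i t > 0 \<and> fw i t = d"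
      hence "t = ew i d" using fw_props[of i t] by auto
      thus False using False ew_Wd[OF dW] by simp
    qed
    ultimately show ?thesis unfolding kashiwara_e_phi[OF i] by simp
  qed
  have iff: "ph i t > 0 \<and> fw i t = d \<longleftrightarrow> ep i d > 0 \<and> t = ew i d" for t
    using fw_props[of i t] ew_props[of i d] by auto
  have rw: "reg (\<phi> ?w)" by (rule L_reg[OF wL])
  show 1: "crystal_e R M L i (bc d) = (if ep i d > 0 then bc (ew i d) else qcoset M L 0)"
  proof (cases "ep i d > 0")
    case True
    have "congr (\<phi> ?w) (ew i d)" unfolding congr_def using rw ev iff True by auto
    thus ?thesis unfolding c using True qcoset_bc by simp
  next
    case False
    hence "?w \<in> qcoset M L 0" unfolding zero_coset using rw ev iff by auto
    thus ?thesis unfolding c using False qcoset_eq_iff by simp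
  qed
  assume e: "ep i d > 0"
  have cw: "congr (\<phi> ?w) (ew i d)" unfolding congr_def using rw ev iff e by auto
  hence wb: "?w \<in> bc (ew i d)" unfolding bc_def by simp
  have "bc (ew i d) \<noteq> qcoset M L 0"
  proof
    assume "bc (ew i d) = qcoset M L 0"
    hence "ev0 (\<phi> ?w (ew i d)) = 0" using wb unfolding zero_coset by simp
    thus False using cw unfolding congr_def by simp
  qed
  hence "bc (ew i d) \<in> B" using B_e[OF i bc_B[OF d]] 1 e by simp
  then obtain d' where d': "d' \<in> reach b" "bc (ew i d) = bc d'" using B_bc by blast
  hence "ew i d = d'" using bc_inj[OF cw] wb unfolding bc_def by auto
  thus "ew i d \<in> reach b" using d' by simp
qed

lemma crystal_wt_bc:
  assumes d: "d \<in> reach b"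
  shows "crystal_wt R M L (bc d) \<in> weight_lattice R"
    and "i \<in> idxs \<Longrightarrow> cpair (crystal_wt R M L (bc d)) (al i) = of_int (hp i d)"
proof -
  let ?P = "\<lambda>\<mu>. \<mu> \<in> weight_lattice R \<and> (\<exists>x\<in>L \<inter> weight_space R M \<mu>. bc d = qcoset M L x)"
  have wt: "cpair \<mu> (al i) = of_int (hp i d)" if mu: "?P \<mu>" and i: "i \<in> idxs" for \<mu> i
  proof -
    obtain v where v: "v \<in> L" "v \<in> weight_space R M \<mu>" "bc d = qcoset M L v" using mu by blast
    hence "congr (\<phi> v) d" using qcoset_self[of v] unfolding bc_def by blast
    hence "ev0 (\<phi> v d) = 1" unfolding congr_def by simp
    hence "\<phi> v d \<noteq> 0" by auto
    hence "hp i d = \<lfloor>cpair \<mu> (al i)\<rfloor>" using v(2) i eigen_supp unfolding weight_space_phi by blast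
    thus ?thesis using cpair_floor[of \<mu> i] mu i by simp
  qed
  have ex: "\<exists>\<mu>. ?P \<mu>" using B_weight[OF bc_B[OF d]] by blast
  have "\<exists>!\<mu>. ?P \<mu>"
  proof (rule ex_ex1I[OF ex])
    fix \<mu> \<nu> assume "?P \<mu>" "?P \<nu>"
    thus "\<mu> = \<nu>" using weight_eqI[of \<mu> \<nu>] wt idx_eq by auto
  qed
  hence P: "?P (crystal_wt R M L (bc d))" unfolding crystal_wt_def by (rule theI')
  show "crystal_wt R M L (bc d) \<in> weight_lattice R" using P by blast
  show "i \<in> idxs \<Longrightarrow> cpair (crystal_wt R M L (bc d)) (al i) = of_int (hp i d)" using wt[OF P] .
qed

end

section \<open>String patterns of words\<close>

context letter_chain
begin

definition rlen :: "nat \<Rightarrow> nat" where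
  "rlen m = (if X = Type_A then m else 2 * m - 1)"

lemma rlen_A: "X = Type_A \<Longrightarrow> rlen m = m" and rlen_C: "X = Type_C \<Longrightarrow> rlen m = 2 * m - 1"
  unfolding rlen_def by simp_all

definition rlab :: "nat \<Rightarrow> nat \<Rightarrow> nat" where
  "rlab m t = (if t < m then m - t else t - m + 2)"

lemma word_row_eq:
  assumes "1 \<le> m"
  shows "word_row X m = map (rlab m) [0..<rlen m]"
proof -
  have *: "rev [Suc 0..<Suc m] ! t = m - t" if "t < m" for t
    using that by (simp add: rev_nth del: upt_Suc)
  show ?thesis
  proof (rule cartan_type.exhaust[of X])
    assume X: "X = Type_A"
    have row: "word_row X m = rev [1..<Suc m]" using X by simp
    show ?thesis unfolding row rlen_A[OF X]
      by (rule nth_equalityI) (auto simp: rlab_def * simp del: upt_Suc)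
  next
    assume X: "X = Type_C"
    have row: "word_row X m = rev [1..<Suc m] @ [2..<Suc m]" using X by simp
    show ?thesis unfolding row rlen_C[OF X]
      using assms by (intro nth_equalityI) (auto simp: rlab_def * nth_append simp del: upt_Suc)
  qed
qed

definition wd :: "nat \<Rightarrow> nat list" where
  "wd n = concat (map (word_row X) [1..<Suc n])"

abbreviation roff :: "nat \<Rightarrow> nat" where
  "roff n \<equiv> length (wd n)"

lemma wd_Suc: "wd (Suc n) = wd n @ map (rlab (Suc n)) [0..<rlen (Suc n)]"
  using word_row_eq[of "Suc n"] by (simp add: wd_def)

lemma wd_0 [simp]: "wd 0 = []"
  by (simp add: wd_def)

lemma roff_Suc: "roff (Suc n) = roff n + rlen (Suc n)"
  by (simp add: wd_Suc)

lemma wd_prefix: "n \<le> n' \<Longrightarrow> \<exists>zs. wd n' = wd n @ zs"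
  by (induction n' rule: dec_induct) (auto simp: wd_Suc)

lemma roff_mono: "n \<le> n' \<Longrightarrow> roff n \<le> roff n'"
  using wd_prefix[of n n'] by auto

lemma nth_wd:
  assumes "n < n'" "t < rlen (Suc n)"
  shows "wd n' ! (roff n + t) = rlab (Suc n) t" "roff n + t < roff n'"
proof -
  obtain zs where "wd n' = wd (Suc n) @ zs" using wd_prefix[of "Suc n" n'] assms by auto
  thus "wd n' ! (roff n + t) = rlab (Suc n) t" "roff n + t < roff n'"
    using assms(2) by (auto simp: wd_Suc nth_append)
qed

lemma position_cases:
  assumes "j < roff n'"
  obtains n t where "n < n'" "t < rlen (Suc n)" "j = roff n + t"
proof -
  have "\<exists>n t. n < n' \<and> t < rlen (Suc n) \<and> j = roff n + t" using assms
  proof (induction n')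
    case (Suc n')
    show ?case
    proof (cases "j < roff n'")
      case True
      thus ?thesis using Suc.IH less_SucI by blast
    next
      case False
      thus ?thesis using Suc.prems by (intro exI[of _ n'] exI[of _ "j - roff n'"]) (auto simp: roff_Suc)
    qed
  qed simp
  thus ?thesis using that by blast
qed

lemma rlab_range: "t < rlen m \<Longrightarrow> rlab m t \<in> {1..m}"
  by (auto simp: rlen_def rlab_def split: if_splits)

lemma set_wd: "set (wd n) \<subseteq> {1..n}"
proof (induction n)
  case (Suc n)
  have "rlab (Suc n) ` {0..<rlen (Suc n)} \<subseteq> {1..Suc n}" using rlab_range by auto
  thus ?case using Suc by (auto simp: wd_Suc)
qed simp

definition st :: "nat list \<Rightarrow> nat \<Rightarrow> nat list" where
  "st d j = fold em (take j (wd r)) d"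

definition bz :: "nat list \<Rightarrow> nat \<Rightarrow> nat" where
  "bz d j = ep (wd r ! j) (st d j)"

lemma st_0 [simp]: "st d 0 = d"
  by (simp add: st_def)

lemma st_Suc: "j < roff r \<Longrightarrow> st d (Suc j) = em (wd r ! j) (st d j)"
  by (simp add: st_def take_Suc_conv_app_nth)

lemma st_row: "n < r \<Longrightarrow> t < rlen (Suc n) \<Longrightarrow> st d (roff n + Suc t) = em (rlab (Suc n) t) (st d (roff n + t))"
  using st_Suc[of "roff n + t" d] nth_wd[of n r t] by simp

lemma wd_nth_idxs: "j < roff r \<Longrightarrow> wd r ! j \<in> idxs"
  using set_wd[of r] nth_mem[of j "wd r"] by blast

lemma hp_st: "j < roff r \<Longrightarrow> i \<in> idxs \<Longrightarrow> hp i (st d (Suc j)) = hp i (st d j) + int (bz d j) * ca i (wd r ! j)"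
  by (simp add: st_Suc bz_def hp_em)

text \<open>After t letters of a row only the next letter can still raise. A node k not adjacent to
  the letter just applied is undisturbed by it. An adjacent k must have been applied one step
  earlier, since otherwise it would come next, and the rank two lemmas apply.\<close>

lemma row_ep_zero:
  assumes n: "n < r" and z: "\<And>k. k \<in> {1..n} \<Longrightarrow> ep k (st d (roff n)) = 0"
  shows "t \<le> rlen (Suc n) \<Longrightarrow> k \<in> {1..Suc n} \<Longrightarrow> (t < rlen (Suc n) \<Longrightarrow> k \<noteq> rlab (Suc n) t) \<Longrightarrow>
    ep k (st d (roff n + t)) = 0"
proof (induction t arbitrary: k rule: less_induct)
  case (less t)
  let ?m = "Suc n" and ?V = "\<lambda>t. st d (roff n + t)"
  have rl: "t > 0" if "rlen ?m = t" using that by (auto simp: rlen_def split: if_splits)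
  show ?case
  proof (cases t)
    case 0
    hence "k \<noteq> ?m" using less.prems(3) rl by (auto simp: rlab_def)
    thus ?thesis using z[of k] less.prems(2) 0 by simp
  next
    case (Suc s)
    let ?p = "rlab ?m s"
    have s: "s < rlen ?m" using less.prems(1) Suc by simp
    have V: "?V t = em ?p (?V s)" unfolding Suc by (rule st_row[OF n s])
    have pm: "?p \<in> {1..?m}" by (rule rlab_range[OF s])
    have ids: "k \<in> idxs" "?p \<in> idxs" using less.prems(2) pm n by auto
    have IHs: "l \<in> {1..?m} \<Longrightarrow> l \<noteq> ?p \<Longrightarrow> ep l (?V s) = 0" for l
      using less.IH[of s l] Suc s by simp
    consider "k = ?p" | "k \<noteq> ?p" "ca k ?p = 0" | "k \<noteq> ?p" "ca k ?p \<noteq> 0" by blast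
    thus ?thesis
    proof cases
      case 1
      thus ?thesis unfolding V by (simp add: ep_em)
    next
      case 2
      thus ?thesis unfolding V using em_commute[OF ids 2(2) IHs[OF less.prems(2)]] by simp
    next
      case 3
      hence adj: "k = Suc ?p \<or> ?p = Suc k" by (auto simp: cartan_int_def split: if_splits)
      have "\<exists>u. s = Suc u \<and> k = rlab ?m u"
      proof -
        have nx: "s + 1 < rlen ?m \<Longrightarrow> k \<noteq> rlab ?m (s + 1)" using less.prems(3) Suc by simp
        have "s > 0"
        proof (rule ccontr)
          assume "\<not> s > 0"
          hence "s = 0" "?p = ?m" by (auto simp: rlab_def)
          hence "k = n" "k \<noteq> 0" using adj less.prems(2) by auto
          hence "1 < rlen ?m" "rlab ?m 1 = n" by (auto simp: rlen_def rlab_def)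
          thus False using nx \<open>s = 0\<close> \<open>k = n\<close> by simp
        qed
        moreover have "k = rlab ?m (s - 1)"
          using nx s adj less.prems(2) \<open>s > 0\<close> by (auto simp: rlen_def rlab_def split: if_splits; arith)
        ultimately show ?thesis by (intro exI[of _ "s - 1"]) auto
      qed
      then obtain u where u: "s = Suc u" "k = rlab ?m u" by blast
      have V2: "?V s = em k (?V u)" using st_row[OF n, of u d] s u by simp
      have pu: "ep ?p (?V u) = 0"
        using less.IH[of u ?p] pm s u 3(1) Suc by simp
      show ?thesis
      proof (cases "ca k ?p = -1 \<and> ca ?p k = -1")
        case True
        thus ?thesis unfolding V V2 using em_A2[OF ids(2,1) _ _ pu] by simp
      next
        case False
        hence C: "X = Type_C" "(k = 1 \<and> ?p = 2) \<or> (k = 2 \<and> ?p = 1)" using adj by (auto simp: cartan_int_def split: if_splits)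
        have nx: "s + 1 < rlen ?m \<Longrightarrow> k \<noteq> rlab ?m (s + 1)" using less.prems(3) Suc by simp
        \<comment> \<open>The turn 2, 1, 2 of a row in type C. The alternative, k = 2 right after
          the letter 1, is excluded because 2 is the next letter.\<close>
        have k1: "k = 1" "?p = 2" "u = n" "n > 0"
          using C(2) nx u s unfolding rlen_C[OF C(1)] by (auto simp: rlab_def split: if_splits)
        then obtain y where y: "u = Suc y" by (cases u) auto
        have ry: "rlab ?m y = 2" using k1 y by (auto simp: rlab_def)
        have V3: "?V u = em 2 (?V y)" using st_row[OF n, of y d] s u y ry by simp
        have "ep 1 (?V y) = 0" using less.IH[of y 1] s u y ry Suc by simp
        thus ?thesis unfolding V V2 V3 k1(1,2)
          using em_C2[of 1 2 "?V y"] ids k1 C(1) by (simp add: cartan_int_def)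
      qed
    qed
  qed
qed

lemma st_ep_zero: "n \<le> r \<Longrightarrow> k \<in> {1..n} \<Longrightarrow> ep k (st d (roff n)) = 0"
proof (induction n arbitrary: k)
  case (Suc n)
  thus ?case using row_ep_zero[of n d "rlen (Suc n)" k] by (auto simp: roff_Suc)
qed simp

lemma dominant_st: "dominant (st d (roff r))"
  unfolding dominant_def using st_ep_zero[of r] by simp

lemma row_ep_next:
  assumes "n < r" "Suc t < rlen (Suc n)"
  shows "ep (rlab (Suc n) (Suc t)) (st d (roff n + t)) = 0"
proof (rule row_ep_zero[OF assms(1)])
  show "rlab (Suc n) (Suc t) \<in> {1..Suc n}" by (rule rlab_range[OF assms(2)])
  show "rlab (Suc n) (Suc t) \<noteq> rlab (Suc n) t" by (auto simp: rlab_def)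
qed (use st_ep_zero assms in auto)

text \<open>On an extremal word the strings are read off from the weights; each row then performs one
  insertion step of a sorting algorithm.\<close>

lemma extremal_row:
  assumes ext: "\<And>j i. j \<le> roff r \<Longrightarrow> i \<in> idxs \<Longrightarrow> hp i (st d j) \<noteq> 0 \<and> int (ep i (st d j)) = max 0 (- hp i (st d j))"
    and n: "n < r" and t: "Suc t < rlen (Suc n)"
  shows "bz d (roff n + t) = 0 \<and> bz d (roff n + Suc t) = 0 \<or> bz d (roff n + Suc t) < bz d (roff n + t)"
  using t
proof (induction t rule: less_induct)
  case (less t)
  let ?m = "Suc n" and ?j = "roff n + t"
  let ?i = "rlab ?m (Suc t)" and ?p = "rlab ?m t"
  have t: "t < rlen ?m" using less.prems by simp
  have ids: "?i \<in> idxs" "?p \<in> idxs" using rlab_range[OF less.prems] rlab_range[OF t] n by auto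
  have pos: "?j < roff r" "wd r ! ?j = ?p" "Suc ?j < roff r" "wd r ! Suc ?j = ?i"
    using nth_wd[OF n t] nth_wd[OF n less.prems] by auto
  have h: "hp ?i (st d (Suc ?j)) = hp ?i (st d ?j) + int (bz d ?j) * ca ?i ?p"
    using hp_st[OF pos(1) ids(1)] pos(2) by simp
  have g: "hp ?i (st d ?j) > 0"
    using ext[of ?j ?i] row_ep_next[OF n less.prems, of d] ids pos by (auto simp: max_def split: if_splits)
  have b': "int (bz d (Suc ?j)) = max 0 (- hp ?i (st d (Suc ?j)))"
    unfolding bz_def[of d "Suc ?j"] pos(4) using ext[of "Suc ?j" ?i] ids pos by simp
  show ?case
  proof (cases "ca ?i ?p = -1")
    case True
    thus ?thesis using h g b' by auto
  next
    case False
    hence turn: "X = Type_C" "?i = 2" "?p = 1" "t = n" "n > 0"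
      using less.prems by (auto simp: cartan_int_def rlab_def rlen_def split: if_splits)
    then obtain s where s: "t = Suc s" by (cases t) auto
    have rs: "rlab ?m s = 2" using turn s by (auto simp: rlab_def)
    have sp: "roff n + s < roff r" "wd r ! (roff n + s) = 2" using nth_wd[OF n, of s] s t rs by auto
    have IH: "bz d (roff n + s) = 0 \<and> bz d ?j = 0 \<or> bz d ?j < bz d (roff n + s)"
      using less.IH[of s] s t by simp
    have two: "2 \<in> idxs" using ids(1) unfolding turn(2) .
    have c: "ca 2 1 = -2" "ca 2 2 = 2" using turn(1) by (simp_all add: cartan_int_def)
    have h2: "hp 2 (st d ?j) = hp 2 (st d (roff n + s)) + int (bz d (roff n + s)) * 2"
      using hp_st[OF sp(1) two, of d] unfolding sp(2) c s by simp
    have b0: "int (bz d (roff n + s)) = max 0 (- hp 2 (st d (roff n + s)))"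
      unfolding bz_def sp(2) using ext[of "roff n + s" 2] ids turn sp by simp
    \<comment> \<open>If the entry x before the 1 is positive, the height is x after it, so the new
      entry is max(0, 2 y - x) with y the entry at 1; as y < x, it is below y or both vanish. If x =
      0, all three vanish.\<close>
    show ?thesis using IH h2 b0 h g b' unfolding turn(2,3) c by auto
  qed
qed

definition row_end :: "nat \<Rightarrow> bool" where
  "row_end j \<longleftrightarrow> (\<exists>n\<in>{1..r}. Suc j = roff n)"

lemma row_end_iff:
  assumes "n < r" "t < rlen (Suc n)"
  shows "row_end (roff n + t) \<longleftrightarrow> Suc t = rlen (Suc n)"
proof
  assume "Suc t = rlen (Suc n)"
  thus "row_end (roff n + t)" unfolding row_end_def using assms(1) by (intro bexI[of _ "Suc n"]) (auto simp: roff_Suc)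
next
  assume "row_end (roff n + t)"
  then obtain m where m: "Suc (roff n + t) = roff m" unfolding row_end_def by blast
  have "\<not> m \<le> n" using roff_mono[of m n] m by auto
  hence "roff (Suc n) \<le> roff m" by (intro roff_mono) simp
  thus "Suc t = rlen (Suc n)" using m assms(2) by (simp add: roff_Suc)
qed

lemma sum_two_ends:
  fixes c :: "nat \<Rightarrow> int"
  assumes "a < b" "\<And>k. Suc a < k \<Longrightarrow> k < b \<Longrightarrow> c k = 0"
  shows "(\<Sum>k=Suc a..<Suc b. c k) = c b + (if Suc a = b then 0 else c (Suc a))"
proof (cases "Suc a = b")
  case False
  hence "(\<Sum>k=Suc a..<b. c k) = c (Suc a) + (\<Sum>k=Suc (Suc a)..<b. c k)"
    using assms(1) by (intro sum.atLeast_Suc_lessThan) simp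
  also have "(\<Sum>k=Suc (Suc a)..<b. c k) = 0" using assms(2) by (intro sum.neutral) auto
  finally show ?thesis using False assms(1) by simp
qed (use assms(1) in simp)

text \<open>Between two consecutive occurrences of $s_i$ in the reduced word only the two outermost letters
  are adjacent to $i$ in the Dynkin diagram.\<close>

lemma previous_occurrence:
  fixes f :: "nat \<Rightarrow> int"
  assumes n: "n < r" and t: "Suc t < rlen (Suc n)"
  defines "i \<equiv> rlab (Suc n) (Suc t)"
  obtains j' where "j' < roff n + t" "wd r ! j' = i"
    "(\<Sum>k=Suc j'..<Suc (roff n + t). f k * ca i (wd r ! k)) = - f (roff n + t) - (if row_end j' then 0 else f (Suc j'))"
proof (cases "Suc t \<le> n")
  case True
  then obtain n0 where n0: "n = Suc n0" by (cases n) auto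
  have i: "i = n - t" using True by (simp add: i_def rlab_def)
  \<comment> \<open>On the descending half of a row the letter i last occurred in the previous row:
    in type A at the same distance t from its start, in type C on its ascending half, or at its
    centre when i = 1.\<close>
  define t' where "t' = (if X = Type_A then t else 2 * n - 2 - t)"
  have t': "t' < rlen n" "rlab n t' = i"
    using True i by (auto simp: t'_def rlen_def rlab_def)
  let ?j' = "roff n0 + t'" and ?j = "roff n + t"
  have n0r: "n0 < r" using n n0 by simp
  have off: "roff n = roff n0 + rlen n" unfolding n0 by (rule roff_Suc)
  have l1: "wd r ! (roff n0 + s) = rlab n s" if "s < rlen n" for s
    using nth_wd(1)[OF n0r, of s] that n0 by simp
  have l2: "wd r ! (roff n + s) = rlab (Suc n) s" if "s \<le> t" for s
    using nth_wd(1)[OF n, of s] that t by simp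
  have re: "row_end ?j' \<longleftrightarrow> Suc t' = rlen n" using row_end_iff[OF n0r, of t'] t' n0 by simp
  let ?c = "\<lambda>k. f k * ca i (wd r ! k)"
  have "rlab (Suc n) t = Suc i" using True i by (simp add: rlab_def)
  hence cj: "?c ?j = - f ?j" unfolding l2[OF order.refl] by (simp add: cartan_int_def)
  have zr: "ca i (rlab (Suc n) s) = 0" if st: "s < t" for s
  proof -
    have "Suc i < rlab (Suc n) s" using st True i unfolding rlab_def by arith
    thus ?thesis by (simp add: cartan_int_def)
  qed
  have zl: "ca i (rlab n s) = (if s = Suc t' then -1 else 0)" if s: "t' < s" "s < rlen n" for s
  proof (rule cartan_type.exhaust[of X])
    assume X: "X = Type_A"
    have "t' = t" "s < n" using s(2) unfolding t'_def rlen_A[OF X] by (simp_all add: X)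
    hence "s = Suc t' \<Longrightarrow> i = Suc (rlab n s)" "s \<noteq> Suc t' \<Longrightarrow> Suc (rlab n s) < i"
      using s(1) i unfolding rlab_def by (simp, arith)+
    thus ?thesis using X by (cases "s = Suc t'") (simp_all add: cartan_int_def)
  next
    assume X: "X = Type_C"
    have t2: "t' + t + 2 = 2 * n" using True unfolding t'_def by (simp add: X)
    hence "n \<le> s" using s(1) True by linarith
    hence "rlab n s + n = s + 2" by (simp add: rlab_def)
    moreover have "i + t = n" using i True by simp
    ultimately have "s = Suc t' \<Longrightarrow> rlab n s = Suc i" "s \<noteq> Suc t' \<Longrightarrow> Suc i < rlab n s"
      using s(1) t2 by linarith+
    thus ?thesis by (cases "s = Suc t'") (simp_all add: cartan_int_def)
  qed
  have z: "?c k = 0" if "Suc ?j' < k" "k < ?j" for k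
  proof (cases "k < roff n")
    case True
    define s where "s = k - roff n0"
    have "k = roff n0 + s" "Suc t' < s" "s < rlen n" using True that off unfolding s_def by auto
    thus ?thesis using l1 zl by simp
  next
    case False
    define s where "s = k - roff n"
    have "k = roff n + s" "s < t" using False that unfolding s_def by auto
    thus ?thesis using l2 zr by simp
  qed
  show ?thesis
  proof (rule that[of ?j'])
    show lt: "?j' < ?j" using t' off by simp
    show "wd r ! ?j' = i" using l1 t' by simp
    have S: "(\<Sum>k=Suc ?j'..<Suc ?j. ?c k) = ?c ?j + (if Suc ?j' = ?j then 0 else ?c (Suc ?j'))"
      using z by (rule sum_two_ends[OF lt])
    show "(\<Sum>k=Suc ?j'..<Suc ?j. ?c k) = - f ?j - (if row_end ?j' then 0 else f (Suc ?j'))"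
    proof (cases "row_end ?j'")
      case True
      hence e: "Suc ?j' = roff n + 0" using re off by simp
      have "Suc ?j' \<noteq> ?j \<Longrightarrow> ?c (Suc ?j') = 0" unfolding e using l2[of 0] zr[of 0] by simp
      thus ?thesis unfolding S cj using True by auto
    next
      case False
      hence s: "Suc t' < rlen n" using re t' by simp
      hence "?c (Suc ?j') = - f (Suc ?j')" using l1[of "Suc t'"] zl[of "Suc t'"] by simp
      moreover have "Suc ?j' \<noteq> ?j" using s off by simp
      ultimately show ?thesis unfolding S cj using False by simp
    qed
  qed
next
  case False
  hence C: "X = Type_C" using t by (auto simp: rlen_def split: if_splits) (metis cartan_type.exhaust)
  have tn: "n \<le> t" "t + 2 \<le> 2 * n + 1" using False t unfolding rlen_C[OF C] by auto
  have i: "i = t - n + 2" using tn by (auto simp: i_def rlab_def)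
  \<comment> \<open>On the ascending half the last occurrence is the mirror image of position t + 1
    about the centre n of the same row.\<close>
  define t' where "t' = 2 * n - 1 - t"
  let ?j' = "roff n + t'" and ?j = "roff n + t"
  have l: "wd r ! (roff n + s) = rlab (Suc n) s" if "s \<le> t" for s
    using nth_wd(1)[OF n, of s] that t by simp
  let ?c = "\<lambda>k. f k * ca i (wd r ! k)"
  have lt: "t' < t" using tn unfolding t'_def by simp
  have "Suc t' < rlen (Suc n)" using lt t by simp
  hence re: "\<not> row_end ?j'" using row_end_iff[OF n, of t'] by simp
  have t2: "t' + t + 1 = 2 * n" and i2: "i + n = t + 2" using tn i unfolding t'_def by simp_all
  have rl: "rlab (Suc n) s + s = n + 1 \<and> s \<le> n \<or> rlab (Suc n) s + n + 1 = s + 2 \<and> n < s" for s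
    by (auto simp: rlab_def)
  have cz: "ca i (rlab (Suc n) s) = 0" if s: "Suc t' < s" "s < t" for s
  proof -
    have "Suc (rlab (Suc n) s) < i" using rl[of s] s t2 i2 by linarith
    thus ?thesis by (simp add: cartan_int_def)
  qed
  have c1: "ca i (rlab (Suc n) s) = (if t = n then -2 else -1)" if s: "s = t \<or> s = Suc t'" for s
  proof -
    have "i = Suc (rlab (Suc n) s)" using rl[of s] s t2 i2 tn(1) by linarith
    moreover have "i = 2 \<longleftrightarrow> t = n" using i2 by linarith
    ultimately show ?thesis using C by (simp add: cartan_int_def)
  qed
  have z: "?c k = 0" if "Suc ?j' < k" "k < ?j" for k
  proof -
    define s where "s = k - roff n"
    have "k = roff n + s" "Suc t' < s" "s < t" using that unfolding s_def by auto
    thus ?thesis using l cz by simp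
  qed
  have lt': "?j' < ?j" using lt by simp
  have e: "Suc t' = t \<longleftrightarrow> t = n" using tn unfolding t'_def by auto
  show ?thesis
  proof (rule that[of ?j'])
    show "?j' < ?j" by (rule lt')
    show "wd r ! ?j' = i" using l[of t'] lt tn i by (auto simp: rlab_def t'_def)
    have S: "(\<Sum>k=Suc ?j'..<Suc ?j. ?c k) = ?c ?j + (if Suc ?j' = ?j then 0 else ?c (Suc ?j'))"
      using z by (rule sum_two_ends[OF lt'])
    have "?c ?j = f ?j * (if t = n then -2 else -1)" "?c (Suc ?j') = f (Suc ?j') * (if t = n then -2 else -1)"
      using l[of t] l[of "Suc t'"] c1[of t] c1[of "Suc t'"] lt by auto
    thus "(\<Sum>k=Suc ?j'..<Suc ?j. ?c k) = - f ?j - (if row_end ?j' then 0 else f (Suc ?j'))"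
      unfolding S using re e by auto
  qed
qed

end

section \<open>Stable patterns\<close>

context root_datum_loc
begin

lemma long_word_eq: "long_word R = wd (rk R)"
  unfolding long_word_def word_rows_def wd_def ..

lemma last_in_row_iff: "last_in_row R j \<longleftrightarrow> row_end j"
proof -
  have "concat (take m (word_rows R)) = wd m" if "m \<in> {1..rk R}" for m
    using that unfolding word_rows_def wd_def by (simp add: take_map del: upt_Suc)
  thus ?thesis unfolding last_in_row_def row_end_def by auto
qed

text \<open>For a pattern of a crystal element this is the weight after the first j raisings
  (\<open>mu_pat\<close>), computed backwards from the highest weight.\<close>

definition mu :: "'a \<Rightarrow> nat list \<Rightarrow> nat \<Rightarrow> 'a" where
  "mu lam bs j = lam - (\<Sum>k=j..<roff (rk R). real (bs ! k) *\<^sub>R al (wd (rk R) ! k))"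

lemma mu_end: "mu lam bs (roff (rk R)) = lam"
  by (simp add: mu_def)

lemma mu_diff: "i \<le> j \<Longrightarrow> j \<le> roff (rk R) \<Longrightarrow>
    mu lam bs j - mu lam bs i = (\<Sum>k=i..<j. real (bs ! k) *\<^sub>R al (wd (rk R) ! k))"
  unfolding mu_def
  using sum.atLeastLessThan_concat[of i j "roff (rk R)" "\<lambda>k. real (bs ! k) *\<^sub>R al (wd (rk R) ! k)", symmetric]
  by (simp add: algebra_simps)

lemma mu_Suc: "j < roff (rk R) \<Longrightarrow> mu lam bs j = mu lam bs (Suc j) - real (bs ! j) *\<^sub>R al (wd (rk R) ! j)"
  using mu_diff[of j "Suc j" lam bs] by (simp add: algebra_simps)

lemma boxed_iff: "boxed R lam bs j \<longleftrightarrow> real (bs ! j) = cpair (mu lam bs (Suc j)) (al (wd (rk R) ! j))"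
  unfolding boxed_def mu_def long_word_eq by (simp add: atLeastSucLessThan_greaterThanLessThan)

lemma circled_iff: "circled R bs j \<longleftrightarrow> bs ! j = (if row_end j then 0 else bs ! Suc j)"
  unfolding circled_def last_in_row_iff by auto

lemma cpair_al_self: "i \<in> idxs \<Longrightarrow> cpair (al i) (al i) = 2"
  using al_nz[of i] idx_eq by (simp add: cpair_def)

text \<open>Let j' be the previous occurrence of the boxed letter. The box and the circle fix the
  pairing after the circled position as minus the circled entry. \<open>previous_occurrence\<close>
  carries it back to j' + 1, where it equals the entry following j' in its row, or 0 at a row end.
  So at j' the bounds for boxing and for circling coincide.\<close>

lemma boxed_after_circled:
  assumes n: "n < rk R" and t: "Suc t < rlen (Suc n)"
    and c: "circled R bs (roff n + t)" and bx: "boxed R lam bs (roff n + Suc t)"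
  shows "\<exists>j<roff (rk R). boxed R lam bs j \<longleftrightarrow> circled R bs j"
proof -
  let ?w = "wd (rk R)" and ?j = "roff n + t" and ?i = "rlab (Suc n) (Suc t)"
  obtain j' where j': "j' < ?j" "?w ! j' = ?i"
    "(\<Sum>k=Suc j'..<Suc ?j. int (bs ! k) * ca ?i (?w ! k)) =
      - int (bs ! ?j) - (if row_end j' then 0 else int (bs ! Suc j'))"
    by (rule previous_occurrence[OF n t, of "\<lambda>k. int (bs ! k)"], rule that; assumption)
  have jr: "Suc ?j < roff (rk R)" "?w ! Suc ?j = ?i" using nth_wd[OF n t] by auto
  have ii: "?i \<in> idxs" using wd_nth_idxs[OF jr(1)] jr(2) by simp
  have "\<not> row_end ?j" using row_end_iff[OF n, of t] t by simp
  hence cj: "bs ! ?j = bs ! Suc ?j" using c unfolding circled_iff by simp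
  have "cpair (mu lam bs (Suc ?j) - mu lam bs (Suc j')) (al ?i) =
      (\<Sum>k=Suc j'..<Suc ?j. real (bs ! k) * cpair (al (?w ! k)) (al ?i))"
    using j'(1) jr(1) by (subst mu_diff) (simp_all add: cpair_sum cpair_linear)
  also have "\<dots> = (\<Sum>k=Suc j'..<Suc ?j. of_int (int (bs ! k) * ca ?i (?w ! k)))"
  proof (rule sum.cong[OF HOL.refl])
    fix k assume "k \<in> {Suc j'..<Suc ?j}"
    hence "?w ! k \<in> idxs" using jr(1) by (intro wd_nth_idxs) auto
    thus "real (bs ! k) * cpair (al (?w ! k)) (al ?i) = of_int (int (bs ! k) * ca ?i (?w ! k))"
      using cart[of ?i "?w ! k"] ii idx_eq by simp
  qed
  also have "\<dots> = of_int (\<Sum>k=Suc j'..<Suc ?j. int (bs ! k) * ca ?i (?w ! k))"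
    by (simp only: of_int_sum)
  also have "\<dots> = - real (bs ! ?j) - (if row_end j' then 0 else real (bs ! Suc j'))"
    unfolding j'(3) by simp
  finally have 1: "cpair (mu lam bs (Suc ?j)) (al ?i) - cpair (mu lam bs (Suc j')) (al ?i) =
      - real (bs ! ?j) - (if row_end j' then 0 else real (bs ! Suc j'))"
    unfolding cpair_linear .
  have "cpair (mu lam bs (Suc ?j)) (al ?i) = cpair (mu lam bs (Suc (Suc ?j))) (al ?i) - 2 * real (bs ! Suc ?j)"
    unfolding mu_Suc[OF jr(1)] jr(2) cpair_linear cpair_al_self[OF ii] by simp
  also have "\<dots> = - real (bs ! Suc ?j)" using bx jr(2) unfolding boxed_iff by simp
  finally have "cpair (mu lam bs (Suc j')) (al ?i) = (if row_end j' then 0 else real (bs ! Suc j'))"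
    using 1 cj by simp
  hence "boxed R lam bs j' \<longleftrightarrow> circled R bs j'" unfolding boxed_iff circled_iff j'(2) by auto
  thus ?thesis using j'(1) jr(1) by (intro exI[of _ j']) auto
qed

text \<open>By \<open>boxed_after_circled\<close> the successor of a circled entry in its row is not
  boxed, hence circled by stability. Circles thus propagate to the end of the row, where they mean
  zero.\<close>

lemma stable_circled_zero:
  assumes s: "stable R lam bs" and j: "j < roff (rk R)" and c: "circled R bs j"
  shows "bs ! j = 0"
proof -
  have st: "circled R bs j \<noteq> boxed R lam bs j" if "j < roff (rk R)" for j
    using s that unfolding stable_def long_word_eq by blast
  obtain n t where nt: "n < rk R" "t < rlen (Suc n)" "j = roff n + t" by (rule position_cases[OF j])
  have "circled R bs (roff n + t) \<Longrightarrow> bs ! (roff n + t) = 0" using nt(2)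
  proof (induction "rlen (Suc n) - t" arbitrary: t)
    case (Suc k)
    show ?case
    proof (cases "Suc t = rlen (Suc n)")
      case True
      thus ?thesis using Suc.prems row_end_iff[OF nt(1) Suc.prems(2)] unfolding circled_iff by simp
    next
      case False
      hence t: "Suc t < rlen (Suc n)" using Suc.prems by simp
      have "\<not> boxed R lam bs (roff n + Suc t)"
        using boxed_after_circled[OF nt(1) t Suc.prems(1)] st by blast
      hence "circled R bs (roff n + Suc t)" using st nth_wd(2)[OF nt(1) t] by blast
      hence "bs ! (roff n + Suc t) = 0" using Suc.hyps(1)[of "Suc t"] Suc.hyps(2) t by simp
      thus ?thesis using Suc.prems(1) row_end_iff[OF nt(1) Suc.prems(2)] False unfolding circled_iff by simp
    qed
  qed simp
  thus ?thesis using c nt(3) by simp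
qed

text \<open>A box at j says exactly that \<open>mu lam bs j\<close> is the simple reflection of
  \<open>mu lam bs (Suc j)\<close>, and a zero entry leaves the weight unchanged.\<close>

lemma pattern_weyl_apply:
  assumes "\<And>j. j < roff (rk R) \<Longrightarrow> \<not> boxed R lam bs j \<Longrightarrow> bs ! j = 0"
  shows "pattern_weyl R lam bs lam = mu lam bs 0"
proof -
  define F where "F j w = (if boxed R lam bs j then sreflection R (wd (rk R) ! j) else id) \<circ> w" for j :: nat and w :: "'a \<Rightarrow> 'a"
  have "foldr F [j..<roff (rk R)] id lam = mu lam bs j" if "j \<le> roff (rk R)" for j
    using that
  proof (induction j rule: inc_induct)
    case base
    show ?case by (simp add: mu_end)
  next
    case (step j)
    have "foldr F [j..<roff (rk R)] id lam = F j (foldr F [Suc j..<roff (rk R)] id) lam"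
      unfolding upt_conv_Cons[OF step(2)] foldr.simps comp_apply ..
    also have "\<dots> = (if boxed R lam bs j then sreflection R (wd (rk R) ! j) else id) (mu lam bs (Suc j))"
      unfolding F_def[of j] comp_apply step(3) ..
    finally have E: "foldr F [j..<roff (rk R)] id lam = \<dots>" .
    show ?case unfolding E using mu_Suc[OF step(2), of lam bs] assms[OF step(2)]
      unfolding boxed_iff sreflection_def reflection_def by auto
  qed
  thus ?thesis unfolding pattern_weyl_def long_word_eq F_def[abs_def] by simp
qed

lemma pattern_weyl_mem: "pattern_weyl R lam bs \<in> weyl_group R"
proof -
  define F where "F j w = (if boxed R lam bs j then sreflection R (wd (rk R) ! j) else id) \<circ> w" for j :: nat and w :: "'a \<Rightarrow> 'a"
  have F: "F j w \<in> weyl_group R" if "j < roff (rk R)" "w \<in> weyl_group R" for j w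
    using weyl_group.refl[OF that(2), of "wd (rk R) ! j"] wd_nth_idxs[OF that(1)] that(2) idx_eq
    unfolding F_def by (cases "boxed R lam bs j") simp_all
  have *: "foldr F js id \<in> weyl_group R" if "set js \<subseteq> {..<roff (rk R)}" for js
    using that
  proof (induction js)
    case Nil
    show ?case using weyl_group.id[of R] by (simp add: id_def)
  next
    case (Cons j js)
    have j: "j < roff (rk R)" "set js \<subseteq> {..<roff (rk R)}" using Cons.prems by simp_all
    show ?case unfolding foldr.simps comp_apply by (rule F[OF j(1) Cons.IH[OF j(2)]])
  qed
  have "foldr F [0..<roff (rk R)] id \<in> weyl_group R" by (rule *) auto
  thus ?thesis unfolding pattern_weyl_def long_word_eq F_def[abs_def] .
qed

lemma reflection_linear: "reflection a (x + y) = reflection a x + reflection a y" "reflection a (c *\<^sub>R x) = c *\<^sub>R reflection a x"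
  by (simp_all add: reflection_def cpair_linear algebra_simps)

lemma reflection_inner: "a \<noteq> 0 \<Longrightarrow> reflection a x \<bullet> y = x \<bullet> reflection a y"
  by (simp add: reflection_def cpair_def inner_diff_left inner_diff_right inner_commute)

lemma reflection_reflection: "a \<noteq> 0 \<Longrightarrow> reflection a (reflection a x) = x"
  by (simp add: reflection_def cpair_def inner_diff_left algebra_simps scaleR_left_distrib[symmetric])

lemma weyl_linear: "w \<in> weyl_group R \<Longrightarrow> linear w"
proof (induction rule: weyl_group.induct)
  case (refl w i)
  show ?case
    by (rule linearI) (simp_all add: sreflection_def reflection_linear linear_add[OF refl.IH] linear_scale[OF refl.IH])
qed (rule linear_id)

lemma weyl_inner: "w \<in> weyl_group R \<Longrightarrow> w x \<bullet> w y = x \<bullet> y"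
proof (induction rule: weyl_group.induct)
  case (refl w i)
  thus ?case using al_nz[of i] by (simp add: sreflection_def reflection_inner reflection_reflection)
qed simp

lemma weyl_root:
  "w \<in> weyl_group R \<Longrightarrow> \<beta> \<in> roots R \<Longrightarrow> \<exists>\<gamma>\<in>roots R. \<forall>x. w x \<bullet> \<beta> = x \<bullet> \<gamma>"
proof (induction arbitrary: \<beta> rule: weyl_group.induct)
  case (refl w i)
  have "reflection (al i) \<beta> \<in> roots R" using refl.prems al_root[OF refl.hyps(2)] rs unfolding root_system_def by blast
  then obtain \<gamma> where "\<gamma> \<in> roots R" "\<forall>x. w x \<bullet> reflection (al i) \<beta> = x \<bullet> \<gamma>" using refl.IH by blast
  thus ?case using al_nz[OF refl.hyps(2)] by (intro bexI[of _ \<gamma>]) (simp_all add: sreflection_def reflection_inner)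
qed auto

lemma cpair_pos_inner: "cpair x a > 0 \<Longrightarrow> x \<bullet> a > 0"
  using inner_ge_zero[of a] by (auto simp: cpair_def zero_less_divide_iff)

text \<open>The last fundamental weight, obtained by rescaling the component of the last simple root
  orthogonal to the others. It is the weight of the letter 0.\<close>

lemma top_letter_exists: "\<exists>v. \<forall>i\<in>idxs. cpair v (al i) = of_bool (i = rk R)"
proof -
  let ?S = "al ` (idxs - {rk R})" and ?a = "al (rk R)"
  have ri: "rk R \<in> idxs" using rk_pos by simp
  obtain y z where yz: "y \<in> span ?S" "\<And>w. w \<in> span ?S \<Longrightarrow> orthogonal z w" "?a = y + z"
    using orthogonal_subspace_decomp_exists[of ?S ?a] by blast
  have ind: "independent (al ` idxs)" and inj: "inj_on al idxs" using ss unfolding simple_system_def idx_eq by auto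
  have img: "?S = al ` idxs - {?a}" using inj_on_image_set_diff[OF inj, of idxs "{rk R}"] ri by simp
  have "?a \<notin> span ?S" using ind ri unfolding img dependent_def by blast
  hence "z \<noteq> 0" using yz by auto
  have za: "z \<bullet> ?a = z \<bullet> z" unfolding yz(3) inner_add_right using yz(2)[OF yz(1)] by (simp add: orthogonal_def)
  have an: "?a \<bullet> ?a \<noteq> 0" using al_nz[of "rk R"] ri idx_eq by simp
  let ?v = "((?a \<bullet> ?a) / (2 * (z \<bullet> z))) *\<^sub>R z"
  have "cpair ?v (al i) = of_bool (i = rk R)" if i: "i \<in> idxs" for i
  proof (cases "i = rk R")
    case True
    thus ?thesis using za an \<open>z \<noteq> 0\<close> by (simp add: cpair_def)
  next
    case False
    hence "al i \<in> span ?S" using i by (intro span_base) auto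
    thus ?thesis using yz(2) False by (simp add: cpair_def orthogonal_def)
  qed
  thus ?thesis by blast
qed

text \<open>The orbit of the weights of the vector representation distinguishes the elements of the Weyl
  group, because a strictly dominant weight separates these weights.\<close>

lemma weyl_regular_orbit_inj:
  assumes lam: "\<And>i. i \<in> idxs \<Longrightarrow> cpair lam (al i) > 0"
    and v: "v \<in> weyl_group R" and w: "w \<in> weyl_group R" and eq: "v lam = w lam"
  shows "v = w"
proof -
  obtain p0 where p0: "\<forall>i\<in>idxs. cpair p0 (al i) = of_bool (i = rk R)" using top_letter_exists by blast
  \<comment> \<open>The weight of the letter t as a vector: each arrow subtracts the simple root of
    its label.\<close>
  define p where "p t = p0 - (\<Sum>s<t. al (lab s))" for t
  have p_Suc: "p (Suc t) = p t - al (lab t)" for t unfolding p_def by simp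
  have pr: "t \<le> D \<Longrightarrow> i \<in> idxs \<Longrightarrow> cpair (p t) (al i) = of_int (pr i t)" for t i
  proof (induction t)
    case 0
    have "0 < D" using r_le_D rk_pos by linarith
    hence "pr i 0 = of_bool (i = rk R)" using rk_pos by (auto simp: pr_def up_def dn_def lab_def)
    thus ?case using p0 0 by (simp add: p_def)
  next
    case (Suc t)
    thus ?case using pr_Suc[of t i] cart[of i "lab t"] lab_idxs[of t] idx_eq by (simp add: p_Suc cpair_linear)
  qed
  have refl_p: "reflection (al i) (p t) \<in> p ` {..D}" if t: "t \<le> D" and i: "i \<in> idxs" for t i
  proof -
    consider "up i t" | "dn i t" | "\<not> up i t" "\<not> dn i t" by blast
    thus ?thesis
    proof cases
      case 1
      hence "reflection (al i) (p t) = p (Suc t)" "Suc t \<le> D"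
        using pr[OF t i] by (auto simp: reflection_def p_Suc up_def)
      thus ?thesis by blast
    next
      case 2
      hence "reflection (al i) (p t) = p (t - 1)" "t - 1 \<le> D"
        using pr[OF t i] p_Suc[of "t - 1"] by (auto simp: reflection_def dn_def)
      thus ?thesis by blast
    next
      case 3
      hence "reflection (al i) (p t) = p t" using pr[OF t i] by (simp add: reflection_def)
      thus ?thesis using t by simp
    qed
  qed
  have perm: "w ` p ` {..D} \<subseteq> p ` {..D}" if "w \<in> weyl_group R" for w
    using that
  proof (induction rule: weyl_group.induct)
    case (refl w i)
    show ?case
    proof
      fix y assume "y \<in> (sreflection R i \<circ> w) ` p ` {..D}"
      then obtain t where "t \<le> D" "y = sreflection R i (w (p t))" by auto
      moreover then obtain s where "s \<le> D" "w (p t) = p s" using refl.IH by auto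
      ultimately show "y \<in> p ` {..D}" using refl_p[of s i] refl.hyps(2) idx_eq by (simp add: sreflection_def)
    qed
  qed simp
  have step: "lam \<bullet> p (Suc t) < lam \<bullet> p t" if "t < D" for t
  proof -
    have "lam \<bullet> al (lab t) > 0" by (rule cpair_pos_inner[OF lam[OF lab_idxs[OF that]]])
    thus ?thesis by (simp add: p_Suc inner_diff_right)
  qed
  have dec: "s < t \<Longrightarrow> t \<le> D \<Longrightarrow> lam \<bullet> p t < lam \<bullet> p s" for s t
  proof (induction t)
    case (Suc t)
    thus ?case using step[of t] by (cases "s = t") auto
  qed simp
  have lam_inj: "x = y" if "x \<in> p ` {..D}" "y \<in> p ` {..D}" "lam \<bullet> x = lam \<bullet> y" for x y
  proof -
    obtain s t where "x = p s" "y = p t" "s \<le> D" "t \<le> D" using \<open>x \<in> p ` {..D}\<close> \<open>y \<in> p ` {..D}\<close> by auto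
    thus ?thesis using dec[of s t] dec[of t s] that(3) by (cases s t rule: linorder_cases) auto
  qed
  have inj: "inj_on v (p ` {..D})"
  proof (rule inj_onI)
    fix x y assume h: "x \<in> p ` {..D}" "y \<in> p ` {..D}" "v x = v y"
    have "lam \<bullet> x = lam \<bullet> y" using weyl_inner[OF v, of lam x] weyl_inner[OF v, of lam y] h(3) by simp
    thus "x = y" by (rule lam_inj[OF h(1,2)])
  qed
  have surj: "v ` p ` {..D} = p ` {..D}" by (rule endo_inj_surj[OF _ perm[OF v] inj]) simp
  have vw: "v (p t) = w (p t)" if t: "t \<le> D" for t
  proof -
    have "w (p t) \<in> p ` {..D}" using perm[OF w] t by blast
    hence "w (p t) \<in> v ` p ` {..D}" by (simp only: surj)
    then obtain x where x: "x \<in> p ` {..D}" "w (p t) = v x" by blast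
    have "lam \<bullet> x = lam \<bullet> p t" using weyl_inner[OF v, of lam x] weyl_inner[OF w, of lam "p t"] x(2) eq by simp
    hence "x = p t" using lam_inj[OF x(1)] t by blast
    thus ?thesis using x(2) by simp
  qed
  have "v a = w a" if "a \<in> al ` idx R" for a
  proof -
    obtain i where i: "i \<in> idxs" "a = al i" using \<open>a \<in> al ` idx R\<close> idx_eq by auto
    let ?t = "rk R - i"
    have t: "?t < D" "lab ?t = i" using i(1) r_le_D by (auto simp: lab_def)
    have "a = p ?t - p (Suc ?t)" unfolding p_Suc t(2) i(2) by simp
    thus ?thesis using vw[of ?t] vw[of "Suc ?t"] t(1) linear_diff[OF weyl_linear[OF v]] linear_diff[OF weyl_linear[OF w]] by simp
  qed
  hence "v x = w x" for x
    using linear_eq_on_span[OF weyl_linear[OF v] weyl_linear[OF w], of "al ` idx R" x] span_simple by simp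
  thus ?thesis by blast
qed

text \<open>The pairing moves to one of \<open>lam\<close> with a root, which is a nonzero
  combination of simple roots with coefficients of one sign.\<close>

lemma regular_orbit:
  assumes lam: "\<And>i. i \<in> idxs \<Longrightarrow> cpair lam (al i) > 0" and w: "w \<in> weyl_group R" and i: "i \<in> idxs"
  shows "cpair (w lam) (al i) \<noteq> 0"
proof -
  have la: "lam \<bullet> al j > 0" if "j \<in> idxs" for j
    by (rule cpair_pos_inner[OF lam[OF that]])
  have ii: "i \<in> idx R" using i idx_eq by simp
  obtain \<gamma> where g: "\<gamma> \<in> roots R" "\<forall>x. w x \<bullet> al i = x \<bullet> \<gamma>" using weyl_root[OF w al_root[OF ii]] by blast
  obtain c :: "nat \<Rightarrow> nat" where c: "\<gamma> = (\<Sum>j\<in>idxs. real (c j) *\<^sub>R al j) \<or> \<gamma> = - (\<Sum>j\<in>idxs. real (c j) *\<^sub>R al j)"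
    using ss g(1) unfolding simple_system_def idx_eq by blast
  have "\<gamma> \<noteq> 0" using g(1) rs unfolding root_system_def by auto
  hence "\<exists>j\<in>idxs. c j \<noteq> 0" using c by (auto intro: ccontr)
  then obtain j where j: "j \<in> idxs" "c j \<noteq> 0" by blast
  have "(\<Sum>j\<in>idxs. real (c j) * (lam \<bullet> al j)) > 0"
    using j la by (intro sum_pos2[of idxs j]) (auto simp: less_imp_le)
  hence "lam \<bullet> \<gamma> \<noteq> 0" using c by (auto simp: inner_sum_right)
  thus ?thesis using g(2) cpair_eq_0[OF ii] by simp
qed

end

section \<open>Crystal graphs and extremal elements\<close>

context letter_chain
begin

lemma fw_funpow: "k \<le> ph i w \<Longrightarrow> j \<in> idxs \<Longrightarrow> ph i ((fw i ^^ k) w) = ph i w - k \<and> hp j ((fw i ^^ k) w) = hp j w - int k * ca j i"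
proof (induction k)
  case (Suc k)
  thus ?case using fw_props[of i "(fw i ^^ k) w"] hp_fw[of i "(fw i ^^ k) w" j] by (auto simp: algebra_simps)
qed simp

end

context crystal_adapted
begin

abbreviation "z0 \<equiv> qcoset M L 0"

lemma dominant_reach:
  assumes "d \<in> reach b" "dominant d"
  shows "d = b"
  using assms(1)
proof (cases rule: reach.cases)
  case (reach_step e i)
  thus ?thesis using assms(2) fw_props[of i e] unfolding dominant_def by auto
qed simp

lemma crystal_e_pow:
  assumes "i \<in> idxs" "d \<in> reach b"
  shows "k \<le> ep i d \<Longrightarrow> (crystal_e R M L i ^^ k) (bc d) = bc ((ew i ^^ k) d) \<and> (ew i ^^ k) d \<in> reach b"
proof (induction k)
  case (Suc k)
  let ?d = "(ew i ^^ k) d"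
  have IH: "(crystal_e R M L i ^^ k) (bc d) = bc ?d" "?d \<in> reach b" using Suc by auto
  have "ep i ?d > 0" using ep_funpow_ew[of k i d] Suc.prems by simp
  thus ?case using crystal_e_bc[OF assms(1) IH(2)] IH(1) by simp
qed (simp add: assms(2))

lemma crystal_e_pow_zero:
  assumes "i \<in> idxs" "d \<in> reach b" "ep i d < k"
  shows "(crystal_e R M L i ^^ k) (bc d) = z0"
proof -
  have "(crystal_e R M L i ^^ (Suc (ep i d) + l)) (bc d) = z0" for l
  proof (induction l)
    case 0
    have "ep i ((ew i ^^ ep i d) d) = 0" using ep_funpow_ew[of "ep i d" i d] by simp
    thus ?case using crystal_e_pow[OF assms(1,2), of "ep i d"] crystal_e_bc[OF assms(1), of "(ew i ^^ ep i d) d"] by simp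
  qed (simp add: crystal_e_zero[OF assms(1)])
  from this[of "k - Suc (ep i d)"] show ?thesis using assms(3) by simp
qed

lemma em_reach: "i \<in> idxs \<Longrightarrow> d \<in> reach b \<Longrightarrow> em i d \<in> reach b"
  using crystal_e_pow[of i d "ep i d"] by (simp add: em_eq_funpow)

lemma string_along_bc:
  "set js \<subseteq> idxs \<Longrightarrow> d \<in> reach b \<Longrightarrow> k < length js \<Longrightarrow>
    string_along (crystal_e R M L) z0 js (bc d) ! k = ep (js ! k) (fold em (take k js) d)"
proof (induction js arbitrary: d k)
  case (Cons i js)
  have i: "i \<in> idxs" using Cons.prems by simp
  have G: "(GREATEST k. (crystal_e R M L i ^^ k) (bc d) \<noteq> z0) = ep i d"
  proof (rule Greatest_equality)
    show "(crystal_e R M L i ^^ ep i d) (bc d) \<noteq> z0"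
      using crystal_e_pow[OF i Cons.prems(2), of "ep i d"] bc_neq_zero by simp
    show "y \<le> ep i d" if "(crystal_e R M L i ^^ y) (bc d) \<noteq> z0" for y
      using crystal_e_pow_zero[OF i Cons.prems(2), of y] that by force
  qed
  have e: "(crystal_e R M L i ^^ ep i d) (bc d) = bc (em i d)"
    using crystal_e_pow[OF i Cons.prems(2), of "ep i d"] by (simp add: em_eq_funpow)
  have s: "string_along (crystal_e R M L) z0 (i # js) (bc d) = ep i d # string_along (crystal_e R M L) z0 js (bc (em i d))"
    unfolding string_along.simps Let_def G e ..
  show ?case unfolding s using Cons.IH[of "em i d"] Cons.prems em_reach[OF i Cons.prems(2)] by (cases k) auto
qed simp

abbreviation "N \<equiv> roff (rk R)"
abbreviation "pat d \<equiv> BZL R M L (bc d)"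
abbreviation "wt d \<equiv> crystal_wt R M L (bc d)"

lemma pat_nth: "d \<in> reach b \<Longrightarrow> j < N \<Longrightarrow> pat d ! j = bz d j"
  unfolding BZL_def long_word_eq bz_def st_def using set_wd by (intro string_along_bc) auto

lemma st_reach: "d \<in> reach b \<Longrightarrow> j \<le> N \<Longrightarrow> st d j \<in> reach b"
proof (induction j)
  case (Suc j)
  thus ?case using em_reach[OF wd_nth_idxs[of j]] by (simp add: st_Suc)
qed simp

lemma st_end: "d \<in> reach b \<Longrightarrow> st d N = b"
  using dominant_reach[OF st_reach dominant_st] by simp

lemma cpair_wt: "d \<in> reach b \<Longrightarrow> i \<in> idxs \<Longrightarrow> cpair (wt d) (al i) = of_int (hp i d)"
  by (rule crystal_wt_bc(2))

lemma wt_eqI: "d \<in> reach b \<Longrightarrow> (\<And>i. i \<in> idxs \<Longrightarrow> of_int (hp i d) = cpair y (al i)) \<Longrightarrow> wt d = y"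
  using cpair_wt idx_eq by (intro weight_eqI) simp

lemma wt_b: "wt b = lam"
  using reach_base b(3) cpair_lam by (intro wt_eqI) simp_all

lemma cart_of: "i \<in> idxs \<Longrightarrow> j \<in> idxs \<Longrightarrow> cpair (al j) (al i) = of_int (ca i j)"
  using cart idx_eq by simp

lemma wt_em:
  assumes d: "d \<in> reach b" and i: "i \<in> idxs"
  shows "wt (em i d) = wt d + real (ep i d) *\<^sub>R al i"
  using d i by (intro wt_eqI em_reach) (simp_all add: cpair_linear cpair_wt cart_of hp_em)

lemma wt_st: "d \<in> reach b \<Longrightarrow> j < N \<Longrightarrow> wt (st d (Suc j)) = wt (st d j) + real (bz d j) *\<^sub>R al (wd (rk R) ! j)"
  using wt_em[OF st_reach[of d j] wd_nth_idxs[of j]] by (simp add: st_Suc bz_def)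

text \<open>Proved from the end of the word, where every element has been raised to b and the weight
  is \<open>lam\<close>.\<close>

lemma mu_pat:
  assumes d: "d \<in> reach b"
  shows "j \<le> N \<Longrightarrow> mu lam (pat d) j = wt (st d j)"
proof (induction j rule: inc_induct)
  case base
  show ?case by (simp add: mu_end st_end[OF d] wt_b)
next
  case (step j)
  thus ?case using mu_Suc[OF step(2)] wt_st[OF d step(2)] pat_nth[OF d step(2)] by simp
qed

text \<open>The pairing of the weight with the coroot is \<open>ph\<close> minus \<open>ep\<close>,
  so the linear and the quadratic term in \<open>ep\<close> combine to \<open>ep\<close> times
  \<open>ph\<close>. Raising to the top of a string never shortens the weight.\<close>

lemma wt_em_norm:
  assumes d: "d \<in> reach b" and i: "i \<in> idxs"
  shows "wt (em i d) \<bullet> wt (em i d) = wt d \<bullet> wt d + real (ep i d) * real (ph i d) * (al i \<bullet> al i)"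
proof -
  have nz: "al i \<bullet> al i \<noteq> 0" using al_nz[of i] i idx_eq by simp
  have "2 * (wt d \<bullet> al i) = of_int (hp i d) * (al i \<bullet> al i)"
    using cpair_wt[OF d i] nz by (simp add: cpair_def field_simps)
  hence w: "2 * (wt d \<bullet> al i) = (real (ph i d) - real (ep i d)) * (al i \<bullet> al i)"
    by (simp add: hp_eq)
  have "wt (em i d) \<bullet> wt (em i d) = wt d \<bullet> wt d + real (ep i d) * (2 * (wt d \<bullet> al i)) + real (ep i d) * real (ep i d) * (al i \<bullet> al i)"
    unfolding wt_em[OF d i] by (simp add: inner_add_left inner_add_right inner_commute algebra_simps)
  thus ?thesis unfolding w by (simp add: algebra_simps)
qed

lemma wt_norm_le:
  assumes d: "d \<in> reach b"
  shows "wt d \<bullet> wt d \<le> lam \<bullet> lam"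
proof -
  have "wt (st d j) \<bullet> wt (st d j) \<le> lam \<bullet> lam" if "j \<le> N" for j
    using that
  proof (induction j rule: inc_induct)
    case base
    show ?case by (simp add: st_end[OF d] wt_b)
  next
    case (step j)
    have "wt (st d (Suc j)) \<bullet> wt (st d (Suc j)) \<ge> wt (st d j) \<bullet> wt (st d j)"
      using wt_em_norm[OF st_reach[OF d] wd_nth_idxs[OF step(2)], of j] step(2) by (simp add: st_Suc)
    thus ?case using step(3) by linarith
  qed
  from this[of 0] show ?thesis by simp
qed

text \<open>A weight of maximal norm cannot get longer, so \<open>ep\<close> times \<open>ph\<close>
  vanishes: the element sits at an end of its i-string.\<close>

lemma extremal_ep:
  assumes d: "d \<in> reach b" and e: "wt d \<bullet> wt d = lam \<bullet> lam" and i: "i \<in> idxs"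
  shows "int (ep i d) = max 0 (- hp i d)"
proof -
  have "real (ep i d) * real (ph i d) * (al i \<bullet> al i) \<le> 0"
    using wt_norm_le[OF em_reach[OF i d]] wt_em_norm[OF d i] e by simp
  moreover have "al i \<bullet> al i > 0" using al_nz[of i] i idx_eq by simp
  ultimately have "real (ep i d) * real (ph i d) \<le> 0" by (simp add: mult_le_0_iff)
  hence "ep i d = 0 \<or> ph i d = 0" by (auto simp: mult_le_0_iff)
  thus ?thesis using hp_eq[of i d] by auto
qed

lemma orbit_norm: "w \<in> weyl_group R \<Longrightarrow> w lam \<bullet> w lam = lam \<bullet> lam"
  by (rule weyl_inner)

text \<open>A simple reflection is realized along the i-string: by lowering \<open>hp i d\<close>
  times if this is nonnegative, otherwise by raising to the top, where extremality gives the right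
  number of steps.\<close>

lemma orbit_reach: "w \<in> weyl_group R \<Longrightarrow> \<exists>d\<in>reach b. wt d = w lam"
proof (induction rule: weyl_group.induct)
  case id
  show ?case using reach_base[of b] wt_b by (intro bexI[of _ b]) simp_all
next
  case (refl w i)
  then obtain d where d: "d \<in> reach b" "wt d = w lam" by blast
  have i: "i \<in> idxs" using refl.hyps(2) idx_eq by simp
  have refl_wt: "wt d' = sreflection R i (w lam)"
    if "d' \<in> reach b" "\<And>j. j \<in> idxs \<Longrightarrow> hp j d' = hp j d - hp i d * ca j i" for d'
    using that d i cpair_wt[OF d(1)]
    by (intro wt_eqI) (simp_all add: sreflection_def reflection_def cpair_linear cart_of d(2)[symmetric])
  show ?case
  proof (cases "hp i d \<ge> 0")
    case True
    define k where "k = nat (hp i d)"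
    have k: "int k = hp i d" "k \<le> ph i d" using True hp_eq[of i d] unfolding k_def by auto
    have "l \<le> k \<Longrightarrow> (fw i ^^ l) d \<in> reach b" for l
    proof (induction l)
      case (Suc l)
      thus ?case using fw_funpow[of l i d i] k(2) i reach_step[of "(fw i ^^ l) d" b i] by simp
    qed (simp add: d)
    hence "(fw i ^^ k) d \<in> reach b" by simp
    moreover have "wt ((fw i ^^ k) d) = sreflection R i (w lam)"
      using fw_funpow[OF k(2)] k(1) calculation by (intro refl_wt) auto
    ultimately show ?thesis by auto
  next
    case False
    have e: "int (ep i d) = - hp i d"
      using extremal_ep[OF d(1) _ i] d(2) orbit_norm[OF refl.hyps(1)] False by simp
    have "wt (em i d) = sreflection R i (w lam)"
      using em_reach[OF i d(1)] e by (intro refl_wt) (simp_all add: hp_em)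
    thus ?thesis using em_reach[OF i d(1)] by auto
  qed
qed

lemma st_orbit:
  assumes d: "d \<in> reach b" "w \<in> weyl_group R" "wt d = w lam"
  shows "j \<le> N \<Longrightarrow> \<exists>w\<in>weyl_group R. wt (st d j) = w lam"
proof (induction j)
  case 0
  show ?case using d by auto
next
  case (Suc j)
  then obtain w where w: "w \<in> weyl_group R" "wt (st d j) = w lam" by auto
  have j: "j < N" using Suc.prems by simp
  let ?i = "wd (rk R) ! j"
  have i: "?i \<in> idxs" by (rule wd_nth_idxs[OF j])
  have sr: "st d j \<in> reach b" using st_reach[OF d(1)] j by simp
  have e: "int (ep ?i (st d j)) = max 0 (- hp ?i (st d j))"
    using extremal_ep[OF sr _ i] w(2) orbit_norm[OF w(1)] by simp
  have s: "wt (st d (Suc j)) = w lam + of_int (max 0 (- hp ?i (st d j))) *\<^sub>R al ?i"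
    using wt_st[OF d(1) j] w(2) unfolding bz_def e[symmetric] by simp
  show ?case
  proof (cases "hp ?i (st d j) < 0")
    case True
    have "wt (st d (Suc j)) = (sreflection R ?i \<circ> w) lam"
      using s True cpair_wt[OF sr i] w(2) by (simp add: sreflection_def reflection_def)
    moreover have "sreflection R ?i \<circ> w \<in> weyl_group R" using weyl_group.refl[OF w(1)] i idx_eq by simp
    ultimately show ?thesis by blast
  next
    case False
    thus ?thesis using s w by auto
  qed
qed

lemma lam_regular: "i \<in> idxs \<Longrightarrow> cpair lam (al i) > 0"
  using pos idx_eq by simp

text \<open>All intermediate weights stay in the regular orbit. So an entry is either 0 with
  positive pairing, hence not boxed, or minus a negative pairing, hence boxed. By
  \<open>extremal_row\<close> an entry is circled only when it is 0.\<close>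

lemma extremal_stable:
  assumes d: "d \<in> reach b" "w \<in> weyl_group R" "wt d = w lam"
  shows "stable R lam (pat d)" and "pattern_weyl R lam (pat d) lam = w lam"
proof -
  have ext: "hp i (st d j) \<noteq> 0 \<and> int (ep i (st d j)) = max 0 (- hp i (st d j))"
    if j: "j \<le> N" and i: "i \<in> idxs" for j i
  proof -
    obtain v where v: "v \<in> weyl_group R" "wt (st d j) = v lam" using st_orbit[OF d j] by blast
    have sr: "st d j \<in> reach b" by (rule st_reach[OF d(1) j])
    show ?thesis using extremal_ep[OF sr _ i] orbit_norm[OF v(1)] v(2)
      regular_orbit[OF lam_regular v(1) i] cpair_wt[OF sr i] by auto
  qed
  have bx: "boxed R lam (pat d) j \<longleftrightarrow> bz d j \<noteq> 0" if j: "j < N" for j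
  proof -
    let ?i = "wd (rk R) ! j"
    have i: "?i \<in> idxs" by (rule wd_nth_idxs[OF j])
    have "cpair (mu lam (pat d) (Suc j)) (al ?i) = of_int (hp ?i (st d (Suc j)))"
      using mu_pat[OF d(1), of "Suc j"] cpair_wt[OF st_reach[OF d(1), of "Suc j"] i] j by simp
    moreover have "hp ?i (st d (Suc j)) = hp ?i (st d j) + 2 * int (bz d j)"
      using hp_st[OF j i] by (simp add: cartan_int_def)
    moreover have "int (bz d j) = max 0 (- hp ?i (st d j))" "hp ?i (st d j) \<noteq> 0"
      using ext[of j ?i] i j unfolding bz_def by auto
    ultimately have "boxed R lam (pat d) j \<longleftrightarrow> int (bz d j) = hp ?i (st d j) + 2 * int (bz d j)"
      unfolding boxed_iff pat_nth[OF d(1) j] by (metis of_int_eq_iff of_int_of_nat_eq)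
    thus ?thesis using \<open>int (bz d j) = _\<close> \<open>hp ?i (st d j) \<noteq> 0\<close> by auto
  qed
  have ci: "circled R (pat d) j \<longleftrightarrow> bz d j = 0" if j: "j < N" for j
  proof -
    obtain n t where nt: "n < rk R" "t < rlen (Suc n)" "j = roff n + t" by (rule position_cases[OF j])
    show ?thesis
    proof (cases "Suc t = rlen (Suc n)")
      case True
      thus ?thesis unfolding circled_iff pat_nth[OF d(1) j] using row_end_iff[OF nt(1,2)] nt(3) by simp
    next
      case False
      hence t: "Suc t < rlen (Suc n)" using nt(2) by simp
      have "Suc j < N" using nth_wd(2)[OF nt(1) t] nt(3) by simp
      thus ?thesis unfolding circled_iff pat_nth[OF d(1) j]
        using row_end_iff[OF nt(1,2)] nt(3) False extremal_row[OF ext nt(1) t] pat_nth[OF d(1), of "Suc j"] by auto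
    qed
  qed
  show "stable R lam (pat d)" unfolding stable_def long_word_eq using bx ci by blast
  have "pattern_weyl R lam (pat d) lam = mu lam (pat d) 0"
    using bx pat_nth[OF d(1)] by (intro pattern_weyl_apply) auto
  thus "pattern_weyl R lam (pat d) lam = w lam" using mu_pat[OF d(1), of 0] d(3) by simp
qed

lemma pattern_weyl_surj: "pattern_weyl R lam ` stable_patterns R M lam L B = weyl_group R"
proof
  show "pattern_weyl R lam ` stable_patterns R M lam L B \<subseteq> weyl_group R" using pattern_weyl_mem by auto
  show "weyl_group R \<subseteq> pattern_weyl R lam ` stable_patterns R M lam L B"
  proof
    fix w assume w: "w \<in> weyl_group R"
    then obtain d where d: "d \<in> reach b" "wt d = w lam" using orbit_reach by blast
    have "pattern_weyl R lam (pat d) = w"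
      by (rule weyl_regular_orbit_inj[OF lam_regular pattern_weyl_mem w extremal_stable(2)[OF d(1) w d(2)]])
    moreover have "pat d \<in> stable_patterns R M lam L B"
      unfolding stable_patterns_def using bc_B[OF d(1)] extremal_stable(1)[OF d(1) w d(2)] by blast
    ultimately show "w \<in> pattern_weyl R lam ` stable_patterns R M lam L B" by blast
  qed
qed

lemma stable_wt:
  assumes v: "v \<in> B" and s: "stable R lam (BZL R M L v)"
  shows "crystal_wt R M L v = pattern_weyl R lam (BZL R M L v) lam"
proof -
  obtain d where d: "d \<in> reach b" "v = bc d" using B_bc[OF v] by blast
  have "pattern_weyl R lam (pat d) lam = mu lam (pat d) 0"
    using s stable_circled_zero[OF s] unfolding stable_def long_word_eq d(2)
    by (intro pattern_weyl_apply) blast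
  thus ?thesis using mu_pat[OF d(1), of 0] d(2) by simp
qed

end

theorem proposition4p6:
  fixes R :: "'a::euclidean_space root_datum"
    and lam :: 'a
    and M :: "'v::ab_group_add qmodule"
    and L :: "'v set"
    and B :: "'v set set"
  assumes "root_datum_AC R"
    and "lam \<in> weight_lattice R"
    and "\<And>i. i \<in> idx R \<Longrightarrow> cpair lam (sroot R i) > 0"
    and "crystal_graph_of R M lam L B"
  shows "pattern_weyl R lam ` stable_patterns R M lam L B = weyl_group R \<and>
         (\<forall>v\<in>B. stable R lam (BZL R M L v) \<longrightarrow>
            crystal_wt R M L v = pattern_weyl R lam (BZL R M L v) lam)"
proof -
  interpret crystal_setup R lam M L B by unfold_locales (use assms in auto)
  obtain n b where b: "b \<in> Wd n" "dominant b" "\<And>i. i \<in> idxs \<Longrightarrow> hp i b = hl i"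
    using dominant_word_exists[of hl] hl_pos by (metis less_imp_le)
  obtain x where x0: "Thw n (hpf b) x" "congr x b" using lifts_all[of n] b(1,2) unfolding lifts_def by blast
  have x: "Thw n hl x" using x0(1) Thw_cong[of hl "hpf b" n x] b(3) by simp
  have emb: "\<exists>\<phi>. crystal_embedding R lam M L B n b x \<phi> u"
    if u: "u \<noteq> 0" "u \<in> weight_space R M lam" "\<forall>i\<in>idxs. Eop M i u = 0" for u
  proof -
    obtain \<phi> where "\<And>v w. \<phi> (v + w) = \<phi> v + \<phi> w" "\<And>c v. \<phi> (sc c v) = tscale c (\<phi> v)"
      "\<And>v. \<phi> v = 0 \<Longrightarrow> v = 0" "\<And>v. \<phi> v \<in> tU x" "\<And>y. y \<in> tU x \<Longrightarrow> \<exists>v. \<phi> v = y"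
      "\<And>i v. i \<in> idxs \<Longrightarrow> \<phi> (Eop M i v) = TE i (\<phi> v)" "\<And>i v. i \<in> idxs \<Longrightarrow> \<phi> (Fop M i v) = TF i (\<phi> v)"
      "\<And>i v. i \<in> idxs \<Longrightarrow> \<phi> (Kop M i v) = TK i (\<phi> v)" "\<phi> u = x"
      by (rule phi_exists[OF u(1,2) _ x], rule bspec[OF u(3)], assumption) (rule that; assumption)
    hence "crystal_embedding R lam M L B n b x \<phi> u"
      by unfold_locales (use b x x0(2) in simp_all)
    thus ?thesis by blast
  qed
  obtain u0 where u0: "u0 \<noteq> 0" "u0 \<in> weight_space R M lam" "\<forall>i\<in>idxs. Eop M i u0 = 0"
    using hwm unfolding highest_weight_module_def idx_eq by blast
  \<comment> \<open>The embedding is built twice: first for an arbitrary highest weight vector, in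
    order to find one adapted to L and B, and then for that vector.\<close>
  obtain \<phi>0 where "crystal_embedding R lam M L B n b x \<phi>0 u0" using emb[OF u0] by blast
  then obtain u where u: "u \<noteq> 0" "u \<in> weight_space R M lam" "\<forall>i\<in>idxs. Eop M i u = 0" "u \<in> L"
    "\<forall>a. sc a u \<in> L \<longrightarrow> a \<in> regular_at_0" "qcoset M L u \<in> B"
    using crystal_embedding.adapted_generator[OF _ u0(2)] by blast
  obtain \<phi> where "crystal_embedding R lam M L B n b x \<phi> u" using emb[OF u(1-3)] by blast
  then interpret crystal_adapted R lam M L B n b x \<phi> u
    by (intro crystal_adapted.intro crystal_adapted_axioms.intro) (use u in auto)
  show ?thesis using pattern_weyl_surj stable_wt by blast
qed

end
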